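(* Suppose that: (1) $\Gamma_{11}$ is positive definite; (2) the model $f_{t+\delta}=\rho f_t+\varepsilon_t$ defines a weakly stationary $H$-valued process $\{f_t\}$ such that $E\|f_t\|^4<\infty$; (3) all eigenvalues of the operator pencil $\Gamma_{21}\Gamma_{12}-\lambda\Gamma_{11}$ are distinct. Let the regularization parameter $\alpha=\alpha_n>0$ satisfy $\alpha\to0$ and $(n/\log n)^{1/2}\alpha\to\infty$ as $n\to\infty$. Then for each $j=1,2,\dots$: (i) $\hat\lambda_{\alpha j}$ converges in probability to $\lambda_j$ as $n\to\infty$; (ii) for an appropriate choice of the signs of the eigenvectors $\hat b_{\alpha j}$ and $b_j$, $(\hat b_{\alpha j}-b_j)'\Gamma_{11}(\hat b_{\alpha j}-b_j)\to0$ in probability as $n\to\infty$.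
   Context: Let $\bar T>0$ and let $H=L^2[0,\bar T]$ be the real Hilbert space of square-integrable functions, with norm $\|\cdot\|$. For $x,y\in H$ write $x'y=\int_0^{\bar T}x(T)y(T)\,dT$; a prime on an operator denotes its adjoint; $I$ is the identity operator. A strong $H$-white noise is a sequence of i.i.d. $H$-valued random variables with mean zero and finite, nonzero $E\|\cdot\|^2$. The process $\{f_t\}$ (with $t$ in steps of $\delta>0$) is a mean-zero $H$-valued process satisfying $f_{t+\delta}=\rho f_t+\varepsilon_t$, where $\rho$ is a Hilbert-Schmidt integral operator on $H$, $(\rho x)(S)=\int_0^{\bar T}\rho(S,T)x(T)\,dT$ with $\iint\rho(S,T)^2\,dS\,dT<\infty$, and $\{\varepsilon_t\}$ is a strong $H$-white noise with $\varepsilon_t$ uncorrelated with $f_t$. $\Gamma_{11}$ is the covariance operator of $f_t$: $\Gamma_{11}x=E[(f_t'x)f_t]$. $\Gamma_{12}$ is the cross-covariance operator $\Gamma_{12}x=E[(f_t'x)f_{t+\delta}]$, i.e. the integral operator with kernel $\Gamma_{12}(S,T)=E\{f_{t+\delta}(S)f_t(T)\}$, so that $\Gamma_{12}=\rho\Gamma_{11}$; $\Gamma_{21}=\Gamma_{12}'$. The sample consists of $f_\delta,f_{2\delta},\dots,f_{n\delta}$. The empirical operators $\hat\Gamma_{11}$ and $\hat\Gamma_{12}$ are the integral operators (a kernel $K$ acts by $x\mapsto\int_0^{\bar T}K(\cdot,T_2)x(T_2)\,dT_2$) with kernels $$\hat\Gamma_{11}(T_1,T_2)=\frac1n\sum_{i=1}^n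 f_{i\delta}(T_1)f_{i\delta}(T_2)-\frac1n\sum_{i=1}^n f_{i\delta}(T_1)\cdot\frac1n\sum_{i=1}^n f_{i\delta}(T_2),$$ $$\hat\Gamma_{12}(T_1,T_2)=\frac1{n-1}\sum_{i=1}^{n-1} f_{(i+1)\delta}(T_1)f_{i\delta}(T_2)-\frac1n\sum_{i=1}^n f_{i\delta}(T_1)\cdot\frac1n\sum_{i=1}^n f_{i\delta}(T_2),$$ and $\hat\Gamma_{21}=\hat\Gamma_{12}'$. An eigenvalue $\lambda$ and eigenvector $b\neq0$ of an operator pencil $P-\lambda Q$ are such that $(P-\lambda Q)b=0$; eigenvalues are listed in decreasing order, with multiplicity. Denote by $\lambda_j,b_j$ the $j$-th eigenvalue and eigenvector of the pencil $\Gamma_{21}\Gamma_{12}-\lambda\Gamma_{11}$, and by $\hat\lambda_{\alpha j},\hat b_{\alpha j}$ those of the pencil $\hat\Gamma_{21}\hat\Gamma_{12}-\lambda(\hat\Gamma_{11}+\alpha I)$. The eigenvectors are normalized so that $b_j'\Gamma_{11}b_i=\delta_{ji}$ and $\hat b_{\alpha j}'(\hat\Gamma_{11}+\alpha I)\hat b_{\alpha i}=\delta_{ji}$ (Kronecker delta). *)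

theory Defs
  imports "HOL-Probability.Probability"
begin

definition sq_int :: "(real \<Rightarrow> real) \<Rightarrow> bool"
  where "sq_int f \<longleftrightarrow> f \<in> borel_measurable lborel \<and> integrable lborel (\<lambda>x. (f x)\<^sup>2)"

lemma sq_intD:
  assumes "sq_int f"
  shows "f \<in> borel_measurable lborel" "f \<in> borel_measurable borel" "integrable lborel (\<lambda>x. (f x)\<^sup>2)"
  using assms by (auto simp: sq_int_def)

lemma sq_int_mult:
  assumes "sq_int f" "sq_int g"
  shows "integrable lborel (\<lambda>x. f x * g x)"
proof (rule Bochner_Integration.integrable_bound)
  note [measurable] = sq_intD(2)[OF assms(1)] sq_intD(2)[OF assms(2)]
  show "integrable lborel (\<lambda>x. (f x)\<^sup>2 + (g x)\<^sup>2)"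
    using assms by (auto simp: sq_int_def)
  show "(\<lambda>x. f x * g x) \<in> borel_measurable lborel" by measurable
  have "\<bar>a * b\<bar> \<le> a\<^sup>2 + b\<^sup>2" for a b :: real
    using sum_squares_bound[of "\<bar>a\<bar>" "\<bar>b\<bar>"] abs_ge_zero[of "a * b"] unfolding abs_mult power2_abs by linarith
  then show "AE x in lborel. norm (f x * g x) \<le> norm ((f x)\<^sup>2 + (g x)\<^sup>2)"
    by auto
qed

lemma sq_int_0: "sq_int (\<lambda>_. 0)"
  by (simp add: sq_int_def)

lemma sq_int_add:
  assumes "sq_int f" "sq_int g"
  shows "sq_int (\<lambda>x. f x + g x)"
  unfolding sq_int_def
proof
  note [measurable] = sq_intD(2)[OF assms(1)] sq_intD(2)[OF assms(2)]
  show "(\<lambda>x. f x + g x) \<in> borel_measurable lborel" by measurable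
  show "integrable lborel (\<lambda>x. (f x + g x)\<^sup>2)"
    unfolding power2_sum using sq_intD(3)[OF assms(1)] sq_intD(3)[OF assms(2)] sq_int_mult[OF assms]
    by (intro Bochner_Integration.integrable_add) (auto simp: mult.assoc)
qed

lemma sq_int_scale:
  assumes "sq_int f"
  shows "sq_int (\<lambda>x. c * f x)"
  using assms by (auto simp: sq_int_def power_mult_distrib)

lemma sq_int_minus: "sq_int f \<Longrightarrow> sq_int (\<lambda>x. - f x)"
  using sq_int_scale[of f "-1"] by simp

lemma sq_int_diff: "sq_int f \<Longrightarrow> sq_int g \<Longrightarrow> sq_int (\<lambda>x. f x - g x)"
  using sq_int_add[of f "\<lambda>x. - g x"] sq_int_minus[of g] by simp

text \<open>
  Square-integrable functions on the real line modulo equality almost everywhere. The Hilbert space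
  \<open>L\<^sup>2[0,T]\<close> is realised below as its closed subspace \<open>L2_on T\<close>, i.e. via extension by zero, because
  the endpoint is a variable of the theorem and cannot index a type.
\<close>

quotient_type L2 = "real \<Rightarrow> real" / partial: "\<lambda>f g. sq_int f \<and> sq_int g \<and> (AE x in lborel. f x = g x)"
  morphisms fun_of L2_of
proof (rule part_equivpI)
  show "\<exists>f. sq_int f \<and> sq_int f \<and> (AE x in lborel. f x = f x)"
    by (intro exI[of _ "\<lambda>_. 0"]) (auto simp: sq_int_0)
  show "symp (\<lambda>f g. sq_int f \<and> sq_int g \<and> (AE x in lborel. f x = g x))"
    by (rule sympI) (auto elim: AE_mp)
  show "transp (\<lambda>f g. sq_int f \<and> sq_int g \<and> (AE x in lborel. f x = g x))"
    by (rule transpI) (auto elim: AE_mp)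
qed

instantiation L2 :: real_inner
begin

lift_definition zero_L2 :: L2 is "\<lambda>_. 0" by (simp add: sq_int_0)

lift_definition plus_L2 :: "L2 \<Rightarrow> L2 \<Rightarrow> L2" is "\<lambda>f g x. f x + g x"
  by (auto intro: sq_int_add)

lift_definition minus_L2 :: "L2 \<Rightarrow> L2 \<Rightarrow> L2" is "\<lambda>f g x. f x - g x"
  by (auto intro: sq_int_diff)

lift_definition uminus_L2 :: "L2 \<Rightarrow> L2" is "\<lambda>f x. - f x"
  by (auto intro: sq_int_minus)

lift_definition scaleR_L2 :: "real \<Rightarrow> L2 \<Rightarrow> L2" is "\<lambda>c f x. c * f x"
  by (auto intro: sq_int_scale)

lift_definition inner_L2 :: "L2 \<Rightarrow> L2 \<Rightarrow> real" is "\<lambda>f g. \<integral>x. f x * g x \<partial>lborel"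
  by (intro integral_cong_AE) (auto intro!: borel_measurable_times dest: sq_intD(2))

definition norm_L2 :: "L2 \<Rightarrow> real"
  where "norm_L2 x = sqrt (x \<bullet> x)"

definition sgn_L2 :: "L2 \<Rightarrow> L2"
  where "sgn_L2 x = scaleR (inverse (norm x)) x"

definition dist_L2 :: "L2 \<Rightarrow> L2 \<Rightarrow> real"
  where "dist_L2 x y = norm (x - y)"

definition uniformity_L2 :: "(L2 \<times> L2) filter"
  where "uniformity_L2 = (INF e\<in>{0 <..}. principal {(x, y). dist x y < e})"

definition open_L2 :: "L2 set \<Rightarrow> bool"
  where "open_L2 S = (\<forall>x\<in>S. \<forall>\<^sub>F (x', y) in uniformity. x' = x \<longrightarrow> y \<in> S)"

instance
proof
  fix x y z :: L2 and a b :: real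
  show "x + y + z = x + (y + z)" "x + y = y + x" "0 + x = x" "- x + x = 0" "x - y = x + - y"
    "a *\<^sub>R (x + y) = a *\<^sub>R x + a *\<^sub>R y" "(a + b) *\<^sub>R x = a *\<^sub>R x + b *\<^sub>R x"
    "a *\<^sub>R b *\<^sub>R x = (a * b) *\<^sub>R x" "1 *\<^sub>R x = x"
    by (transfer; auto simp: algebra_simps intro: sq_int_0 sq_int_add sq_int_diff sq_int_scale sq_int_minus)+
  show "x \<bullet> y = y \<bullet> x"
    by transfer (simp add: mult.commute)
  show "(x + y) \<bullet> z = x \<bullet> z + y \<bullet> z"
    by transfer (simp add: distrib_right sq_int_mult)
  show "(a *\<^sub>R x) \<bullet> y = a * (x \<bullet> y)"
    by transfer (simp add: mult.assoc)
  show "0 \<le> x \<bullet> x"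
    by transfer simp
  show "(x \<bullet> x = 0) = (x = 0)"
    by transfer (auto simp: sq_int_0 sq_int_def power2_eq_square[symmetric] integral_nonneg_eq_0_iff_AE)
qed (simp_all add: sgn_L2_def dist_L2_def uniformity_L2_def open_L2_def norm_L2_def)

end

lemma sq_int_fun_of: "sq_int (fun_of x)"
  using Quotient3_rep_reflp[OF Quotient3_L2] by simp

lemma L2_of_fun_of: "L2_of (fun_of x) = x"
  using Quotient3_abs_rep[OF Quotient3_L2] .

lemma fun_of_L2_of:
  assumes "sq_int f"
  shows "AE x in lborel. fun_of (L2_of f) x = f x"
  using rep_abs_rsp_left[OF Quotient3_L2, of f f] assms by simp


lemma L2_of_eqI:
  assumes "sq_int f" "sq_int g" "AE x in lborel. f x = g x"
  shows "L2_of f = L2_of g"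
  using Quotient3_rel_abs[OF Quotient3_L2, of f g] assms by blast

lemma L2_of_add: "sq_int f \<Longrightarrow> sq_int g \<Longrightarrow> L2_of (\<lambda>x. f x + g x) = L2_of f + L2_of g"
  by (simp add: plus_L2.abs_eq)

lemma L2_of_diff: "sq_int f \<Longrightarrow> sq_int g \<Longrightarrow> L2_of (\<lambda>x. f x - g x) = L2_of f - L2_of g"
  by (simp add: minus_L2.abs_eq)

lemma L2_of_scale: "sq_int f \<Longrightarrow> L2_of (\<lambda>x. c * f x) = c *\<^sub>R L2_of f"
  by (simp add: scaleR_L2.abs_eq)

lemma inner_L2_of: "sq_int f \<Longrightarrow> sq_int g \<Longrightarrow> L2_of f \<bullet> L2_of g = (\<integral>x. f x * g x \<partial>lborel)"
  by (simp add: inner_L2.abs_eq)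

lemma norm_L2_of: "sq_int f \<Longrightarrow> (norm (L2_of f))\<^sup>2 = (\<integral>x. (f x)\<^sup>2 \<partial>lborel)"
  by (simp add: power2_norm_eq_inner inner_L2_of) (simp add: power2_eq_square)

lemma nn_integral_norm_L2_of:
  assumes "sq_int f"
  shows "(\<integral>\<^sup>+x. ennreal ((f x)\<^sup>2) \<partial>lborel) = ennreal ((norm (L2_of f))\<^sup>2)"
  unfolding norm_L2_of[OF assms] using sq_intD(3)[OF assms] by (intro nn_integral_eq_integral) auto

lemma sq_int_abs: "sq_int f \<Longrightarrow> sq_int (\<lambda>x. \<bar>f x\<bar>)"
  by (auto simp: sq_int_def)

lemma norm_L2_of_abs: "sq_int f \<Longrightarrow> norm (L2_of (\<lambda>x. \<bar>f x\<bar>)) = norm (L2_of f)"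
  by (rule power2_eq_imp_eq) (simp_all add: norm_L2_of sq_int_abs)

lemma sq_int_sum_norm:
  fixes n :: nat
  assumes "\<And>k. sq_int (D k)"
  shows "sq_int (\<lambda>x. \<Sum>k<n. D k x) \<and> norm (L2_of (\<lambda>x. \<Sum>k<n. D k x)) \<le> (\<Sum>k<n. norm (L2_of (D k)))"
proof (induction n)
  case 0
  show ?case by (simp add: sq_int_0 zero_L2.abs_eq[symmetric])
next
  case (Suc n)
  then show ?case using assms[of n] norm_triangle_ineq[of "L2_of (\<lambda>x. \<Sum>k<n. D k x)" "L2_of (D n)"]
    by (auto simp: sq_int_add L2_of_add)
qed

instance L2 :: complete_space
proof
  fix X :: "nat \<Rightarrow> L2"
  assume X: "Cauchy X"
  have "\<exists>N. \<forall>m\<ge>N. \<forall>n\<ge>N. norm (X m - X n) < (1/2) ^ k" for k :: nat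
    using X unfolding Cauchy_def dist_norm by simp
  then obtain N where N: "\<And>k m n. m \<ge> N k \<Longrightarrow> n \<ge> N k \<Longrightarrow> norm (X m - X n) < (1/2) ^ k"
    by metis
  define r where "r k = (\<Sum>i\<le>k. N i) + k" for k
  have r: "strict_mono r"
    by (auto simp: strict_mono_Suc_iff r_def)
  have rN: "r m \<ge> N k" if "k \<le> m" for k m
    using member_le_sum[of k "{..m}" N] that by (auto simp: r_def)
  define F where "F k = fun_of (X (r k))" for k
  have F: "sq_int (F k)" and XF: "X (r k) = L2_of (F k)" for k
    by (simp_all add: F_def sq_int_fun_of L2_of_fun_of)
  note [measurable] = sq_intD(2)[OF F]
  define D where "D k x = \<bar>F (Suc k) x - F k x\<bar>" for k x
  have D: "sq_int (D k)" for k
    unfolding D_def by (intro sq_int_abs sq_int_diff F)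
  note [measurable] = sq_intD(2)[OF D]
  have Dn: "norm (L2_of (D k)) \<le> (1/2) ^ k" for k
    unfolding D_def using N[OF rN rN, of k "Suc k" k] F
    by (simp add: norm_L2_of_abs sq_int_diff L2_of_diff XF)
  define G where "G n x = (\<Sum>k<n. D k x)" for n x
  have G: "sq_int (G n)" "norm (L2_of (G n)) \<le> 2" for n
  proof -
    have Geq: "G n = (\<lambda>x. \<Sum>k<n. D k x)"
      by (rule ext) (simp add: G_def)
    show "sq_int (G n)"
      using sq_int_sum_norm[of D n, OF D] by (simp add: Geq)
    have "norm (L2_of (G n)) \<le> (\<Sum>k<n. norm (L2_of (D k)))"
      using sq_int_sum_norm[of D n, OF D] by (simp add: Geq)
    also have "\<dots> \<le> (\<Sum>k<n. (1/2) ^ k)"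
      by (intro sum_mono Dn)
    also have "\<dots> \<le> (2::real)"
      by (simp add: geometric_sum)
    finally show "norm (L2_of (G n)) \<le> 2" .
  qed
  note [measurable] = sq_intD(2)[OF G(1)]
  have D0: "D k x \<ge> 0" for k x
    by (simp add: D_def)
  have G0: "G n x \<ge> 0" for n x
    unfolding G_def by (intro sum_nonneg D0)
  have Gmono: "mono (\<lambda>n. G n x)" for x
    by (intro incseq_SucI) (simp add: G_def D0)
  have "(\<integral>\<^sup>+x. (SUP n. ennreal ((G n x)\<^sup>2)) \<partial>lborel) = (SUP n. \<integral>\<^sup>+x. ennreal ((G n x)\<^sup>2) \<partial>lborel)"
    using Gmono G0 by (intro nn_integral_monotone_convergence_SUP)
      (auto simp: incseq_def le_fun_def intro!: ennreal_leI power_mono)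
  also have "\<dots> \<le> ennreal 4"
  proof (rule SUP_least)
    fix n
    have "(norm (L2_of (G n)))\<^sup>2 \<le> 2\<^sup>2"
      by (intro power_mono G) simp
    then show "(\<integral>\<^sup>+x. ennreal ((G n x)\<^sup>2) \<partial>lborel) \<le> ennreal 4"
      unfolding nn_integral_norm_L2_of[OF G(1)] by (intro ennreal_leI) simp
  qed
  finally have "(\<integral>\<^sup>+x. (SUP n. ennreal ((G n x)\<^sup>2)) \<partial>lborel) \<noteq> \<infinity>"
    by (auto simp: top_unique)
  then have "AE x in lborel. (SUP n. ennreal ((G n x)\<^sup>2)) \<noteq> \<infinity>"
    by (intro nn_integral_PInf_AE) auto
  then have conv: "AE x in lborel. (\<lambda>k. F k x) \<longlonglongrightarrow> lim (\<lambda>k. F k x)"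
  proof eventually_elim
    case (elim x)
    then obtain c where c: "c \<ge> 0" "(SUP n. ennreal ((G n x)\<^sup>2)) = ennreal c"
      by (cases "SUP n. ennreal ((G n x)\<^sup>2)") auto
    have "G n x \<le> sqrt c" for n
    proof -
      have "ennreal ((G n x)\<^sup>2) \<le> ennreal c"
        unfolding c(2)[symmetric] by (rule SUP_upper) simp
      then show ?thesis
        using c(1) by (intro real_le_rsqrt) (simp add: ennreal_le_iff)
    qed
    then have "(\<Sum>k\<le>n. norm (F (Suc k) x - F k x)) \<le> sqrt c" for n
      unfolding lessThan_Suc_atMost[symmetric] G_def D_def real_norm_def .
    then have "summable (\<lambda>k. norm (F (Suc k) x - F k x))"
      by (intro bounded_imp_summable[of _ "sqrt c"]) simp_all
    then have "summable (\<lambda>k. F (Suc k) x - F k x)"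
      by (rule summable_norm_cancel)
    then have "convergent (\<lambda>n. \<Sum>k<n. F (Suc k) x - F k x)"
      by (simp add: summable_iff_convergent)
    then have "convergent (\<lambda>n. (F n x - F 0 x) + F 0 x)"
      unfolding sum_lessThan_telescope[of "\<lambda>k. F k x"] by (intro convergent_add convergent_const)
    then show ?case
      by (simp add: convergent_LIMSEQ_iff)
  qed
  define L where "L x = lim (\<lambda>k. F k x)" for x
  have [measurable]: "L \<in> borel_measurable borel"
    unfolding L_def by measurable
  have bound: "(\<integral>\<^sup>+x. ennreal ((L x - F k x)\<^sup>2) \<partial>lborel) \<le> ennreal (((1/2) ^ k)\<^sup>2)" for k
  proof -
    have "(\<integral>\<^sup>+x. ennreal ((L x - F k x)\<^sup>2) \<partial>lborel) = (\<integral>\<^sup>+x. liminf (\<lambda>m. ennreal ((F m x - F k x)\<^sup>2)) \<partial>lborel)"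
    proof (rule nn_integral_cong_AE, use conv in eventually_elim)
      case (elim x)
      then have "(\<lambda>m. ennreal ((F m x - F k x)\<^sup>2)) \<longlonglongrightarrow> ennreal ((L x - F k x)\<^sup>2)"
        unfolding L_def by (intro tendsto_ennrealI tendsto_intros)
      then show ?case
        by (rule lim_imp_Liminf[OF trivial_limit_sequentially, symmetric])
    qed
    also have "\<dots> \<le> liminf (\<lambda>m. \<integral>\<^sup>+x. ennreal ((F m x - F k x)\<^sup>2) \<partial>lborel)"
      by (rule nn_integral_liminf) simp
    also have "\<dots> \<le> ennreal (((1/2) ^ k)\<^sup>2)"
    proof (rule Liminf_le[OF trivial_limit_sequentially], rule eventually_sequentiallyI)
      fix m assume m: "k \<le> m"
      have "(norm (X (r m) - X (r k)))\<^sup>2 \<le> ((1/2) ^ k)\<^sup>2"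
        using N[OF rN rN, of k m k] m by (intro power_mono) auto
      then show "(\<integral>\<^sup>+x. ennreal ((F m x - F k x)\<^sup>2) \<partial>lborel) \<le> ennreal (((1/2) ^ k)\<^sup>2)"
        unfolding nn_integral_norm_L2_of[OF sq_int_diff[OF F F]]
        by (intro ennreal_leI) (simp add: XF L2_of_diff F)
    qed
    finally show ?thesis .
  qed
  have LF: "sq_int (\<lambda>x. L x - F k x)" for k
    unfolding sq_int_def
  proof
    show "integrable lborel (\<lambda>x. (L x - F k x)\<^sup>2)"
      using bound[of k] by (intro integrableI_bounded) (auto simp: top_unique less_top[symmetric])
  qed simp
  have L: "sq_int L"
    using sq_int_add[OF LF[of 0] F[of 0]] by simp
  have "norm (L2_of L - X (r k)) \<le> (1/2) ^ k" for k
  proof -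
    have "ennreal ((norm (L2_of L - X (r k)))\<^sup>2) \<le> ennreal (((1/2) ^ k)\<^sup>2)"
      using bound[of k] unfolding nn_integral_norm_L2_of[OF LF] by (simp add: XF L2_of_diff F L)
    then show ?thesis
      by (simp add: power2_le_iff_abs_le)
  qed
  moreover have "(\<lambda>k. (1/2::real) ^ k) \<longlonglongrightarrow> 0"
    by (rule LIMSEQ_power_zero) simp
  ultimately have "(\<lambda>k. norm (L2_of L - X (r k))) \<longlonglongrightarrow> 0"
    by (intro tendsto_sandwich[of "\<lambda>_. 0" "\<lambda>k. norm (L2_of L - X (r k))" sequentially "\<lambda>k. (1/2) ^ k"]) auto
  then have "(X \<circ> r) \<longlonglongrightarrow> L2_of L"
    unfolding tendsto_dist_iff[of "X \<circ> r"] by (simp add: dist_norm norm_minus_commute)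
  then show "convergent X"
    using Cauchy_converges_subseq[OF X r] by (auto simp: convergent_def)
qed

instance L2 :: banach ..

lemma L2_of_tendsto:
  assumes f: "sq_int f" and F: "\<And>i. sq_int (F i)" and g: "sq_int g"
    and le: "\<And>i x. \<bar>F i x\<bar> \<le> g x" and lim: "\<And>x. (\<lambda>i. F i x) \<longlonglongrightarrow> f x"
  shows "(\<lambda>i::nat. L2_of (F i)) \<longlonglongrightarrow> L2_of f"
proof -
  note [measurable] = sq_intD(2)[OF F] sq_intD(2)[OF f]
  have "(\<lambda>i. \<integral>x. (F i x - f x)\<^sup>2 \<partial>lborel) \<longlonglongrightarrow> (\<integral>x. 0 \<partial>(lborel :: real measure))"
  proof (rule integral_dominated_convergence)
    show "integrable lborel (\<lambda>x. (2 * g x)\<^sup>2)"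
      using sq_int_scale[OF g] by (rule sq_intD)
    have "((\<lambda>i. (F i x - f x)\<^sup>2) \<longlongrightarrow> (f x - f x)\<^sup>2) sequentially" for x
      by (intro tendsto_intros lim)
    then show "AE x in lborel. (\<lambda>i. (F i x - f x)\<^sup>2) \<longlonglongrightarrow> 0" by simp
    have fg: "\<bar>f x\<bar> \<le> g x" for x
      by (rule LIMSEQ_le_const2[OF tendsto_rabs[OF lim]]) (use le in auto)
    then have "(F i x - f x)\<^sup>2 \<le> (2 * g x)\<^sup>2" for i x
      using le[of i x] fg[of x] by (intro abs_le_square_iff[THEN iffD1]) linarith
    then show "AE x in lborel. norm ((F i x - f x)\<^sup>2) \<le> (2 * g x)\<^sup>2" for i by simp
  qed simp_all
  then have "(\<lambda>i. (norm (L2_of (F i) - L2_of f))\<^sup>2) \<longlonglongrightarrow> 0"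
    by (simp add: norm_L2_of sq_int_diff F f flip: L2_of_diff)
  from tendsto_real_sqrt[OF this] have "(\<lambda>i. norm (L2_of (F i) - L2_of f)) \<longlonglongrightarrow> 0"
    by simp
  then show ?thesis
    unfolding tendsto_dist_iff[of "\<lambda>i. L2_of (F i)"] by (simp add: dist_norm)
qed


definition rat_step :: "(rat \<times> rat \<times> rat) list \<Rightarrow> real \<Rightarrow> real"
  where "rat_step ps x = (\<Sum>(q, a, b)\<leftarrow>ps. of_rat q * indicator {of_rat a<..of_rat b} x)"

lemma sq_int_indicator:
  assumes "A \<in> sets borel" "emeasure lborel A < \<infinity>"
  shows "sq_int (indicator A)"
proof -
  have "(indicator A x :: real)\<^sup>2 = indicator A x" for x
    by (simp add: indicator_def)
  then show ?thesis using assms by (simp add: sq_int_def)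
qed

lemma sq_int_rat_step: "sq_int (rat_step ps)"
proof (induction ps)
  case Nil
  show ?case by (simp add: rat_step_def[abs_def] sq_int_0)
next
  case (Cons p ps)
  obtain q a b where p: "p = (q, a, b)" by (cases p)
  have "emeasure lborel {real_of_rat a<..of_rat b} < \<infinity>"
    by (cases "a \<le> b") (auto simp: of_rat_less_eq)
  then have "sq_int (\<lambda>x. of_rat q * indicator {of_rat a<..of_rat b} x + rat_step ps x)"
    by (intro sq_int_add sq_int_scale sq_int_indicator Cons) simp
  then show ?case
    by (simp add: rat_step_def[abs_def] p)
qed

lemma rat_sequence: "\<exists>q :: nat \<Rightarrow> rat. (\<lambda>n. real_of_rat (q n)) \<longlonglongrightarrow> c \<and> (\<forall>n. c < real_of_rat (q n) \<and> real_of_rat (q n) < c + 1)"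
proof -
  have "\<exists>q. c < real_of_rat q \<and> real_of_rat q < c + 1 / real (Suc n)" for n
    by (rule of_rat_dense) simp
  then obtain q where q: "\<And>n. c < real_of_rat (q n)" "\<And>n. real_of_rat (q n) < c + 1 / real (Suc n)"
    by metis
  have "(\<lambda>n. real_of_rat (q n)) \<longlonglongrightarrow> c"
  proof (rule tendsto_sandwich)
    show "(\<lambda>n. c) \<longlonglongrightarrow> c" by simp
    have "(\<lambda>n. c + 1 / real (Suc n)) \<longlonglongrightarrow> c + 0"
      by (intro tendsto_intros LIMSEQ_Suc[OF lim_1_over_n])
    then show "(\<lambda>n. c + 1 / real (Suc n)) \<longlonglongrightarrow> c" by simp
  qed (use q in \<open>auto intro!: always_eventually less_imp_le\<close>)
  moreover have "real_of_rat (q n) < c + 1" for n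
    using q(2)[of n] by (rule less_le_trans) (simp add: field_simps)
  ultimately show ?thesis using q(1) by blast
qed

lemma closure_rat_step_add:
  assumes "x \<in> closure (range (\<lambda>ps. L2_of (rat_step ps)))" "y \<in> closure (range (\<lambda>ps. L2_of (rat_step ps)))"
  shows "x + y \<in> closure (range (\<lambda>ps. L2_of (rat_step ps)))"
proof -
  obtain u v where u: "\<And>n. u n \<in> range (\<lambda>ps. L2_of (rat_step ps))" "u \<longlonglongrightarrow> x"
    and v: "\<And>n. v n \<in> range (\<lambda>ps. L2_of (rat_step ps))" "v \<longlonglongrightarrow> y"
    using assms unfolding closure_sequential by metis
  have "L2_of (rat_step ps) + L2_of (rat_step qs) = L2_of (rat_step (ps @ qs))" for ps qs
  proof -
    have "rat_step (ps @ qs) = (\<lambda>x. rat_step ps x + rat_step qs x)"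
      by (rule ext) (simp add: rat_step_def)
    then show ?thesis
      by (simp add: L2_of_add sq_int_rat_step)
  qed
  then have "u n + v n \<in> range (\<lambda>ps. L2_of (rat_step ps))" for n
    using u(1)[of n] v(1)[of n] by auto
  then show ?thesis
    unfolding closure_sequential using tendsto_add[OF u(2) v(2)]
    by (intro exI[of _ "\<lambda>n. u n + v n"]) simp
qed

lemma closure_rat_step_scale:
  assumes "x \<in> closure (range (\<lambda>ps. L2_of (rat_step ps)))"
  shows "c *\<^sub>R x \<in> closure (range (\<lambda>ps. L2_of (rat_step ps)))"
proof -
  obtain u where u: "\<And>n. u n \<in> range (\<lambda>ps. L2_of (rat_step ps))" "u \<longlonglongrightarrow> x"
    using assms unfolding closure_sequential by metis
  obtain q :: "nat \<Rightarrow> rat" where q: "(\<lambda>n. real_of_rat (q n)) \<longlonglongrightarrow> c"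
    using rat_sequence by blast
  have rat_step: "r * rat_step ps x = rat_step (map (\<lambda>(s, a, b). (t * s, a, b)) ps) x" if "r = of_rat t" for r t ps x
    by (induction ps) (auto simp: rat_step_def that of_rat_mult algebra_simps)
  have "real_of_rat t *\<^sub>R L2_of (rat_step ps) = L2_of (rat_step (map (\<lambda>(s, a, b). (t * s, a, b)) ps))" for t ps
    by (simp add: L2_of_scale[symmetric] sq_int_rat_step rat_step[OF refl])
  then have "real_of_rat (q n) *\<^sub>R u n \<in> range (\<lambda>ps. L2_of (rat_step ps))" for n
    using u(1)[of n] by auto
  then show ?thesis
    unfolding closure_sequential using tendsto_scaleR[OF q u(2)]
    by (intro exI[of _ "\<lambda>n. real_of_rat (q n) *\<^sub>R u n"]) simp
qed

lemma closure_rat_step_indicator: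
  fixes N :: nat
  assumes "A \<in> sets borel"
  shows "L2_of (indicator (A \<inter> {- real N<..real N})) \<in> closure (range (\<lambda>ps. L2_of (rat_step ps)))" (is "?ind A \<in> ?V")
proof -
  have sq: "sq_int (indicator (A \<inter> {- real N<..real N}))" if "A \<in> sets borel" for A
  proof (rule sq_int_indicator)
    have "emeasure lborel (A \<inter> {- real N<..real N}) \<le> emeasure lborel {- real N<..real N}"
      by (rule emeasure_mono) auto
    also have "\<dots> < \<infinity>" by simp
    finally show "emeasure lborel (A \<inter> {- real N<..real N}) < \<infinity>" .
  qed (use that in auto)
  have borel: "sets borel = sigma_sets UNIV (range (\<lambda>a::real. {..a}))"
    by (subst borel_eq_atMost) simp
  have sqN: "sq_int (indicator {- real N<..real N})"
    using sq[of UNIV] by simp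
  have indV: "L2_of (indicator {real_of_rat a<..of_rat b}) \<in> ?V" for a b
  proof -
    have "rat_step [(1, a, b)] = indicator {real_of_rat a<..of_rat b}"
      by (rule ext) (simp add: rat_step_def)
    then show ?thesis
      by (metis closure_subset rangeI subsetD)
  qed
  have zero: "0 \<in> ?V"
  proof -
    have "rat_step [] = (\<lambda>_. 0)" by (rule ext) (simp add: rat_step_def)
    then have "L2_of (rat_step []) = 0" by (simp add: zero_L2.abs_eq)
    then show ?thesis by (metis closure_subset rangeI subsetD)
  qed
  have N: "L2_of (indicator {- real N<..real N}) \<in> ?V"
    using indV[of "- of_nat N" "of_nat N"] by (simp add: of_rat_minus)
  have "Int_stable (range (\<lambda>a::real. {..a}))"
    by (auto simp: Int_stable_def)
  then show ?thesis
    using subset_UNIV[THEN PowI, THEN subsetI] assms[unfolded borel]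
  proof (induction rule: sigma_sets_induct_disjoint)
    case (basic A)
    then obtain a :: real where A: "A = {..a}" by auto
    obtain q :: "nat \<Rightarrow> rat" where q: "(\<lambda>n. real_of_rat (q n)) \<longlonglongrightarrow> a" "\<And>n. a < real_of_rat (q n)"
      using rat_sequence by blast
    have lim: "(\<lambda>n. ?ind {..real_of_rat (q n)}) \<longlonglongrightarrow> ?ind A"
    proof (rule L2_of_tendsto[OF _ _ sqN])
      fix x
      show "(\<lambda>n. indicator ({..real_of_rat (q n)} \<inter> {- real N<..real N}) x) \<longlonglongrightarrow> (indicator (A \<inter> {- real N<..real N}) x :: real)"
      proof (cases "x \<le> a")
        case True
        then have "x \<le> real_of_rat (q n)" for n
          using q(2)[of n] by simp
        then show ?thesis using True by (simp add: A indicator_def)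
      next
        case False
        then have ev: "\<forall>\<^sub>F n in sequentially. real_of_rat (q n) < x"
          by (intro order_tendstoD(2)[OF q(1)]) simp
        then show ?thesis
          using False by (intro tendsto_eventually eventually_mono[OF ev]) (simp add: A indicator_def)
      qed
    qed (auto intro!: sq simp: A, auto simp: indicator_def)
    have *: "?ind {..real_of_rat r} \<in> ?V" for r
    proof -
      have "{..real_of_rat r} \<inter> {- real N<..real N} = {real_of_rat (- of_nat N)<..of_rat (min r (of_nat N))}"
        by (auto simp: of_rat_minus min_def of_rat_less_eq[symmetric, where 'a=real] simp del: of_rat_less_eq)
      then show ?thesis using indV by metis
    qed
    show ?case
      by (rule closed_sequentially[OF closed_closure * lim])
  next
    case empty
    show ?case using zero by (simp add: zero_L2.abs_eq[symmetric] indicator_def[abs_def])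
  next
    case (compl A)
    then have A: "A \<in> sets borel" by (simp add: borel)
    have "?ind (UNIV - A) = L2_of (\<lambda>x. indicator {- real N<..real N} x - indicator (A \<inter> {- real N<..real N}) x)"
      by (intro arg_cong[where f=L2_of] ext) (auto simp: indicator_def)
    also have "\<dots> = L2_of (indicator {- real N<..real N}) + (-1) *\<^sub>R ?ind A"
      using sq[OF A] sqN by (simp add: L2_of_diff)
    also have "\<dots> \<in> ?V"
      by (intro closure_rat_step_add closure_rat_step_scale N compl)
    finally show ?case .
  next
    case (union A)
    then have A: "A i \<in> sets borel" for i by (auto simp: borel)
    have ind: "indicator ((\<Union>i<n. A i) \<inter> {- real N<..real N}) x = (\<Sum>i<n. indicator (A i \<inter> {- real N<..real N}) x :: real)" for n x
    proof -
      have "disjoint_family_on (\<lambda>i. A i \<inter> {- real N<..real N}) {..<n}"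
        using union(1) by (auto simp: disjoint_family_on_def)
      then show ?thesis
        using indicator_UN_disjoint[of "{..<n}" "\<lambda>i. A i \<inter> {- real N<..real N}" x] by simp
    qed
    have *: "?ind (\<Union>i<n. A i) \<in> ?V" for n
    proof (induction n)
      case 0
      show ?case using zero by (simp add: zero_L2.abs_eq[symmetric] indicator_def[abs_def])
    next
      case (Suc n)
      have "?ind (\<Union>i<Suc n. A i) = L2_of (\<lambda>x. indicator ((\<Union>i<n. A i) \<inter> {- real N<..real N}) x + indicator (A n \<inter> {- real N<..real N}) x)"
        by (intro arg_cong[where f=L2_of] ext) (simp only: ind sum.lessThan_Suc)
      also have "\<dots> = ?ind (\<Union>i<n. A i) + ?ind (A n)"
        using A by (intro L2_of_add sq) auto
      also have "\<dots> \<in> ?V"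
        using Suc union(3) by (intro closure_rat_step_add)
      finally show ?case .
    qed
    have lim: "(\<lambda>n. ?ind (\<Union>i<n. A i)) \<longlonglongrightarrow> ?ind (\<Union>i. A i)"
    proof (rule L2_of_tendsto[OF _ _ sqN])
      fix x
      show "(\<lambda>n. indicator ((\<Union>i<n. A i) \<inter> {- real N<..real N}) x) \<longlonglongrightarrow> (indicator ((\<Union>i. A i) \<inter> {- real N<..real N}) x :: real)"
        unfolding UN_extend_simps(4) by (rule LIMSEQ_indicator_UN)
    qed (use A in \<open>auto intro!: sq\<close>, auto simp: indicator_def)
    show ?case
      by (rule closed_sequentially[OF closed_closure * lim])
  qed
qed

lemma closure_rat_step: "closure (range (\<lambda>ps. L2_of (rat_step ps))) = UNIV" (is "?V = _")
proof -
  have "z \<in> ?V" for z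
  proof -
    define f where "f = fun_of z"
    have f: "sq_int f" and z: "z = L2_of f"
      by (simp_all add: f_def sq_int_fun_of L2_of_fun_of)
    obtain s where s: "\<And>i::nat. simple_function borel (s i)" "\<And>x. (\<lambda>i. s i x) \<longlonglongrightarrow> f x"
      "\<And>i x. dist (s i x) 0 \<le> 2 * dist (f x) 0"
      using borel_measurable_implies_sequence_metric[OF sq_intD(2)[OF f], of 0] by auto
    define t where "t i x = s i x * indicator {- real i<..real i} x" for i x
    have t: "sq_int (t i) \<and> L2_of (t i) \<in> ?V" for i
    proof -
      have fin: "finite (range (s i))"
        using s(1)[of i] by (auto simp: simple_function_def)
      have "t i = (\<lambda>x. \<Sum>y\<in>range (s i). y * indicator (s i -` {y} \<inter> {- real i<..real i}) x)"
      proof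
        fix x
        have "(\<Sum>y\<in>range (s i). y * indicator (s i -` {y} \<inter> {- real i<..real i}) x)
          = (\<Sum>y\<in>range (s i). if y = s i x then y * indicator {- real i<..real i} x else 0)"
          by (intro sum.cong) (auto simp: indicator_def)
        then show "t i x = (\<Sum>y\<in>range (s i). y * indicator (s i -` {y} \<inter> {- real i<..real i}) x)"
          by (simp add: fin t_def)
      qed
      moreover have "sq_int (\<lambda>x. \<Sum>y\<in>Y. y * indicator (s i -` {y} \<inter> {- real i<..real i}) x)
        \<and> L2_of (\<lambda>x. \<Sum>y\<in>Y. y * indicator (s i -` {y} \<inter> {- real i<..real i}) x) \<in> ?V"
        if "finite Y" for Y
        using that
      proof (induction Y)
        case empty
        have "L2_of (indicator ({} \<inter> {- real 0<..real 0})) \<in> ?V"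
          by (rule closure_rat_step_indicator) simp
        then show ?case by (simp add: sq_int_0 indicator_def[abs_def])
      next
        case (insert y Y)
        have m: "s i -` {y} \<in> sets borel"
          using measurable_sets[OF borel_measurable_simple_function[OF s(1)[of i]], of "{y}"] by simp
        have "emeasure lborel (s i -` {y} \<inter> {- real i<..real i}) \<le> emeasure lborel {- real i<..real i}"
          by (rule emeasure_mono) auto
        also have "\<dots> < \<infinity>" by simp
        finally have "sq_int (indicator (s i -` {y} \<inter> {- real i<..real i}))"
          using m by (intro sq_int_indicator) auto
        note ind = this
        have y: "sq_int (\<lambda>x. y * indicator (s i -` {y} \<inter> {- real i<..real i}) x)"
          "L2_of (\<lambda>x. y * indicator (s i -` {y} \<inter> {- real i<..real i}) x) \<in> ?V"
          unfolding L2_of_scale[OF ind]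
          by (rule sq_int_scale[OF ind], rule closure_rat_step_scale[OF closure_rat_step_indicator[OF m, of i]])
        note IH = insert.IH[THEN conjunct1] insert.IH[THEN conjunct2]
        show ?case
          unfolding sum.insert[OF insert.hyps] L2_of_add[OF y(1) IH(1)]
          by (intro conjI sq_int_add[OF y(1) IH(1)] closure_rat_step_add[OF y(2) IH(2)])
      qed
      ultimately show ?thesis using fin by simp
    qed
    have "(\<lambda>i. L2_of (t i)) \<longlonglongrightarrow> L2_of f"
    proof (rule L2_of_tendsto[OF f])
      show "sq_int (\<lambda>x. 2 * \<bar>f x\<bar>)"
        by (intro sq_int_scale sq_int_abs f)
      show "\<bar>t i x\<bar> \<le> 2 * \<bar>f x\<bar>" for i x
        using s(3)[of i x] by (simp add: t_def indicator_def)
      fix x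
      have "\<forall>\<^sub>F i in sequentially. s i x = t i x"
      proof (rule eventually_sequentiallyI)
        fix i assume "nat \<lceil>\<bar>x\<bar>\<rceil> + 1 \<le> i"
        then have "\<bar>x\<bar> < real i" by linarith
        then show "s i x = t i x" by (auto simp: t_def indicator_def)
      qed
      then show "(\<lambda>i. t i x) \<longlonglongrightarrow> f x"
        using s(2)[of x] by (rule Lim_transform_eventually[rotated])
    qed (rule t[THEN conjunct1])
    then show ?thesis
      unfolding z by (rule closed_sequentially[OF closed_closure, rotated]) (rule t[THEN conjunct2])
  qed
  then show ?thesis
    by (rule UNIV_eq_I[symmetric])
qed

instance L2 :: second_countable_topology
proof
  let ?D = "range (\<lambda>ps. L2_of (rat_step ps))"
  let ?B = "(\<lambda>(d, n). ball d (1 / real (Suc n))) ` (?D \<times> UNIV)"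
  have "topological_basis ?B"
  proof (rule topological_basisI)
    fix U and x :: L2
    assume "open U" "x \<in> U"
    then obtain e where e: "e > 0" "ball x e \<subseteq> U"
      using open_contains_ball by blast
    obtain n where n: "1 / real (Suc n) < e / 2"
      using e(1) nat_approx_posE[of "e / 2"] by auto
    have "x \<in> closure ?D" using closure_rat_step by simp
    then obtain d where d: "d \<in> ?D" "dist d x < 1 / real (Suc n)"
      unfolding closure_approachable by (metis of_nat_0_less_iff zero_less_Suc zero_less_divide_1_iff)
    have "ball d (1 / real (Suc n)) \<subseteq> ball x e"
    proof
      fix y assume "y \<in> ball d (1 / real (Suc n))"
      then show "y \<in> ball x e"
        using d(2) n dist_triangle[of x y d] by (simp add: dist_commute)
    qed
    then show "\<exists>B\<in>?B. x \<in> B \<and> B \<subseteq> U"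
      using d e(2) by (intro bexI[of _ "ball d (1 / real (Suc n))"]) auto
  qed auto
  then have "open = generate_topology ?B"
    by (rule topological_basis_imp_subbasis)
  moreover have "countable ?B"
    by (intro countable_image countable_SIGMA countableI_type)
  ultimately show "\<exists>B::L2 set set. countable B \<and> open = generate_topology B"
    by (intro exI[of _ ?B] conjI)
qed


definition L2_on :: "real \<Rightarrow> L2 set"
  where "L2_on T = {x. AE t in lborel. t \<notin> {0..T} \<longrightarrow> fun_of x t = 0}"

definition int_op :: "real \<Rightarrow> (real \<Rightarrow> real \<Rightarrow> real) \<Rightarrow> L2 \<Rightarrow> L2"
  where "int_op T K x =
    L2_of (\<lambda>s. indicator {0..T} s * (LINT t:{0..T}|lborel. K s t * fun_of x t))"

definition hs_kernel :: "real \<Rightarrow> (real \<Rightarrow> real \<Rightarrow> real) \<Rightarrow> bool"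
  where "hs_kernel T K \<longleftrightarrow>
    set_borel_measurable lborel ({0..T} \<times> {0..T}) (\<lambda>(s, t). K s t) \<and>
    set_integrable lborel ({0..T} \<times> {0..T}) (\<lambda>(s, t). (K s t)\<^sup>2)"

definition random_element :: "'a measure \<Rightarrow> real \<Rightarrow> ('a \<Rightarrow> L2) \<Rightarrow> bool"
  where "random_element M T X \<longleftrightarrow> X \<in> borel_measurable M \<and> (\<forall>\<omega>\<in>space M. X \<omega> \<in> L2_on T)"

text \<open>The operator \<open>x \<mapsto> E[(X'x) Y]\<close>; it is only used for mean-zero \<open>X\<close> and \<open>Y\<close>.\<close>

definition cov_op :: "'a measure \<Rightarrow> ('a \<Rightarrow> L2) \<Rightarrow> ('a \<Rightarrow> L2) \<Rightarrow> L2 \<Rightarrow> L2"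
  where "cov_op M X Y x = (\<integral>\<omega>. (X \<omega> \<bullet> x) *\<^sub>R Y \<omega> \<partial>M)"

text \<open>Processes are indexed by the two-sided grid of integer multiples of \<open>\<delta>\<close>; their values at other
  times are irrelevant.\<close>

definition time_grid :: "real \<Rightarrow> real set"
  where "time_grid \<delta> = range (\<lambda>k::int. of_int k * \<delta>)"

definition strong_white_noise :: "'a measure \<Rightarrow> real \<Rightarrow> real \<Rightarrow> (real \<Rightarrow> 'a \<Rightarrow> L2) \<Rightarrow> bool"
  where "strong_white_noise M T \<delta> \<epsilon> \<longleftrightarrow>
    (\<forall>t\<in>time_grid \<delta>. random_element M T (\<epsilon> t)) \<and>
    prob_space.indep_vars M (\<lambda>_. borel) \<epsilon> (time_grid \<delta>) \<and>
    (\<forall>s\<in>time_grid \<delta>. \<forall>t\<in>time_grid \<delta>. distr M borel (\<epsilon> s) = distr M borel (\<epsilon> t)) \<and>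
    (\<forall>t\<in>time_grid \<delta>. integrable M (\<lambda>\<omega>. (norm (\<epsilon> t \<omega>))\<^sup>2) \<and> (\<integral>\<omega>. (norm (\<epsilon> t \<omega>))\<^sup>2 \<partial>M) \<noteq> 0 \<and>
      (\<integral>\<omega>. \<epsilon> t \<omega> \<partial>M) = 0)"

definition weakly_stationary0 :: "'a measure \<Rightarrow> real \<Rightarrow> real \<Rightarrow> (real \<Rightarrow> 'a \<Rightarrow> L2) \<Rightarrow> bool"
  where "weakly_stationary0 M T \<delta> f \<longleftrightarrow>
    (\<forall>t\<in>time_grid \<delta>. random_element M T (f t) \<and> integrable M (\<lambda>\<omega>. (norm (f t \<omega>))\<^sup>2) \<and>
      (\<integral>\<omega>. f t \<omega> \<partial>M) = 0) \<and>
    (\<forall>s\<in>time_grid \<delta>. \<forall>t\<in>time_grid \<delta>. \<forall>h\<in>time_grid \<delta>. \<forall>x\<in>L2_on T.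
      cov_op M (f (s + h)) (f (t + h)) x = cov_op M (f s) (f t) x)"

definition ar1_solution ::
    "'a measure \<Rightarrow> real \<Rightarrow> real \<Rightarrow> (L2 \<Rightarrow> L2) \<Rightarrow> (real \<Rightarrow> 'a \<Rightarrow> L2) \<Rightarrow> (real \<Rightarrow> 'a \<Rightarrow> L2) \<Rightarrow> bool"
  where "ar1_solution M T \<delta> \<rho> \<epsilon> f \<longleftrightarrow>
    weakly_stationary0 M T \<delta> f \<and>
    (\<forall>t\<in>time_grid \<delta>. AE \<omega> in M. f (t + \<delta>) \<omega> = \<rho> (f t \<omega>) + \<epsilon> t \<omega>) \<and>
    (\<forall>t\<in>time_grid \<delta>. \<forall>x\<in>L2_on T. cov_op M (f t) (\<epsilon> t) x = 0)"

text \<open>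
  The model determines the process: \<open>f\<close> is its only mean-zero weakly stationary solution. Without
  uniqueness the model would admit purely deterministic components such as \<open>f\<^sub>t = Z\<close> for all \<open>t\<close>,
  with the noise vanishing in that direction, which are not estimable from one trajectory.
\<close>

definition ar1_defines ::
    "'a measure \<Rightarrow> real \<Rightarrow> real \<Rightarrow> (L2 \<Rightarrow> L2) \<Rightarrow> (real \<Rightarrow> 'a \<Rightarrow> L2) \<Rightarrow> (real \<Rightarrow> 'a \<Rightarrow> L2) \<Rightarrow> bool"
  where "ar1_defines M T \<delta> \<rho> \<epsilon> f \<longleftrightarrow>
    ar1_solution M T \<delta> \<rho> \<epsilon> f \<and>
    (\<forall>g. ar1_solution M T \<delta> \<rho> \<epsilon> g \<longrightarrow> (\<forall>t\<in>time_grid \<delta>. AE \<omega> in M. g t \<omega> = f t \<omega>))"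

definition Gamma11 :: "'a measure \<Rightarrow> (real \<Rightarrow> 'a \<Rightarrow> L2) \<Rightarrow> real \<Rightarrow> L2 \<Rightarrow> L2"
  where "Gamma11 M f t = cov_op M (f t) (f t)"

definition Gamma12 :: "'a measure \<Rightarrow> real \<Rightarrow> (real \<Rightarrow> 'a \<Rightarrow> L2) \<Rightarrow> real \<Rightarrow> L2 \<Rightarrow> L2"
  where "Gamma12 M \<delta> f t = cov_op M (f t) (f (t + \<delta>))"

definition sample_mean :: "real \<Rightarrow> (real \<Rightarrow> 'a \<Rightarrow> L2) \<Rightarrow> nat \<Rightarrow> 'a \<Rightarrow> real \<Rightarrow> real"
  where "sample_mean \<delta> f n \<omega> s = (1 / real n) * (\<Sum>i=1..n. fun_of (f (real i * \<delta>) \<omega>) s)"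

definition Gamma11_hat :: "real \<Rightarrow> real \<Rightarrow> (real \<Rightarrow> 'a \<Rightarrow> L2) \<Rightarrow> nat \<Rightarrow> 'a \<Rightarrow> L2 \<Rightarrow> L2"
  where "Gamma11_hat T \<delta> f n \<omega> = int_op T (\<lambda>s u.
    (1 / real n) * (\<Sum>i=1..n. fun_of (f (real i * \<delta>) \<omega>) s * fun_of (f (real i * \<delta>) \<omega>) u)
      - sample_mean \<delta> f n \<omega> s * sample_mean \<delta> f n \<omega> u)"

definition Gamma12_hat :: "real \<Rightarrow> real \<Rightarrow> (real \<Rightarrow> 'a \<Rightarrow> L2) \<Rightarrow> nat \<Rightarrow> 'a \<Rightarrow> L2 \<Rightarrow> L2"
  where "Gamma12_hat T \<delta> f n \<omega> = int_op T (\<lambda>s u.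
    (1 / (real n - 1)) * (\<Sum>i=1..n-1. fun_of (f ((real i + 1) * \<delta>) \<omega>) s * fun_of (f (real i * \<delta>) \<omega>) u)
      - sample_mean \<delta> f n \<omega> s * sample_mean \<delta> f n \<omega> u)"

definition pencil_eigen :: "L2 set \<Rightarrow> (L2 \<Rightarrow> L2) \<Rightarrow> (L2 \<Rightarrow> L2) \<Rightarrow> real \<Rightarrow> L2 \<Rightarrow> bool"
  where "pencil_eigen H P Q \<mu> b \<longleftrightarrow> b \<in> H \<and> b \<noteq> 0 \<and> P b - \<mu> *\<^sub>R Q b = 0"

text \<open>
  \<open>lam 1 \<ge> lam 2 \<ge> \<dots>\<close> are the eigenvalues in decreasing order with multiplicity and \<open>b 1, b 2, \<dots>\<close>
  are matching eigenvectors with \<open>b\<^sub>j' Q b\<^sub>i = \<delta>\<^sub>j\<^sub>i\<close> (index 0 is unused). By the last clause every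
  eigenvalue exceeding \<open>lam j\<close> occurs before position \<open>j\<close>, as often as its multiplicity.
\<close>

definition pencil_listing ::
    "L2 set \<Rightarrow> (L2 \<Rightarrow> L2) \<Rightarrow> (L2 \<Rightarrow> L2) \<Rightarrow> (nat \<Rightarrow> real) \<Rightarrow> (nat \<Rightarrow> L2) \<Rightarrow> bool"
  where "pencil_listing H P Q lam b \<longleftrightarrow>
    (\<forall>j\<ge>1. pencil_eigen H P Q (lam j) (b j)) \<and>
    (\<forall>i\<ge>1. \<forall>j\<ge>1. b j \<bullet> Q (b i) = (if j = i then 1 else 0)) \<and>
    (\<forall>i\<ge>1. \<forall>j\<ge>i. lam j \<le> lam i) \<and>
    (\<forall>j\<ge>1. \<forall>\<mu> c. lam j < \<mu> \<longrightarrow> pencil_eigen H P Q \<mu> c \<longrightarrow> c \<in> span (b ` {i. 1 \<le> i \<and> lam i = \<mu>}))"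

text \<open>All eigenvalues are distinct when counted with multiplicity, i.e. eigenspaces are lines.\<close>

definition pencil_distinct :: "L2 set \<Rightarrow> (L2 \<Rightarrow> L2) \<Rightarrow> (L2 \<Rightarrow> L2) \<Rightarrow> bool"
  where "pencil_distinct H P Q \<longleftrightarrow>
    (\<forall>\<mu> b c. pencil_eigen H P Q \<mu> b \<longrightarrow> pencil_eigen H P Q \<mu> c \<longrightarrow> (\<exists>r. c = r *\<^sub>R b))"

text \<open>
  The outer measure coincides with the probability on events, so for random variables this is
  convergence in probability. It spares a measurability assumption on the selected eigenvectors,
  and it does not degenerate on non-measurable sets (where \<^const>\<open>measure\<close> is 0).
\<close>

definition tendsto_in_prob :: "'a measure \<Rightarrow> (nat \<Rightarrow> 'a \<Rightarrow> real) \<Rightarrow> real \<Rightarrow> bool"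
  where "tendsto_in_prob M X c \<longleftrightarrow>
    (\<forall>e>0. (\<lambda>n. outer_measure_of M {\<omega> \<in> space M. e < \<bar>X n \<omega> - c\<bar>}) \<longlonglongrightarrow> 0)"

end

theory Submission
  imports Defs "HOL-Library.Diagonal_Subsequence"
begin

text \<open>
  Write \<open>\<Gamma>\<close> for the covariance operator and \<open>\<rho>\<close> for the autoregression operator, so that the
  cross-covariance operator is \<open>\<rho>\<Gamma>\<close>. The eigenvalues of the pencils are critical values of the Rayleigh
  quotients of \<open>\<parallel>\<rho>\<Gamma>x\<parallel>\<^sup>2\<close> by \<open>x'\<Gamma>x\<close> and of their regularised sample versions. The denominator of a sample
  quotient is at least about \<open>\<alpha>\<parallel>x\<parallel>\<^sup>2\<close>. Therefore, once the operator norm errors of the empirical operators are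
  small compared with \<open>\<alpha>\<close>, the sample quotient is uniformly close to the quotient with denominator
  \<open>x'\<Gamma>x + \<alpha>\<parallel>x\<parallel>\<^sup>2\<close>, which increases to the limit quotient as \<open>\<alpha>\<close> tends to zero. The theorem thus splits into
  a deterministic perturbation result and a rate for the empirical operators.

  The perturbation result rests on the bound \<open>rayleigh_le_eigenvalue\<close>, which holds for the limit pencil and
  for the sample pencils: orthogonally to the first \<open>j - 1\<close> listed eigenvectors the quotient is at most the
  \<open>j\<close>-th eigenvalue. It is proved by constructing a maximiser from compactness, which the completeness
  clause of the listing then excludes if the bound fails. Testing the quotient of one pencil with eigenvectors
  of the other gives \<open>eigenvalue_tendsto\<close>. For the eigenvectors, evaluating the form \<open>\<Gamma>\<rho>'\<rho>\<Gamma>\<close> at a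
  sample eigenvector and a limit eigenvector shows that components along limit eigenvectors with another
  eigenvalue vanish, and a count of energy leaves all mass on the component along \<open>b j\<close>
  (\<open>eigenvector_tendsto\<close>).

  The rate is the probabilistic part. Stationarity gives \<open>\<Gamma> = \<rho>\<Gamma>\<rho>' + \<Sigma>\<close> with the noise covariance \<open>\<Sigma>\<close>. Taking
  traces shows that the moving average \<open>\<Sum>\<^sub>j \<rho>\<^sup>j \<epsilon>\<^sub>k\<^sub>-\<^sub>1\<^sub>-\<^sub>j\<close> converges in mean square. It is a weakly
  stationary solution of the model, so by uniqueness it is the process itself
  (\<open>state_is_moving_average\<close>). Two consequences follow. First, the process at time \<open>k\<close> is a function of
  the noise before time \<open>k\<close>. Secondly, \<open>\<rho>\<^sup>m\<Gamma>(\<rho>\<^sup>m)'\<close> tends to zero in trace. As \<open>\<Gamma>\<close> is positive definite and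
  \<open>\<rho>\<close> is compact, this improves to \<open>\<parallel>\<rho>\<^sup>m\<parallel> \<le> 1/2\<close> for some \<open>m\<close> (\<open>power_contraction\<close>).

  The error \<open>Z\<close> of the empirical second moment then solves a Lyapunov equation \<open>Z = \<rho>Z\<rho>' + W\<close>, where \<open>W\<close>
  consists of averages of martingale differences and a boundary term (\<open>state_error_recursion\<close>). The
  contraction bounds \<open>Z\<close> by a constant times \<open>W\<close>, pathwise. Entrywise variances in a Parseval frame give
  Hilbert-Schmidt norms of mean square \<open>O(1/n)\<close> for the averages, which is where fourth moments are used.
  Hence all errors are of order \<open>n\<^sup>-\<^sup>1\<^sup>/\<^sup>2\<close> in probability and negligible against \<open>\<alpha>\<close>
  (\<open>total_error_rate\<close>).
\<close>

section \<open>Separable Hilbert spaces\<close>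

text \<open>
  Gram-Schmidt without discarding linearly dependent vectors: as \<open>sgn 0 = 0\<close>, a dependent vector
  contributes a zero vector. The result is orthonormal up to zeros, which costs nothing in Parseval's
  identity and spares a case distinction on the dimension.
\<close>

declare sum.cong [fundef_cong]

function gram_schmidt :: "(nat \<Rightarrow> 'h::real_inner) \<Rightarrow> nat \<Rightarrow> 'h" where
  "gram_schmidt d n = sgn (d n - (\<Sum>k<n. (d n \<bullet> gram_schmidt d k) *\<^sub>R gram_schmidt d k))"
  by pat_completeness auto
termination
  by (relation "Wellfounded.measure snd") auto

declare gram_schmidt.simps [simp del] sum.cong [fundef_cong del]

lemma inner_residual:
  fixes e :: "nat \<Rightarrow> 'h::real_inner"
  assumes orth: "\<And>i j. i < n \<Longrightarrow> j < n \<Longrightarrow> i \<noteq> j \<Longrightarrow> e i \<bullet> e j = 0"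
    and unit: "\<And>i. i < n \<Longrightarrow> e i \<bullet> e i = 1 \<or> e i = 0" and "i < n"
  shows "(x - (\<Sum>k<n. (x \<bullet> e k) *\<^sub>R e k)) \<bullet> e i = 0"
proof -
  have "(\<Sum>k<n. (x \<bullet> e k) *\<^sub>R e k) \<bullet> e i = (\<Sum>k<n. if k = i then x \<bullet> e i else 0)"
    unfolding inner_sum_left using orth unit[OF \<open>i < n\<close>] \<open>i < n\<close> by (intro sum.cong) auto
  also have "\<dots> = x \<bullet> e i" using \<open>i < n\<close> by simp
  finally show ?thesis by (simp add: inner_diff_left)
qed

lemma gram_schmidt_orthogonal:
  "(\<forall>i<n. \<forall>j<n. i \<noteq> j \<longrightarrow> gram_schmidt d i \<bullet> gram_schmidt d j = 0) \<and>
   (\<forall>i<n. gram_schmidt d i \<bullet> gram_schmidt d i = 1 \<or> gram_schmidt d i = 0)"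
proof (induction n)
  case (Suc n)
  let ?e = "gram_schmidt d"
  define r where "r = d n - (\<Sum>k<n. (d n \<bullet> ?e k) *\<^sub>R ?e k)"
  have e: "?e n = sgn r"
    unfolding r_def by (rule gram_schmidt.simps)
  have "r \<bullet> ?e i = 0" if "i < n" for i
    unfolding r_def using Suc.IH that by (intro inner_residual) auto
  then have 0: "?e n \<bullet> ?e i = 0" if "i < n" for i
    using that by (simp add: e sgn_div_norm)
  have "?e n \<bullet> ?e n = 1 \<or> ?e n = 0"
    by (cases "r = 0") (auto simp: e power2_norm_eq_inner[symmetric] norm_sgn)
  then show ?case
    using Suc.IH 0 by (auto simp: less_Suc_eq inner_commute)
qed simp

definition parseval :: "(nat \<Rightarrow> 'h::real_inner) \<Rightarrow> bool"
  where "parseval e \<longleftrightarrow> (\<forall>x. (\<lambda>k. (x \<bullet> e k)\<^sup>2) sums (norm x)\<^sup>2)"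

lemma norm_residual:
  fixes e :: "nat \<Rightarrow> 'h::real_inner"
  assumes orth: "\<And>i j. i \<noteq> j \<Longrightarrow> e i \<bullet> e j = 0"
    and unit: "\<And>i. e i \<bullet> e i = 1 \<or> e i = 0"
  shows "(norm (x - (\<Sum>k<n. (x \<bullet> e k) *\<^sub>R e k)))\<^sup>2 = (norm x)\<^sup>2 - (\<Sum>k<n. (x \<bullet> e k)\<^sup>2)"
proof -
  let ?P = "\<Sum>k<n. (x \<bullet> e k) *\<^sub>R e k"
  have "(x - ?P) \<bullet> ?P = 0"
    using inner_residual[of n e _ x] orth unit by (simp add: inner_sum_right)
  moreover have "x \<bullet> ?P = (\<Sum>k<n. (x \<bullet> e k)\<^sup>2)"
    by (simp add: inner_sum_right power2_eq_square)
  ultimately show ?thesis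
    by (simp add: power2_norm_eq_inner inner_diff_left inner_diff_right inner_commute)
qed

text \<open>The Gram-Schmidt vectors of a dense sequence serve: the residual after \<open>n\<close> steps is a contraction and
  kills the first \<open>n\<close> members of the sequence, so it tends to zero at every point.\<close>

lemma ex_parseval: "\<exists>e :: nat \<Rightarrow> 'h::{real_inner,second_countable_topology}. parseval e"
proof -
  obtain D :: "'h set" where D: "countable D" "\<And>X. open X \<Longrightarrow> X \<noteq> {} \<Longrightarrow> \<exists>d\<in>D. d \<in> X"
    by (erule countable_dense_setE)
  have "D \<noteq> {}" using D(2)[of UNIV] by auto
  then obtain d :: "nat \<Rightarrow> 'h" where d: "range d = D"
    using D(1) range_from_nat_into by metis
  define e where "e = gram_schmidt d"
  have orth: "e i \<bullet> e j = 0" if "i \<noteq> j" for i j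
    using gram_schmidt_orthogonal[of "Suc (max i j)" d] that by (auto simp: e_def less_Suc_eq_le)
  have unit: "e i \<bullet> e i = 1 \<or> e i = 0" for i
    using gram_schmidt_orthogonal[of "Suc i" d] by (auto simp: e_def less_Suc_eq_le)
  define R where "R n x = x - (\<Sum>k<n. (x \<bullet> e k) *\<^sub>R e k)" for n x
  have norm_R: "(norm (R n x))\<^sup>2 = (norm x)\<^sup>2 - (\<Sum>k<n. (x \<bullet> e k)\<^sup>2)" for n x
    unfolding R_def by (rule norm_residual[OF orth unit])
  have contr: "norm (R n x) \<le> norm x" for n x
    by (rule power2_le_imp_le) (auto simp: norm_R sum_nonneg)
  have R_diff: "R n (x - y) = R n x - R n y" for n x y
    by (simp add: R_def inner_diff_left scaleR_left_diff_distrib sum_subtractf)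
  have kill: "R (Suc m) (d m) = 0" for m
  proof -
    let ?r = "R m (d m)"
    have em: "e m = sgn ?r"
      unfolding e_def R_def by (rule gram_schmidt.simps)
    have "d m \<bullet> e m = ?r \<bullet> e m"
      by (simp add: R_def inner_diff_left inner_sum_left orth)
    also have "\<dots> = norm ?r"
      by (simp add: em sgn_div_norm power2_norm_eq_inner[symmetric] power2_eq_square divide_simps)
    finally have c: "d m \<bullet> e m = norm ?r" .
    have "R (Suc m) (d m) = ?r - (d m \<bullet> e m) *\<^sub>R e m"
      by (simp add: R_def)
    also have "\<dots> = 0"
      unfolding c unfolding em by (cases "?r = 0") (simp_all add: sgn_div_norm)
    finally show ?thesis .
  qed
  have mono: "norm (R n x) \<le> norm (R m x)" if "m \<le> n" for m n x
  proof (rule power2_le_imp_le)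
    have "(\<Sum>k<m. (x \<bullet> e k)\<^sup>2) \<le> (\<Sum>k<n. (x \<bullet> e k)\<^sup>2)"
      using that by (intro sum_mono2) auto
    then show "(norm (R n x))\<^sup>2 \<le> (norm (R m x))\<^sup>2" by (simp add: norm_R)
  qed simp
  have "(\<lambda>n. norm (R n x)) \<longlonglongrightarrow> 0" for x
  proof (rule LIMSEQ_I)
    fix r :: real assume "r > 0"
    then obtain m where m: "dist x (d m) < r"
      using D(2)[of "ball x r"] d by auto
    have "norm (norm (R n x) - 0) < r" if "n \<ge> Suc m" for n
    proof -
      have "norm (R n x) \<le> norm (R n (x - d m)) + norm (R n (d m))"
        using norm_triangle_ineq[of "R n (x - d m)" "R n (d m)"] by (simp add: R_diff)
      also have "norm (R n (d m)) = 0" using mono[OF that, of "d m"] kill[of m] by simp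
      also have "norm (R n (x - d m)) \<le> norm (x - d m)" by (rule contr)
      finally show ?thesis using m by (simp add: dist_norm)
    qed
    then show "\<exists>no. \<forall>n\<ge>no. norm (norm (R n x) - 0) < r" by blast
  qed
  then have lim: "(\<lambda>n. (norm x)\<^sup>2 - (norm (R n x))\<^sup>2) \<longlonglongrightarrow> (norm x)\<^sup>2 - 0\<^sup>2" for x
    by (intro tendsto_intros)
  have "parseval e"
    unfolding parseval_def sums_def using lim by (simp add: norm_R)
  then show ?thesis by blast
qed

lemma parseval_inner:
  assumes "parseval e"
  shows "(\<lambda>k. (x \<bullet> e k) * (y \<bullet> e k)) sums (x \<bullet> y)"
proof -
  have "(\<lambda>k. (((x + y) \<bullet> e k)\<^sup>2 - ((x - y) \<bullet> e k)\<^sup>2) / 4) sums (((norm (x + y))\<^sup>2 - (norm (x - y))\<^sup>2) / 4)"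
    using assms unfolding parseval_def by (intro sums_divide sums_diff) auto
  moreover have "(((x + y) \<bullet> e k)\<^sup>2 - ((x - y) \<bullet> e k)\<^sup>2) / 4 = (x \<bullet> e k) * (y \<bullet> e k)" for k
    by (simp add: inner_add_left inner_diff_left power2_eq_square field_simps)
  moreover have "((norm (x + y))\<^sup>2 - (norm (x - y))\<^sup>2) / 4 = x \<bullet> y"
    by (simp add: power2_norm_eq_inner inner_simps inner_commute)
  ultimately show ?thesis by simp
qed

lemma parseval_nn_suminf:
  assumes "parseval e"
  shows "(\<Sum>k. ennreal ((x \<bullet> e k)\<^sup>2)) = ennreal ((norm x)\<^sup>2)"
  using assms by (intro suminf_ennreal_eq) (auto simp: parseval_def)

text \<open>By diagonalisation the inner products with a dense sequence converge along a subsequence, and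
  boundedness extends this to all vectors.\<close>

lemma bounded_seq_weakly_convergent_subseq:
  fixes x :: "nat \<Rightarrow> 'h::{real_inner,second_countable_topology}"
  assumes B: "\<And>n. norm (x n) \<le> B"
  shows "\<exists>r. strict_mono r \<and> (\<forall>y. convergent (\<lambda>n. y \<bullet> x (r n)))"
proof -
  obtain D :: "'h set" where D: "countable D" "\<And>X. open X \<Longrightarrow> X \<noteq> {} \<Longrightarrow> \<exists>d\<in>D. d \<in> X"
    by (erule countable_dense_setE)
  have "D \<noteq> {}" using D(2)[of UNIV] by auto
  then obtain d :: "nat \<Rightarrow> 'h" where d: "range d = D"
    using D(1) range_from_nat_into by metis
  have B0: "B \<ge> 0" using B[of 0] norm_ge_zero order_trans by blast
  interpret subseqs "\<lambda>k s. convergent (\<lambda>n. d k \<bullet> x (s n))"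
  proof
    fix k and s :: "nat \<Rightarrow> nat"
    have "\<bar>d k \<bullet> x (s n)\<bar> \<le> norm (d k) * B" for n
      using Cauchy_Schwarz_ineq2[of "d k" "x (s n)"] mult_left_mono[OF B norm_ge_zero] by (rule order_trans)
    then have "bounded (range (\<lambda>n. d k \<bullet> x (s n)))"
      by (intro boundedI[of _ "norm (d k) * B"]) auto
    from bounded_imp_convergent_subsequence[OF this]
    show "\<exists>r'. strict_mono r' \<and> convergent (\<lambda>n. d k \<bullet> x ((s \<circ> r') n))"
      by (auto simp: convergent_def o_def)
  qed
  have conv: "convergent (\<lambda>n. d k \<bullet> x (diagseq n))" for k
  proof -
    have "convergent (\<lambda>n. d k \<bullet> x ((diagseq \<circ> (+) (Suc k)) n))"
      by (rule diagseq_holds)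
        (auto simp: o_def convergent_def intro: LIMSEQ_subseq_LIMSEQ[unfolded o_def])
    then have "convergent (\<lambda>n. d k \<bullet> x (diagseq (n + Suc k)))"
      by (simp only: o_def add.commute)
    then show ?thesis
      using convergent_ignore_initial_segment[of "\<lambda>n. d k \<bullet> x (diagseq n)" "Suc k"] by blast
  qed
  have "Cauchy (\<lambda>n. y \<bullet> x (diagseq n))" for y
  proof (rule metric_CauchyI)
    fix \<eta> :: real assume \<eta>: "\<eta> > 0"
    define h where "h = \<eta> / (4 * (B + 1))"
    have h: "h > 0" "h * B \<le> \<eta> / 4" using \<eta> B0 by (auto simp: h_def field_simps)
    then obtain k where k: "dist y (d k) < h"
      using D(2)[of "ball y h"] d by auto
    have *: "\<bar>y \<bullet> x m - d k \<bullet> x m\<bar> \<le> \<eta> / 4" for m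
    proof -
      have "\<bar>(y - d k) \<bullet> x m\<bar> \<le> norm (y - d k) * norm (x m)" by (rule Cauchy_Schwarz_ineq2)
      also have "\<dots> \<le> h * B" using k B h(1) by (intro mult_mono) (auto simp: dist_norm)
      finally show ?thesis using h(2) by (simp add: inner_diff_left)
    qed
    obtain M where M: "\<And>m n. m \<ge> M \<Longrightarrow> n \<ge> M \<Longrightarrow> dist (d k \<bullet> x (diagseq m)) (d k \<bullet> x (diagseq n)) < \<eta> / 2"
      using metric_CauchyD[OF convergent_Cauchy[OF conv[of k]], of "\<eta> / 2"] \<eta> by auto
    have "dist (y \<bullet> x (diagseq m)) (y \<bullet> x (diagseq n)) < \<eta>" if "m \<ge> M" "n \<ge> M" for m n
      using M[OF that] *[of "diagseq m"] *[of "diagseq n"] unfolding dist_real_def by linarith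
    then show "\<exists>M. \<forall>m\<ge>M. \<forall>n\<ge>M. dist (y \<bullet> x (diagseq m)) (y \<bullet> x (diagseq n)) < \<eta>" by blast
  qed
  then show ?thesis
    using subseq_diagseq by (intro exI[of _ diagseq]) (auto intro: Cauchy_convergent)
qed

text \<open>Gaussian elimination, one equation at a time. It provides the test vectors for the eigenvalue
  comparison: combinations of \<open>j\<close> vectors that meet \<open>j - 1\<close> orthogonality conditions.\<close>

lemma underdetermined_system:
  fixes A :: "'i \<Rightarrow> 'k \<Rightarrow> real"
  assumes "finite I" "finite S" "card I < card S"
  shows "\<exists>c. (\<exists>k\<in>S. c k \<noteq> 0) \<and> (\<forall>i\<in>I. (\<Sum>k\<in>S. A i k * c k) = 0)"
  using assms
proof (induction I arbitrary: S A rule: finite_induct)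
  case empty
  then obtain k where "k \<in> S" by fastforce
  then show ?case by (intro exI[of _ "\<lambda>_. 1"]) auto
next
  case (insert i0 I)
  show ?case
  proof (cases "\<forall>k\<in>S. A i0 k = 0")
    case True
    obtain c where "\<exists>k\<in>S. c k \<noteq> 0" "\<forall>i\<in>I. (\<Sum>k\<in>S. A i k * c k) = 0"
      using insert.IH[of S A] insert.prems insert.hyps by auto
    then show ?thesis using True by (intro exI[of _ c]) auto
  next
    case False
    then obtain p where p: "p \<in> S" "A i0 p \<noteq> 0" by blast
    define A' where "A' i k = A i k - A i p * A i0 k / A i0 p" for i k
    have "card I < card (S - {p})" using insert p by simp
    then obtain c' where c': "\<exists>k\<in>S-{p}. c' k \<noteq> 0" "\<And>i. i \<in> I \<Longrightarrow> (\<Sum>k\<in>S-{p}. A' i k * c' k) = 0"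
      using insert.IH[of "S - {p}" A'] insert.prems by auto
    define c where "c = c'(p := - (\<Sum>k\<in>S-{p}. A i0 k * c' k) / A i0 p)"
    have split: "(\<Sum>k\<in>S. A i k * c k) = A i p * c p + (\<Sum>k\<in>S-{p}. A i k * c' k)" for i
      using insert.prems p by (subst sum.remove[of S p]) (auto simp: c_def intro!: sum.cong)
    have "(\<Sum>k\<in>S. A i k * c k) = 0" if "i \<in> insert i0 I" for i
    proof (cases "i = i0")
      case True
      then show ?thesis unfolding split using p by (simp add: c_def)
    next
      case False
      then have "(\<Sum>k\<in>S-{p}. A' i k * c' k) = 0" using c'(2) that by auto
      then have "(\<Sum>k\<in>S-{p}. A i k * c' k) - A i p / A i0 p * (\<Sum>k\<in>S-{p}. A i0 k * c' k) = 0"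
        by (simp add: A'_def left_diff_distrib sum_subtractf sum_distrib_left mult.assoc)
      then show ?thesis unfolding split by (simp add: c_def)
    qed
    moreover have "\<exists>k\<in>S. c k \<noteq> 0" using c'(1) by (auto simp: c_def)
    ultimately show ?thesis by blast
  qed
qed

section \<open>The variational principle for operator pencils\<close>

lemma quadratic_nonneg_discriminant:
  fixes A B C :: real
  assumes "\<And>t. 0 \<le> A + 2 * t * B + t\<^sup>2 * C"
  shows "B\<^sup>2 \<le> A * C"
proof (cases "C = 0")
  case True
  have "B = 0"
  proof (rule ccontr)
    assume "B \<noteq> 0"
    then have "A + 2 * (- (A + 1) / (2 * B)) * B = - 1" by (simp add: field_simps)
    then show False using assms[of "- (A + 1) / (2 * B)"] True by simp
  qed
  then show ?thesis using True by simp
next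
  case False
  have "C \<ge> 0"
  proof (rule ccontr)
    assume "\<not> C \<ge> 0"
    define t where "t = (\<bar>A\<bar> + 2 * \<bar>B\<bar> + 1) / (- C) + 1"
    have C: "C < 0" using \<open>\<not> C \<ge> 0\<close> by simp
    have t: "t \<ge> 1" "t * C = - (\<bar>A\<bar> + 2 * \<bar>B\<bar> + 1) + C"
      using C by (auto simp: t_def field_simps)
    have "A + 2 * t * B + t\<^sup>2 * C = A + 2 * t * B + t * (- (\<bar>A\<bar> + 2 * \<bar>B\<bar> + 1) + C)"
      using t(2) by (simp add: power2_eq_square mult.assoc)
    also have "\<dots> = (A - t * \<bar>A\<bar>) + 2 * t * (B - \<bar>B\<bar>) + t * (C - 1)" by (simp add: algebra_simps)
    also have "\<dots> < 0"
    proof -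
      have "A \<le> t * \<bar>A\<bar>" using mult_right_mono[OF t(1), of "\<bar>A\<bar>"] by simp
      moreover have "2 * t * (B - \<bar>B\<bar>) \<le> 0" using t(1) by (intro mult_nonneg_nonpos) auto
      moreover have "t * (C - 1) < 0" using t(1) C by (intro mult_pos_neg) auto
      ultimately show ?thesis by linarith
    qed
    finally show False using assms[of t] by simp
  qed
  then have "C > 0" using False by simp
  have "A + 2 * (- B / C) * B + (- B / C)\<^sup>2 * C = A - B\<^sup>2 / C"
    using False by (simp add: power2_eq_square field_simps)
  then have "B\<^sup>2 / C \<le> A" using assms[of "- B / C"] by linarith
  then show ?thesis using \<open>C > 0\<close> by (simp add: pos_divide_le_eq)
qed

text \<open>
  The pencil \<open>G'G - \<lambda> Q\<close> on a subspace \<open>H\<close>. Compactness of the form \<open>G'G\<close> relative to \<open>Q\<close> is stated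
  through approximate eigenvectors: along a subsequence their images under \<open>Q\<close> and \<open>G\<close> converge to the
  images of a vector of \<open>H\<close>. In this form it covers both the regularised pencils, where \<open>Q\<close> is bounded
  below and the approximate eigenvectors themselves converge, and the limit pencil, where \<open>Q\<close> is compact
  and they may diverge.
\<close>

locale hilbert_pencil =
  fixes H :: "L2 set" and G G' Q :: "L2 \<Rightarrow> L2"
  assumes sub: "subspace H"
    and linG: "bounded_linear G" and linG': "bounded_linear G'" and linQ: "bounded_linear Q"
    and adj: "G x \<bullet> y = x \<bullet> G' y"
    and symQ: "Q x \<bullet> y = x \<bullet> Q y"
    and posQ: "x \<in> H \<Longrightarrow> x \<noteq> 0 \<Longrightarrow> x \<bullet> Q x > 0"
    and QH: "x \<in> H \<Longrightarrow> Q x \<in> H" and G'H: "G' y \<in> H"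
    and dominated: "\<exists>C\<ge>0. \<forall>x\<in>H. (norm (G x))\<^sup>2 \<le> C * (x \<bullet> Q x)"
    and relatively_compact: "m > 0 \<Longrightarrow> (\<And>n. u n \<in> H) \<Longrightarrow> (\<And>n. u n \<bullet> Q (u n) = 1) \<Longrightarrow>
      (\<lambda>n. m *\<^sub>R Q (u n) - G' (G (u n))) \<longlonglongrightarrow> 0 \<Longrightarrow>
      \<exists>c\<in>H. \<exists>r::nat \<Rightarrow> nat. strict_mono r \<and> (\<lambda>n. Q (u (r n))) \<longlonglongrightarrow> Q c \<and> (\<lambda>n. G (u (r n))) \<longlonglongrightarrow> G c"
begin

lemma nonnegQ: "x \<in> H \<Longrightarrow> 0 \<le> x \<bullet> Q x"
  using posQ[of x] bounded_linear.linear[OF linQ] by (cases "x = 0") (auto simp: less_imp_le)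

lemmas linear_Q = bounded_linear.linear[OF linQ]
lemmas linear_G = bounded_linear.linear[OF linG]
lemmas linear_G' = bounded_linear.linear[OF linG']

context
  fixes lam :: "nat \<Rightarrow> real" and b :: "nat \<Rightarrow> L2"
  assumes listing: "pencil_listing H (G' \<circ> G) Q lam b"
begin

lemma listing_mem: "i \<ge> 1 \<Longrightarrow> b i \<in> H"
  and listing_eigen: "i \<ge> 1 \<Longrightarrow> G' (G (b i)) = lam i *\<^sub>R Q (b i)"
  and listing_orth: "i \<ge> 1 \<Longrightarrow> j \<ge> 1 \<Longrightarrow> b j \<bullet> Q (b i) = (if j = i then 1 else 0)"
  and listing_mono: "i \<ge> 1 \<Longrightarrow> i \<le> j \<Longrightarrow> lam j \<le> lam i"
  and listing_complete: "j \<ge> 1 \<Longrightarrow> lam j < \<mu> \<Longrightarrow> pencil_eigen H (G' \<circ> G) Q \<mu> c \<Longrightarrow>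
    c \<in> span (b ` {i. 1 \<le> i \<and> lam i = \<mu>})"
  using listing unfolding pencil_listing_def pencil_eigen_def by auto

lemma listing_inner_G: "i \<ge> 1 \<Longrightarrow> G x \<bullet> G (b i) = lam i * (x \<bullet> Q (b i))"
  by (simp add: adj listing_eigen)

lemma listing_nonneg: "i \<ge> 1 \<Longrightarrow> lam i \<ge> 0"
  using listing_inner_G[of i "b i"] listing_orth[of i i] by (metis inner_ge_zero mult.right_neutral)

lemma listing_combination:
  assumes fin: "finite I" "I \<subseteq> {1..}"
  defines "x c \<equiv> \<Sum>i\<in>I. c i *\<^sub>R b i"
  shows "x c \<in> H"
    and "k \<ge> 1 \<Longrightarrow> x c \<bullet> Q (b k) = (if k \<in> I then c k else 0)"
    and "x c \<bullet> Q (x c) = (\<Sum>i\<in>I. (c i)\<^sup>2)"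
    and "(norm (G (x c)))\<^sup>2 = (\<Sum>i\<in>I. (c i)\<^sup>2 * lam i)"
proof -
  have I: "finite I" "\<And>i. i \<in> I \<Longrightarrow> 1 \<le> i"
    using fin by auto
  show "x c \<in> H" unfolding x_def using I listing_mem
    by (intro subspace_sum[OF sub] subspace_scale[OF sub]) auto
  show coef: "x c \<bullet> Q (b k) = (if k \<in> I then c k else 0)" if "k \<ge> 1" for k
  proof -
    have "x c \<bullet> Q (b k) = (\<Sum>i\<in>I. if i = k then c i else 0)"
      unfolding x_def inner_sum_left using I that by (intro sum.cong) (auto simp: listing_orth)
    then show ?thesis using I by simp
  qed
  have "Q (x c) = (\<Sum>i\<in>I. c i *\<^sub>R Q (b i))"
    unfolding x_def by (simp add: linear_sum[OF linear_Q] linear_scale[OF linear_Q])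
  then have "x c \<bullet> Q (x c) = (\<Sum>i\<in>I. c i * (x c \<bullet> Q (b i)))"
    by (simp add: inner_sum_right)
  also have "\<dots> = (\<Sum>i\<in>I. (c i)\<^sup>2)"
    using I coef by (intro sum.cong) (auto simp: power2_eq_square)
  finally show "x c \<bullet> Q (x c) = (\<Sum>i\<in>I. (c i)\<^sup>2)" .
  have "G (x c) = (\<Sum>i\<in>I. c i *\<^sub>R G (b i))"
    unfolding x_def by (simp add: linear_sum[OF linear_G] linear_scale[OF linear_G])
  then have "(norm (G (x c)))\<^sup>2 = (\<Sum>i\<in>I. c i * (G (x c) \<bullet> G (b i)))"
    by (simp add: power2_norm_eq_inner inner_sum_right)
  also have "\<dots> = (\<Sum>i\<in>I. (c i)\<^sup>2 * lam i)"
    using I coef listing_inner_G by (intro sum.cong) (auto simp: power2_eq_square)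
  finally show "(norm (G (x c)))\<^sup>2 = (\<Sum>i\<in>I. (c i)\<^sup>2 * lam i)" .
qed

lemma listing_residual:
  assumes "x \<in> H" and fin: "finite I" "I \<subseteq> {1..}"
  defines "w \<equiv> x - (\<Sum>i\<in>I. (x \<bullet> Q (b i)) *\<^sub>R b i)"
  shows "w \<in> H"
    and "\<And>i. i \<in> I \<Longrightarrow> w \<bullet> Q (b i) = 0"
    and "x \<bullet> Q x = (\<Sum>i\<in>I. (x \<bullet> Q (b i))\<^sup>2) + w \<bullet> Q w"
    and "(norm (G x))\<^sup>2 = (\<Sum>i\<in>I. (x \<bullet> Q (b i))\<^sup>2 * lam i) + (norm (G w))\<^sup>2"
proof -
  have I: "finite I" "\<And>i. i \<in> I \<Longrightarrow> 1 \<le> i"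
    using fin by auto
  define p where "p = (\<Sum>i\<in>I. (x \<bullet> Q (b i)) *\<^sub>R b i)"
  note p = listing_combination[OF fin, where c = "\<lambda>i. x \<bullet> Q (b i)", folded p_def]
  have x: "x = p + w" by (simp add: p_def w_def)
  show "w \<in> H" using p(1) \<open>x \<in> H\<close> unfolding w_def p_def[symmetric] by (intro subspace_diff[OF sub])
  show w: "w \<bullet> Q (b i) = 0" if "i \<in> I" for i
    using p(2)[of i] I(2)[OF that] that unfolding w_def p_def[symmetric] by (simp add: inner_diff_left)
  have "w \<bullet> Q p = (\<Sum>i\<in>I. (x \<bullet> Q (b i)) * (w \<bullet> Q (b i)))"
    unfolding p_def by (simp add: linear_sum[OF linear_Q] linear_scale[OF linear_Q] inner_sum_right)
  also have "\<dots> = 0" using w by simp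
  finally have wp: "w \<bullet> Q p = 0" .
  then have pw: "p \<bullet> Q w = 0" by (metis symQ inner_commute)
  show "x \<bullet> Q x = (\<Sum>i\<in>I. (x \<bullet> Q (b i))\<^sup>2) + w \<bullet> Q w"
  proof -
    have "x \<bullet> Q x = (p + w) \<bullet> Q (p + w)" by (simp only: x[symmetric])
    also have "\<dots> = p \<bullet> Q p + w \<bullet> Q w"
      using wp pw by (simp add: linear_add[OF linear_Q] inner_add_left inner_add_right)
    finally show ?thesis using p(3) by simp
  qed
  have "G w \<bullet> G p = (\<Sum>i\<in>I. (x \<bullet> Q (b i)) * (G w \<bullet> G (b i)))"
    unfolding p_def by (simp add: linear_sum[OF linear_G] linear_scale[OF linear_G] inner_sum_right)
  also have "\<dots> = 0" using w I by (simp add: listing_inner_G)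
  finally have "G w \<bullet> G p = 0" .
  then show "(norm (G x))\<^sup>2 = (\<Sum>i\<in>I. (x \<bullet> Q (b i))\<^sup>2 * lam i) + (norm (G w))\<^sup>2"
  proof -
    have "(norm (G x))\<^sup>2 = (norm (G (p + w)))\<^sup>2" by (simp only: x[symmetric])
    also have "\<dots> = (norm (G p))\<^sup>2 + (norm (G w))\<^sup>2"
      using \<open>G w \<bullet> G p = 0\<close>
      by (simp add: linear_add[OF linear_G] power2_norm_eq_inner inner_add_left inner_add_right inner_commute)
    finally show ?thesis using p(4) by simp
  qed
qed

text \<open>
  The Courant-Fischer bound. If the Rayleigh quotient exceeded \<open>lam j\<close> somewhere on the \<open>Q\<close>-orthogonal
  complement \<open>W\<close> of the first \<open>j - 1\<close> eigenvectors, then its supremum \<open>m\<close> over \<open>W\<close> would be an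
  eigenvalue with an eigenvector in \<open>W\<close>: a maximising sequence consists of approximate eigenvectors, by
  the Cauchy-Schwarz inequality for the form \<open>m Q - G'G\<close>, which is positive on \<open>W\<close>. But the listing
  places all eigenvectors for \<open>m > lam j\<close> in the span of the first \<open>j - 1\<close>.
\<close>

theorem rayleigh_le_eigenvalue:
  assumes j: "j \<ge> 1" and x: "x \<in> H" and orth: "\<And>i. 1 \<le> i \<Longrightarrow> i < j \<Longrightarrow> x \<bullet> Q (b i) = 0"
  shows "(norm (G x))\<^sup>2 \<le> lam j * (x \<bullet> Q x)"
proof (rule ccontr)
  assume contra: "\<not> ?thesis"
  define I where "I = {1..<j}"
  have fin: "finite I" "I \<subseteq> {1..}" by (auto simp: I_def)
  have I: "\<And>i. i \<in> I \<Longrightarrow> 1 \<le> i" by (auto simp: I_def)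
  define W where "W = {x\<in>H. \<forall>i\<in>I. x \<bullet> Q (b i) = 0}"
  have W_scale: "a *\<^sub>R y \<in> W" if "y \<in> W" for a y
    using that subspace_scale[OF sub] by (auto simp: W_def)
  have W_add: "y + z \<in> W" if "y \<in> W" "z \<in> W" for y z
    using that subspace_add[OF sub] by (auto simp: W_def inner_add_left)
  obtain C where C: "C \<ge> 0" "\<And>x. x \<in> H \<Longrightarrow> (norm (G x))\<^sup>2 \<le> C * (x \<bullet> Q x)" using dominated by blast
  define S where "S = (\<lambda>y. (norm (G y))\<^sup>2) ` {y\<in>W. y \<bullet> Q y = 1}"
  have bdd: "bdd_above S"
    unfolding S_def bdd_above_def using C by (intro exI[of _ C]) (fastforce simp: W_def)
  define m where "m = Sup S"
  have normalise: "(norm (G y))\<^sup>2 / (y \<bullet> Q y) \<in> S" if "y \<in> W" "y \<noteq> 0" for y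
  proof -
    have q: "y \<bullet> Q y > 0" using posQ that by (auto simp: W_def)
    define a where "a = 1 / sqrt (y \<bullet> Q y)"
    have a2: "a\<^sup>2 = 1 / (y \<bullet> Q y)" using q by (simp add: a_def power_divide)
    have "(a *\<^sub>R y) \<bullet> Q (a *\<^sub>R y) = a\<^sup>2 * (y \<bullet> Q y)"
      by (simp add: linear_scale[OF linear_Q] power2_eq_square)
    also have "\<dots> = 1" using q a2 by simp
    finally have "a *\<^sub>R y \<in> {y\<in>W. y \<bullet> Q y = 1}" using W_scale that by simp
    moreover have "(norm (G (a *\<^sub>R y)))\<^sup>2 = (norm (G y))\<^sup>2 / (y \<bullet> Q y)"
      by (simp add: linear_scale[OF linear_G] power_mult_distrib a2)
    ultimately show ?thesis unfolding S_def by force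
  qed
  have upper: "(norm (G y))\<^sup>2 \<le> m * (y \<bullet> Q y)" if "y \<in> W" for y
  proof (cases "y = 0")
    case True
    then show ?thesis using linear_0[OF linear_G] by simp
  next
    case False
    have "(norm (G y))\<^sup>2 / (y \<bullet> Q y) \<le> m"
      unfolding m_def by (intro cSup_upper bdd normalise that False)
    then show ?thesis using posQ[of y] that False by (auto simp: W_def field_simps)
  qed
  have xW: "x \<in> W" using x orth by (auto simp: W_def I_def)
  have x0: "x \<noteq> 0" using contra linear_0[OF linear_G] by auto
  have q: "x \<bullet> Q x > 0" using posQ x x0 by blast
  have "lam j < (norm (G x))\<^sup>2 / (x \<bullet> Q x)" using contra q by (simp add: field_simps)
  also have "\<dots> \<le> m" unfolding m_def by (intro cSup_upper bdd normalise xW x0)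
  finally have m: "lam j < m" .
  then have m0: "m > 0" using listing_nonneg[OF j] by simp
  have "S \<noteq> {}" using normalise[OF xW x0] by blast
  have "\<exists>y. y \<in> W \<and> y \<bullet> Q y = 1 \<and> m - 1 / real (Suc n) < (norm (G y))\<^sup>2" for n
    using less_cSupD[OF \<open>S \<noteq> {}\<close>, of "m - 1 / real (Suc n)"] unfolding m_def[symmetric] by (auto simp: S_def)
  then obtain y where y: "\<And>n. y n \<in> W" "\<And>n. y n \<bullet> Q (y n) = 1"
    "\<And>n. m - 1 / real (Suc n) < (norm (G (y n)))\<^sup>2" by metis
  have yH: "y n \<in> H" for n using y(1) by (auto simp: W_def)
  have Gy: "(norm (G (y n)))\<^sup>2 \<le> m" for n using upper[OF y(1)] y(2) by (metis mult.right_neutral)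
  have lim_m: "(\<lambda>n. (norm (G (y n)))\<^sup>2) \<longlonglongrightarrow> m"
  proof (rule tendsto_sandwich[of "\<lambda>n. m - 1 / real (Suc n)" _ _ "\<lambda>_. m"])
    have "(\<lambda>n. m - 1 / real (Suc n)) \<longlonglongrightarrow> m - 0"
      by (intro tendsto_intros LIMSEQ_Suc[OF lim_1_over_n])
    then show "(\<lambda>n. m - 1 / real (Suc n)) \<longlonglongrightarrow> m" by simp
  qed (use y(3) Gy in \<open>auto intro!: always_eventually less_imp_le\<close>)
  define z where "z n = m *\<^sub>R Q (y n) - G' (G (y n))" for n
  have zH: "z n \<in> H" for n
    unfolding z_def by (intro subspace_diff[OF sub] subspace_scale[OF sub] QH yH G'H)
  have z_inner: "z n \<bullet> v = m * (y n \<bullet> Q v) - G (y n) \<bullet> G v" for n v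
    using adj[of v "G (y n)"] by (simp add: z_def inner_diff_left inner_diff_right symQ inner_commute)
  obtain L where L: "\<And>v. norm (Q v) \<le> norm v * L" "L > 0"
    using bounded_linear.pos_bounded[OF linQ] by blast
  have z_le: "(norm (z n))\<^sup>2 \<le> (m - (norm (G (y n)))\<^sup>2) * (m * L)" for n
  proof -
    \<comment> \<open>The residual \<open>z n\<close> is orthogonal to the removed eigenvectors, so pairing it with itself amounts to pairing it with its component \<open>w\<close> in \<open>W\<close>.\<close>
    define w where "w = z n - (\<Sum>i\<in>I. (z n \<bullet> Q (b i)) *\<^sub>R b i)"
    note res = listing_residual[OF zH[of n] fin, folded w_def]
    have wW: "w \<in> W" using res(1,2) by (auto simp: W_def)
    have "z n \<bullet> b i = 0" if "i \<in> I" for i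
      using y(1)[of n] I[OF that] that unfolding z_inner by (simp add: W_def listing_inner_G)
    then have "z n \<bullet> (\<Sum>i\<in>I. (z n \<bullet> Q (b i)) *\<^sub>R b i) = 0" by (simp add: inner_sum_right)
    then have zw: "z n \<bullet> z n = z n \<bullet> w" by (simp add: w_def inner_diff_right)
    have "(z n \<bullet> w)\<^sup>2 \<le> (m - (norm (G (y n)))\<^sup>2) * (m * (w \<bullet> Q w) - (norm (G w))\<^sup>2)"
    proof (rule quadratic_nonneg_discriminant)
      fix t
      have "y n + t *\<^sub>R w \<in> W" by (intro W_add W_scale y wW)
      from upper[OF this] have "0 \<le> m * ((y n + t *\<^sub>R w) \<bullet> Q (y n + t *\<^sub>R w)) - (norm (G (y n + t *\<^sub>R w)))\<^sup>2" by simp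
      also have "\<dots> = (m - (norm (G (y n)))\<^sup>2) + 2 * t * (z n \<bullet> w) + t\<^sup>2 * (m * (w \<bullet> Q w) - (norm (G w))\<^sup>2)"
      proof -
        have "(norm (G (y n + t *\<^sub>R w)))\<^sup>2 = (norm (G (y n)))\<^sup>2 + 2 * t * (G (y n) \<bullet> G w) + t * t * (norm (G w))\<^sup>2"
          unfolding power2_norm_eq_inner linear_add[OF linear_G] linear_scale[OF linear_G]
          by (simp add: inner_add_left inner_add_right inner_commute algebra_simps)
        moreover have "(y n + t *\<^sub>R w) \<bullet> Q (y n + t *\<^sub>R w) = 1 + 2 * t * (y n \<bullet> Q w) + t * t * (w \<bullet> Q w)"
          using symQ[of w "y n"] y(2)[of n] unfolding linear_add[OF linear_Q] linear_scale[OF linear_Q]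
          by (simp add: inner_add_left inner_add_right inner_commute algebra_simps)
        ultimately show ?thesis
          unfolding z_inner by (simp add: algebra_simps power2_eq_square)
      qed
      finally show "0 \<le> \<dots>" .
    qed
    also have "\<dots> \<le> (m - (norm (G (y n)))\<^sup>2) * (m * (L * (norm (z n))\<^sup>2))"
    proof (rule mult_left_mono)
      have "w \<bullet> Q w \<le> z n \<bullet> Q (z n)"
        using res(3) by (simp add: sum_nonneg)
      also have "\<dots> \<le> norm (z n) * norm (Q (z n))" using norm_cauchy_schwarz by blast
      also have "\<dots> \<le> norm (z n) * (norm (z n) * L)" by (intro mult_left_mono L) simp
      finally have "m * (w \<bullet> Q w) \<le> m * (L * (norm (z n))\<^sup>2)"
        using m0 by (intro mult_left_mono) (auto simp: power2_eq_square mult_ac)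
      then show "m * (w \<bullet> Q w) - (norm (G w))\<^sup>2 \<le> m * (L * (norm (z n))\<^sup>2)"
        using zero_le_power2[of "norm (G w)"] by linarith
    qed (use Gy in simp)
    finally have le: "(norm (z n))\<^sup>2 * (norm (z n))\<^sup>2 \<le> (m - (norm (G (y n)))\<^sup>2) * (m * L) * (norm (z n))\<^sup>2"
      unfolding zw[symmetric] by (simp add: power2_norm_eq_inner[symmetric] power2_eq_square mult_ac)
    then show ?thesis
    proof (cases "z n = 0")
      case True
      then show ?thesis using Gy[of n] m0 L(2) by simp
    next
      case False
      then have "0 < (norm (z n))\<^sup>2" by simp
      then show ?thesis using mult_right_le_imp_le[OF le] by blast
    qed
  qed
  have "(\<lambda>n. (m - (norm (G (y n)))\<^sup>2) * (m * L)) \<longlonglongrightarrow> (m - m) * (m * L)"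
    by (intro tendsto_intros lim_m)
  then have "(\<lambda>n. (norm (z n))\<^sup>2) \<longlonglongrightarrow> 0"
    by (intro tendsto_sandwich[of "\<lambda>_. 0" "\<lambda>n. (norm (z n))\<^sup>2" sequentially "\<lambda>n. (m - (norm (G (y n)))\<^sup>2) * (m * L)"])
      (auto simp: z_le)
  from tendsto_real_sqrt[OF this] have z0: "z \<longlonglongrightarrow> 0"
    by (auto intro: tendsto_norm_zero_cancel)
  obtain c r where c: "c \<in> H" "strict_mono r" "(\<lambda>n. Q (y (r n))) \<longlonglongrightarrow> Q c" "(\<lambda>n. G (y (r n))) \<longlonglongrightarrow> G c"
    using relatively_compact[OF m0 yH y(2) z0[unfolded z_def]] by blast
  have "(\<lambda>n. m *\<^sub>R Q (y (r n)) - G' (G (y (r n)))) \<longlonglongrightarrow> m *\<^sub>R Q c - G' (G c)"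
    by (intro tendsto_intros c bounded_linear.tendsto[OF linG'])
  moreover have "(\<lambda>n. m *\<^sub>R Q (y (r n)) - G' (G (y (r n)))) \<longlonglongrightarrow> 0"
    using LIMSEQ_subseq_LIMSEQ[OF z0 c(2)] by (simp add: z_def o_def)
  ultimately have eig: "m *\<^sub>R Q c - G' (G c) = 0" by (rule LIMSEQ_unique)
  have "(\<lambda>n. (norm (G (y (r n))))\<^sup>2) \<longlonglongrightarrow> (norm (G c))\<^sup>2" by (intro tendsto_intros c)
  moreover have "(\<lambda>n. (norm (G (y (r n))))\<^sup>2) \<longlonglongrightarrow> m"
    using LIMSEQ_subseq_LIMSEQ[OF lim_m c(2)] by (simp add: o_def)
  ultimately have "(norm (G c))\<^sup>2 = m" by (rule LIMSEQ_unique)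
  then have c0: "c \<noteq> 0" using m0 linear_0[OF linear_G] by auto
  have "pencil_eigen H (G' \<circ> G) Q m c"
    using c(1) c0 eig by (simp add: pencil_eigen_def)
  then have span: "c \<in> span (b ` {i. 1 \<le> i \<and> lam i = m})" using listing_complete[OF j m] by blast
  have cb: "c \<bullet> Q (b i) = 0" if i: "1 \<le> i" "lam i = m" for i
  proof -
    have "i < j" using listing_mono[OF j, of i] i m by (meson not_le)
    then have "y (r n) \<bullet> Q (b i) = 0" for n using y(1)[of "r n"] i by (auto simp: W_def I_def)
    then have "Q (y (r n)) \<bullet> b i = 0" for n by (simp add: symQ)
    moreover have "(\<lambda>n. Q (y (r n)) \<bullet> b i) \<longlonglongrightarrow> Q c \<bullet> b i" by (intro tendsto_intros c)
    ultimately have "Q c \<bullet> b i = 0" by (simp add: LIMSEQ_const_iff)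
    then show ?thesis by (simp add: symQ)
  qed
  have "c \<bullet> Q c = 0"
  proof (rule span_induct[where P = "\<lambda>v. c \<bullet> Q v = 0", OF span])
    show "subspace {v. c \<bullet> Q v = 0}"
      by (auto simp: subspace_def linear_0[OF linear_Q] linear_add[OF linear_Q] linear_scale[OF linear_Q] inner_add_right)
  qed (use cb in auto)
  then show False using posQ[OF c(1) c0] by simp
qed

end

end

section \<open>Perturbation of simple eigenvalues under regularisation\<close>

text \<open>
  A deterministic sequence of regularised pencils approaching a limit pencil with simple eigenvalues,
  with operator errors \<open>Dl n\<close> that vanish relative to the regularisation \<open>al n\<close>.
\<close>

locale pencil_perturbation = pop: hilbert_pencil H G G' \<Gamma>
  for H G G' \<Gamma> +
  fixes lam :: "nat \<Rightarrow> real" and b :: "nat \<Rightarrow> L2"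
    and Gn Gn' \<Gamma>n :: "nat \<Rightarrow> L2 \<Rightarrow> L2" and al Dl :: "nat \<Rightarrow> real"
    and lamn :: "nat \<Rightarrow> nat \<Rightarrow> real" and bn :: "nat \<Rightarrow> nat \<Rightarrow> L2"
  assumes pop_listing: "pencil_listing H (G' \<circ> G) \<Gamma> lam b"
    and sample: "\<And>n. hilbert_pencil H (Gn n) (Gn' n) (\<lambda>x. \<Gamma>n n x + al n *\<^sub>R x)"
    and sample_listing: "\<And>n. pencil_listing H (Gn' n \<circ> Gn n) (\<lambda>x. \<Gamma>n n x + al n *\<^sub>R x) (lamn n) (bn n)"
    and closeG: "\<And>n x. norm (Gn n x - G x) \<le> Dl n * norm x"
    and close\<Gamma>: "\<And>n x. norm (\<Gamma>n n x - \<Gamma> x) \<le> Dl n * norm x"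
    and al_pos: "\<And>n. al n > 0" and Dl_nonneg: "\<And>n. Dl n \<ge> 0"
    and al_lim: "al \<longlonglongrightarrow> 0" and ratio_lim: "(\<lambda>n. Dl n / al n) \<longlonglongrightarrow> 0"
    and simple: "\<And>i. i \<ge> 1 \<Longrightarrow> lam (Suc i) < lam i"
begin

lemma lam_pos: "i \<ge> 1 \<Longrightarrow> lam i > 0"
  using simple[of i] pop.listing_nonneg[OF pop_listing, of "Suc i"] by simp

lemma lam_less: "1 \<le> i \<Longrightarrow> i < j \<Longrightarrow> lam j < lam i"
  using simple[of i] pop.listing_mono[OF pop_listing, of "Suc i" j] by simp

definition sample_form :: "nat \<Rightarrow> L2 \<Rightarrow> real" where "sample_form n x = x \<bullet> (\<Gamma>n n x + al n *\<^sub>R x)"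

text \<open>The regularisation bounds the norm of a vector by its form \<^const>\<open>sample_form\<close>. Measured by the root of this form,
  the error of the sample operator \<open>Gn n\<close> is at most \<open>eta n\<close>.\<close>

definition eta :: "nat \<Rightarrow> real" where "eta n = Dl n / al n * sqrt (2 * al n)"

lemma eta_nonneg: "eta n \<ge> 0"
  using al_pos[of n] Dl_nonneg[of n] by (simp add: eta_def)

lemma eta_lim: "eta \<longlonglongrightarrow> 0"
proof -
  have "(\<lambda>n. Dl n / al n * sqrt (2 * al n)) \<longlonglongrightarrow> 0 * sqrt (2 * 0)"
    by (intro tendsto_intros al_lim ratio_lim)
  then show ?thesis by (simp add: eta_def[abs_def])
qed

lemma Dl_lim: "Dl \<longlonglongrightarrow> 0"
proof -
  have "(\<lambda>n. Dl n / al n * al n) \<longlonglongrightarrow> 0 * 0" by (intro tendsto_intros al_lim ratio_lim)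
  moreover have "Dl n / al n * al n = Dl n" for n using al_pos[of n] by simp
  ultimately show ?thesis by simp
qed

lemma small_error: "\<forall>\<^sub>F n in sequentially. Dl n \<le> al n / 2"
proof -
  have "\<forall>\<^sub>F n in sequentially. Dl n / al n < 1 / 2" by (rule order_tendstoD[OF ratio_lim]) simp
  then show ?thesis
    by eventually_elim (use al_pos in \<open>simp add: field_simps less_imp_le\<close>)
qed

lemma form_error: "\<bar>x \<bullet> \<Gamma>n n x - x \<bullet> \<Gamma> x\<bar> \<le> Dl n * (norm x)\<^sup>2"
proof -
  have "\<bar>x \<bullet> (\<Gamma>n n x - \<Gamma> x)\<bar> \<le> norm x * norm (\<Gamma>n n x - \<Gamma> x)" by (rule Cauchy_Schwarz_ineq2)
  also have "\<dots> \<le> norm x * (Dl n * norm x)" by (intro mult_left_mono close\<Gamma>) simp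
  finally show ?thesis by (simp add: inner_diff_right power2_eq_square mult_ac)
qed

lemma sample_form_upper: "sample_form n x \<le> x \<bullet> \<Gamma> x + (al n + Dl n) * (norm x)\<^sup>2"
  using form_error[of x n] by (simp add: sample_form_def inner_add_right power2_norm_eq_inner algebra_simps)

lemma sample_form_lower:
  assumes "Dl n \<le> al n / 2"
  shows "x \<bullet> \<Gamma> x + al n / 2 * (norm x)\<^sup>2 \<le> sample_form n x"
proof -
  have "Dl n * (norm x)\<^sup>2 \<le> al n / 2 * (norm x)\<^sup>2" using assms by (rule mult_right_mono) simp
  moreover have "sample_form n x = x \<bullet> \<Gamma>n n x + al n * (norm x)\<^sup>2"
    by (simp add: sample_form_def inner_add_right power2_norm_eq_inner)
  ultimately show ?thesis using form_error[of x n] by (simp add: field_simps)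
qed

lemma form_le_sample_form:
  assumes "Dl n \<le> al n / 2"
  shows "x \<bullet> \<Gamma> x \<le> sample_form n x"
proof -
  have "0 \<le> al n / 2 * (norm x)\<^sup>2" using al_pos[of n] by simp
  then show ?thesis using sample_form_lower[OF assms, of x] by linarith
qed

lemma norm_le_sample_form:
  assumes "Dl n \<le> al n / 2" "x \<in> H"
  shows "al n * norm x \<le> sqrt (2 * al n) * sqrt (sample_form n x)"
proof -
  have "al n * (norm x)\<^sup>2 \<le> 2 * sample_form n x"
    using sample_form_lower[OF assms(1), of x] pop.nonnegQ[OF assms(2)] by simp
  then have "al n * (al n * (norm x)\<^sup>2) \<le> al n * (2 * sample_form n x)"
    using al_pos[of n] by (intro mult_left_mono) auto
  then have "(al n * norm x)\<^sup>2 \<le> 2 * al n * sample_form n x" by (simp add: power2_eq_square mult_ac)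
  then have "al n * norm x \<le> sqrt (2 * al n * sample_form n x)" by (rule real_le_rsqrt)
  then show ?thesis by (simp add: real_sqrt_mult)
qed

lemma error_le_eta:
  assumes "Dl n \<le> al n / 2" "x \<in> H"
  shows "Dl n * norm x \<le> eta n * sqrt (sample_form n x)"
proof -
  have "Dl n / al n * (al n * norm x) \<le> Dl n / al n * (sqrt (2 * al n) * sqrt (sample_form n x))"
    using Dl_nonneg[of n] al_pos[of n] by (intro mult_left_mono norm_le_sample_form assms) auto
  then show ?thesis using al_pos[of n] by (simp add: eta_def)
qed

text \<open>The test vector is a combination of the first \<open>j\<close> sample eigenvectors that is \<open>\<Gamma>\<close>-orthogonal to the
  first \<open>j - 1\<close> limit eigenvectors: its sample Rayleigh quotient is at least \<open>lamn n j\<close>, while its limit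
  quotient is at most \<open>lam j\<close>.\<close>

lemma sample_eigenvalue_upper:
  assumes small: "Dl n \<le> al n / 2" and j: "j \<ge> 1"
  shows "sqrt (lamn n j) \<le> sqrt (lam j) + eta n"
proof -
  interpret S: hilbert_pencil H "Gn n" "Gn' n" "\<lambda>x. \<Gamma>n n x + al n *\<^sub>R x" by (rule sample)
  note SL = sample_listing[of n]
  have "\<exists>c. (\<exists>k\<in>{1..j}. c k \<noteq> 0) \<and> (\<forall>i\<in>{1..<j}. (\<Sum>k\<in>{1..j}. (bn n k \<bullet> \<Gamma> (b i)) * c k) = 0)"
    by (rule underdetermined_system) (use j in auto)
  then obtain c p where c: "p \<in> {1..j}" "c p \<noteq> 0"
    "\<And>i. i \<in> {1..<j} \<Longrightarrow> (\<Sum>k\<in>{1..j}. (bn n k \<bullet> \<Gamma> (b i)) * c k) = 0" by blast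
  define x where "x = (\<Sum>k\<in>{1..j}. c k *\<^sub>R bn n k)"
  define s where "s = (\<Sum>k\<in>{1..j}. (c k)\<^sup>2)"
  have I: "finite {1..j}" "{1..j} \<subseteq> {1..}" by auto
  note comb = S.listing_combination[OF SL I, where c = c, folded x_def s_def]
  have s: "s > 0" unfolding s_def using c(1,2) by (intro sum_pos2[of _ p]) auto
  have q: "sample_form n x = s" using comb(3) by (simp add: sample_form_def)
  have "x \<bullet> \<Gamma> (b i) = 0" if "1 \<le> i" "i < j" for i
    using c(3)[of i] that by (simp add: x_def inner_sum_left mult.commute)
  then have "(norm (G x))\<^sup>2 \<le> lam j * (x \<bullet> \<Gamma> x)"
    by (intro pop.rayleigh_le_eigenvalue[OF pop_listing j comb(1)])
  also have "\<dots> \<le> lam j * s"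
    using form_le_sample_form[OF small, of x] lam_pos[OF j] by (simp add: q)
  finally have "norm (G x) \<le> sqrt (lam j * s)" by (rule real_le_rsqrt)
  then have "norm (G x) \<le> sqrt (lam j) * sqrt s" by (simp add: real_sqrt_mult)
  moreover have "norm (Gn n x) \<le> norm (G x) + norm (Gn n x - G x)" by norm
  moreover have "norm (Gn n x - G x) \<le> eta n * sqrt s"
    using closeG[of n x] error_le_eta[OF small comb(1)] by (simp add: q)
  ultimately have up: "norm (Gn n x) \<le> (sqrt (lam j) + eta n) * sqrt s" by (simp add: algebra_simps)
  have "lamn n j * s = (\<Sum>k\<in>{1..j}. (c k)\<^sup>2 * lamn n j)"
    by (simp add: s_def sum_distrib_left mult.commute)
  also have "\<dots> \<le> (norm (Gn n x))\<^sup>2"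
    unfolding comb(4) using S.listing_mono[OF SL] by (intro sum_mono mult_left_mono) auto
  finally have "sqrt (lamn n j * s) \<le> norm (Gn n x)" by (rule real_le_lsqrt[rotated]) simp
  then have "sqrt (lamn n j) * sqrt s \<le> (sqrt (lam j) + eta n) * sqrt s"
    using up by (simp add: real_sqrt_mult)
  then show ?thesis using s by simp
qed

text \<open>The roles are exchanged. On the fixed span of the first \<open>j\<close> limit eigenvectors the squared norm is at
  most \<open>\<kappa>\<close> times the form of \<open>\<Gamma>\<close>, so that regularisation changes the quotient only by a factor close to 1.\<close>

lemma sample_eigenvalue_lower:
  assumes j: "j \<ge> 1"
  defines "\<kappa> \<equiv> \<Sum>i\<in>{1..j}. (norm (b i))\<^sup>2"
  shows "sqrt (lam j) - Dl n * sqrt \<kappa> \<le> sqrt (lamn n j) * sqrt (1 + \<kappa> * (al n + Dl n))"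
proof -
  interpret S: hilbert_pencil H "Gn n" "Gn' n" "\<lambda>x. \<Gamma>n n x + al n *\<^sub>R x" by (rule sample)
  note SL = sample_listing[of n]
  have "\<exists>c. (\<exists>k\<in>{1..j}. c k \<noteq> 0) \<and>
      (\<forall>i\<in>{1..<j}. (\<Sum>k\<in>{1..j}. (b k \<bullet> (\<Gamma>n n (bn n i) + al n *\<^sub>R bn n i)) * c k) = 0)"
    by (rule underdetermined_system) (use j in auto)
  then obtain c p where c: "p \<in> {1..j}" "c p \<noteq> 0"
    "\<And>i. i \<in> {1..<j} \<Longrightarrow> (\<Sum>k\<in>{1..j}. (b k \<bullet> (\<Gamma>n n (bn n i) + al n *\<^sub>R bn n i)) * c k) = 0" by blast
  define x where "x = (\<Sum>k\<in>{1..j}. c k *\<^sub>R b k)"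
  define s where "s = (\<Sum>k\<in>{1..j}. (c k)\<^sup>2)"
  have I: "finite {1..j}" "{1..j} \<subseteq> {1..}" by auto
  note comb = pop.listing_combination[OF pop_listing I, where c = c, folded x_def s_def]
  have s: "s > 0" unfolding s_def using c(1,2) by (intro sum_pos2[of _ p]) auto
  have \<kappa>: "\<kappa> \<ge> 0" by (simp add: \<kappa>_def sum_nonneg)
  have nx: "(norm x)\<^sup>2 \<le> \<kappa> * s"
  proof -
    have "norm x \<le> (\<Sum>k\<in>{1..j}. \<bar>c k\<bar> * norm (b k))"
      unfolding x_def using norm_sum[of "\<lambda>k. c k *\<^sub>R b k" "{1..j}"] by simp
    then have "(norm x)\<^sup>2 \<le> (\<Sum>k\<in>{1..j}. \<bar>c k\<bar> * norm (b k))\<^sup>2" by (intro power_mono) auto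
    also have "\<dots> \<le> (\<Sum>k\<in>{1..j}. \<bar>c k\<bar>\<^sup>2) * (\<Sum>k\<in>{1..j}. (norm (b k))\<^sup>2)" by (rule Cauchy_Schwarz_ineq_sum)
    finally show ?thesis by (simp add: s_def \<kappa>_def mult.commute)
  qed
  have "x \<bullet> (\<Gamma>n n (bn n i) + al n *\<^sub>R bn n i) = 0" if "1 \<le> i" "i < j" for i
    using c(3)[of i] that by (simp add: x_def inner_sum_left mult.commute)
  then have "(norm (Gn n x))\<^sup>2 \<le> lamn n j * sample_form n x"
    unfolding sample_form_def by (intro S.rayleigh_le_eigenvalue[OF SL j comb(1)])
  also have "\<dots> \<le> lamn n j * (s * (1 + \<kappa> * (al n + Dl n)))"
  proof (rule mult_left_mono)
    have "sample_form n x \<le> s + (al n + Dl n) * (norm x)\<^sup>2" using sample_form_upper[of n x] comb(3) by simp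
    also have "\<dots> \<le> s + (al n + Dl n) * (\<kappa> * s)"
      using nx al_pos[of n] Dl_nonneg[of n] by (intro add_left_mono mult_left_mono) auto
    finally show "sample_form n x \<le> s * (1 + \<kappa> * (al n + Dl n))" by (simp add: algebra_simps)
  qed (rule S.listing_nonneg[OF SL j])
  finally have "norm (Gn n x) \<le> sqrt (lamn n j * (s * (1 + \<kappa> * (al n + Dl n))))" by (rule real_le_rsqrt)
  then have up: "norm (Gn n x) \<le> sqrt (lamn n j) * sqrt (1 + \<kappa> * (al n + Dl n)) * sqrt s"
    by (simp add: real_sqrt_mult mult_ac)
  have "lam j * s = (\<Sum>k\<in>{1..j}. (c k)\<^sup>2 * lam j)"
    by (simp add: s_def sum_distrib_left mult.commute)
  also have "\<dots> \<le> (norm (G x))\<^sup>2"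
    unfolding comb(4) using pop.listing_mono[OF pop_listing] by (intro sum_mono mult_left_mono) auto
  finally have "sqrt (lam j * s) \<le> norm (G x)" by (rule real_le_lsqrt[rotated]) simp
  then have "sqrt (lam j) * sqrt s \<le> norm (G x)" by (simp add: real_sqrt_mult)
  also have "\<dots> \<le> norm (Gn n x) + norm (Gn n x - G x)" by norm
  also have "norm (Gn n x - G x) \<le> Dl n * sqrt \<kappa> * sqrt s"
  proof -
    have "norm x \<le> sqrt \<kappa> * sqrt s" using real_le_rsqrt[OF nx] by (simp add: real_sqrt_mult)
    then have "Dl n * norm x \<le> Dl n * (sqrt \<kappa> * sqrt s)" using Dl_nonneg[of n] by (rule mult_left_mono)
    then show ?thesis using closeG[of n x] by (simp add: mult_ac)
  qed
  finally have "(sqrt (lam j) - Dl n * sqrt \<kappa>) * sqrt s \<le> sqrt (lamn n j) * sqrt (1 + \<kappa> * (al n + Dl n)) * sqrt s"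
    using up by (simp add: algebra_simps)
  then show ?thesis using s by simp
qed

theorem eigenvalue_tendsto:
  assumes j: "j \<ge> 1"
  shows "(\<lambda>n. lamn n j) \<longlonglongrightarrow> lam j"
proof -
  define \<kappa> where "\<kappa> = (\<Sum>i\<in>{1..j}. (norm (b i))\<^sup>2)"
  have \<kappa>: "\<kappa> \<ge> 0" by (simp add: \<kappa>_def sum_nonneg)
  have nonneg: "lamn n j \<ge> 0" for n
    using hilbert_pencil.listing_nonneg[OF sample sample_listing j] .
  have "(\<lambda>n. sqrt (lamn n j)) \<longlonglongrightarrow> sqrt (lam j)"
  proof (rule tendsto_sandwich[of "\<lambda>n. (sqrt (lam j) - Dl n * sqrt \<kappa>) / sqrt (1 + \<kappa> * (al n + Dl n))"
        _ _ "\<lambda>n. sqrt (lam j) + eta n"])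
    show "\<forall>\<^sub>F n in sequentially. sqrt (lamn n j) \<le> sqrt (lam j) + eta n"
      using small_error by eventually_elim (rule sample_eigenvalue_upper[OF _ j])
    have "(\<lambda>n. sqrt (lam j) + eta n) \<longlonglongrightarrow> sqrt (lam j) + 0" by (intro tendsto_intros eta_lim)
    then show "(\<lambda>n. sqrt (lam j) + eta n) \<longlonglongrightarrow> sqrt (lam j)" by simp
    have "(\<lambda>n. (sqrt (lam j) - Dl n * sqrt \<kappa>) / sqrt (1 + \<kappa> * (al n + Dl n)))
        \<longlonglongrightarrow> (sqrt (lam j) - 0 * sqrt \<kappa>) / sqrt (1 + \<kappa> * (0 + 0))"
      by (intro tendsto_intros Dl_lim al_lim) simp
    then show "(\<lambda>n. (sqrt (lam j) - Dl n * sqrt \<kappa>) / sqrt (1 + \<kappa> * (al n + Dl n))) \<longlonglongrightarrow> sqrt (lam j)" by simp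
    show "\<forall>\<^sub>F n in sequentially. (sqrt (lam j) - Dl n * sqrt \<kappa>) / sqrt (1 + \<kappa> * (al n + Dl n)) \<le> sqrt (lamn n j)"
    proof (rule always_eventually, rule allI)
      fix n
      have "0 \<le> \<kappa> * (al n + Dl n)" using \<kappa> al_pos[of n] Dl_nonneg[of n] by simp
      then have "sqrt (1 + \<kappa> * (al n + Dl n)) > 0" by simp
      then show "(sqrt (lam j) - Dl n * sqrt \<kappa>) / sqrt (1 + \<kappa> * (al n + Dl n)) \<le> sqrt (lamn n j)"
        using sample_eigenvalue_lower[OF j, of n, folded \<kappa>_def] by (simp add: pos_divide_le_eq)
    qed
  qed
  then have "(\<lambda>n. (sqrt (lamn n j))\<^sup>2) \<longlonglongrightarrow> (sqrt (lam j))\<^sup>2" by (rule tendsto_power)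
  then show ?thesis by (simp only: real_sqrt_pow2[OF nonneg] real_sqrt_pow2[OF less_imp_le[OF lam_pos[OF j]]])
qed

lemma sample_eigenvector:
  assumes "j \<ge> 1"
  shows "bn n j \<in> H" "sample_form n (bn n j) = 1" "(norm (Gn n (bn n j)))\<^sup>2 = lamn n j"
  using hilbert_pencil.listing_mem[OF sample sample_listing assms]
    hilbert_pencil.listing_orth[OF sample sample_listing assms assms, of n]
    hilbert_pencil.listing_inner_G[OF sample sample_listing assms, of n "bn n j"]
  by (auto simp: sample_form_def power2_norm_eq_inner)

text \<open>
  Evaluating the form \<open>G'G\<close> at a sample eigenvector and a limit eigenvector in both ways shows that
  the component of one along the other is almost annihilated by the difference of the eigenvalues.
\<close>

lemma cross_component_tendsto:
  assumes i: "i \<ge> 1" and j: "j \<ge> 1" and "i \<noteq> j"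
  shows "(\<lambda>n. bn n j \<bullet> \<Gamma> (b i)) \<longlonglongrightarrow> 0"
proof -
  \<comment> \<open>An explicit bound \<open>E n\<close> for the component times the difference of the eigenvalues: the first summand compares the sample form with \<open>\<Gamma>\<close>, the others compare \<open>Gn n\<close> with \<open>G\<close>.\<close>
  obtain C where C: "C \<ge> 0" "\<And>x. x \<in> H \<Longrightarrow> (norm (G x))\<^sup>2 \<le> C * (x \<bullet> \<Gamma> x)" using pop.dominated by blast
  define E where "E n = lamn n j * ((Dl n / al n + 1) * sqrt (2 * al n) * norm (b i))
    + (eta n * (norm (G (b i)) + Dl n * norm (b i)) + sqrt C * (Dl n * norm (b i)))" for n
  have "E \<longlonglongrightarrow> lam j * ((0 + 1) * sqrt (2 * 0) * norm (b i)) + (0 * (norm (G (b i)) + 0 * norm (b i)) + sqrt C * (0 * norm (b i)))"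
    unfolding E_def by (intro tendsto_intros eigenvalue_tendsto j ratio_lim al_lim eta_lim Dl_lim)
  then have E: "E \<longlonglongrightarrow> 0" by simp
  have bound: "\<bar>(lamn n j - lam i) * (bn n j \<bullet> \<Gamma> (b i))\<bar> \<le> E n" if small: "Dl n \<le> al n / 2" for n
  proof -
    interpret S: hilbert_pencil H "Gn n" "Gn' n" "\<lambda>x. \<Gamma>n n x + al n *\<^sub>R x" by (rule sample)
    note SL = sample_listing[of n]
    let ?x = "bn n j"
    note x = sample_eigenvector[OF j, of n]
    have lam0: "lamn n j \<ge> 0" using S.listing_nonneg[OF SL j] .
    have "?x \<bullet> (\<Gamma>n n (b i) + al n *\<^sub>R b i) = b i \<bullet> (\<Gamma>n n ?x + al n *\<^sub>R ?x)"
      using S.symQ[of ?x "b i"] by (simp add: inner_commute)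
    then have e1: "lamn n j * (?x \<bullet> (\<Gamma>n n (b i) + al n *\<^sub>R b i)) = Gn n (b i) \<bullet> Gn n ?x"
      using S.listing_inner_G[OF SL j, of "b i"] by simp
    have e2: "G ?x \<bullet> G (b i) = lam i * (?x \<bullet> \<Gamma> (b i))" by (rule pop.listing_inner_G[OF pop_listing i])
    have t1: "\<bar>?x \<bullet> (\<Gamma>n n (b i) + al n *\<^sub>R b i) - ?x \<bullet> \<Gamma> (b i)\<bar> \<le> (Dl n / al n + 1) * sqrt (2 * al n) * norm (b i)"
    proof -
      have "\<bar>?x \<bullet> ((\<Gamma>n n (b i) - \<Gamma> (b i)) + al n *\<^sub>R b i)\<bar> \<le> norm ?x * norm ((\<Gamma>n n (b i) - \<Gamma> (b i)) + al n *\<^sub>R b i)"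
        by (rule Cauchy_Schwarz_ineq2)
      also have "\<dots> \<le> norm ?x * (Dl n * norm (b i) + al n * norm (b i))"
        using norm_triangle_ineq[of "\<Gamma>n n (b i) - \<Gamma> (b i)" "al n *\<^sub>R b i"] close\<Gamma>[of n "b i"] al_pos[of n]
        by (intro mult_left_mono) auto
      also have "\<dots> = (Dl n / al n + 1) * (al n * norm ?x) * norm (b i)"
        using al_pos[of n] by (simp add: field_simps)
      also have "\<dots> \<le> (Dl n / al n + 1) * (sqrt (2 * al n) * sqrt (sample_form n ?x)) * norm (b i)"
        using al_pos[of n] Dl_nonneg[of n] by (intro mult_right_mono mult_left_mono norm_le_sample_form small x) auto
      finally show ?thesis
        unfolding x(2) by (simp add: inner_add_right inner_diff_right algebra_simps)
    qed
    have t2: "\<bar>Gn n (b i) \<bullet> Gn n ?x - G ?x \<bullet> G (b i)\<bar>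
      \<le> eta n * (norm (G (b i)) + Dl n * norm (b i)) + sqrt C * (Dl n * norm (b i))"
    proof -
      have "Gn n (b i) \<bullet> Gn n ?x - G ?x \<bullet> G (b i) = (Gn n ?x - G ?x) \<bullet> Gn n (b i) + G ?x \<bullet> (Gn n (b i) - G (b i))"
        by (simp add: inner_diff_left inner_diff_right inner_commute)
      also have "\<bar>\<dots>\<bar> \<le> norm (Gn n ?x - G ?x) * norm (Gn n (b i)) + norm (G ?x) * norm (Gn n (b i) - G (b i))"
        using Cauchy_Schwarz_ineq2[of "Gn n ?x - G ?x" "Gn n (b i)"] Cauchy_Schwarz_ineq2[of "G ?x" "Gn n (b i) - G (b i)"]
        by linarith
      also have "\<dots> \<le> eta n * (norm (G (b i)) + Dl n * norm (b i)) + sqrt C * (Dl n * norm (b i))"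
      proof (intro add_mono mult_mono)
        show "norm (Gn n ?x - G ?x) \<le> eta n"
          using closeG[of n ?x] error_le_eta[OF small x(1)] x(2) by simp
        have "norm (Gn n (b i)) \<le> norm (G (b i)) + norm (Gn n (b i) - G (b i))" by norm
        then show "norm (Gn n (b i)) \<le> norm (G (b i)) + Dl n * norm (b i)" using closeG[of n "b i"] by linarith
        have "(norm (G ?x))\<^sup>2 \<le> C * (?x \<bullet> \<Gamma> ?x)" using C x by blast
        also have "\<dots> \<le> C * 1" using form_le_sample_form[OF small, of ?x] x C by (intro mult_left_mono) auto
        finally show "norm (G ?x) \<le> sqrt C" by (intro real_le_rsqrt) simp
        show "norm (Gn n (b i) - G (b i)) \<le> Dl n * norm (b i)" by (rule closeG)
      qed (use eta_nonneg C in auto)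
      finally show ?thesis .
    qed
    have "(lamn n j - lam i) * (?x \<bullet> \<Gamma> (b i)) =
      - lamn n j * (?x \<bullet> (\<Gamma>n n (b i) + al n *\<^sub>R b i) - ?x \<bullet> \<Gamma> (b i)) + (Gn n (b i) \<bullet> Gn n ?x - G ?x \<bullet> G (b i))"
      unfolding e1[symmetric] e2 by (simp add: algebra_simps)
    also have "\<bar>\<dots>\<bar> \<le> lamn n j * \<bar>?x \<bullet> (\<Gamma>n n (b i) + al n *\<^sub>R b i) - ?x \<bullet> \<Gamma> (b i)\<bar> + \<bar>Gn n (b i) \<bullet> Gn n ?x - G ?x \<bullet> G (b i)\<bar>"
      using lam0 by (intro order_trans[OF abs_triangle_ineq]) (simp add: abs_mult)
    also have "\<dots> \<le> E n"
      unfolding E_def by (rule add_mono[OF mult_left_mono[OF t1 lam0] t2])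
    finally show ?thesis .
  qed
  have "(\<lambda>n. \<bar>(lamn n j - lam i) * (bn n j \<bullet> \<Gamma> (b i))\<bar>) \<longlonglongrightarrow> 0"
  proof (rule tendsto_sandwich[OF _ _ tendsto_const E])
    show "\<forall>\<^sub>F n in sequentially. \<bar>(lamn n j - lam i) * (bn n j \<bullet> \<Gamma> (b i))\<bar> \<le> E n"
      using small_error by eventually_elim (rule bound)
  qed simp
  then have num: "(\<lambda>n. (lamn n j - lam i) * (bn n j \<bullet> \<Gamma> (b i))) \<longlonglongrightarrow> 0"
    by (rule tendsto_rabs_zero_cancel)
  have ne: "lam j - lam i \<noteq> 0"
    using lam_less[of i j] lam_less[of j i] i j \<open>i \<noteq> j\<close> by (cases i j rule: linorder_cases) auto
  have den: "(\<lambda>n. lamn n j - lam i) \<longlonglongrightarrow> lam j - lam i" by (intro tendsto_intros eigenvalue_tendsto j)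
  have "(\<lambda>n. (lamn n j - lam i) * (bn n j \<bullet> \<Gamma> (b i)) / (lamn n j - lam i)) \<longlonglongrightarrow> 0 / (lam j - lam i)"
    by (intro tendsto_divide num den ne)
  moreover have "\<forall>\<^sub>F n in sequentially. (lamn n j - lam i) * (bn n j \<bullet> \<Gamma> (b i)) / (lamn n j - lam i) = bn n j \<bullet> \<Gamma> (b i)"
    using tendsto_imp_eventually_ne[OF den ne] by eventually_elim simp
  ultimately show ?thesis using Lim_transform_eventually by fastforce
qed

text \<open>
  The squared norm of \<open>G (bn n j)\<close> tends to \<open>lam j\<close>. The components along earlier eigenvectors vanish, and
  the part beyond index \<open>j\<close> has Rayleigh quotient at most \<open>lam (Suc j) < lam j\<close>; hence the whole mass of the
  sample eigenvector has to lie along \<open>b j\<close>. The lower bound \<open>L\<close> makes this quantitative.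
\<close>

lemma own_component_tendsto:
  assumes j: "j \<ge> 1"
  shows "(\<lambda>n. (bn n j \<bullet> \<Gamma> (b j))\<^sup>2) \<longlonglongrightarrow> 1"
proof -
  define c where "c n i = bn n j \<bullet> \<Gamma> (b i)" for n i
  define L where "L n = ((norm (G (bn n j)))\<^sup>2 - lam (Suc j) - (\<Sum>i\<in>{1..<j}. (c n i)\<^sup>2 * lam i)) / (lam j - lam (Suc j))" for n
  have gap: "lam j - lam (Suc j) > 0" using simple[OF j] by simp
  have lamS: "lam (Suc j) \<ge> 0" using lam_pos[of "Suc j"] by simp
  have bounds: "L n \<le> (c n j)\<^sup>2 \<and> (c n j)\<^sup>2 \<le> 1" if small: "Dl n \<le> al n / 2" for n
  proof -
    let ?x = "bn n j"
    note x = sample_eigenvector[OF j, of n]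
    have I: "finite {1..j}" "{1..j} \<subseteq> {1..}" by auto
    define w where "w = ?x - (\<Sum>i\<in>{1..j}. (?x \<bullet> \<Gamma> (b i)) *\<^sub>R b i)"
    note res = pop.listing_residual[OF pop_listing x(1) I, folded w_def, folded c_def]
    have q: "(\<Sum>i\<in>{1..j}. (c n i)\<^sup>2) + w \<bullet> \<Gamma> w \<le> 1"
      using res(3) form_le_sample_form[OF small, of ?x] x(2) by simp
    have split: "sum g {1..j} = sum g {1..<j} + g j" for g :: "nat \<Rightarrow> real"
      using j sum.last_plus[of 1 j g] by (simp add: atLeastLessThanSuc_atLeastAtMost[symmetric] add.commute)
    note q = q[unfolded split] and res4 = res(4)[unfolded split]
    have w0: "w \<bullet> \<Gamma> w \<ge> 0" by (rule pop.nonnegQ[OF res(1)])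
    have s0: "(\<Sum>i\<in>{1..<j}. (c n i)\<^sup>2) \<ge> 0" by (intro sum_nonneg) auto
    have "(norm (G w))\<^sup>2 \<le> lam (Suc j) * (w \<bullet> \<Gamma> w)"
      using res(2) by (intro pop.rayleigh_le_eigenvalue[OF pop_listing _ res(1)]) auto
    also have "\<dots> \<le> lam (Suc j) * (1 - (c n j)\<^sup>2)"
      using q s0 lamS by (intro mult_left_mono) linarith+
    finally have "(norm (G ?x))\<^sup>2 \<le> (\<Sum>i\<in>{1..<j}. (c n i)\<^sup>2 * lam i) + (c n j)\<^sup>2 * lam j + lam (Suc j) * (1 - (c n j)\<^sup>2)"
      using res4 by linarith
    then have "L n \<le> (c n j)\<^sup>2"
      unfolding L_def using gap by (simp add: pos_divide_le_eq algebra_simps)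
    moreover have "(c n j)\<^sup>2 \<le> 1" using q s0 w0 by linarith
    ultimately show ?thesis by blast
  qed
  have "(\<lambda>n. norm (G (bn n j)) - norm (Gn n (bn n j))) \<longlonglongrightarrow> 0"
  proof (rule Lim_null_comparison[OF _ eta_lim])
    show "\<forall>\<^sub>F n in sequentially. norm (norm (G (bn n j)) - norm (Gn n (bn n j))) \<le> eta n"
      using small_error
    proof eventually_elim
      case (elim n)
      note x = sample_eigenvector[OF j, of n]
      have "\<bar>norm (G (bn n j)) - norm (Gn n (bn n j))\<bar> \<le> norm (Gn n (bn n j) - G (bn n j))"
        using norm_triangle_ineq3[of "G (bn n j)" "Gn n (bn n j)"] by (simp add: norm_minus_commute)
      then show ?case using closeG[of n "bn n j"] error_le_eta[OF elim x(1)] x(2) by simp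
    qed
  qed
  moreover have "(\<lambda>n. norm (Gn n (bn n j))) \<longlonglongrightarrow> sqrt (lam j)"
  proof -
    have "norm (Gn n (bn n j)) = sqrt (lamn n j)" for n
      by (simp add: sample_eigenvector(3)[OF j, symmetric])
    then show ?thesis using tendsto_real_sqrt[OF eigenvalue_tendsto[OF j]] by simp
  qed
  ultimately have "(\<lambda>n. (norm (G (bn n j)) - norm (Gn n (bn n j))) + norm (Gn n (bn n j))) \<longlonglongrightarrow> 0 + sqrt (lam j)"
    by (rule tendsto_add)
  then have nG: "(\<lambda>n. norm (G (bn n j))) \<longlonglongrightarrow> sqrt (lam j)" by simp
  have "L \<longlonglongrightarrow> ((sqrt (lam j))\<^sup>2 - lam (Suc j) - (\<Sum>i\<in>{1..<j}. 0\<^sup>2 * lam i)) / (lam j - lam (Suc j))"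
    unfolding L_def c_def using j gap by (intro tendsto_intros nG cross_component_tendsto) auto
  then have L1: "L \<longlonglongrightarrow> 1" using lam_pos[OF j] gap by simp
  have "(\<lambda>n. (c n j)\<^sup>2) \<longlonglongrightarrow> 1"
  proof (rule tendsto_sandwich[OF _ _ L1 tendsto_const])
    show "\<forall>\<^sub>F n in sequentially. L n \<le> (c n j)\<^sup>2" "\<forall>\<^sub>F n in sequentially. (c n j)\<^sup>2 \<le> 1"
      using small_error by (eventually_elim, use bounds in blast)+
  qed
  then show ?thesis by (simp add: c_def)
qed

theorem eigenvector_tendsto:
  assumes j: "j \<ge> 1"
  defines "s \<equiv> \<lambda>n. if bn n j \<bullet> \<Gamma> (b j) \<ge> 0 then 1 else - 1 :: real"
  shows "(\<lambda>n. (s n *\<^sub>R bn n j - b j) \<bullet> \<Gamma> (s n *\<^sub>R bn n j - b j)) \<longlonglongrightarrow> 0"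
proof (rule tendsto_sandwich[of "\<lambda>_. 0" _ _ "\<lambda>n. 2 - 2 * \<bar>bn n j \<bullet> \<Gamma> (b j)\<bar>"])
  have bH: "b j \<in> H" by (rule pop.listing_mem[OF pop_listing j])
  show "\<forall>\<^sub>F n in sequentially. 0 \<le> (s n *\<^sub>R bn n j - b j) \<bullet> \<Gamma> (s n *\<^sub>R bn n j - b j)"
    by (intro always_eventually allI pop.nonnegQ subspace_diff[OF pop.sub] subspace_scale[OF pop.sub] bH sample_eigenvector j)
  show "\<forall>\<^sub>F n in sequentially. (s n *\<^sub>R bn n j - b j) \<bullet> \<Gamma> (s n *\<^sub>R bn n j - b j) \<le> 2 - 2 * \<bar>bn n j \<bullet> \<Gamma> (b j)\<bar>"
    using small_error
  proof eventually_elim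
    case (elim n)
    have "(s n *\<^sub>R bn n j - b j) \<bullet> \<Gamma> (s n *\<^sub>R bn n j - b j) =
      s n * s n * (bn n j \<bullet> \<Gamma> (bn n j)) - 2 * (s n * (bn n j \<bullet> \<Gamma> (b j))) + b j \<bullet> \<Gamma> (b j)"
      using pop.symQ[of "bn n j" "b j"]
      by (simp add: linear_diff[OF pop.linear_Q] linear_scale[OF pop.linear_Q] inner_diff_left inner_diff_right
          inner_commute algebra_simps)
    also have "s n * s n = 1" by (simp add: s_def)
    also have "s n * (bn n j \<bullet> \<Gamma> (b j)) = \<bar>bn n j \<bullet> \<Gamma> (b j)\<bar>" by (simp add: s_def)
    also have "b j \<bullet> \<Gamma> (b j) = 1" using pop.listing_orth[OF pop_listing j j] by simp
    finally show ?case
      using form_le_sample_form[OF elim, of "bn n j"] sample_eigenvector(2)[OF j, of n] by simp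
  qed
  have "(\<lambda>n. 2 - 2 * sqrt ((bn n j \<bullet> \<Gamma> (b j))\<^sup>2)) \<longlonglongrightarrow> 2 - 2 * sqrt 1"
    by (intro tendsto_intros own_component_tendsto j)
  then show "(\<lambda>n. 2 - 2 * \<bar>bn n j \<bullet> \<Gamma> (b j)\<bar>) \<longlonglongrightarrow> 0" by simp
qed simp

end

section \<open>Integral operators on \<open>L\<^sup>2[0,T]\<close>\<close>

lemma abs_mult_le_sum_squares: "\<bar>a * c\<bar> \<le> a\<^sup>2 + c\<^sup>2" for a c :: real
  using sum_squares_bound[of "\<bar>a\<bar>" "\<bar>c\<bar>"] abs_ge_zero[of "a * c"] unfolding abs_mult power2_abs by linarith

lemma sq_int_bounded:
  assumes "f \<in> borel_measurable borel" "sq_int g" "\<And>x. \<bar>f x\<bar> \<le> g x"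
  shows "sq_int f"
  unfolding sq_int_def
proof
  show "f \<in> borel_measurable lborel" using assms(1) by simp
  show "integrable lborel (\<lambda>x. (f x)\<^sup>2)"
  proof (rule Bochner_Integration.integrable_bound[OF sq_intD(3)[OF assms(2)]])
    show "(\<lambda>x. (f x)\<^sup>2) \<in> borel_measurable lborel" using assms(1) by measurable
    have "(f x)\<^sup>2 \<le> (g x)\<^sup>2" for x using assms(3)[of x] by (metis abs_ge_zero power2_abs power_mono)
    then show "AE x in lborel. norm ((f x)\<^sup>2) \<le> norm ((g x)\<^sup>2)" by simp
  qed
qed

lemma L2_of_sum:
  assumes "finite I" "\<And>i. i \<in> I \<Longrightarrow> sq_int (a i)"
  shows "sq_int (\<lambda>s. \<Sum>i\<in>I. c i * a i s) \<and> L2_of (\<lambda>s. \<Sum>i\<in>I. c i * a i s) = (\<Sum>i\<in>I. c i *\<^sub>R L2_of (a i))"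
  using assms
proof (induction I rule: finite_induct)
  case empty
  show ?case by (simp add: sq_int_0 zero_L2.abs_eq)
next
  case (insert i I)
  then show ?case by (simp add: sq_int_add sq_int_scale L2_of_add L2_of_scale)
qed

lemma inner_L2_of_left: "sq_int f \<Longrightarrow> L2_of f \<bullet> y = (\<integral>t. f t * fun_of y t \<partial>lborel)"
  using inner_L2_of[of f "fun_of y"] by (simp add: L2_of_fun_of sq_int_fun_of)

text \<open>The orthogonal projection onto \<^term>\<open>L2_on T\<close>. As its fixed space, \<^term>\<open>L2_on T\<close> is at once
  seen to be linear and closed.\<close>

definition restr :: "real \<Rightarrow> L2 \<Rightarrow> L2"
  where "restr T x = L2_of (\<lambda>t. indicator {0..T} t * fun_of x t)"

lemma sq_int_indicator_mult: "sq_int f \<Longrightarrow> sq_int (\<lambda>t. indicator {0..T} t * f t)"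
  by (rule sq_int_bounded[of _ "\<lambda>t. \<bar>f t\<bar>"]) (auto intro: sq_int_abs dest: sq_intD(2) simp: indicator_def)

lemma restr_L2_of:
  assumes "sq_int f"
  shows "restr T (L2_of f) = L2_of (\<lambda>t. indicator {0..T} t * f t)"
  unfolding restr_def
proof (rule L2_of_eqI)
  show "AE t in lborel. indicator {0..T} t * fun_of (L2_of f) t = indicator {0..T} t * f t"
    using fun_of_L2_of[OF assms] by eventually_elim simp
qed (intro sq_int_indicator_mult sq_int_fun_of assms)+

lemma L2_on_iff_restr: "x \<in> L2_on T \<longleftrightarrow> restr T x = x"
proof
  assume "x \<in> L2_on T"
  then have "AE t in lborel. t \<notin> {0..T} \<longrightarrow> fun_of x t = 0" by (simp add: L2_on_def)
  then have "AE t in lborel. indicator {0..T} t * fun_of x t = fun_of x t"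
    by eventually_elim (auto simp: indicator_def)
  then have "restr T x = L2_of (fun_of x)"
    unfolding restr_def by (intro L2_of_eqI sq_int_indicator_mult sq_int_fun_of)
  then show "restr T x = x" by (simp add: L2_of_fun_of)
next
  assume "restr T x = x"
  then have "AE t in lborel. fun_of x t = indicator {0..T} t * fun_of x t"
    using fun_of_L2_of[OF sq_int_indicator_mult[OF sq_int_fun_of], of T x] by (simp add: restr_def)
  then show "x \<in> L2_on T"
    unfolding L2_on_def by (simp, eventually_elim) (auto simp: indicator_def split: if_splits)
qed

lemma restr_inner: "restr T x \<bullet> y = x \<bullet> restr T y"
proof -
  have r: "restr T u \<bullet> v = (\<integral>t. indicator {0..T} t * fun_of u t * fun_of v t \<partial>lborel)" for u v
    by (simp add: restr_def inner_L2_of_left sq_int_indicator_mult sq_int_fun_of)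
  show ?thesis unfolding inner_commute[of x] r by (simp add: mult_ac)
qed

lemma bounded_linear_restr: "bounded_linear (restr T)"
proof (rule bounded_linear_intro[of _ 1])
  show "restr T (x + y) = restr T x + restr T y" for x y
    by (rule vector_eq_ldot[THEN iffD1]) (metis inner_add_right inner_commute restr_inner)
  show "restr T (c *\<^sub>R x) = c *\<^sub>R restr T x" for c x
    by (rule vector_eq_ldot[THEN iffD1]) (metis inner_scaleR_right inner_commute restr_inner)
  show "norm (restr T x) \<le> norm x * 1" for x
  proof -
    have idem: "restr T (restr T x) = restr T x"
      by (simp add: restr_def[of T x] restr_L2_of sq_int_indicator_mult sq_int_fun_of)
        (intro arg_cong[where f = L2_of] ext, simp add: indicator_def)
    have "norm (restr T x) * norm (restr T x) = restr T x \<bullet> restr T x"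
      by (simp add: power2_norm_eq_inner[symmetric] power2_eq_square)
    also have "\<dots> = x \<bullet> restr T x" by (simp add: restr_inner idem)
    also have "\<dots> \<le> norm x * norm (restr T x)" by (rule norm_cauchy_schwarz)
    finally show ?thesis by (cases "restr T x = 0") auto
  qed
qed

lemma subspace_L2_on: "subspace (L2_on T)"
  using bounded_linear.linear[OF bounded_linear_restr[of T]]
  by (auto simp: subspace_def L2_on_iff_restr linear_0 linear_add linear_scale)

lemma closed_L2_on: "closed (L2_on T)"
proof -
  have "L2_on T = (\<lambda>x. restr T x - x) -` {0}" by (auto simp: L2_on_iff_restr)
  moreover have "continuous_on UNIV (\<lambda>x. restr T x - x)"
    by (intro continuous_intros linear_continuous_on bounded_linear_restr)
  ultimately show ?thesis by (simp add: closed_vimage)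
qed

lemma restr_in_L2_on: "restr T x \<in> L2_on T"
  unfolding L2_on_iff_restr
  by (simp add: restr_def[of T x] restr_L2_of sq_int_indicator_mult sq_int_fun_of)
    (intro arg_cong[where f = L2_of] ext, simp add: indicator_def)

lemma inner_L2_on: "x \<in> L2_on T \<Longrightarrow> x \<bullet> y = x \<bullet> restr T y"
  by (metis L2_on_iff_restr restr_inner)

lemma L2_of_in_L2_on:
  assumes "sq_int f" "\<And>t. t \<notin> {0..T} \<Longrightarrow> f t = 0"
  shows "L2_of f \<in> L2_on T"
  unfolding L2_on_iff_restr restr_L2_of[OF assms(1)]
  using assms(2) by (intro arg_cong[where f = L2_of] ext) (auto simp: indicator_def)

text \<open>
  A Hilbert-Schmidt operator acts by inner products with the rows of its kernel. On the null set of
  rows that are not square integrable the row is replaced by zero; this leaves the operator unchanged.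
\<close>

definition kernel_rows :: "real \<Rightarrow> (L2 \<Rightarrow> L2) \<Rightarrow> (real \<Rightarrow> L2) \<Rightarrow> bool"
  where "kernel_rows T R rw \<longleftrightarrow> (\<forall>x. (\<lambda>s. rw s \<bullet> x) \<in> borel_measurable borel) \<and>
    sq_int (\<lambda>s. norm (rw s)) \<and> (\<forall>s. s \<notin> {0..T} \<longrightarrow> rw s = 0) \<and> (\<forall>x. R x = L2_of (\<lambda>s. rw s \<bullet> x))"

lemma kernel_rowsD:
  assumes "kernel_rows T R rw"
  shows "(\<lambda>s. rw s \<bullet> x) \<in> borel_measurable borel" "sq_int (\<lambda>s. norm (rw s))"
    "s \<notin> {0..T} \<Longrightarrow> rw s = 0" "R x = L2_of (\<lambda>s. rw s \<bullet> x)" "sq_int (\<lambda>s. rw s \<bullet> x)"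
proof -
  show 1: "(\<lambda>s. rw s \<bullet> x) \<in> borel_measurable borel" and 2: "sq_int (\<lambda>s. norm (rw s))"
    and "s \<notin> {0..T} \<Longrightarrow> rw s = 0" "R x = L2_of (\<lambda>s. rw s \<bullet> x)"
    using assms by (auto simp: kernel_rows_def)
  show "sq_int (\<lambda>s. rw s \<bullet> x)"
    by (rule sq_int_bounded[OF 1 sq_int_scale[OF 2, of "norm x"]])
      (metis Cauchy_Schwarz_ineq2 mult.commute)
qed

lemma kernel_rows_bounded_linear:
  assumes "kernel_rows T R rw"
  shows "bounded_linear R"
proof (rule bounded_linear_intro)
  note D = kernel_rowsD[OF assms]
  show "R (x + y) = R x + R y" for x y
    by (simp add: D(4) inner_add_right L2_of_add D(5))
  show "R (c *\<^sub>R x) = c *\<^sub>R R x" for c x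
    by (simp add: D(4) L2_of_scale D(5))
  show "norm (R x) \<le> norm x * norm (L2_of (\<lambda>s. norm (rw s)))" for x
  proof (rule power2_le_imp_le)
    have "(norm (R x))\<^sup>2 = (\<integral>s. (rw s \<bullet> x)\<^sup>2 \<partial>lborel)" by (simp add: D(4) norm_L2_of D(5))
    also have "\<dots> \<le> (\<integral>s. (norm x * norm (rw s))\<^sup>2 \<partial>lborel)"
    proof (intro integral_mono sq_intD(3) D(5) sq_int_scale D(2))
      show "(rw s \<bullet> x)\<^sup>2 \<le> (norm x * norm (rw s))\<^sup>2" for s
        by (metis Cauchy_Schwarz_ineq2 abs_ge_zero mult.commute power2_abs power_mono)
    qed
    also have "\<dots> = (norm x * norm (L2_of (\<lambda>s. norm (rw s))))\<^sup>2"
      by (simp add: power_mult_distrib norm_L2_of D(2))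
    finally show "(norm (R x))\<^sup>2 \<le> (norm x * norm (L2_of (\<lambda>s. norm (rw s))))\<^sup>2" .
  qed simp
qed

lemma kernel_rows_range:
  assumes "kernel_rows T R rw"
  shows "R x \<in> L2_on T"
  using kernel_rowsD[OF assms] by (auto intro!: L2_of_in_L2_on)

text \<open>Along a weakly convergent subsequence the images converge pointwise, since each value is an inner
  product with a row. They are dominated by a multiple of the norms of the rows, so they converge in
  mean square.\<close>

lemma kernel_rows_compact:
  assumes R: "kernel_rows T R rw" and B: "\<And>n::nat. norm (x n) \<le> B"
  shows "\<exists>r l. strict_mono r \<and> (\<lambda>n. R (x (r n))) \<longlonglongrightarrow> l"
proof -
  note D = kernel_rowsD[OF R]
  obtain r where r: "strict_mono r" "\<And>y. convergent (\<lambda>n. y \<bullet> x (r n))"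
    using bounded_seq_weakly_convergent_subseq[of x B] B by blast
  define h where "h s = lim (\<lambda>n. rw s \<bullet> x (r n))" for s
  have lim: "(\<lambda>n. rw s \<bullet> x (r n)) \<longlonglongrightarrow> h s" for s
    using r(2)[of "rw s"] by (simp add: h_def convergent_LIMSEQ_iff)
  have le: "\<bar>rw s \<bullet> x (r n)\<bar> \<le> B * norm (rw s)" for n s
    using Cauchy_Schwarz_ineq2[of "rw s" "x (r n)"] mult_right_mono[OF B[of "r n"], of "norm (rw s)"]
    by (simp add: mult.commute)
  have g: "sq_int (\<lambda>s. B * norm (rw s))" by (intro sq_int_scale D(2))
  have "\<bar>h s\<bar> \<le> B * norm (rw s)" for s
    by (rule LIMSEQ_le_const2[OF tendsto_rabs[OF lim]]) (use le in auto)
  moreover have "h \<in> borel_measurable borel"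
    by (rule borel_measurable_LIMSEQ_real[OF lim D(1)])
  ultimately have "sq_int h" by (intro sq_int_bounded[OF _ g])
  from L2_of_tendsto[OF this D(5) g le lim]
  have "(\<lambda>n. R (x (r n))) \<longlonglongrightarrow> L2_of h" by (simp add: D(4))
  then show ?thesis using r(1) by blast
qed

lemma hs_kernel_properties:
  assumes "hs_kernel T K"
  defines "K0 \<equiv> \<lambda>s t. indicator {0..T} s * (indicator {0..T} t * K s t)"
  shows "case_prod K0 \<in> borel_measurable (lborel \<Otimes>\<^sub>M lborel)"
    and "integrable (lborel \<Otimes>\<^sub>M lborel) (\<lambda>(s, t). (K0 s t)\<^sup>2)"
proof -
  have eq: "case_prod K0 = (\<lambda>p. indicator ({0..T} \<times> {0..T}) p *\<^sub>R (case p of (s, t) \<Rightarrow> K s t))"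
    by (auto simp: K0_def indicator_def)
  show "case_prod K0 \<in> borel_measurable (lborel \<Otimes>\<^sub>M lborel)"
    using assms unfolding hs_kernel_def set_borel_measurable_def eq lborel_prod by simp
  have eq2: "(\<lambda>(s, t). (K0 s t)\<^sup>2) = (\<lambda>p. indicator ({0..T} \<times> {0..T}) p *\<^sub>R (case p of (s, t) \<Rightarrow> (K s t)\<^sup>2))"
    by (auto simp: K0_def indicator_def)
  show "integrable (lborel \<Otimes>\<^sub>M lborel) (\<lambda>(s, t). (K0 s t)\<^sup>2)"
    using assms unfolding hs_kernel_def set_integrable_def eq2 lborel_prod by simp
qed

lemma int_op_kernel_rows:
  assumes "hs_kernel T K"
  shows "\<exists>rw. kernel_rows T (int_op T K) rw \<and>
    (\<forall>x. AE s in lborel. rw s \<bullet> x = (\<integral>t. indicator {0..T} s * (indicator {0..T} t * K s t) * fun_of x t \<partial>lborel))"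
proof -
  define K0 where "K0 s t = indicator {0..T} s * (indicator {0..T} t * K s t)" for s t
  note K0 = hs_kernel_properties[OF assms, folded K0_def]
  note [measurable] = K0(1)
  define N where "N s = (\<integral>\<^sup>+t. ennreal ((K0 s t)\<^sup>2) \<partial>lborel)" for s
  have [measurable]: "N \<in> borel_measurable borel" unfolding N_def by measurable
  have int: "(\<integral>\<^sup>+s. N s \<partial>lborel) < \<infinity>"
  proof -
    have "(\<integral>\<^sup>+s. N s \<partial>lborel) = (\<integral>\<^sup>+p. ennreal ((case_prod K0 p)\<^sup>2) \<partial>(lborel \<Otimes>\<^sub>M lborel))"
      unfolding N_def by (subst lborel.nn_integral_fst[symmetric]) (auto simp: split_beta')
    also have "\<dots> < \<infinity>"
      using K0(2) by (auto simp: integrable_iff_bounded split_beta')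
    finally show ?thesis .
  qed
  have fin: "AE s in lborel. N s \<noteq> \<infinity>" using int by (intro nn_integral_PInf_AE) auto
  define K1 where "K1 s t = (if N s = \<infinity> then 0 else K0 s t)" for s t
  have [measurable]: "case_prod K1 \<in> borel_measurable (lborel \<Otimes>\<^sub>M lborel)" unfolding K1_def by measurable
  have [measurable]: "K1 s \<in> borel_measurable borel" for s by measurable
  have N1: "(\<integral>\<^sup>+t. ennreal ((K1 s t)\<^sup>2) \<partial>lborel) = (if N s = \<infinity> then 0 else N s)" for s
    by (simp add: K1_def N_def)
  have sq: "sq_int (K1 s)" for s
    unfolding sq_int_def
  proof
    show "integrable lborel (\<lambda>t. (K1 s t)\<^sup>2)"
      using N1[of s] by (intro integrableI_bounded) (auto simp: less_top)
  qed simp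
  define rw where "rw s = L2_of (K1 s)" for s
  have inner: "rw s \<bullet> x = (\<integral>t. K1 s t * fun_of x t \<partial>lborel)" for s x
    by (simp add: rw_def inner_L2_of_left sq)
  have [measurable]: "fun_of x \<in> borel_measurable borel" for x
    using sq_intD(2)[OF sq_int_fun_of] .
  have m: "(\<lambda>s. rw s \<bullet> x) \<in> borel_measurable borel" for x
    unfolding inner by measurable
  have n2: "ennreal ((norm (rw s))\<^sup>2) = (if N s = \<infinity> then 0 else N s)" for s
    using nn_integral_norm_L2_of[OF sq, of s] N1[of s] by (simp add: rw_def)
  have nm: "norm (rw s) = sqrt (enn2real (if N s = \<infinity> then 0 else N s))" for s
    unfolding n2[symmetric] by simp
  have [measurable]: "(\<lambda>s. norm (rw s)) \<in> borel_measurable borel" unfolding nm by measurable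
  have "sq_int (\<lambda>s. norm (rw s))"
    unfolding sq_int_def
  proof
    have "(\<integral>\<^sup>+s. ennreal ((norm (rw s))\<^sup>2) \<partial>lborel) \<le> (\<integral>\<^sup>+s. N s \<partial>lborel)"
      unfolding n2 by (intro nn_integral_mono) auto
    then show "integrable lborel (\<lambda>s. (norm (rw s))\<^sup>2)"
      using int by (intro integrableI_bounded) auto
  qed simp
  moreover have "rw s = 0" if "s \<notin> {0..T}" for s
  proof -
    have "K1 s = (\<lambda>_. 0)" using that by (auto simp: K1_def K0_def)
    then show ?thesis by (simp add: rw_def zero_L2.abs_eq)
  qed
  moreover have "AE s in lborel. rw s \<bullet> x = (\<integral>t. K0 s t * fun_of x t \<partial>lborel)" for x
    using fin by eventually_elim (simp add: inner K1_def)
  moreover have "int_op T K x = L2_of (\<lambda>s. rw s \<bullet> x)" for x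
  proof -
    define g where "g s = (\<integral>t. K0 s t * fun_of x t \<partial>lborel)" for s
    have [measurable]: "g \<in> borel_measurable borel" unfolding g_def by measurable
    have e1: "indicator {0..T} s * (LINT t:{0..T}|lborel. K s t * fun_of x t) = g s" for s
      unfolding set_lebesgue_integral_def g_def K0_def
      by (simp add: mult.assoc integral_mult_right_zero[symmetric] del: integral_mult_right_zero)
    have ae: "AE s in lborel. g s = rw s \<bullet> x"
      using fin by eventually_elim (simp add: g_def inner K1_def)
    have s2: "sq_int (\<lambda>s. rw s \<bullet> x)"
      by (rule sq_int_bounded[OF m sq_int_scale[OF \<open>sq_int (\<lambda>s. norm (rw s))\<close>, of "norm x"]])
        (metis Cauchy_Schwarz_ineq2 mult.commute)
    have "sq_int g"
      unfolding sq_int_def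
    proof
      show "integrable lborel (\<lambda>s. (g s)\<^sup>2)"
        by (rule integrable_cong_AE_imp[OF sq_intD(3)[OF s2]]) (use ae in \<open>auto elim: eventually_mono\<close>)
    qed simp
    then show ?thesis
      unfolding int_op_def e1 by (intro L2_of_eqI s2 ae)
  qed
  ultimately show ?thesis using m unfolding kernel_rows_def K0_def by blast
qed

lemma hs_kernel_transpose:
  assumes "hs_kernel T K"
  shows "hs_kernel T (\<lambda>s t. K t s)"
proof -
  define A where "A = {0..T} \<times> {0..T}"
  define f where "f p = indicator A p *\<^sub>R (case p of (s, t) \<Rightarrow> K s t)" for p
  define f2 where "f2 p = indicator A p *\<^sub>R (case p of (s, t) \<Rightarrow> (K s t)\<^sup>2)" for p
  have f: "f \<in> borel_measurable (lborel \<Otimes>\<^sub>M lborel)" "integrable (lborel \<Otimes>\<^sub>M lborel) f2"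
    using assms unfolding hs_kernel_def set_borel_measurable_def set_integrable_def lborel_prod f_def f2_def A_def
    by auto
  have "(\<lambda>p. indicator A p *\<^sub>R (case p of (s, t) \<Rightarrow> K t s)) = (\<lambda>(s, t). f (t, s))"
    by (auto simp: f_def A_def indicator_def)
  moreover have "(\<lambda>(s, t). f (t, s)) \<in> borel_measurable (lborel \<Otimes>\<^sub>M lborel)"
    using f(1) by measurable
  moreover have "(\<lambda>p. indicator A p *\<^sub>R (case p of (s, t) \<Rightarrow> (K t s)\<^sup>2)) = (\<lambda>(s, t). f2 (t, s))"
    by (auto simp: f2_def A_def indicator_def)
  moreover have "integrable (lborel \<Otimes>\<^sub>M lborel) (\<lambda>(s, t). f2 (t, s))"
    using f(2) by (rule lborel_pair.integrable_product_swap)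
  ultimately show ?thesis
    unfolding hs_kernel_def set_borel_measurable_def set_integrable_def lborel_prod A_def by simp
qed

lemma int_op_inner:
  assumes "hs_kernel T K"
  defines "K0 \<equiv> \<lambda>s t. indicator {0..T} s * (indicator {0..T} t * K s t)"
  shows "int_op T K x \<bullet> y = (\<integral>s. (\<integral>t. K0 s t * fun_of x t \<partial>lborel) * fun_of y s \<partial>lborel)"
proof -
  note [measurable] = hs_kernel_properties(1)[OF assms(1), folded K0_def] sq_intD(2)[OF sq_int_fun_of]
  obtain rw where rw: "kernel_rows T (int_op T K) rw"
    "AE s in lborel. rw s \<bullet> x = (\<integral>t. K0 s t * fun_of x t \<partial>lborel)"
    using int_op_kernel_rows[OF assms(1)] unfolding K0_def by blast
  note [measurable] = kernel_rowsD(1)[OF rw(1)]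
  have "int_op T K x \<bullet> y = (\<integral>s. (rw s \<bullet> x) * fun_of y s \<partial>lborel)"
    by (simp add: kernel_rowsD(4)[OF rw(1)] inner_L2_of_left kernel_rowsD(5)[OF rw(1)])
  also have "\<dots> = (\<integral>s. (\<integral>t. K0 s t * fun_of x t \<partial>lborel) * fun_of y s \<partial>lborel)"
    using rw(2) by (intro integral_cong_AE) (auto elim: eventually_mono)
  finally show ?thesis .
qed

lemma int_op_adjoint:
  assumes "hs_kernel T K"
  shows "int_op T K x \<bullet> y = x \<bullet> int_op T (\<lambda>s t. K t s) y"
proof -
  define K0 where "K0 s t = indicator {0..T} s * (indicator {0..T} t * K s t)" for s t
  note K0 = hs_kernel_properties[OF assms, folded K0_def]
  note [measurable] = K0(1)
  define X Y where "X = fun_of x" and "Y = fun_of y"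
  have XY: "sq_int X" "sq_int Y" by (simp_all add: X_def Y_def sq_int_fun_of)
  note [measurable] = sq_intD(2)[OF XY(1)] sq_intD(2)[OF XY(2)]
  have sq: "integrable (lborel \<Otimes>\<^sub>M lborel) (\<lambda>(s, t). (Y s)\<^sup>2 * (X t)\<^sup>2)"
    by (rule lborel_pair.Fubini_integrable) (use sq_intD(3)[OF XY(1)] sq_intD(3)[OF XY(2)] in auto)
  have int: "integrable (lborel \<Otimes>\<^sub>M lborel) (\<lambda>(s, t). K0 s t * X t * Y s)"
  proof (rule Bochner_Integration.integrable_bound[OF Bochner_Integration.integrable_add[OF K0(2) sq]])
    have "\<bar>k * a * c\<bar> \<le> k\<^sup>2 + c\<^sup>2 * a\<^sup>2" for k a c :: real
      using abs_mult_le_sum_squares[of k "a * c"] by (simp add: power_mult_distrib mult_ac)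
    then show "AE p in lborel \<Otimes>\<^sub>M lborel. norm (case p of (s, t) \<Rightarrow> K0 s t * X t * Y s)
        \<le> norm ((case p of (s, t) \<Rightarrow> (K0 s t)\<^sup>2) + (case p of (s, t) \<Rightarrow> (Y s)\<^sup>2 * (X t)\<^sup>2))"
      by (auto split: prod.split)
  qed measurable
  have "int_op T K x \<bullet> y = (\<integral>s. (\<integral>t. K0 s t * X t * Y s \<partial>lborel) \<partial>lborel)"
    unfolding int_op_inner[OF assms] K0_def X_def Y_def by (simp only: integral_mult_left_zero)
  also have "\<dots> = (\<integral>t. (\<integral>s. K0 s t * X t * Y s \<partial>lborel) \<partial>lborel)"
    using lborel_pair.Fubini_integral[OF int] by simp
  also have "\<dots> = (\<integral>t. (\<integral>s. indicator {0..T} t * (indicator {0..T} s * K s t) * Y s * X t \<partial>lborel) \<partial>lborel)"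
    unfolding K0_def by (simp add: mult_ac)
  also have "\<dots> = int_op T (\<lambda>s t. K t s) y \<bullet> x"
    unfolding int_op_inner[OF hs_kernel_transpose[OF assms]] X_def Y_def by (simp only: integral_mult_left_zero)
  finally show ?thesis by (simp add: inner_commute)
qed

lemma int_op_finite_rank:
  assumes I: "finite I" and a: "\<And>i. i \<in> I \<Longrightarrow> a i \<in> L2_on T" and b: "\<And>i. i \<in> I \<Longrightarrow> b i \<in> L2_on T"
    and p: "sq_int p" "L2_of p \<in> L2_on T" and q: "sq_int q" "L2_of q \<in> L2_on T"
  shows "int_op T (\<lambda>s u. c * (\<Sum>i\<in>I. fun_of (a i) s * fun_of (b i) u) - p s * q u) x
    = c *\<^sub>R (\<Sum>i\<in>I. (b i \<bullet> x) *\<^sub>R a i) - (L2_of q \<bullet> x) *\<^sub>R L2_of p"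
proof -
  let ?i = "indicator {0..T} :: real \<Rightarrow> real"
  have rw: "(\<integral>u. ?i u * (f u * fun_of x u) \<partial>lborel) = L2_of f \<bullet> x" "integrable lborel (\<lambda>u. ?i u * (f u * fun_of x u))"
    if "sq_int f" "L2_of f \<in> L2_on T" for f
  proof -
    have "L2_of f \<bullet> x = restr T (L2_of f) \<bullet> x" using that(2) by (simp add: L2_on_iff_restr)
    also have "\<dots> = (\<integral>u. ?i u * (f u * fun_of x u) \<partial>lborel)"
      by (simp add: restr_L2_of that inner_L2_of_left sq_int_indicator_mult mult.assoc)
    finally show "(\<integral>u. ?i u * (f u * fun_of x u) \<partial>lborel) = L2_of f \<bullet> x" by simp
    show "integrable lborel (\<lambda>u. ?i u * (f u * fun_of x u))"
      using sq_int_mult[OF sq_int_indicator_mult[OF that(1)] sq_int_fun_of, of T x] by (simp add: mult.assoc)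
  qed
  note rowb = rw[OF sq_int_fun_of, unfolded L2_of_fun_of]
  have inner: "(LINT u:{0..T}|lborel. (c * (\<Sum>i\<in>I. fun_of (a i) s * fun_of (b i) u) - p s * q u) * fun_of x u)
    = (\<Sum>i\<in>I. (c * (b i \<bullet> x)) * fun_of (a i) s) - (L2_of q \<bullet> x) * p s" for s
  proof -
    have "(LINT u:{0..T}|lborel. (c * (\<Sum>i\<in>I. fun_of (a i) s * fun_of (b i) u) - p s * q u) * fun_of x u)
      = (\<integral>u. (\<Sum>i\<in>I. c * fun_of (a i) s * (?i u * (fun_of (b i) u * fun_of x u))) - p s * (?i u * (q u * fun_of x u)) \<partial>lborel)"
      unfolding set_lebesgue_integral_def
      by (intro Bochner_Integration.integral_cong refl) (simp add: algebra_simps sum_distrib_left)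
    also have "\<dots> = (\<Sum>i\<in>I. c * fun_of (a i) s * (b i \<bullet> x)) - p s * (L2_of q \<bullet> x)"
      using rowb[OF b] rw[OF q] by (subst Bochner_Integration.integral_diff) (auto intro!: Bochner_Integration.integrable_sum integrable_mult_right)
    finally show ?thesis by (simp add: mult_ac)
  qed
  have sum: "sq_int (\<lambda>s. \<Sum>i\<in>I. (c * (b i \<bullet> x)) * fun_of (a i) s)"
    "L2_of (\<lambda>s. \<Sum>i\<in>I. (c * (b i \<bullet> x)) * fun_of (a i) s) = (\<Sum>i\<in>I. (c * (b i \<bullet> x)) *\<^sub>R a i)"
    using L2_of_sum[OF I, of "\<lambda>i. fun_of (a i)" "\<lambda>i. c * (b i \<bullet> x)"] by (simp_all add: sq_int_fun_of L2_of_fun_of)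
  have "int_op T (\<lambda>s u. c * (\<Sum>i\<in>I. fun_of (a i) s * fun_of (b i) u) - p s * q u) x
    = restr T (L2_of (\<lambda>s. (\<Sum>i\<in>I. (c * (b i \<bullet> x)) * fun_of (a i) s) - (L2_of q \<bullet> x) * p s))"
    unfolding int_op_def inner by (simp add: restr_L2_of sq_int_diff sum(1) sq_int_scale p)
  also have "L2_of (\<lambda>s. (\<Sum>i\<in>I. (c * (b i \<bullet> x)) * fun_of (a i) s) - (L2_of q \<bullet> x) * p s)
    = (\<Sum>i\<in>I. (c * (b i \<bullet> x)) *\<^sub>R a i) - (L2_of q \<bullet> x) *\<^sub>R L2_of p"
    by (simp add: L2_of_diff sum sq_int_scale p L2_of_scale)
  also have "restr T \<dots> = \<dots>"
    unfolding L2_on_iff_restr[symmetric] using a p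
    by (intro subspace_diff[OF subspace_L2_on] subspace_sum[OF subspace_L2_on] subspace_scale[OF subspace_L2_on])
  finally show ?thesis by (simp add: scaleR_sum_right)
qed

section \<open>Square-integrable random elements of a Hilbert space\<close>

definition sq_rv :: "'a measure \<Rightarrow> ('a \<Rightarrow> L2) \<Rightarrow> bool"
  where "sq_rv M X \<longleftrightarrow> X \<in> borel_measurable M \<and> integrable M (\<lambda>\<omega>. (norm (X \<omega>))\<^sup>2)"

definition msq :: "'a measure \<Rightarrow> ('a \<Rightarrow> L2) \<Rightarrow> real"
  where "msq M X = (\<integral>\<omega>. (norm (X \<omega>))\<^sup>2 \<partial>M)"

definition cov_form :: "'a measure \<Rightarrow> ('a \<Rightarrow> L2) \<Rightarrow> ('a \<Rightarrow> L2) \<Rightarrow> L2 \<Rightarrow> L2 \<Rightarrow> real"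
  where "cov_form M X Y x y = (\<integral>\<omega>. (X \<omega> \<bullet> x) * (Y \<omega> \<bullet> y) \<partial>M)"

lemma msq_nonneg [simp]: "msq M X \<ge> 0"
  by (simp add: msq_def)

lemma sq_rvD:
  assumes "sq_rv M X"
  shows "X \<in> borel_measurable M" "integrable M (\<lambda>\<omega>. (norm (X \<omega>))\<^sup>2)"
  using assms by (auto simp: sq_rv_def)

lemma sq_rv_boundI:
  assumes [measurable]: "X \<in> borel_measurable M" and g: "integrable M g"
    and le: "\<And>\<omega>. \<omega> \<in> space M \<Longrightarrow> (norm (X \<omega>))\<^sup>2 \<le> g \<omega>"
  shows "sq_rv M X"
  unfolding sq_rv_def
proof
  show "integrable M (\<lambda>\<omega>. (norm (X \<omega>))\<^sup>2)"
    by (rule Bochner_Integration.integrable_bound[OF g]) (use le in \<open>auto intro!: AE_I2 order_trans[OF _ abs_ge_self]\<close>)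
qed fact

lemma norm_add_sq_le: "(norm (x + y :: 'b::real_normed_vector))\<^sup>2 \<le> 2 * (norm x)\<^sup>2 + 2 * (norm y)\<^sup>2"
proof -
  have "(norm (x + y))\<^sup>2 \<le> (norm x + norm y)\<^sup>2" by (intro power_mono norm_triangle_ineq) simp
  also have "\<dots> \<le> 2 * (norm x)\<^sup>2 + 2 * (norm y)\<^sup>2"
    using sum_squares_bound[of "norm x" "norm y"] by (simp add: power2_sum)
  finally show ?thesis .
qed

lemma sq_rv_zero: "sq_rv M (\<lambda>_. 0)"
  by (simp add: sq_rv_def)

lemma sq_rv_add:
  assumes "sq_rv M X" "sq_rv M Y"
  shows "sq_rv M (\<lambda>\<omega>. X \<omega> + Y \<omega>)"
proof (rule sq_rv_boundI)
  note [measurable] = sq_rvD(1)[OF assms(1)] sq_rvD(1)[OF assms(2)]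
  show "(\<lambda>\<omega>. X \<omega> + Y \<omega>) \<in> borel_measurable M" by measurable
  show "integrable M (\<lambda>\<omega>. 2 * (norm (X \<omega>))\<^sup>2 + 2 * (norm (Y \<omega>))\<^sup>2)"
    using sq_rvD(2)[OF assms(1)] sq_rvD(2)[OF assms(2)] by auto
qed (rule norm_add_sq_le)

lemma borel_measurable_bounded_linear:
  assumes "bounded_linear A" "X \<in> borel_measurable M"
  shows "(\<lambda>\<omega>. A (X \<omega>)) \<in> borel_measurable M"
  using borel_measurable_continuous_onI[OF linear_continuous_on[OF assms(1)]] assms(2) by measurable

lemma sq_rv_bounded_linear:
  assumes A: "bounded_linear A" and X: "sq_rv M X"
  shows "sq_rv M (\<lambda>\<omega>. A (X \<omega>))"
proof (rule sq_rv_boundI)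
  show "(\<lambda>\<omega>. A (X \<omega>)) \<in> borel_measurable M" by (rule borel_measurable_bounded_linear[OF A sq_rvD(1)[OF X]])
  show "integrable M (\<lambda>\<omega>. (onorm A)\<^sup>2 * (norm (X \<omega>))\<^sup>2)" using sq_rvD(2)[OF X] by auto
  show "(norm (A (X \<omega>)))\<^sup>2 \<le> (onorm A)\<^sup>2 * (norm (X \<omega>))\<^sup>2" for \<omega>
    using power_mono[OF onorm[OF A, of "X \<omega>"], of 2] by (simp add: power_mult_distrib)
qed

lemma sq_rv_diff:
  assumes "sq_rv M X" "sq_rv M Y"
  shows "sq_rv M (\<lambda>\<omega>. X \<omega> - Y \<omega>)"
  using sq_rv_add[OF assms(1) sq_rv_bounded_linear[OF bounded_linear_minus[OF bounded_linear_ident] assms(2)]] by simp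

lemma sq_rv_sum:
  "finite I \<Longrightarrow> (\<And>i. i \<in> I \<Longrightarrow> sq_rv M (X i)) \<Longrightarrow> sq_rv M (\<lambda>\<omega>. \<Sum>i\<in>I. X i \<omega>)"
  by (induction I rule: finite_induct) (auto simp: sq_rv_zero sq_rv_add)

lemma integrable_prod_of_squares:
  fixes u v :: "'a \<Rightarrow> real"
  assumes [measurable]: "u \<in> borel_measurable M" "v \<in> borel_measurable M"
    and "integrable M (\<lambda>\<omega>. (u \<omega>)\<^sup>2)" "integrable M (\<lambda>\<omega>. (v \<omega>)\<^sup>2)"
  shows "integrable M (\<lambda>\<omega>. u \<omega> * v \<omega>)"
proof (rule Bochner_Integration.integrable_bound)
  show "integrable M (\<lambda>\<omega>. (u \<omega>)\<^sup>2 + (v \<omega>)\<^sup>2)" using assms by auto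
  show "AE \<omega> in M. norm (u \<omega> * v \<omega>) \<le> norm ((u \<omega>)\<^sup>2 + (v \<omega>)\<^sup>2)"
    using abs_mult_le_sum_squares by auto
qed measurable

lemma inner_square_le: "(z \<bullet> x)\<^sup>2 \<le> (norm x)\<^sup>2 * (norm z)\<^sup>2"
  using Cauchy_Schwarz_ineq[of z x] by (simp add: power2_norm_eq_inner mult.commute)

lemma sq_rv_inner:
  assumes "sq_rv M X"
  shows "integrable M (\<lambda>\<omega>. (X \<omega> \<bullet> x)\<^sup>2)" "(\<lambda>\<omega>. X \<omega> \<bullet> x) \<in> borel_measurable M"
proof -
  note [measurable] = sq_rvD(1)[OF assms]
  show "(\<lambda>\<omega>. X \<omega> \<bullet> x) \<in> borel_measurable M" by measurable
  show "integrable M (\<lambda>\<omega>. (X \<omega> \<bullet> x)\<^sup>2)"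
  proof (rule Bochner_Integration.integrable_bound)
    show "integrable M (\<lambda>\<omega>. (norm x)\<^sup>2 * (norm (X \<omega>))\<^sup>2)" using sq_rvD(2)[OF assms] by auto
    show "AE \<omega> in M. norm ((X \<omega> \<bullet> x)\<^sup>2) \<le> norm ((norm x)\<^sup>2 * (norm (X \<omega>))\<^sup>2)"
      by (simp add: inner_square_le)
  qed measurable
qed

lemma integrable_cov_form:
  "sq_rv M X \<Longrightarrow> sq_rv M Y \<Longrightarrow> integrable M (\<lambda>\<omega>. (X \<omega> \<bullet> x) * (Y \<omega> \<bullet> y))"
  by (intro integrable_prod_of_squares sq_rv_inner)

lemma integrable_norm_mult:
  assumes "sq_rv M X" "sq_rv M Y"
  shows "integrable M (\<lambda>\<omega>. norm (X \<omega>) * norm (Y \<omega>))"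
  using sq_rvD[OF assms(1)] sq_rvD[OF assms(2)] by (intro integrable_prod_of_squares) auto

lemma integrable_inner:
  assumes "sq_rv M X" "sq_rv M Y"
  shows "integrable M (\<lambda>\<omega>. X \<omega> \<bullet> Y \<omega>)"
proof (rule Bochner_Integration.integrable_bound[OF integrable_norm_mult[OF assms]])
  show "(\<lambda>\<omega>. X \<omega> \<bullet> Y \<omega>) \<in> borel_measurable M"
    using sq_rvD(1)[OF assms(1)] sq_rvD(1)[OF assms(2)] by measurable
qed (auto simp: Cauchy_Schwarz_ineq2)

lemma (in prob_space) sq_rv_integrable:
  assumes "sq_rv M X"
  shows "integrable M X"
proof (rule Bochner_Integration.integrable_bound)
  show "integrable M (\<lambda>\<omega>. 1 + (norm (X \<omega>))\<^sup>2)" using sq_rvD(2)[OF assms] by auto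
  have "a \<le> 1 + a\<^sup>2" if "a \<ge> 0" for a :: real
    using that sum_squares_bound[of 1 a] by (simp add: power2_eq_square)
  then show "AE \<omega> in M. norm (X \<omega>) \<le> norm (1 + (norm (X \<omega>))\<^sup>2)" by (auto intro!: AE_I2)
qed (rule sq_rvD[OF assms])

lemma cov_op_inner:
  assumes "sq_rv M X" "sq_rv M Y"
  shows "cov_op M X Y x \<bullet> y = cov_form M X Y x y"
proof -
  note [measurable] = sq_rvD(1)[OF assms(1)] sq_rvD(1)[OF assms(2)]
  have "integrable M (\<lambda>\<omega>. (X \<omega> \<bullet> x) *\<^sub>R Y \<omega>)"
  proof (rule Bochner_Integration.integrable_bound)
    show "integrable M (\<lambda>\<omega>. norm x * (norm (X \<omega>) * norm (Y \<omega>)))"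
      using integrable_norm_mult[OF assms] by auto
    show "AE \<omega> in M. norm ((X \<omega> \<bullet> x) *\<^sub>R Y \<omega>) \<le> norm (norm x * (norm (X \<omega>) * norm (Y \<omega>)))"
      using mult_right_mono[OF Cauchy_Schwarz_ineq2[of "X _" x] norm_ge_zero[of "Y _"]]
      by (auto simp: abs_mult mult_ac)
  qed measurable
  then show ?thesis
    unfolding cov_op_def cov_form_def by (subst integral_inner_left[symmetric]) (auto simp: inner_scaleR_left)
qed

lemma cov_form_commute: "cov_form M X Y x y = cov_form M Y X y x"
  by (simp add: cov_form_def mult.commute)

lemma cov_form_cong_AE:
  assumes "sq_rv M X" "sq_rv M Y" "sq_rv M X'" "sq_rv M Y'"
    and "AE \<omega> in M. X \<omega> = X' \<omega>" "AE \<omega> in M. Y \<omega> = Y' \<omega>"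
  shows "cov_form M X Y x y = cov_form M X' Y' x y"
  unfolding cov_form_def
proof (rule integral_cong_AE)
  show "AE \<omega> in M. (X \<omega> \<bullet> x) * (Y \<omega> \<bullet> y) = (X' \<omega> \<bullet> x) * (Y' \<omega> \<bullet> y)"
    using assms(5,6) by eventually_elim simp
qed (use assms in \<open>auto intro!: borel_measurable_times sq_rv_inner\<close>)

lemma cov_form_add_left:
  assumes "sq_rv M X" "sq_rv M X'" "sq_rv M Y"
  shows "cov_form M (\<lambda>\<omega>. X \<omega> + X' \<omega>) Y x y = cov_form M X Y x y + cov_form M X' Y x y"
  unfolding cov_form_def using integrable_cov_form[OF assms(1,3)] integrable_cov_form[OF assms(2,3)]
  by (simp add: inner_add_left distrib_right)

lemma cov_form_diff_left:
  assumes "sq_rv M X" "sq_rv M X'" "sq_rv M Y"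
  shows "cov_form M (\<lambda>\<omega>. X \<omega> - X' \<omega>) Y x y = cov_form M X Y x y - cov_form M X' Y x y"
  unfolding cov_form_def using integrable_cov_form[OF assms(1,3)] integrable_cov_form[OF assms(2,3)]
  by (simp add: inner_diff_left left_diff_distrib)

lemma cov_form_sum_left:
  assumes "finite I" "\<And>i. i \<in> I \<Longrightarrow> sq_rv M (X i)" "sq_rv M Y"
  shows "cov_form M (\<lambda>\<omega>. \<Sum>i\<in>I. X i \<omega>) Y x y = (\<Sum>i\<in>I. cov_form M (X i) Y x y)"
  unfolding cov_form_def inner_sum_left sum_distrib_right
  by (rule Bochner_Integration.integral_sum) (rule integrable_cov_form[OF assms(2,3)])

lemma cov_form_adjoint_left:
  assumes "\<And>x y. A x \<bullet> y = x \<bullet> A' y"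
  shows "cov_form M (\<lambda>\<omega>. A (X \<omega>)) Y x y = cov_form M X Y (A' x) y"
  by (simp add: cov_form_def assms)

lemma cov_form_bound:
  assumes X: "sq_rv M X" and Y: "sq_rv M Y"
  shows "(cov_form M X Y x y)\<^sup>2 \<le> (norm x)\<^sup>2 * msq M X * ((norm y)\<^sup>2 * msq M Y)"
proof -
  have one: "(\<integral>\<omega>. (Z \<omega> \<bullet> z)\<^sup>2 \<partial>M) \<le> (norm z)\<^sup>2 * msq M Z" if "sq_rv M Z" for Z z
  proof -
    have "(\<integral>\<omega>. (Z \<omega> \<bullet> z)\<^sup>2 \<partial>M) \<le> (\<integral>\<omega>. (norm z)\<^sup>2 * (norm (Z \<omega>))\<^sup>2 \<partial>M)"
      using sq_rv_inner[OF that] sq_rvD[OF that] by (intro integral_mono inner_square_le) auto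
    then show ?thesis by (simp add: msq_def)
  qed
  have "(cov_form M X Y x y)\<^sup>2 \<le> (\<integral>\<omega>. (X \<omega> \<bullet> x)\<^sup>2 \<partial>M) * (\<integral>\<omega>. (Y \<omega> \<bullet> y)\<^sup>2 \<partial>M)"
  proof (rule quadratic_nonneg_discriminant)
    fix t :: real
    have "0 \<le> (\<integral>\<omega>. (X \<omega> \<bullet> x + t * (Y \<omega> \<bullet> y))\<^sup>2 \<partial>M)" by simp
    also have "\<dots> = (\<integral>\<omega>. (X \<omega> \<bullet> x)\<^sup>2 + 2 * t * ((X \<omega> \<bullet> x) * (Y \<omega> \<bullet> y)) + t\<^sup>2 * (Y \<omega> \<bullet> y)\<^sup>2 \<partial>M)"
      by (intro Bochner_Integration.integral_cong) (auto simp: power2_eq_square algebra_simps)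
    also have "\<dots> = (\<integral>\<omega>. (X \<omega> \<bullet> x)\<^sup>2 \<partial>M) + 2 * t * cov_form M X Y x y + t\<^sup>2 * (\<integral>\<omega>. (Y \<omega> \<bullet> y)\<^sup>2 \<partial>M)"
      using sq_rv_inner(1)[OF X, of x] sq_rv_inner(1)[OF Y, of y] integrable_cov_form[OF X Y, of x y]
      by (simp add: cov_form_def)
    finally show "0 \<le> \<dots>" .
  qed
  also have "\<dots> \<le> (norm x)\<^sup>2 * msq M X * ((norm y)\<^sup>2 * msq M Y)"
    by (intro mult_mono one X Y) auto
  finally show ?thesis .
qed

lemma msq_add_le:
  assumes "sq_rv M X" "sq_rv M Y"
  shows "msq M (\<lambda>\<omega>. X \<omega> + Y \<omega>) \<le> 2 * msq M X + 2 * msq M Y"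
proof -
  have "msq M (\<lambda>\<omega>. X \<omega> + Y \<omega>) \<le> (\<integral>\<omega>. 2 * (norm (X \<omega>))\<^sup>2 + 2 * (norm (Y \<omega>))\<^sup>2 \<partial>M)"
    unfolding msq_def using sq_rvD[OF assms(1)] sq_rvD[OF assms(2)] sq_rvD[OF sq_rv_add[OF assms]]
    by (intro integral_mono norm_add_sq_le) auto
  then show ?thesis
    using sq_rvD[OF assms(1)] sq_rvD[OF assms(2)] by (simp add: msq_def)
qed

lemma cov_form_tendsto:
  assumes X: "sq_rv M X" and Xn: "\<And>n. sq_rv M (Xn n)" and limX: "(\<lambda>n. msq M (\<lambda>\<omega>. Xn n \<omega> - X \<omega>)) \<longlonglongrightarrow> 0"
    and Y: "sq_rv M Y" and Yn: "\<And>n. sq_rv M (Yn n)" and limY: "(\<lambda>n. msq M (\<lambda>\<omega>. Yn n \<omega> - Y \<omega>)) \<longlonglongrightarrow> 0"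
  shows "(\<lambda>n. cov_form M (Xn n) (Yn n) x y) \<longlonglongrightarrow> cov_form M X Y x y"
proof -
  let ?dX = "\<lambda>n \<omega>. Xn n \<omega> - X \<omega>" and ?dY = "\<lambda>n \<omega>. Yn n \<omega> - Y \<omega>"
  have dX: "sq_rv M (?dX n)" and dY: "sq_rv M (?dY n)" for n using X Xn Y Yn by (auto intro: sq_rv_diff)
  have eq: "cov_form M (Xn n) (Yn n) x y = cov_form M (?dX n) (?dY n) x y + cov_form M (?dX n) Y x y + cov_form M X (?dY n) x y + cov_form M X Y x y" for n
    using cov_form_diff_left[OF Xn X dY, of n n x y] cov_form_diff_left[OF Xn X Y, of n x y]
      cov_form_diff_left[OF Yn Y Xn, of n n y x] cov_form_diff_left[OF Yn Y X, of n y x]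
    by (simp add: cov_form_commute[of M "Yn n"] cov_form_commute[of M Y] cov_form_commute[of M "?dY n"])
  have zero: "c \<longlonglongrightarrow> 0" if "\<And>n. (c n)\<^sup>2 \<le> B n" "B \<longlonglongrightarrow> 0" for c B :: "nat \<Rightarrow> real"
  proof -
    have "(\<lambda>n. (c n)\<^sup>2) \<longlonglongrightarrow> 0"
      by (rule tendsto_sandwich[OF _ _ tendsto_const that(2)]) (auto simp: that(1))
    from tendsto_real_sqrt[OF this] show ?thesis by (simp add: tendsto_rabs_zero_iff)
  qed
  have "(\<lambda>n. cov_form M (?dX n) (?dY n) x y) \<longlonglongrightarrow> 0"
  proof (rule zero[OF cov_form_bound[OF dX dY]])
    have "(\<lambda>n. (norm x)\<^sup>2 * msq M (?dX n) * ((norm y)\<^sup>2 * msq M (?dY n))) \<longlonglongrightarrow> (norm x)\<^sup>2 * 0 * ((norm y)\<^sup>2 * 0)"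
      by (intro tendsto_intros limX limY)
    then show "(\<lambda>n. (norm x)\<^sup>2 * msq M (?dX n) * ((norm y)\<^sup>2 * msq M (?dY n))) \<longlonglongrightarrow> 0" by simp
  qed
  moreover have "(\<lambda>n. cov_form M (?dX n) Y x y) \<longlonglongrightarrow> 0"
  proof (rule zero[OF cov_form_bound[OF dX Y]])
    have "(\<lambda>n. (norm x)\<^sup>2 * msq M (?dX n) * ((norm y)\<^sup>2 * msq M Y)) \<longlonglongrightarrow> (norm x)\<^sup>2 * 0 * ((norm y)\<^sup>2 * msq M Y)"
      by (intro tendsto_intros limX)
    then show "(\<lambda>n. (norm x)\<^sup>2 * msq M (?dX n) * ((norm y)\<^sup>2 * msq M Y)) \<longlonglongrightarrow> 0" by simp
  qed
  moreover have "(\<lambda>n. cov_form M X (?dY n) x y) \<longlonglongrightarrow> 0"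
  proof (rule zero[OF cov_form_bound[OF X dY]])
    have "(\<lambda>n. (norm x)\<^sup>2 * msq M X * ((norm y)\<^sup>2 * msq M (?dY n))) \<longlonglongrightarrow> (norm x)\<^sup>2 * msq M X * ((norm y)\<^sup>2 * 0)"
      by (intro tendsto_intros limY)
    then show "(\<lambda>n. (norm x)\<^sup>2 * msq M X * ((norm y)\<^sup>2 * msq M (?dY n))) \<longlonglongrightarrow> 0" by simp
  qed
  ultimately have "(\<lambda>n. cov_form M (Xn n) (Yn n) x y) \<longlonglongrightarrow> 0 + 0 + 0 + cov_form M X Y x y"
    unfolding eq by (intro tendsto_intros)
  then show ?thesis by simp
qed

text \<open>
  The expectation of an inner product is a trace, hence determined by the cross-covariance. In this way
  the operator identities of weak stationarity become identities between mean squares.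
\<close>

lemma inner_expectation_trace:
  assumes e: "parseval e" and X: "sq_rv M X" and Y: "sq_rv M Y"
  shows "(\<lambda>k. cov_form M X Y (e k) (e k)) sums (\<integral>\<omega>. X \<omega> \<bullet> Y \<omega> \<partial>M)"
proof -
  note [measurable] = sq_rvD(1)[OF X] sq_rvD(1)[OF Y]
  have "(\<lambda>n. \<integral>\<omega>. (\<Sum>k<n. (X \<omega> \<bullet> e k) * (Y \<omega> \<bullet> e k)) \<partial>M) \<longlonglongrightarrow> (\<integral>\<omega>. X \<omega> \<bullet> Y \<omega> \<partial>M)"
  proof (rule integral_dominated_convergence)
    show "integrable M (\<lambda>\<omega>. (norm (X \<omega>))\<^sup>2 + (norm (Y \<omega>))\<^sup>2)" using sq_rvD[OF X] sq_rvD[OF Y] by auto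
    show "AE \<omega> in M. (\<lambda>n. \<Sum>k<n. (X \<omega> \<bullet> e k) * (Y \<omega> \<bullet> e k)) \<longlonglongrightarrow> X \<omega> \<bullet> Y \<omega>"
      using parseval_inner[OF e] by (auto simp: sums_def)
    have bessel: "(\<Sum>k<n. (z \<bullet> e k)\<^sup>2) \<le> (norm z)\<^sup>2" for n z
      using e sum_le_suminf[of "\<lambda>k. (z \<bullet> e k)\<^sup>2" "{..<n}"] unfolding parseval_def by (auto simp: sums_iff)
    have "\<bar>\<Sum>k<n. (x \<bullet> e k) * (y \<bullet> e k)\<bar> \<le> (norm x)\<^sup>2 + (norm y)\<^sup>2" for n x y
    proof -
      have "\<bar>\<Sum>k<n. (x \<bullet> e k) * (y \<bullet> e k)\<bar> \<le> (\<Sum>k<n. (x \<bullet> e k)\<^sup>2 + (y \<bullet> e k)\<^sup>2)"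
        by (rule order_trans[OF sum_abs sum_mono]) (rule abs_mult_le_sum_squares)
      then show ?thesis using bessel[where z = x and n = n] bessel[where z = y and n = n]
        by (simp add: sum.distrib)
    qed
    then show "AE \<omega> in M. norm (\<Sum>k<n. (X \<omega> \<bullet> e k) * (Y \<omega> \<bullet> e k)) \<le> (norm (X \<omega>))\<^sup>2 + (norm (Y \<omega>))\<^sup>2" for n
      by simp
  qed measurable
  moreover have "(\<integral>\<omega>. (\<Sum>k<n. (X \<omega> \<bullet> e k) * (Y \<omega> \<bullet> e k)) \<partial>M) = (\<Sum>k<n. cov_form M X Y (e k) (e k))" for n
    unfolding cov_form_def by (rule Bochner_Integration.integral_sum) (rule integrable_cov_form[OF X Y])
  ultimately show ?thesis by (simp add: sums_def)
qed

lemma inner_expectation_cong: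
  assumes "sq_rv M X" "sq_rv M Y" "sq_rv N X'" "sq_rv N Y'"
    and "\<And>x. cov_form M X Y x x = cov_form N X' Y' x x"
  shows "(\<integral>\<omega>. X \<omega> \<bullet> Y \<omega> \<partial>M) = (\<integral>\<omega>. X' \<omega> \<bullet> Y' \<omega> \<partial>N)"
proof -
  obtain e :: "nat \<Rightarrow> L2" where "parseval e" using ex_parseval by blast
  from inner_expectation_trace[OF this assms(1,2)] inner_expectation_trace[OF this assms(3,4)]
  show ?thesis using assms(5) by (simp add: sums_unique2)
qed

lemma msq_eq_inner: "msq M X = (\<integral>\<omega>. X \<omega> \<bullet> X \<omega> \<partial>M)"
  by (simp add: msq_def power2_norm_eq_inner)

lemma inner_expectation_zero:
  assumes "sq_rv M X" "sq_rv M Y" "\<And>x. cov_form M X Y x x = 0"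
  shows "(\<integral>\<omega>. X \<omega> \<bullet> Y \<omega> \<partial>M) = 0"
  using inner_expectation_cong[OF assms(1,2) sq_rv_zero[of M] sq_rv_zero[of M]] assms(3) by (simp add: cov_form_def)

lemma msq_sum_orthogonal:
  assumes fin: "finite I" and X: "\<And>i. i \<in> I \<Longrightarrow> sq_rv M (X i)"
    and orth: "\<And>i j. i \<in> I \<Longrightarrow> j \<in> I \<Longrightarrow> i \<noteq> j \<Longrightarrow> (\<integral>\<omega>. X i \<omega> \<bullet> X j \<omega> \<partial>M) = 0"
  shows "msq M (\<lambda>\<omega>. \<Sum>i\<in>I. X i \<omega>) = (\<Sum>i\<in>I. msq M (X i))"
proof -
  have "msq M (\<lambda>\<omega>. \<Sum>i\<in>I. X i \<omega>) = (\<integral>\<omega>. (\<Sum>i\<in>I. \<Sum>j\<in>I. X j \<omega> \<bullet> X i \<omega>) \<partial>M)"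
    by (simp add: msq_eq_inner inner_sum_left inner_sum_right)
  also have "\<dots> = (\<Sum>i\<in>I. \<Sum>j\<in>I. \<integral>\<omega>. X j \<omega> \<bullet> X i \<omega> \<partial>M)"
    using X by (subst Bochner_Integration.integral_sum) (auto intro!: Bochner_Integration.integrable_sum integrable_inner sum.cong Bochner_Integration.integral_sum)
  also have "\<dots> = (\<Sum>i\<in>I. \<Sum>j\<in>I. if j = i then msq M (X i) else 0)"
    using orth by (intro sum.cong) (auto simp: msq_eq_inner)
  also have "\<dots> = (\<Sum>i\<in>I. msq M (X i))" using fin by simp
  finally show ?thesis .
qed

section \<open>Negligibility in probability\<close>

text \<open>
  \<open>Y\<^sub>n = o\<^sub>P(\<alpha>\<^sub>n)\<close>, from above and in outer probability: the quantities of interest are operator norms of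
  random operators, and only upper bounds for them matter.
\<close>

definition o_prob :: "'a measure \<Rightarrow> (nat \<Rightarrow> real) \<Rightarrow> (nat \<Rightarrow> 'a \<Rightarrow> real) \<Rightarrow> bool"
  where "o_prob M \<alpha> Y \<longleftrightarrow> (\<forall>\<eta>>0. (\<lambda>n. outer_measure_of M {\<omega> \<in> space M. \<eta> * \<alpha> n < Y n \<omega>}) \<longlonglongrightarrow> 0)"

lemma outer_measure_of_Un_le:
  assumes "A \<subseteq> space M" "B \<subseteq> space M"
  shows "outer_measure_of M (A \<union> B) \<le> outer_measure_of M A + outer_measure_of M B"
proof -
  obtain E F where E: "E \<in> sets M" "A \<subseteq> E" "outer_measure_of M A = emeasure M E"
    and F: "F \<in> sets M" "B \<subseteq> F" "outer_measure_of M B = emeasure M F"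
    using outer_measure_of_attain[OF assms(1)] outer_measure_of_attain[OF assms(2)] by metis
  have "outer_measure_of M (A \<union> B) \<le> outer_measure_of M (E \<union> F)"
    using E F by (intro outer_measure_of_mono) auto
  also have "\<dots> = emeasure M (E \<union> F)" using E F by simp
  also have "\<dots> \<le> emeasure M E + emeasure M F" using E F by (intro emeasure_subadditive) auto
  finally show ?thesis using E F by simp
qed

lemma ennreal_tendsto_zero_le:
  fixes f g :: "nat \<Rightarrow> ennreal"
  assumes "g \<longlonglongrightarrow> 0" "\<forall>\<^sub>F n in sequentially. f n \<le> g n"
  shows "f \<longlonglongrightarrow> 0"
  by (rule tendsto_sandwich[OF _ assms(2) tendsto_const assms(1)]) simp

lemma o_prob_add:
  assumes "o_prob M \<alpha> X" "o_prob M \<alpha> Y"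
  shows "o_prob M \<alpha> (\<lambda>n \<omega>. X n \<omega> + Y n \<omega>)"
  unfolding o_prob_def
proof (intro allI impI)
  fix \<eta> :: real assume "\<eta> > 0"
  then have "\<eta> / 2 > 0" by simp
  let ?O = "\<lambda>Z n. outer_measure_of M {\<omega> \<in> space M. \<eta> / 2 * \<alpha> n < Z n \<omega>}"
  have "(\<lambda>n. ?O X n + ?O Y n) \<longlonglongrightarrow> 0 + 0"
    using assms \<open>\<eta> / 2 > 0\<close> unfolding o_prob_def by (intro tendsto_intros) blast+
  then have lim: "(\<lambda>n. ?O X n + ?O Y n) \<longlonglongrightarrow> 0" by (simp only: add_0_left)
  show "(\<lambda>n. outer_measure_of M {\<omega> \<in> space M. \<eta> * \<alpha> n < X n \<omega> + Y n \<omega>}) \<longlonglongrightarrow> 0"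
  proof (rule ennreal_tendsto_zero_le[OF lim], rule always_eventually, rule allI)
    fix n
    have "{\<omega> \<in> space M. \<eta> * \<alpha> n < X n \<omega> + Y n \<omega>}
      \<subseteq> {\<omega> \<in> space M. \<eta> / 2 * \<alpha> n < X n \<omega>} \<union> {\<omega> \<in> space M. \<eta> / 2 * \<alpha> n < Y n \<omega>}"
      by (auto simp: not_less)
    then show "outer_measure_of M {\<omega> \<in> space M. \<eta> * \<alpha> n < X n \<omega> + Y n \<omega>} \<le> ?O X n + ?O Y n"
      by (intro order_trans[OF outer_measure_of_mono outer_measure_of_Un_le]) auto
  qed
qed

lemma o_prob_cmult:
  assumes Y: "o_prob M \<alpha> Y" and c: "c \<ge> 0" and \<alpha>: "\<And>n. \<alpha> n > 0"
  shows "o_prob M \<alpha> (\<lambda>n \<omega>. c * Y n \<omega>)"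
proof (cases "c = 0")
  case True
  have "\<not> \<eta> * \<alpha> n < 0" if "\<eta> > 0" for n and \<eta> :: real
    using mult_pos_pos[OF that \<alpha>[of n]] by simp
  then show ?thesis using True by (simp add: o_prob_def)
next
  case False
  then have c: "c > 0" using c by simp
  show ?thesis
    unfolding o_prob_def
  proof (intro allI impI)
    fix \<eta> :: real assume "\<eta> > 0"
    then have pos: "\<eta> / c > 0" using c by simp
    have eq: "(\<eta> * \<alpha> n < c * Y n \<omega>) = (\<eta> / c * \<alpha> n < Y n \<omega>)" for n \<omega>
      using c by (simp add: field_simps)
    show "(\<lambda>n. outer_measure_of M {\<omega> \<in> space M. \<eta> * \<alpha> n < c * Y n \<omega>}) \<longlonglongrightarrow> 0"
      unfolding eq using Y pos unfolding o_prob_def by blast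
  qed
qed

lemma o_prob_mono_AE:
  assumes Y: "o_prob M \<alpha> Y" and le: "\<And>n. n \<ge> n0 \<Longrightarrow> AE \<omega> in M. X n \<omega> \<le> Y n \<omega>"
  shows "o_prob M \<alpha> X"
  unfolding o_prob_def
proof (intro allI impI)
  fix \<eta> :: real assume "\<eta> > 0"
  then have lim: "(\<lambda>n. outer_measure_of M {\<omega> \<in> space M. \<eta> * \<alpha> n < Y n \<omega>}) \<longlonglongrightarrow> 0"
    using Y by (simp add: o_prob_def)
  show "(\<lambda>n. outer_measure_of M {\<omega> \<in> space M. \<eta> * \<alpha> n < X n \<omega>}) \<longlonglongrightarrow> 0"
  proof (rule ennreal_tendsto_zero_le[OF lim], rule eventually_sequentiallyI)
    fix n assume "n0 \<le> n"
    from le[OF this] obtain N where N: "N \<in> null_sets M" "{\<omega> \<in> space M. \<not> X n \<omega> \<le> Y n \<omega>} \<subseteq> N"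
      by (auto elim!: AE_E simp: null_sets_def)
    have N': "N \<subseteq> space M" using N(1) by (auto dest: null_setsD2 sets.sets_into_space)
    have "{\<omega> \<in> space M. \<eta> * \<alpha> n < X n \<omega>} \<subseteq> {\<omega> \<in> space M. \<eta> * \<alpha> n < Y n \<omega>} \<union> N"
      using N(2) by fastforce
    then have "outer_measure_of M {\<omega> \<in> space M. \<eta> * \<alpha> n < X n \<omega>} \<le>
      outer_measure_of M {\<omega> \<in> space M. \<eta> * \<alpha> n < Y n \<omega>} + outer_measure_of M N"
      using N' by (intro order_trans[OF outer_measure_of_mono outer_measure_of_Un_le]) auto
    also have "outer_measure_of M N = 0" using N(1) by (auto simp: null_sets_def)
    finally show "outer_measure_of M {\<omega> \<in> space M. \<eta> * \<alpha> n < X n \<omega>} \<le> outer_measure_of M {\<omega> \<in> space M. \<eta> * \<alpha> n < Y n \<omega>}"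
      by simp
  qed
qed

text \<open>Markov's inequality for the power \<open>p\<close>.\<close>

lemma o_prob_moment:
  assumes D: "\<And>n. D n \<in> borel_measurable M" "\<And>n. n \<ge> n0 \<Longrightarrow> (\<integral>\<^sup>+\<omega>. D n \<omega> \<partial>M) \<le> ennreal (C n)"
    and le: "\<And>n \<omega>. n \<ge> n0 \<Longrightarrow> \<omega> \<in> space M \<Longrightarrow> ennreal (Y n \<omega> ^ p) \<le> D n \<omega>"
    and p: "p > 0" and \<alpha>: "\<And>n. \<alpha> n > 0" and rate: "(\<lambda>n. C n / \<alpha> n ^ p) \<longlonglongrightarrow> 0"
  shows "o_prob M \<alpha> Y"
  unfolding o_prob_def
proof (intro allI impI)
  fix \<eta> :: real assume \<eta>: "\<eta> > 0"
  have "(\<lambda>n. C n / \<alpha> n ^ p / \<eta> ^ p) \<longlonglongrightarrow> 0 / \<eta> ^ p" using \<eta> by (intro tendsto_intros rate) auto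
  then have "(\<lambda>n. ennreal (C n / \<alpha> n ^ p / \<eta> ^ p)) \<longlonglongrightarrow> ennreal 0" by (intro tendsto_ennrealI) simp
  then have lim: "(\<lambda>n. ennreal (C n / \<alpha> n ^ p / \<eta> ^ p)) \<longlonglongrightarrow> 0" by simp
  show "(\<lambda>n. outer_measure_of M {\<omega> \<in> space M. \<eta> * \<alpha> n < Y n \<omega>}) \<longlonglongrightarrow> 0"
  proof (rule ennreal_tendsto_zero_le[OF lim], rule eventually_sequentiallyI)
    fix n assume n: "n0 \<le> n"
    define h where "h = (\<eta> * \<alpha> n) ^ p"
    have h: "h > 0" using \<eta> \<alpha>[of n] by (simp add: h_def)
    note [measurable] = D(1)[of n]
    have "{\<omega> \<in> space M. \<eta> * \<alpha> n < Y n \<omega>} \<subseteq> {\<omega> \<in> space M. 1 \<le> ennreal (1 / h) * D n \<omega>}"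
    proof safe
      fix \<omega> assume \<omega>: "\<omega> \<in> space M" "\<eta> * \<alpha> n < Y n \<omega>"
      then have "h \<le> Y n \<omega> ^ p" unfolding h_def using \<eta> \<alpha>[of n] by (intro power_mono) auto
      then have "ennreal h \<le> D n \<omega>" using le[OF n \<omega>(1)] by (meson ennreal_leI order_trans)
      then have "ennreal (1 / h) * ennreal h \<le> ennreal (1 / h) * D n \<omega>" by (rule mult_left_mono) simp
      then show "1 \<le> ennreal (1 / h) * D n \<omega>" using h by (simp add: ennreal_mult[symmetric])
    qed
    then have "outer_measure_of M {\<omega> \<in> space M. \<eta> * \<alpha> n < Y n \<omega>} \<le> outer_measure_of M {\<omega> \<in> space M. 1 \<le> ennreal (1 / h) * D n \<omega>}"
      by (rule outer_measure_of_mono)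
    also have "\<dots> = emeasure M {\<omega> \<in> space M. 1 \<le> ennreal (1 / h) * D n \<omega>}"
      by (rule outer_measure_of_eq) measurable
    also have "\<dots> \<le> ennreal (1 / h) * (\<integral>\<^sup>+\<omega>. D n \<omega> \<partial>M)"
      using nn_integral_Markov_inequality[where u = "D n" and M = M and A = "space M" and c = "ennreal (1 / h)"] by (simp cong: nn_integral_cong)
    also have "\<dots> \<le> ennreal (1 / h) * ennreal (C n)" by (intro mult_left_mono D n) simp
    also have "\<dots> = ennreal (C n / \<alpha> n ^ p / \<eta> ^ p)"
      using h by (subst ennreal_mult'[symmetric]) (simp_all add: h_def power_mult_distrib mult_ac)
    finally show "outer_measure_of M {\<omega> \<in> space M. \<eta> * \<alpha> n < Y n \<omega>} \<le> ennreal (C n / \<alpha> n ^ p / \<eta> ^ p)" .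
  qed
qed

section \<open>The stationary solution of the autoregression\<close>

locale ar1_process = prob_space M for M :: "'a measure" +
  fixes T \<delta> :: real and K :: "real \<Rightarrow> real \<Rightarrow> real" and \<epsilon> f :: "real \<Rightarrow> 'a \<Rightarrow> L2"
  assumes hs: "hs_kernel T K" and \<delta>: "\<delta> > 0"
    and noise: "strong_white_noise M T \<delta> \<epsilon>"
    and model: "ar1_defines M T \<delta> (int_op T K) \<epsilon> f"
begin

definition R :: "L2 \<Rightarrow> L2" where "R = int_op T K"
definition R' :: "L2 \<Rightarrow> L2" where "R' = int_op T (\<lambda>s t. K t s)"
definition F :: "int \<Rightarrow> 'a \<Rightarrow> L2" where "F k = f (of_int k * \<delta>)"
definition E :: "int \<Rightarrow> 'a \<Rightarrow> L2" where "E k = \<epsilon> (of_int k * \<delta>)"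

lemma grid: "of_int k * \<delta> \<in> time_grid \<delta>"
  by (auto simp: time_grid_def)

lemma linear_R: "bounded_linear R" and R_range: "R x \<in> L2_on T"
  using int_op_kernel_rows[OF hs] kernel_rows_bounded_linear kernel_rows_range by (auto simp: R_def)

lemma linear_R': "bounded_linear R'" and R'_range: "R' x \<in> L2_on T"
  using int_op_kernel_rows[OF hs_kernel_transpose[OF hs]] kernel_rows_bounded_linear kernel_rows_range
  by (auto simp: R'_def)

lemma R_adjoint: "R x \<bullet> y = x \<bullet> R' y"
  unfolding R_def R'_def by (rule int_op_adjoint[OF hs])

lemma bounded_linear_funpow: "bounded_linear A \<Longrightarrow> bounded_linear (A ^^ m)" for A :: "L2 \<Rightarrow> L2"
proof (induction m)
  case (Suc m)
  then show ?case using bounded_linear_compose[of A "A ^^ m"] by (simp add: o_def)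
qed (simp add: id_def bounded_linear_ident)

lemma linear_R_pow: "bounded_linear (R ^^ m)" and linear_R'_pow: "bounded_linear (R' ^^ m)"
  using bounded_linear_funpow linear_R linear_R' by auto

lemma R_pow_adjoint: "(R ^^ m) x \<bullet> y = x \<bullet> (R' ^^ m) y"
  by (induction m arbitrary: x y) (simp_all add: R_adjoint funpow_swap1)

lemma R_pow_L2_on: "x \<in> L2_on T \<Longrightarrow> (R ^^ m) x \<in> L2_on T"
  by (cases m) (auto intro: R_range)

lemma F_rv: "sq_rv M (F k)" and F_mem: "\<omega> \<in> space M \<Longrightarrow> F k \<omega> \<in> L2_on T"
  using model grid[of k]
  unfolding ar1_defines_def ar1_solution_def weakly_stationary0_def random_element_def sq_rv_def F_def by auto

lemma E_rv: "sq_rv M (E k)" and E_mem: "\<omega> \<in> space M \<Longrightarrow> E k \<omega> \<in> L2_on T" and E_mean: "(\<integral>\<omega>. E k \<omega> \<partial>M) = 0"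
  using noise grid[of k] unfolding strong_white_noise_def random_element_def sq_rv_def E_def by auto

lemma E_distr: "distr M borel (E a) = distr M borel (E b)"
  using noise grid[of a] grid[of b] unfolding strong_white_noise_def E_def by blast

lemma F_recursion: "AE \<omega> in M. F (k + 1) \<omega> = R (F k \<omega>) + E k \<omega>"
proof -
  have "AE \<omega> in M. f (of_int k * \<delta> + \<delta>) \<omega> = int_op T K (f (of_int k * \<delta>) \<omega>) + \<epsilon> (of_int k * \<delta>) \<omega>"
    using model grid[of k] unfolding ar1_defines_def ar1_solution_def by blast
  moreover have "of_int (k + 1) * \<delta> = of_int k * \<delta> + \<delta>" by (simp add: algebra_simps)
  ultimately show ?thesis by (simp only: F_def E_def R_def)
qed

lemma cov_form_F_restr: "cov_form M (F k) Y x y = cov_form M (F k) Y (restr T x) y"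
  unfolding cov_form_def by (intro Bochner_Integration.integral_cong refl) (metis F_mem inner_L2_on)

lemma F_stationary: "cov_form M (F (s + h)) (F (t + h)) x y = cov_form M (F s) (F t) x y"
proof -
  have eq: "F (k + h) = f (of_int k * \<delta> + of_int h * \<delta>)" for k by (simp add: F_def algebra_simps)
  have "cov_op M (F (s + h)) (F (t + h)) (restr T x) = cov_op M (F s) (F t) (restr T x)"
    using model grid[of s] grid[of t] grid[of h] restr_in_L2_on[of T x] unfolding eq unfolding F_def
    unfolding ar1_defines_def ar1_solution_def weakly_stationary0_def by blast
  then show ?thesis
    using cov_op_inner[OF F_rv F_rv, of "s + h" "t + h" "restr T x" y] cov_op_inner[OF F_rv F_rv, of s t "restr T x" y]
      cov_form_F_restr[of "s + h" "F (t + h)" x y] cov_form_F_restr[of s "F t" x y] by metis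
qed

lemma F_E_uncorrelated: "cov_form M (F k) (E k) x y = 0"
proof -
  have "cov_op M (F k) (E k) (restr T x) = 0"
    using model grid[of k] restr_in_L2_on[of T x]
    unfolding F_def E_def ar1_defines_def ar1_solution_def by blast
  then show ?thesis
    using cov_op_inner[OF F_rv E_rv, of k k "restr T x" y] cov_form_F_restr[of k "E k" x y]
    by (metis inner_zero_left)
qed

text \<open>The information generated by the noise strictly before time \<open>j\<close>.\<close>

definition past :: "int \<Rightarrow> 'a measure"
  where "past j = vimage_algebra (space M) (\<lambda>\<omega>. \<lambda>i\<in>{..<j}. E i \<omega>) (PiM {..<j} (\<lambda>_. borel))"

lemma space_past [simp]: "space (past j) = space M"
  by (simp add: past_def)

lemma measurable_E [measurable]: "E k \<in> borel_measurable M"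
  using sq_rvD(1)[OF E_rv] .

lemma past_map_measurable: "(\<lambda>\<omega>. \<lambda>i\<in>J. E i \<omega>) \<in> measurable M (PiM J (\<lambda>_. borel))"
  by measurable

lemma E_past: "i < j \<Longrightarrow> E i \<in> borel_measurable (past j)"
proof -
  assume i: "i < j"
  have "(\<lambda>\<omega>. \<lambda>i\<in>{..<j}. E i \<omega>) \<in> measurable (past j) (PiM {..<j} (\<lambda>_. borel))"
    unfolding past_def by (rule measurable_vimage_algebra1) (auto simp: space_PiM)
  from measurable_compose[OF this measurable_component_singleton[of i]] i
  have "(\<lambda>\<omega>. (\<lambda>i\<in>{..<j}. E i \<omega>) i) \<in> borel_measurable (past j)" by simp
  then show ?thesis using i by simp
qed

lemma sets_past: "sets (past j) = {(\<lambda>\<omega>. \<lambda>i\<in>{..<j}. E i \<omega>) -` A \<inter> space M | A. A \<in> sets (PiM {..<j} (\<lambda>_. borel))}"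
  unfolding past_def by (rule sets_vimage_algebra2) (auto simp: space_PiM)

lemma measurable_past:
  assumes "u \<in> measurable (past j) N"
  shows "u \<in> measurable M N"
proof (rule measurableI)
  show "u \<omega> \<in> space N" if "\<omega> \<in> space M" for \<omega> using measurable_space[OF assms] that by simp
  fix A assume "A \<in> sets N"
  then have "u -` A \<inter> space M \<in> sets (past j)" using measurable_sets[OF assms] by simp
  then show "u -` A \<inter> space M \<in> sets M"
    unfolding sets_past using measurable_sets[OF past_map_measurable] by auto
qed

lemma E_indep: "indep_vars (\<lambda>_. borel) E UNIV"
proof -
  have "indep_vars (\<lambda>_. borel) \<epsilon> (time_grid \<delta>)" using noise by (simp add: strong_white_noise_def)
  then have "indep_vars (\<lambda>j::int. PiM {of_int j * \<delta>} (\<lambda>_. borel)) (\<lambda>j \<omega>. restrict (\<lambda>i. \<epsilon> i \<omega>) {of_int j * \<delta>}) UNIV"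
    using \<delta> by (intro indep_vars_restrict) (auto simp: grid disjoint_family_on_def)
  then have "indep_vars (\<lambda>_. borel) (\<lambda>j \<omega>. restrict (\<lambda>i. \<epsilon> i \<omega>) {of_int j * \<delta>} (of_int j * \<delta>)) (UNIV :: int set)"
    by (rule indep_vars_compose2[where Y = "\<lambda>j p. p (of_int j * \<delta>)"]) (auto intro: measurable_component_singleton)
  then show ?thesis by (simp add: E_def[abs_def])
qed

lemma indep_past:
  assumes u: "u \<in> borel_measurable (past j)" and \<phi>: "\<phi> \<in> borel_measurable borel"
  shows "indep_var borel (u :: 'a \<Rightarrow> real) borel (\<lambda>\<omega>. \<phi> (E j \<omega>) :: real)"
  unfolding indep_var_eq
proof (intro conjI)
  have "indep_var (PiM {..<j} (\<lambda>_. borel)) (\<lambda>\<omega>. restrict (\<lambda>i. E i \<omega>) {..<j}) (PiM {j} (\<lambda>_. borel)) (\<lambda>\<omega>. restrict (\<lambda>i. E i \<omega>) {j})"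
    by (rule indep_var_restrict[OF E_indep]) auto
  then have ind: "indep_set (sigma_sets (space M) {(\<lambda>\<omega>. restrict (\<lambda>i. E i \<omega>) {..<j}) -` A \<inter> space M |A. A \<in> sets (PiM {..<j} (\<lambda>_. borel))})
      (sigma_sets (space M) {(\<lambda>\<omega>. restrict (\<lambda>i. E i \<omega>) {j}) -` A \<inter> space M |A. A \<in> sets (PiM {j} (\<lambda>_. borel))})"
    (is "indep_set ?A ?B")
    unfolding indep_var_eq by blast
  show "random_variable borel u" by (rule measurable_past[OF u])
  show "random_variable borel (\<lambda>\<omega>. \<phi> (E j \<omega>))" using \<phi> by measurable
  have A: "sigma_sets (space M) {u -` A \<inter> space M |A. A \<in> sets borel} \<subseteq> ?A"
    using measurable_sets[OF u] unfolding sets_past by (intro sigma_sets_subseteq) auto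
  have B: "sigma_sets (space M) {(\<lambda>\<omega>. \<phi> (E j \<omega>)) -` A \<inter> space M |A. A \<in> sets borel} \<subseteq> ?B"
  proof (rule sigma_sets_subseteq, safe)
    fix A :: "real set" assume "A \<in> sets borel"
    have "(\<lambda>p. \<phi> (p j)) \<in> measurable (PiM {j} (\<lambda>_. borel)) borel"
      using measurable_compose[OF measurable_component_singleton[of j "{j}" "\<lambda>_. borel"] \<phi>] by simp
    from measurable_sets[OF this \<open>A \<in> sets borel\<close>]
    have "(\<lambda>p. \<phi> (p j)) -` A \<inter> space (PiM {j} (\<lambda>_. borel)) \<in> sets (PiM {j} (\<lambda>_. borel))" .
    moreover have "(\<lambda>\<omega>. \<phi> (E j \<omega>)) -` A \<inter> space M =
      (\<lambda>\<omega>. restrict (\<lambda>i. E i \<omega>) {j}) -` ((\<lambda>p. \<phi> (p j)) -` A \<inter> space (PiM {j} (\<lambda>_. borel))) \<inter> space M"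
      by (auto simp: space_PiM)
    ultimately show "\<exists>B. (\<lambda>\<omega>. \<phi> (E j \<omega>)) -` A \<inter> space M = (\<lambda>\<omega>. restrict (\<lambda>i. E i \<omega>) {j}) -` B \<inter> space M
        \<and> B \<in> sets (PiM {j} (\<lambda>_. borel))" by blast
  qed
  show "indep_set (sigma_sets (space M) {u -` A \<inter> space M |A. A \<in> sets borel})
      (sigma_sets (space M) {(\<lambda>\<omega>. \<phi> (E j \<omega>)) -` A \<inter> space M |A. A \<in> sets borel})"
    using ind A B unfolding indep_sets2_eq by (meson subset_eq)
qed

lemma expectation_past_mult:
  assumes "u \<in> borel_measurable (past j)" "\<phi> \<in> borel_measurable borel"
    and "integrable M u" "integrable M (\<lambda>\<omega>. \<phi> (E j \<omega>))"
  shows "(\<integral>\<omega>. u \<omega> * \<phi> (E j \<omega>) \<partial>M) = (\<integral>\<omega>. u \<omega> \<partial>M) * (\<integral>\<omega>. \<phi> (E j \<omega>) \<partial>M)"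
    and "integrable M (\<lambda>\<omega>. u \<omega> * (\<phi> (E j \<omega>) :: real))"
  using indep_var_lebesgue_integral[OF indep_past[OF assms(1,2)] assms(3,4)]
    indep_var_integrable[OF indep_past[OF assms(1,2)] assms(3,4)] by auto

lemma E_inner_mean: "(\<integral>\<omega>. E k \<omega> \<bullet> y \<partial>M) = 0"
  using integral_inner_left[OF sq_rv_integrable[OF E_rv[of k]], of y] E_mean[of k] by simp

lemma E_inner_integrable: "integrable M (\<lambda>\<omega>. E k \<omega> \<bullet> y)"
  using sq_rv_integrable[OF E_rv[of k]] by simp

lemma past_E_uncorrelated:
  assumes X: "sq_rv M X" "X \<in> borel_measurable (past j)"
  shows "cov_form M X (E j) x y = 0"
proof -
  have "(\<integral>\<omega>. (X \<omega> \<bullet> x) * (E j \<omega> \<bullet> y) \<partial>M) = (\<integral>\<omega>. X \<omega> \<bullet> x \<partial>M) * (\<integral>\<omega>. E j \<omega> \<bullet> y \<partial>M)"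
    using X sq_rv_integrable[OF X(1)] E_inner_integrable by (intro expectation_past_mult) auto
  then show ?thesis by (simp add: cov_form_def E_inner_mean)
qed

lemma E_uncorrelated: "a \<noteq> b \<Longrightarrow> cov_form M (E a) (E b) x y = 0"
proof (cases "a < b")
  case True
  then show ?thesis by (intro past_E_uncorrelated E_rv E_past)
next
  case False
  assume "a \<noteq> b"
  then have "cov_form M (E b) (E a) y x = 0" using False by (intro past_E_uncorrelated E_rv E_past) simp
  then show ?thesis by (simp add: cov_form_commute[of M "E a"])
qed

lemma E_identical:
  assumes "h \<in> borel_measurable borel"
  shows "(\<integral>\<omega>. (h (E a \<omega>) :: real) \<partial>M) = (\<integral>\<omega>. h (E b \<omega>) \<partial>M)"
  using integral_distr[OF measurable_E[of a] assms] integral_distr[OF measurable_E[of b] assms] E_distr[of a b] by simp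

lemma E_cov_identical: "cov_form M (E a) (E a) x y = cov_form M (E b) (E b) x y"
  unfolding cov_form_def by (rule E_identical[where h = "\<lambda>z. (z \<bullet> x) * (z \<bullet> y)"]) measurable

definition noise_energy :: "nat \<Rightarrow> real" where "noise_energy m = msq M (\<lambda>\<omega>. (R ^^ m) (E 0 \<omega>))"
definition state_energy :: "nat \<Rightarrow> real" where "state_energy m = msq M (\<lambda>\<omega>. (R ^^ m) (F 0 \<omega>))"

lemma R_pow_measurable: "(\<lambda>z. (R ^^ m) z) \<in> borel_measurable borel"
  by (rule borel_measurable_continuous_onI[OF linear_continuous_on[OF linear_R_pow]])

lemma noise_energy: "msq M (\<lambda>\<omega>. (R ^^ m) (E k \<omega>)) = noise_energy m"
  unfolding msq_def noise_energy_def
  by (rule E_identical[where h = "\<lambda>z. (norm ((R ^^ m) z))\<^sup>2"])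
    (rule borel_measurable_power[OF measurable_compose[OF R_pow_measurable borel_measurable_norm]])

lemma R_pow_F_rv: "sq_rv M (\<lambda>\<omega>. (R ^^ m) (F k \<omega>))" and R_pow_E_rv: "sq_rv M (\<lambda>\<omega>. (R ^^ m) (E k \<omega>))"
  by (rule sq_rv_bounded_linear[OF linear_R_pow F_rv], rule sq_rv_bounded_linear[OF linear_R_pow E_rv])

lemma state_energy: "msq M (\<lambda>\<omega>. (R ^^ m) (F k \<omega>)) = state_energy m"
  unfolding state_energy_def msq_eq_inner
proof (rule inner_expectation_cong)
  fix x
  show "cov_form M (\<lambda>\<omega>. (R ^^ m) (F k \<omega>)) (\<lambda>\<omega>. (R ^^ m) (F k \<omega>)) x x
    = cov_form M (\<lambda>\<omega>. (R ^^ m) (F 0 \<omega>)) (\<lambda>\<omega>. (R ^^ m) (F 0 \<omega>)) x x"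
    using F_stationary[of 0 k 0 "(R' ^^ m) x" "(R' ^^ m) x"] unfolding cov_form_def R_pow_adjoint
    by (simp only: add_0_left)
qed (rule R_pow_F_rv)+

text \<open>The trace of \<open>\<Gamma> = \<rho>\<Gamma>\<rho>' + \<Sigma>\<close> after conjugation with \<open>\<rho>\<^sup>m\<close>. Summed over \<open>m\<close> it shows that the energies
  of the terms of the moving average are summable, before anything is known about the size of \<open>\<rho>\<^sup>m\<close>.\<close>

lemma energy_balance: "state_energy m = state_energy (Suc m) + noise_energy m"
proof -
  let ?X = "\<lambda>\<omega>. (R ^^ Suc m) (F 0 \<omega>)" and ?Y = "\<lambda>\<omega>. (R ^^ m) (E 0 \<omega>)"
  have X: "sq_rv M ?X" and Y: "sq_rv M ?Y" by (rule R_pow_F_rv, rule R_pow_E_rv)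
  have orth: "(\<integral>\<omega>. ?X \<omega> \<bullet> ?Y \<omega> \<partial>M) = 0"
  proof (rule inner_expectation_zero[OF X Y])
    show "cov_form M ?X ?Y x x = 0" for x
      using F_E_uncorrelated[of 0 "(R' ^^ Suc m) x" "(R' ^^ m) x"] unfolding cov_form_def R_pow_adjoint .
  qed
  have "state_energy m = msq M (\<lambda>\<omega>. (R ^^ m) (F 1 \<omega>))" by (rule state_energy[symmetric])
  also have "\<dots> = (\<integral>\<omega>. (norm (?X \<omega> + ?Y \<omega>))\<^sup>2 \<partial>M)"
    unfolding msq_def
  proof (rule integral_cong_AE)
    show "AE \<omega> in M. (norm ((R ^^ m) (F 1 \<omega>)))\<^sup>2 = (norm (?X \<omega> + ?Y \<omega>))\<^sup>2"
      using F_recursion[of 0]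
      by eventually_elim (simp add: linear_add[OF bounded_linear.linear[OF linear_R_pow]] funpow_swap1)
  qed (use sq_rvD[OF sq_rv_add[OF X Y]] sq_rvD[OF R_pow_F_rv] in auto)
  also have "\<dots> = (\<integral>\<omega>. (norm (?X \<omega>))\<^sup>2 + 2 * (?X \<omega> \<bullet> ?Y \<omega>) + (norm (?Y \<omega>))\<^sup>2 \<partial>M)"
    by (intro Bochner_Integration.integral_cong refl)
      (simp add: power2_norm_eq_inner inner_add_left inner_add_right inner_commute)
  also have "\<dots> = msq M ?X + msq M ?Y"
    using sq_rvD(2)[OF X] sq_rvD(2)[OF Y] integrable_inner[OF X Y] orth by (simp add: msq_def)
  finally show ?thesis by (simp only: noise_energy state_energy)
qed

lemma energy_sum: "state_energy 0 = state_energy m + (\<Sum>j<m. noise_energy j)"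
proof (induction m)
  case (Suc m)
  then show ?case using energy_balance[of m] by simp
qed simp

lemma noise_energy_nonneg: "noise_energy m \<ge> 0" and state_energy_nonneg: "state_energy m \<ge> 0"
  by (simp_all add: noise_energy_def state_energy_def)

lemma summable_noise_energy: "summable noise_energy"
proof (rule summableI_nonneg_bounded[of _ "state_energy 0"])
  show "(\<Sum>j<m. noise_energy j) \<le> state_energy 0" for m
    using energy_sum[of m] state_energy_nonneg[of m] by simp
qed (rule noise_energy_nonneg)

definition tail_energy :: "nat \<Rightarrow> real" where "tail_energy m = suminf noise_energy - (\<Sum>j<m. noise_energy j)"

lemma tail_energy_lim: "tail_energy \<longlonglongrightarrow> 0"
proof -
  have "(\<lambda>m. suminf noise_energy - (\<Sum>j<m. noise_energy j)) \<longlonglongrightarrow> suminf noise_energy - suminf noise_energy"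
    by (intro tendsto_intros summable_LIMSEQ summable_noise_energy)
  then show ?thesis by (simp add: tail_energy_def[abs_def])
qed

text \<open>Partial sums of the moving average \<open>\<Sum>\<^sub>j \<rho>\<^sup>j \<epsilon>\<^sub>k\<^sub>-\<^sub>1\<^sub>-\<^sub>j\<close>.\<close>

definition S :: "int \<Rightarrow> nat \<Rightarrow> 'a \<Rightarrow> L2"
  where "S k m \<omega> = (\<Sum>j<m. (R ^^ j) (E (k - 1 - int j) \<omega>))"

lemma S_rv: "sq_rv M (S k m)"
  unfolding S_def by (intro sq_rv_sum R_pow_E_rv) simp

lemma S_mem: "\<omega> \<in> space M \<Longrightarrow> S k m \<omega> \<in> L2_on T"
  unfolding S_def by (intro subspace_sum[OF subspace_L2_on] R_pow_L2_on E_mem)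

lemma S_past: "k \<le> j \<Longrightarrow> S k m \<in> borel_measurable (past j)"
  unfolding S_def by (intro borel_measurable_sum borel_measurable_bounded_linear[OF linear_R_pow E_past]) simp

lemma S_increment: "m \<le> m' \<Longrightarrow> msq M (\<lambda>\<omega>. S k m' \<omega> - S k m \<omega>) \<le> tail_energy m"
proof -
  assume mm: "m \<le> m'"
  have "S k m' \<omega> - S k m \<omega> = (\<Sum>j\<in>{m..<m'}. (R ^^ j) (E (k - 1 - int j) \<omega>))" for \<omega>
    unfolding S_def using mm sum_diff[of "{..<m'}" "{..<m}" "\<lambda>j. (R ^^ j) (E (k - 1 - int j) \<omega>)"]
    by (simp add: ivl_diff lessThan_atLeast0)
  then have "msq M (\<lambda>\<omega>. S k m' \<omega> - S k m \<omega>) = msq M (\<lambda>\<omega>. \<Sum>j\<in>{m..<m'}. (R ^^ j) (E (k - 1 - int j) \<omega>))" by simp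
  also have "\<dots> = (\<Sum>j\<in>{m..<m'}. msq M (\<lambda>\<omega>. (R ^^ j) (E (k - 1 - int j) \<omega>)))"
  proof (rule msq_sum_orthogonal)
    fix i j :: nat assume "i \<noteq> j"
    then have "k - 1 - int i \<noteq> k - 1 - int j" by simp
    from E_uncorrelated[OF this] show "(\<integral>\<omega>. (R ^^ i) (E (k - 1 - int i) \<omega>) \<bullet> (R ^^ j) (E (k - 1 - int j) \<omega>) \<partial>M) = 0"
      by (intro inner_expectation_zero R_pow_E_rv) (simp add: cov_form_def R_pow_adjoint)
  qed (auto intro: R_pow_E_rv)
  also have "\<dots> = (\<Sum>j\<in>{m..<m'}. noise_energy j)" by (simp add: noise_energy)
  also have "\<dots> = (\<Sum>j<m'. noise_energy j) - (\<Sum>j<m. noise_energy j)"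
    using mm sum_diff[of "{..<m'}" "{..<m}" noise_energy] by (simp add: ivl_diff lessThan_atLeast0)
  also have "\<dots> \<le> tail_energy m"
    unfolding tail_energy_def
    using sum_le_suminf[OF summable_noise_energy, of "{..<m'}"] noise_energy_nonneg by simp
  finally show ?thesis .
qed

text \<open>
  Along a sufficiently sparse subsequence the partial sums of the moving average converge almost
  surely, and by Fatou's lemma also in mean square. The limit inherits measurability with respect to
  the past of the noise.
\<close>

lemma ex_moving_average:
  "\<exists>g r. strict_mono (r :: nat \<Rightarrow> nat) \<and> (\<forall>k. sq_rv M (g k) \<and> (\<forall>\<omega>\<in>space M. g k \<omega> \<in> L2_on T) \<and>
     (\<forall>j\<ge>k. g k \<in> borel_measurable (past j)) \<and> (\<lambda>i. msq M (\<lambda>\<omega>. S k (r i) \<omega> - g k \<omega>)) \<longlonglongrightarrow> 0)"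
proof -
  have "\<exists>N. \<forall>m\<ge>N. tail_energy m < (1/4) ^ i" for i :: nat
    using order_tendstoD(2)[OF tail_energy_lim, of "(1/4) ^ i"] by (simp add: eventually_sequentially)
  then obtain N where N: "\<And>i m. m \<ge> N i \<Longrightarrow> tail_energy m < (1/4) ^ i" by metis
  \<comment> \<open>Strictly increasing and at least \<open>N i\<close> at \<open>i\<close>.\<close>
  define r where "r i = (\<Sum>l\<le>i. N l) + i" for i
  have r: "strict_mono r" by (auto simp: strict_mono_Suc_iff r_def)
  have rN: "r i \<ge> N i" for i using member_le_sum[of i "{..i}" N] by (simp add: r_def)
  have tail: "tail_energy (r i) \<le> (1/4) ^ i" for i using N[OF rN[of i]] by simp
  define g where "g k \<omega> = (if Cauchy (\<lambda>i. S k (r i) \<omega>) then lim (\<lambda>i. S k (r i) \<omega>) else 0)" for k \<omega>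
  have g_past: "g k \<in> borel_measurable (past j)" if "k \<le> j" for k j
  proof -
    note [measurable] = S_past[OF that]
    show ?thesis unfolding g_def by measurable
  qed
  have g_meas: "g k \<in> borel_measurable M" for k using measurable_past[OF g_past[OF order_refl]] .
  have g_mem: "g k \<omega> \<in> L2_on T" if "\<omega> \<in> space M" for k \<omega>
  proof (cases "Cauchy (\<lambda>i. S k (r i) \<omega>)")
    case True
    then have lim: "(\<lambda>i. S k (r i) \<omega>) \<longlonglongrightarrow> g k \<omega>" by (simp add: g_def Cauchy_convergent_iff convergent_LIMSEQ_iff)
    have "S k (r i) \<omega> \<in> L2_on T" for i by (rule S_mem[OF that])
    then show ?thesis by (rule closed_sequentially[OF closed_L2_on _ lim])
  next
    case False
    then show ?thesis using subspace_0[OF subspace_L2_on] by (simp add: g_def)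
  qed
  have conv: "AE \<omega> in M. (\<lambda>i. S k (r i) \<omega>) \<longlonglongrightarrow> g k \<omega>" for k
  proof -
    let ?D = "\<lambda>i \<omega>. S k (r (Suc i)) \<omega> - S k (r i) \<omega>"
    have D: "sq_rv M (?D i)" for i by (intro sq_rv_diff S_rv)
    have step: "(\<integral>\<^sup>+\<omega>. ennreal (norm (?D i \<omega>)) \<partial>M) \<le> ennreal ((1/2) ^ i)" for i
    proof -
      \<comment> \<open>The inequality of the means at scale \<open>c\<close> turns the mean square bound \<open>c\<^sup>2\<close> into the mean bound \<open>c\<close>.\<close>
      define c where "c = (1/2::real) ^ i"
      have c: "c > 0" "(1/4) ^ i = c * c" by (simp_all add: c_def power_mult_distrib[symmetric])
      have amgm: "a \<le> (c + a\<^sup>2 / c) / 2" for a :: real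
      proof -
        have "0 \<le> (a - c)\<^sup>2 / c" using c by simp
        also have "\<dots> = a\<^sup>2 / c - 2 * a + c" using c by (simp add: power2_eq_square field_simps)
        finally show ?thesis by simp
      qed
      have "r i \<le> r (Suc i)" using r by (simp add: strict_mono_less_eq)
      then have m: "msq M (?D i) \<le> c * c" using S_increment[of "r i" "r (Suc i)" k] tail[of i] c(2) by simp
      have "(\<integral>\<omega>. norm (?D i \<omega>) \<partial>M) \<le> (\<integral>\<omega>. (c + (norm (?D i \<omega>))\<^sup>2 / c) / 2 \<partial>M)"
        using sq_rvD(2)[OF D[of i]] integrable_norm[OF sq_rv_integrable[OF D[of i]]]
        by (intro integral_mono amgm) auto
      also have "\<dots> = (c + msq M (?D i) / c) / 2"
        using sq_rvD(2)[OF D[of i]] by (simp add: msq_def prob_space)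
      also have "\<dots> \<le> (c + c * c / c) / 2" using m c by (intro divide_right_mono add_left_mono) auto
      also have "\<dots> = c" using c by simp
      finally have "(\<integral>\<omega>. norm (?D i \<omega>) \<partial>M) \<le> c" .
      then show ?thesis
        using nn_integral_eq_integral[OF integrable_norm[OF sq_rv_integrable[OF D[of i]]]] by (simp add: c_def ennreal_leI)
    qed
    have [measurable]: "?D i \<in> borel_measurable M" for i using sq_rvD(1)[OF D] .
    have "(\<integral>\<^sup>+\<omega>. (\<Sum>i. ennreal (norm (?D i \<omega>))) \<partial>M) = (\<Sum>i. \<integral>\<^sup>+\<omega>. ennreal (norm (?D i \<omega>)) \<partial>M)"
      by (rule nn_integral_suminf) measurable
    also have "\<dots> \<le> (\<Sum>i. ennreal ((1/2) ^ i))" by (intro suminf_le step) auto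
    also have "\<dots> = ennreal (\<Sum>i. (1/2) ^ i)" by (rule suminf_ennreal2) auto
    finally have "(\<integral>\<^sup>+\<omega>. (\<Sum>i. ennreal (norm (?D i \<omega>))) \<partial>M) \<noteq> \<infinity>" by (auto simp: top_unique)
    then have "AE \<omega> in M. (\<Sum>i. ennreal (norm (?D i \<omega>))) \<noteq> \<infinity>"
      by (intro nn_integral_PInf_AE) auto
    then show ?thesis
    proof eventually_elim
      case (elim \<omega>)
      then have "summable (\<lambda>i. norm (?D i \<omega>))" by (intro summable_suminf_not_top) auto
      then have "summable (\<lambda>i. ?D i \<omega>)" by (rule summable_norm_cancel)
      then have "convergent (\<lambda>n. \<Sum>i<n. ?D i \<omega>)" by (simp add: summable_iff_convergent)
      then have "convergent (\<lambda>n. (S k (r n) \<omega> - S k (r 0) \<omega>) + S k (r 0) \<omega>)"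
        unfolding sum_lessThan_telescope[of "\<lambda>i. S k (r i) \<omega>"] by (intro convergent_add convergent_const)
      then show ?case by (simp add: g_def Cauchy_convergent_iff convergent_LIMSEQ_iff)
    qed
  qed
  have fatou: "(\<integral>\<^sup>+\<omega>. ennreal ((norm (S k (r i) \<omega> - g k \<omega>))\<^sup>2) \<partial>M) \<le> ennreal ((1/4) ^ i)" for k i
  proof -
    note [measurable] = sq_rvD(1)[OF S_rv]
    have "(\<integral>\<^sup>+\<omega>. ennreal ((norm (S k (r i) \<omega> - g k \<omega>))\<^sup>2) \<partial>M)
      = (\<integral>\<^sup>+\<omega>. liminf (\<lambda>l. ennreal ((norm (S k (r l) \<omega> - S k (r i) \<omega>))\<^sup>2)) \<partial>M)"
    proof (rule nn_integral_cong_AE, use conv[of k] in eventually_elim)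
      case (elim \<omega>)
      then have "(\<lambda>l. ennreal ((norm (S k (r l) \<omega> - S k (r i) \<omega>))\<^sup>2)) \<longlonglongrightarrow> ennreal ((norm (g k \<omega> - S k (r i) \<omega>))\<^sup>2)"
        by (intro tendsto_ennrealI tendsto_intros)
      then show ?case
        using lim_imp_Liminf[OF trivial_limit_sequentially] by (metis norm_minus_commute)
    qed
    also have "\<dots> \<le> liminf (\<lambda>l. \<integral>\<^sup>+\<omega>. ennreal ((norm (S k (r l) \<omega> - S k (r i) \<omega>))\<^sup>2) \<partial>M)"
      by (rule nn_integral_liminf) measurable
    also have "\<dots> \<le> ennreal ((1/4) ^ i)"
    proof (rule Liminf_le[OF trivial_limit_sequentially], rule eventually_sequentiallyI)
      fix l assume "i \<le> l"
      then have "r i \<le> r l" using r by (simp add: strict_mono_less_eq)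
      have "(\<integral>\<^sup>+\<omega>. ennreal ((norm (S k (r l) \<omega> - S k (r i) \<omega>))\<^sup>2) \<partial>M) = ennreal (msq M (\<lambda>\<omega>. S k (r l) \<omega> - S k (r i) \<omega>))"
        unfolding msq_def by (rule nn_integral_eq_integral[OF sq_rvD(2)[OF sq_rv_diff[OF S_rv S_rv]]]) simp
      also have "\<dots> \<le> ennreal ((1/4) ^ i)"
        using S_increment[OF \<open>r i \<le> r l\<close>, of k] tail[of i] by (intro ennreal_leI) simp
      finally show "(\<integral>\<^sup>+\<omega>. ennreal ((norm (S k (r l) \<omega> - S k (r i) \<omega>))\<^sup>2) \<partial>M) \<le> ennreal ((1/4) ^ i)" .
    qed
    finally show ?thesis .
  qed
  have diff: "sq_rv M (\<lambda>\<omega>. S k (r i) \<omega> - g k \<omega>)" for k i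
    unfolding sq_rv_def
  proof
    note [measurable] = sq_rvD(1)[OF S_rv] g_meas
    show "(\<lambda>\<omega>. S k (r i) \<omega> - g k \<omega>) \<in> borel_measurable M" by measurable
    show "integrable M (\<lambda>\<omega>. (norm (S k (r i) \<omega> - g k \<omega>))\<^sup>2)"
      using fatou[of k i] by (intro integrableI_bounded) (auto simp: less_top[symmetric] top_unique)
  qed
  have "sq_rv M (g k)" for k
    using sq_rv_diff[OF S_rv[of k "r 0"] diff[of k 0]] by simp
  moreover have "(\<lambda>i. msq M (\<lambda>\<omega>. S k (r i) \<omega> - g k \<omega>)) \<longlonglongrightarrow> 0" for k
  proof (rule tendsto_sandwich[OF _ _ tendsto_const])
    show "\<forall>\<^sub>F i in sequentially. msq M (\<lambda>\<omega>. S k (r i) \<omega> - g k \<omega>) \<le> (1/4) ^ i"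
    proof (rule always_eventually, rule allI)
      fix i
      have "ennreal (msq M (\<lambda>\<omega>. S k (r i) \<omega> - g k \<omega>)) \<le> ennreal ((1/4) ^ i)"
        using fatou[of k i] nn_integral_eq_integral[OF sq_rvD(2)[OF diff[of k i]]] by (simp add: msq_def)
      then show "msq M (\<lambda>\<omega>. S k (r i) \<omega> - g k \<omega>) \<le> (1/4) ^ i" by (simp add: ennreal_le_iff)
    qed
    show "(\<lambda>i. (1/4::real) ^ i) \<longlonglongrightarrow> 0" by (rule LIMSEQ_power_zero) simp
  qed simp
  ultimately show ?thesis using r g_mem g_past by blast
qed

end

lemma bounded_linear_cov_op:
  assumes X: "sq_rv M X" and Y: "sq_rv M Y"
  shows "bounded_linear (cov_op M X Y)"
proof (rule bounded_linear_intro)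
  note inner = cov_op_inner[OF X Y]
  have form_add: "cov_form M X Y (x + x') y = cov_form M X Y x y + cov_form M X Y x' y" for x x' y
    using integrable_cov_form[OF X Y] by (simp add: cov_form_def inner_add_right distrib_right)
  have form_scale: "cov_form M X Y (c *\<^sub>R x) y = c * cov_form M X Y x y" for c x y
    by (simp add: cov_form_def mult.assoc)
  show "cov_op M X Y (x + x') = cov_op M X Y x + cov_op M X Y x'" for x x'
    by (rule vector_eq_ldot[THEN iffD1]) (simp add: inner_add_right inner_commute[of _ "cov_op _ _ _ _"] inner form_add)
  show "cov_op M X Y (c *\<^sub>R x) = c *\<^sub>R cov_op M X Y x" for c x
    by (rule vector_eq_ldot[THEN iffD1]) (simp add: inner_commute[of _ "cov_op _ _ _ _"] inner form_scale)
  show "norm (cov_op M X Y x) \<le> norm x * sqrt (msq M X * msq M Y)" for x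
  proof -
    let ?c = "cov_op M X Y x"
    have "((norm ?c)\<^sup>2)\<^sup>2 \<le> (norm x)\<^sup>2 * msq M X * ((norm ?c)\<^sup>2 * msq M Y)"
      using cov_form_bound[OF X Y, of x ?c] by (simp add: inner[symmetric] power2_norm_eq_inner)
    then have "(norm ?c)\<^sup>2 * (norm ?c)\<^sup>2 \<le> ((norm x)\<^sup>2 * (msq M X * msq M Y)) * (norm ?c)\<^sup>2"
      by (simp add: power2_eq_square mult_ac)
    then have "(norm ?c)\<^sup>2 \<le> (norm x)\<^sup>2 * (msq M X * msq M Y)"
      using mult_right_le_imp_le[of "(norm ?c)\<^sup>2" "(norm ?c)\<^sup>2"] by (cases "?c = 0") auto
    then have "norm ?c \<le> sqrt ((norm x)\<^sup>2 * (msq M X * msq M Y))" by (rule real_le_rsqrt)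
    then show ?thesis by (simp add: real_sqrt_mult)
  qed
qed

lemma cov_form_sum_right:
  assumes "finite I" "sq_rv M X" "\<And>i. i \<in> I \<Longrightarrow> sq_rv M (Y i)"
  shows "cov_form M X (\<lambda>\<omega>. \<Sum>i\<in>I. Y i \<omega>) x y = (\<Sum>i\<in>I. cov_form M X (Y i) x y)"
  using cov_form_sum_left[OF assms(1,3,2)] by (simp only: cov_form_commute[of M X])

lemma msq_bounded_linear_le:
  assumes A: "bounded_linear A" and X: "sq_rv M X"
  shows "msq M (\<lambda>\<omega>. A (X \<omega>)) \<le> (onorm A)\<^sup>2 * msq M X"
proof -
  have "msq M (\<lambda>\<omega>. A (X \<omega>)) \<le> (\<integral>\<omega>. (onorm A)\<^sup>2 * (norm (X \<omega>))\<^sup>2 \<partial>M)"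
    unfolding msq_def
  proof (rule integral_mono)
    show "(norm (A (X \<omega>)))\<^sup>2 \<le> (onorm A)\<^sup>2 * (norm (X \<omega>))\<^sup>2" for \<omega>
      using power_mono[OF onorm[OF A, of "X \<omega>"], of 2] by (simp add: power_mult_distrib)
  qed (use sq_rvD(2)[OF X] sq_rvD(2)[OF sq_rv_bounded_linear[OF A X]] in auto)
  then show ?thesis by (simp add: msq_def)
qed

lemma msq_zero_AE:
  assumes "sq_rv M X" "msq M X = 0"
  shows "AE \<omega> in M. X \<omega> = 0"
  using assms integral_nonneg_eq_0_iff_AE[OF sq_rvD(2)[OF assms(1)]] by (auto simp: msq_def)

context ar1_process
begin

lemma S_Suc: "S (k + 1) (Suc m) \<omega> = E k \<omega> + R (S k m \<omega>)"
  by (simp add: S_def sum.lessThan_Suc_shift linear_sum[OF bounded_linear.linear[OF linear_R]] algebra_simps del: sum.lessThan_Suc)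

lemma E_stationary: "cov_form M (E (a + h)) (E (c + h)) x y = cov_form M (E a) (E c) x y"
  using E_cov_identical[of "a + h" x y a] E_uncorrelated[of "a + h" "c + h"] E_uncorrelated[of a c]
  by (cases "a = c") auto

lemma S_stationary: "cov_form M (S (s + h) m) (S (t + h) m) x y = cov_form M (S s m) (S t m) x y"
proof -
  have S_fun: "S u m = (\<lambda>\<omega>. \<Sum>i<m. (R ^^ i) (E (u - 1 - int i) \<omega>))" for u by (rule ext) (simp add: S_def)
  have expand: "cov_form M (S u m) (S v m) x y =
    (\<Sum>i<m. \<Sum>j<m. cov_form M (E (u - 1 - int i)) (E (v - 1 - int j)) ((R' ^^ i) x) ((R' ^^ j) y))" for u v
  proof -
    have "cov_form M (S u m) (S v m) x y = (\<Sum>i<m. cov_form M (\<lambda>\<omega>. (R ^^ i) (E (u - 1 - int i) \<omega>)) (S v m) x y)"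
      unfolding S_fun[of u] by (intro cov_form_sum_left R_pow_E_rv S_rv) simp
    also have "\<dots> = (\<Sum>i<m. \<Sum>j<m. cov_form M (\<lambda>\<omega>. (R ^^ i) (E (u - 1 - int i) \<omega>)) (\<lambda>\<omega>. (R ^^ j) (E (v - 1 - int j) \<omega>)) x y)"
      unfolding S_fun[of v] by (intro sum.cong refl cov_form_sum_right R_pow_E_rv) simp
    finally show ?thesis by (simp add: cov_form_def R_pow_adjoint)
  qed
  have "cov_form M (E (s + h - 1 - int i)) (E (t + h - 1 - int j)) = cov_form M (E (s - 1 - int i)) (E (t - 1 - int j))" for i j
    using E_stationary[of "s - 1 - int i" h "t - 1 - int j"] by (intro ext) (simp add: algebra_simps)
  then show ?thesis unfolding expand by simp
qed

text \<open>
  All identities of a weakly stationary solution hold for the partial sums, exactly or up to a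
  vanishing term, and pass to the mean-square limit.
\<close>

lemma moving_average_solution:
  assumes r: "strict_mono (r :: nat \<Rightarrow> nat)" and g: "\<And>k. sq_rv M (g k)" "\<And>k \<omega>. \<omega> \<in> space M \<Longrightarrow> g k \<omega> \<in> L2_on T"
    and lim: "\<And>k. (\<lambda>i. msq M (\<lambda>\<omega>. S k (r i) \<omega> - g k \<omega>)) \<longlonglongrightarrow> 0"
  shows "ar1_solution M T \<delta> (int_op T K) \<epsilon> (\<lambda>s. g \<lfloor>s / \<delta>\<rfloor>)"
proof -
  \<comment> \<open>On the time grid, the floor recovers the integer index.\<close>
  have floor: "\<lfloor>of_int k * \<delta> / \<delta>\<rfloor> = k" for k :: int using \<delta> by simp
  have floor_add: "\<lfloor>(of_int k * \<delta> + of_int h * \<delta>) / \<delta>\<rfloor> = k + h" for k h :: int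
  proof -
    have "(of_int k * \<delta> + of_int h * \<delta>) / \<delta> = of_int (k + h)" using \<delta> by (simp add: field_simps)
    then show ?thesis by (simp only: floor_of_int)
  qed
  have floor_Suc: "\<lfloor>(of_int k * \<delta> + \<delta>) / \<delta>\<rfloor> = k + 1" for k :: int
    using floor_add[of k 1] by simp
  have mean: "(\<integral>\<omega>. g k \<omega> \<partial>M) = 0" for k
  proof (rule vector_eq_ldot[THEN iffD1], rule allI)
    fix y
    \<comment> \<open>Paired with the constant \<open>y\<close>, the mean becomes a covariance form, to which the limit theorem applies.\<close>
    have const: "sq_rv M (\<lambda>_. y)" by (simp add: sq_rv_def)
    have inner: "cov_form M X (\<lambda>_. y) y y = (\<integral>\<omega>. X \<omega> \<bullet> y \<partial>M) * (y \<bullet> y)" for X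
      by (simp add: cov_form_def)
    have S0: "(\<integral>\<omega>. S k m \<omega> \<bullet> y \<partial>M) = 0" for m
    proof -
      have "(\<integral>\<omega>. S k m \<omega> \<bullet> y \<partial>M) = (\<Sum>j<m. \<integral>\<omega>. E (k - 1 - int j) \<omega> \<bullet> (R' ^^ j) y \<partial>M)"
        unfolding S_def inner_sum_left R_pow_adjoint by (rule Bochner_Integration.integral_sum) (rule E_inner_integrable)
      then show ?thesis by (simp add: E_inner_mean)
    qed
    have "(\<lambda>i. cov_form M (S k (r i)) (\<lambda>_. y) y y) \<longlonglongrightarrow> cov_form M (g k) (\<lambda>_. y) y y"
      by (rule cov_form_tendsto[OF g(1) S_rv lim const const]) (simp add: msq_def)
    then have "cov_form M (g k) (\<lambda>_. y) y y = 0" unfolding inner S0 by (simp add: LIMSEQ_const_iff)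
    then have "(\<integral>\<omega>. g k \<omega> \<bullet> y \<partial>M) = 0" unfolding inner by auto
    then show "y \<bullet> (\<integral>\<omega>. g k \<omega> \<partial>M) = y \<bullet> 0"
      using integral_inner_left[OF sq_rv_integrable[OF g(1)[of k]], of y] by (simp add: inner_commute)
  qed
  have stat: "cov_op M (g (s + h)) (g (t + h)) x = cov_op M (g s) (g t) x" for s t h x
  proof (rule vector_eq_ldot[THEN iffD1], rule allI)
    fix y
    have "(\<lambda>i. cov_form M (S (s + h) (r i)) (S (t + h) (r i)) x y) \<longlonglongrightarrow> cov_form M (g (s + h)) (g (t + h)) x y"
      by (rule cov_form_tendsto[OF g(1) S_rv lim g(1) S_rv lim])
    moreover have "(\<lambda>i. cov_form M (S s (r i)) (S t (r i)) x y) \<longlonglongrightarrow> cov_form M (g s) (g t) x y"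
      by (rule cov_form_tendsto[OF g(1) S_rv lim g(1) S_rv lim])
    ultimately have "cov_form M (g (s + h)) (g (t + h)) x y = cov_form M (g s) (g t) x y"
      unfolding S_stationary by (rule LIMSEQ_unique)
    then show "y \<bullet> cov_op M (g (s + h)) (g (t + h)) x = y \<bullet> cov_op M (g s) (g t) x"
      by (simp add: inner_commute[of y] cov_op_inner[OF g(1) g(1)])
  qed
  have uncorr: "cov_op M (g k) (E k) x = 0" for k x
  proof (rule vector_eq_ldot[THEN iffD1], rule allI)
    fix y
    have "(\<lambda>i. cov_form M (S k (r i)) (E k) x y) \<longlonglongrightarrow> cov_form M (g k) (E k) x y"
      by (rule cov_form_tendsto[OF g(1) S_rv lim E_rv E_rv]) (simp add: msq_def)
    then have "cov_form M (g k) (E k) x y = 0"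
      unfolding past_E_uncorrelated[OF S_rv S_past[OF order_refl]] by (simp add: LIMSEQ_const_iff)
    then show "y \<bullet> cov_op M (g k) (E k) x = y \<bullet> 0"
      by (simp add: inner_commute[of y] cov_op_inner[OF g(1) E_rv])
  qed
  have rec: "AE \<omega> in M. g (k + 1) \<omega> = R (g k \<omega>) + E k \<omega>" for k
  proof -
    let ?Z = "\<lambda>\<omega>. R (g k \<omega>) + E k \<omega> - g (k + 1) \<omega>"
    let ?A = "\<lambda>i \<omega>. S (k + 1) (r i) \<omega> - g (k + 1) \<omega>"
    let ?B = "\<lambda>i \<omega>. S k (r i) \<omega> - g k \<omega>"
    let ?C = "\<lambda>i \<omega>. S (k + 1) (Suc (r i)) \<omega> - S (k + 1) (r i) \<omega>"
    have rv: "sq_rv M (?A i)" "sq_rv M (?B i)" "sq_rv M (?C i)" for i by (intro sq_rv_diff S_rv g)+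
    have RB: "sq_rv M (\<lambda>\<omega>. (- R (?B i \<omega>)))" for i
      using sq_rv_bounded_linear[OF bounded_linear_minus[OF linear_R] rv(2)] .
    have Z: "sq_rv M ?Z" by (intro sq_rv_diff sq_rv_add g E_rv sq_rv_bounded_linear[OF linear_R g(1)])
    have "msq M ?Z \<le> 2 * (2 * msq M (?A i) + 2 * ((onorm R)\<^sup>2 * msq M (?B i))) + 2 * tail_energy (r i)" for i
    proof -
      have eq: "?Z = (\<lambda>\<omega>. (?A i \<omega> + (- R (?B i \<omega>))) + ?C i \<omega>)"
        unfolding S_Suc by (rule ext) (simp add: linear_diff[OF bounded_linear.linear[OF linear_R]])
      have "msq M ?Z \<le> 2 * msq M (\<lambda>\<omega>. ?A i \<omega> + (- R (?B i \<omega>))) + 2 * msq M (?C i)"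
        unfolding eq by (rule msq_add_le[OF sq_rv_add[OF rv(1) RB] rv(3)])
      also have "\<dots> \<le> 2 * (2 * msq M (?A i) + 2 * msq M (\<lambda>\<omega>. - R (?B i \<omega>))) + 2 * tail_energy (r i)"
        using S_increment[of "r i" "Suc (r i)" "k + 1"]
        by (intro add_mono mult_left_mono msq_add_le[OF rv(1) RB]) auto
      also have "msq M (\<lambda>\<omega>. - R (?B i \<omega>)) = msq M (\<lambda>\<omega>. R (?B i \<omega>))" by (simp add: msq_def)
      also have "2 * (2 * msq M (?A i) + 2 * msq M (\<lambda>\<omega>. R (?B i \<omega>))) + 2 * tail_energy (r i)
        \<le> 2 * (2 * msq M (?A i) + 2 * ((onorm R)\<^sup>2 * msq M (?B i))) + 2 * tail_energy (r i)"
        by (intro add_mono mult_left_mono order_refl msq_bounded_linear_le[OF linear_R rv(2)]) auto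
      finally show ?thesis .
    qed
    moreover have "(\<lambda>i. 2 * (2 * msq M (?A i) + 2 * ((onorm R)\<^sup>2 * msq M (?B i))) + 2 * tail_energy (r i))
        \<longlonglongrightarrow> 2 * (2 * 0 + 2 * ((onorm R)\<^sup>2 * 0)) + 2 * 0"
      using LIMSEQ_subseq_LIMSEQ[OF tail_energy_lim r] by (intro tendsto_intros lim) (simp add: o_def)
    ultimately have "msq M ?Z \<le> 2 * (2 * 0 + 2 * ((onorm R)\<^sup>2 * 0)) + 2 * 0"
      by (intro LIMSEQ_le_const) auto
    then have "msq M ?Z = 0" using msq_nonneg[of M ?Z] by simp
    from msq_zero_AE[OF Z this] show ?thesis by eventually_elim simp
  qed
  show ?thesis
    unfolding ar1_solution_def weakly_stationary0_def
  proof (intro conjI ballI)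
    fix s assume "s \<in> time_grid \<delta>"
    then obtain k :: int where s: "s = of_int k * \<delta>" by (auto simp: time_grid_def)
    show "random_element M T (g \<lfloor>s / \<delta>\<rfloor>)" using g by (simp add: random_element_def sq_rv_def)
    show "integrable M (\<lambda>\<omega>. (norm (g \<lfloor>s / \<delta>\<rfloor> \<omega>))\<^sup>2)" using g by (simp add: sq_rv_def)
    show "(\<integral>\<omega>. g \<lfloor>s / \<delta>\<rfloor> \<omega> \<partial>M) = 0" by (rule mean)
    show "AE \<omega> in M. g \<lfloor>(s + \<delta>) / \<delta>\<rfloor> \<omega> = int_op T K (g \<lfloor>s / \<delta>\<rfloor> \<omega>) + \<epsilon> s \<omega>"
      using rec[of k] unfolding s floor floor_Suc by (simp only: E_def R_def)
    fix x
    show "cov_op M (g \<lfloor>s / \<delta>\<rfloor>) (\<epsilon> s) x = 0" using uncorr[of k x] unfolding s floor by (simp only: E_def)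
  next
    fix s t h x assume "s \<in> time_grid \<delta>" "t \<in> time_grid \<delta>" "h \<in> time_grid \<delta>"
    then obtain k l m :: int where "s = of_int k * \<delta>" "t = of_int l * \<delta>" "h = of_int m * \<delta>"
      by (auto simp: time_grid_def)
    then show "cov_op M (g \<lfloor>(s + h) / \<delta>\<rfloor>) (g \<lfloor>(t + h) / \<delta>\<rfloor>) x = cov_op M (g \<lfloor>s / \<delta>\<rfloor>) (g \<lfloor>t / \<delta>\<rfloor>) x"
      using stat[of k m l x] by (simp only: floor floor_add)
  qed
qed

lemma state_expansion: "AE \<omega> in M. F k \<omega> = S k m \<omega> + (R ^^ m) (F (k - int m) \<omega>)"
proof (induction m)
  case 0
  show ?case by (simp add: S_def)
next
  case (Suc m)
  show ?case
    using Suc F_recursion[of "k - int (Suc m)"]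
  proof eventually_elim
    case (elim \<omega>)
    have "k - int (Suc m) + 1 = k - int m" "k - int (Suc m) = k - 1 - int m" by simp_all
    then have "F (k - int m) \<omega> = R (F (k - 1 - int m) \<omega>) + E (k - 1 - int m) \<omega>" using elim(2) by metis
    then have "(R ^^ m) (F (k - int m) \<omega>) = (R ^^ Suc m) (F (k - 1 - int m) \<omega>) + (R ^^ m) (E (k - 1 - int m) \<omega>)"
      by (simp add: linear_add[OF bounded_linear.linear[OF linear_R_pow]] funpow_swap1)
    then show ?case using elim(1) \<open>k - int (Suc m) = k - 1 - int m\<close> by (simp only: S_def sum.lessThan_Suc) (simp add: add_ac)
  qed
qed

text \<open>
  By uniqueness the process is the moving average. Hence it is measurable with respect to the past of
  the noise, and the part of it that is inherited from \<open>m\<close> steps before fades away as \<open>m\<close> grows.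
\<close>

theorem state_is_moving_average:
  "(\<exists>g. \<forall>k. sq_rv M (g k) \<and> (\<forall>j\<ge>k. g k \<in> borel_measurable (past j)) \<and> (AE \<omega> in M. g k \<omega> = F k \<omega>)) \<and>
   state_energy \<longlonglongrightarrow> 0"
proof -
  obtain g and r :: "nat \<Rightarrow> nat" where r: "strict_mono r" and g: "\<And>k. sq_rv M (g k)" "\<And>k \<omega>. \<omega> \<in> space M \<Longrightarrow> g k \<omega> \<in> L2_on T"
    "\<And>k j. k \<le> j \<Longrightarrow> g k \<in> borel_measurable (past j)" "\<And>k. (\<lambda>i. msq M (\<lambda>\<omega>. S k (r i) \<omega> - g k \<omega>)) \<longlonglongrightarrow> 0"
    using ex_moving_average by blast
  have "AE \<omega> in M. g \<lfloor>of_int k * \<delta> / \<delta>\<rfloor> \<omega> = f (of_int k * \<delta>) \<omega>" for k :: int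
    using model moving_average_solution[OF r g(1,2,4)] grid[of k] unfolding ar1_defines_def by blast
  then have gF: "AE \<omega> in M. g k \<omega> = F k \<omega>" for k :: int
    using \<delta> by (simp add: F_def)
  \<comment> \<open>The state is its own partial moving average plus the inherited part, whose energy is \<^term>\<open>state_energy (r i)\<close>.\<close>
  have sub: "state_energy (r i) = msq M (\<lambda>\<omega>. S 0 (r i) \<omega> - g 0 \<omega>)" for i
  proof -
    have "state_energy (r i) = msq M (\<lambda>\<omega>. (R ^^ r i) (F (0 - int (r i)) \<omega>))" by (rule state_energy[symmetric])
    also have "\<dots> = msq M (\<lambda>\<omega>. S 0 (r i) \<omega> - g 0 \<omega>)"
      unfolding msq_def
    proof (rule integral_cong_AE)
      show "AE \<omega> in M. (norm ((R ^^ r i) (F (0 - int (r i)) \<omega>)))\<^sup>2 = (norm (S 0 (r i) \<omega> - g 0 \<omega>))\<^sup>2"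
        using state_expansion[of 0 "r i"] gF[of 0]
        by eventually_elim (simp add: norm_minus_commute)
    qed (use sq_rvD(2)[OF R_pow_F_rv] sq_rvD(2)[OF sq_rv_diff[OF S_rv g(1)]] in auto)
    finally show ?thesis .
  qed
  have anti: "state_energy m' \<le> state_energy m" if "m \<le> m'" for m m'
    using that by (rule lift_Suc_antimono_le[of state_energy, rotated]) (use energy_balance noise_energy_nonneg in \<open>metis le_add_same_cancel1\<close>)
  have "state_energy \<longlonglongrightarrow> 0"
  proof (rule LIMSEQ_I)
    fix \<eta> :: real assume "\<eta> > 0"
    have "(\<lambda>i. state_energy (r i)) \<longlonglongrightarrow> 0" unfolding sub by (rule g(4))
    then have "\<forall>\<^sub>F i in sequentially. state_energy (r i) < \<eta>" using \<open>\<eta> > 0\<close> by (rule order_tendstoD)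
    then obtain i where "state_energy (r i) < \<eta>" by (auto simp: eventually_sequentially)
    then have "norm (state_energy m - 0) < \<eta>" if "m \<ge> r i" for m
      using anti[OF that] state_energy_nonneg[of m] by simp
    then show "\<exists>no. \<forall>m\<ge>no. norm (state_energy m - 0) < \<eta>" by blast
  qed
  then show ?thesis using g(1,3) gF by blast
qed

definition Gam :: "L2 \<Rightarrow> L2" where "Gam = cov_op M (F 0) (F 0)"

lemma linear_Gam: "bounded_linear Gam"
  unfolding Gam_def by (rule bounded_linear_cov_op[OF F_rv F_rv])

lemma Gam_inner: "Gam x \<bullet> y = cov_form M (F k) (F k) x y"
  using F_stationary[of 0 k 0 x y] by (simp only: Gam_def cov_op_inner[OF F_rv F_rv] add_0_left)

lemma Gam_symmetric: "Gam x \<bullet> y = x \<bullet> Gam y"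
  using cov_form_commute[of M "F 0" "F 0" x y] by (simp add: Gam_inner[of _ _ 0] inner_commute[of x])

lemma Gam_nonneg: "0 \<le> x \<bullet> Gam x"
  unfolding inner_commute[of x] Gam_inner[of _ _ 0] cov_form_def by simp

lemma Gam_range: "Gam x \<in> L2_on T"
proof -
  have eq: "Gam x \<bullet> y = cov_form M (F 0) (F 0) y x" for y
    unfolding Gam_inner[of x y 0] by (rule cov_form_commute)
  have *: "Gam x \<bullet> y = Gam x \<bullet> restr T y" for y
    unfolding eq by (rule cov_form_F_restr)
  have "restr T (Gam x) = Gam x"
    by (rule vector_eq_rdot[THEN iffD1, OF allI]) (rule trans[OF restr_inner *[symmetric]])
  then show ?thesis by (simp add: L2_on_iff_restr)
qed

lemma Gam_eq_cov_op: "cov_op M (F k) (F k) x = Gam x"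
  by (rule vector_eq_rdot[THEN iffD1]) (simp add: Gam_inner[of _ _ k] cov_op_inner[OF F_rv F_rv])

lemma cross_cov_op: "cov_op M (F k) (F (k + 1)) x = R (Gam x)"
proof (rule vector_eq_rdot[THEN iffD1], rule allI)
  fix y
  have RF: "sq_rv M (\<lambda>\<omega>. R (F k \<omega>))" by (rule sq_rv_bounded_linear[OF linear_R F_rv])
  have "cov_op M (F k) (F (k + 1)) x \<bullet> y = cov_form M (F (k + 1)) (F k) y x"
    by (simp add: cov_op_inner[OF F_rv F_rv] cov_form_commute)
  also have "\<dots> = cov_form M (\<lambda>\<omega>. R (F k \<omega>) + E k \<omega>) (F k) y x"
    by (rule cov_form_cong_AE[OF F_rv F_rv sq_rv_add[OF RF E_rv] F_rv F_recursion]) simp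
  also have "\<dots> = cov_form M (\<lambda>\<omega>. R (F k \<omega>)) (F k) y x + cov_form M (E k) (F k) y x"
    by (rule cov_form_add_left[OF RF E_rv F_rv])
  also have "cov_form M (E k) (F k) y x = 0" using F_E_uncorrelated[of k x y] by (simp only: cov_form_commute[of M "E k"])
  also have "cov_form M (\<lambda>\<omega>. R (F k \<omega>)) (F k) y x = cov_form M (F k) (F k) (R' y) x"
    by (rule cov_form_adjoint_left[OF R_adjoint])
  also have "\<dots> = R (Gam x) \<bullet> y"
    by (simp only: Gam_inner[of _ _ k, symmetric] R_adjoint Gam_symmetric inner_commute[of "R' y"])
  finally show "cov_op M (F k) (F (k + 1)) x \<bullet> y = R (Gam x) \<bullet> y" by simp
qed

lemma R'_compact: "(\<And>n::nat. norm (x n) \<le> B) \<Longrightarrow> \<exists>r l. strict_mono r \<and> (\<lambda>n. R' (x (r n))) \<longlonglongrightarrow> l"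
  using int_op_kernel_rows[OF hs_kernel_transpose[OF hs]] kernel_rows_compact unfolding R'_def by blast

lemma R_compact: "(\<And>n::nat. norm (x n) \<le> B) \<Longrightarrow> \<exists>r l. strict_mono r \<and> (\<lambda>n. R (x (r n))) \<longlonglongrightarrow> l"
  using int_op_kernel_rows[OF hs] kernel_rows_compact unfolding R_def by blast

text \<open>An inequality of Ehrling type: since \<open>R'\<close> is compact, the strong norm on its range is controlled
  by the covariance norm up to a small multiple of the norm of the argument.\<close>

lemma ehrling_inequality:
  assumes pos: "\<And>x. x \<in> L2_on T \<Longrightarrow> x \<noteq> 0 \<Longrightarrow> 0 < x \<bullet> Gam x"
  shows "\<exists>C\<ge>0. \<forall>y. norm (R' y) \<le> 1 / 4 * norm y + C * sqrt (R' y \<bullet> Gam (R' y))"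
proof (rule ccontr)
  assume contra: "\<not> ?thesis"
  let ?q = "\<lambda>y. sqrt (R' y \<bullet> Gam (R' y))"
  have "\<exists>y. 1 / 4 * norm y + real n * ?q y < norm (R' y)" for n :: nat
    using contra by (metis not_le of_nat_0_le_iff)
  then obtain y where y: "\<And>n. 1 / 4 * norm (y n) + real n * ?q (y n) < norm (R' (y n))" by metis
  have lin: "linear R'" "linear Gam" using linear_R' linear_Gam by (simp_all add: bounded_linear.linear)
  have y0: "y n \<noteq> 0" for n using y[of n] by (auto simp: linear_0[OF lin(1)] linear_0[OF lin(2)])
  \<comment> \<open>Both sides are homogeneous, so the counterexamples may be taken on the unit sphere.\<close>
  define u where "u n = (1 / norm (y n)) *\<^sub>R y n" for n
  have nu: "norm (u n) = 1" for n using y0 by (simp add: u_def)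
  have q: "?q (u n) = ?q (y n) / norm (y n)" for n
  proof -
    have "R' (u n) \<bullet> Gam (R' (u n)) = (R' (y n) \<bullet> Gam (R' (y n))) / (norm (y n))\<^sup>2"
      by (simp add: u_def linear_scale[OF lin(1)] linear_scale[OF lin(2)] power2_eq_square)
    then show ?thesis by (simp add: real_sqrt_divide)
  qed
  have u: "1 / 4 + real n * ?q (u n) < norm (R' (u n))" for n
  proof -
    have "1 / 4 + real n * ?q (u n) = (1 / 4 * norm (y n) + real n * ?q (y n)) / norm (y n)"
      using y0 by (simp add: q add_divide_distrib)
    also have "\<dots> < norm (R' (y n)) / norm (y n)" using y y0 by (intro divide_strict_right_mono) auto
    also have "\<dots> = norm (R' (u n))" by (simp add: u_def linear_scale[OF lin(1)])
    finally show ?thesis .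
  qed
  obtain r l where r: "strict_mono r" "(\<lambda>n. R' (u (r n))) \<longlonglongrightarrow> l"
    using R'_compact[of u 1] nu by auto
  have "l \<in> L2_on T" by (rule closed_sequentially[OF closed_L2_on R'_range r(2)])
  have "1 / 4 \<le> norm l"
  proof (rule LIMSEQ_le_const[OF tendsto_norm[OF r(2)]], intro exI allI impI)
    show "1 / 4 \<le> norm (R' (u (r n)))" for n
    proof -
      have "0 \<le> real (r n) * ?q (u (r n))" using Gam_nonneg by simp
      then show ?thesis using u[of "r n"] by linarith
    qed
  qed
  then have "l \<noteq> 0" by auto
  have "(\<lambda>n. ?q (u (r n))) \<longlonglongrightarrow> sqrt (l \<bullet> Gam l)"
    by (intro tendsto_intros r bounded_linear.tendsto[OF linear_Gam])
  moreover have "(\<lambda>n. ?q (u (r n))) \<longlonglongrightarrow> 0"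
  proof (rule tendsto_sandwich[OF _ _ tendsto_const])
    have bound: "?q (u n) \<le> onorm R' / real n" if "n > 0" for n
    proof -
      have "real n * ?q (u n) \<le> onorm R'" using u[of n] onorm[OF linear_R', of "u n"] nu[of n] by simp
      then show ?thesis using that by (simp add: field_simps)
    qed
    show "\<forall>\<^sub>F n in sequentially. ?q (u (r n)) \<le> onorm R' / real n"
    proof (rule eventually_sequentiallyI)
      fix n :: nat assume n: "1 \<le> n"
      have "n \<le> r n" using seq_suble[OF r(1)] .
      then have "?q (u (r n)) \<le> onorm R' / real (r n)" using n by (intro bound) simp
      also have "\<dots> \<le> onorm R' / real n"
        using n \<open>n \<le> r n\<close> onorm_pos_le[OF linear_R'] by (intro divide_left_mono) auto
      finally show "?q (u (r n)) \<le> onorm R' / real n" .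
    qed
    show "(\<lambda>n. onorm R' / real n) \<longlonglongrightarrow> 0" by (rule lim_const_over_n)
  qed (use Gam_nonneg in simp)
  ultimately have "sqrt (l \<bullet> Gam l) = 0" by (rule LIMSEQ_unique)
  then show False using pos[OF \<open>l \<in> L2_on T\<close> \<open>l \<noteq> 0\<close>] by simp
qed

text \<open>In the covariance norm the powers of \<open>R'\<close> fade away by the energy balance, and the previous
  inequality transfers this to the strong norm.\<close>

theorem power_contraction:
  assumes pos: "\<And>x. x \<in> L2_on T \<Longrightarrow> x \<noteq> 0 \<Longrightarrow> 0 < x \<bullet> Gam x"
  shows "\<exists>m. \<forall>x. norm ((R ^^ m) x) \<le> 1 / 2 * norm x \<and> norm ((R' ^^ m) x) \<le> 1 / 2 * norm x"
proof -
  obtain C where C: "C \<ge> 0" "\<And>y. norm (R' y) \<le> 1 / 4 * norm y + C * sqrt (R' y \<bullet> Gam (R' y))"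
    using ehrling_inequality[OF pos] by blast
  have fade: "(R' ^^ m) y \<bullet> Gam ((R' ^^ m) y) \<le> (norm y)\<^sup>2 * state_energy m" for m y
  proof -
    have RF: "sq_rv M (\<lambda>\<omega>. (R ^^ m) (F 0 \<omega>))" by (rule R_pow_F_rv)
    have "(R' ^^ m) y \<bullet> Gam ((R' ^^ m) y) = cov_form M (\<lambda>\<omega>. (R ^^ m) (F 0 \<omega>)) (\<lambda>\<omega>. (R ^^ m) (F 0 \<omega>)) y y"
      unfolding inner_commute[of "(R' ^^ m) y"] Gam_inner[of _ _ 0] cov_form_def R_pow_adjoint ..
    also have "\<dots> \<le> (norm y)\<^sup>2 * state_energy m"
    proof (rule power2_le_imp_le)
      show "(cov_form M (\<lambda>\<omega>. (R ^^ m) (F 0 \<omega>)) (\<lambda>\<omega>. (R ^^ m) (F 0 \<omega>)) y y)\<^sup>2 \<le> ((norm y)\<^sup>2 * state_energy m)\<^sup>2"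
        using cov_form_bound[OF RF RF, of y y] by (simp add: state_energy_def power2_eq_square mult_ac)
    qed (simp add: state_energy_nonneg)
    finally show ?thesis .
  qed
  have step: "norm ((R' ^^ Suc m) y) \<le> 1 / 4 * norm ((R' ^^ m) y) + C * sqrt (state_energy (Suc m)) * norm y" for m y
  proof -
    have "norm ((R' ^^ Suc m) y) \<le> 1 / 4 * norm ((R' ^^ m) y) + C * sqrt ((R' ^^ Suc m) y \<bullet> Gam ((R' ^^ Suc m) y))"
      using C(2)[of "(R' ^^ m) y"] by simp
    moreover have "sqrt ((R' ^^ Suc m) y \<bullet> Gam ((R' ^^ Suc m) y)) \<le> sqrt (state_energy (Suc m)) * norm y"
      using real_sqrt_le_mono[OF fade[of "Suc m" y]] by (simp only: real_sqrt_mult real_sqrt_abs abs_norm_cancel mult.commute)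
    from mult_left_mono[OF this C(1)] have "C * sqrt ((R' ^^ Suc m) y \<bullet> Gam ((R' ^^ Suc m) y)) \<le> C * sqrt (state_energy (Suc m)) * norm y"
      by (simp only: mult.assoc)
    ultimately show ?thesis by linarith
  qed
  have "(\<lambda>m. C * sqrt (state_energy m)) \<longlonglongrightarrow> C * sqrt 0"
    using state_is_moving_average by (intro tendsto_intros) auto
  then have "\<forall>\<^sub>F m in sequentially. C * sqrt (state_energy m) < 1 / 8" by (intro order_tendstoD) auto
  then obtain N where N: "\<And>m. m \<ge> N \<Longrightarrow> C * sqrt (state_energy m) < 1 / 8" by (auto simp: eventually_sequentially)
  define B where "B = onorm (R' ^^ N)"
  have B: "norm ((R' ^^ N) y) \<le> B * norm y" for y unfolding B_def by (rule onorm[OF linear_R'_pow])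
  \<comment> \<open>The constant \<open>1/6\<close> is the fixed point of \<open>s = s/4 + 1/8\<close>.\<close>
  have iter: "norm ((R' ^^ (N + k)) y) \<le> ((1/4) ^ k * B + 1/6) * norm y" for k y
  proof (induction k)
    case 0
    show ?case using B[of y] mult_right_mono[of B "B + 1/6" "norm y"] by simp
  next
    case (Suc k)
    have "norm ((R' ^^ Suc (N + k)) y) \<le> 1 / 4 * norm ((R' ^^ (N + k)) y) + C * sqrt (state_energy (Suc (N + k))) * norm y"
      by (rule step)
    also have "\<dots> \<le> 1 / 4 * (((1/4) ^ k * B + 1/6) * norm y) + 1 / 8 * norm y"
      using N[of "Suc (N + k)"] by (intro add_mono mult_left_mono mult_right_mono Suc) auto
    also have "\<dots> = ((1/4) ^ Suc k * B + 1/6) * norm y" by (simp add: algebra_simps)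
    finally show ?case by simp
  qed
  have "(\<lambda>k. (1/4) ^ k * B) \<longlonglongrightarrow> 0 * B" by (intro tendsto_intros LIMSEQ_power_zero) simp
  then have "\<forall>\<^sub>F k in sequentially. (1/4) ^ k * B < 1/3" by (intro order_tendstoD) auto
  then obtain k where k: "(1/4) ^ k * B < 1/3" by (auto simp: eventually_sequentially)
  define m where "m = N + k"
  have R': "norm ((R' ^^ m) x) \<le> 1 / 2 * norm x" for x
  proof -
    have "((1/4) ^ k * B + 1/6) * norm x \<le> 1 / 2 * norm x" using k by (intro mult_right_mono) auto
    then show ?thesis using iter[of k x] by (simp add: m_def)
  qed
  have R: "norm ((R ^^ m) x) \<le> 1 / 2 * norm x" for x
  proof -
    let ?z = "(R ^^ m) x"
    have "norm ?z * norm ?z = x \<bullet> (R' ^^ m) ?z"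
      using R_pow_adjoint[of m x ?z] by (simp add: power2_norm_eq_inner[symmetric] power2_eq_square)
    also have "\<dots> \<le> norm x * norm ((R' ^^ m) ?z)" by (rule norm_cauchy_schwarz)
    also have "\<dots> \<le> norm x * (1 / 2 * norm ?z)" by (intro mult_left_mono R') simp
    finally have "norm ?z * norm ?z \<le> (1 / 2 * norm x) * norm ?z" by simp
    then show ?thesis by (cases "?z = 0") auto
  qed
  show ?thesis using R R' by blast
qed

end

section \<open>Rates for the empirical covariance operators\<close>

text \<open>
  Parseval's identity, applied to the images of the frame under the adjoint. The right-hand side, the
  square of the Hilbert-Schmidt norm, is a sum over scalar entries, so that for a random operator its
  expectation can be computed entry by entry.
\<close>

lemma onorm_le_hilbert_schmidt:
  assumes e: "parseval e" and A: "bounded_linear A" and adj: "\<And>x y. A x \<bullet> y = x \<bullet> A' y"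
  shows "ennreal ((onorm A)\<^sup>2) \<le> (\<Sum>k. \<Sum>l. ennreal ((A (e l) \<bullet> e k)\<^sup>2))"
proof -
  define HS where "HS = (\<Sum>k. \<Sum>l. ennreal ((A (e l) \<bullet> e k)\<^sup>2))"
  have "ennreal ((onorm A)\<^sup>2) \<le> HS"
  proof (cases HS)
    case (real V)
    note V = real(1) real(2)[unfolded HS_def]
  have "norm (A x) \<le> sqrt V * norm x" for x
  proof -
    have "ennreal ((norm (A x))\<^sup>2) = (\<Sum>k. ennreal ((A x \<bullet> e k)\<^sup>2))" by (rule parseval_nn_suminf[OF e, symmetric])
    also have "\<dots> \<le> (\<Sum>k. ennreal ((norm x)\<^sup>2) * (\<Sum>l. ennreal ((A (e l) \<bullet> e k)\<^sup>2)))"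
    proof (intro suminf_le)
      fix k
      have "(A x \<bullet> e k)\<^sup>2 \<le> (norm x)\<^sup>2 * (norm (A' (e k)))\<^sup>2"
        using power_mono[OF Cauchy_Schwarz_ineq2[of x "A' (e k)"], of 2] by (simp add: adj power_mult_distrib)
      then have "ennreal ((A x \<bullet> e k)\<^sup>2) \<le> ennreal ((norm x)\<^sup>2) * ennreal ((norm (A' (e k)))\<^sup>2)"
        by (simp add: ennreal_mult[symmetric] ennreal_leI)
      also have "ennreal ((norm (A' (e k)))\<^sup>2) = (\<Sum>l. ennreal ((A' (e k) \<bullet> e l)\<^sup>2))"
        by (rule parseval_nn_suminf[OF e, symmetric])
      also have "\<dots> = (\<Sum>l. ennreal ((A (e l) \<bullet> e k)\<^sup>2))" by (simp only: adj inner_commute[of "A' (e k)"])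
      finally show "ennreal ((A x \<bullet> e k)\<^sup>2) \<le> ennreal ((norm x)\<^sup>2) * (\<Sum>l. ennreal ((A (e l) \<bullet> e k)\<^sup>2))" .
    qed auto
    also have "\<dots> = ennreal ((norm x)\<^sup>2) * ennreal V" by (simp add: V(2)[symmetric])
    also have "\<dots> = ennreal ((norm x)\<^sup>2 * V)" using V(1) by (simp add: ennreal_mult)
    finally have "(norm (A x))\<^sup>2 \<le> (norm x)\<^sup>2 * V" using V(1) by (simp add: ennreal_le_iff)
    from real_le_rsqrt[OF this] show ?thesis by (simp add: real_sqrt_mult mult.commute)
  qed
  then have "onorm A \<le> sqrt V" using V(1) by (intro onorm_bound) auto
  then have "(onorm A)\<^sup>2 \<le> V" using V(1) onorm_pos_le[OF A] power_mono[of "onorm A" "sqrt V" 2] by simp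
  then show ?thesis unfolding real(2) by (rule ennreal_leI)
  qed simp
  then show ?thesis by (simp only: HS_def)
qed

lemma onorm_adjoint_le:
  assumes A: "bounded_linear A" and adj: "\<And>x y :: 'h::real_inner. A x \<bullet> y = x \<bullet> A' y"
  shows "norm (A' y) \<le> onorm A * norm y"
proof -
  have "norm (A' y) * norm (A' y) = A (A' y) \<bullet> y"
    by (simp add: adj power2_norm_eq_inner[symmetric] power2_eq_square)
  also have "\<dots> \<le> norm (A (A' y)) * norm y" by (rule norm_cauchy_schwarz)
  also have "\<dots> \<le> (onorm A * norm (A' y)) * norm y" by (intro mult_right_mono onorm[OF A]) simp
  finally have "norm (A' y) * norm (A' y) \<le> (onorm A * norm y) * norm (A' y)" by (simp add: mult_ac)
  then show ?thesis using onorm_pos_le[OF A] by (cases "A' y = 0") auto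
qed

lemma mean_square_average:
  fixes X :: "nat \<Rightarrow> 'a \<Rightarrow> real"
  assumes n: "n \<ge> 1" and X: "\<And>i. i \<ge> 1 \<Longrightarrow> X i \<in> borel_measurable M" "\<And>i. i \<ge> 1 \<Longrightarrow> integrable M (\<lambda>\<omega>. (X i \<omega>)\<^sup>2)"
    and orth: "\<And>i j. 1 \<le> i \<Longrightarrow> i < j \<Longrightarrow> (\<integral>\<omega>. X i \<omega> * X j \<omega> \<partial>M) = 0"
    and c: "\<And>i. i \<ge> 1 \<Longrightarrow> (\<integral>\<omega>. (X i \<omega>)\<^sup>2 \<partial>M) \<le> c"
  shows "(\<integral>\<^sup>+\<omega>. ennreal ((1 / real n * (\<Sum>i=1..n. X i \<omega>))\<^sup>2) \<partial>M) \<le> ennreal (1 / real n) * ennreal c"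
proof -
  have int: "integrable M (\<lambda>\<omega>. X i \<omega> * X j \<omega>)" if "i \<ge> 1" "j \<ge> 1" for i j
    using X that by (intro integrable_prod_of_squares) auto
  have orth': "(\<integral>\<omega>. X i \<omega> * X j \<omega> \<partial>M) = 0" if "i \<ge> 1" "j \<ge> 1" "i \<noteq> j" for i j
    using orth[of i j] orth[of j i] that by (cases i j rule: linorder_cases) (auto simp: mult.commute)
  have sq: "(\<Sum>i=1..n. X i \<omega>)\<^sup>2 = (\<Sum>i=1..n. \<Sum>j=1..n. X i \<omega> * X j \<omega>)" for \<omega>
    by (simp add: power2_eq_square sum_product)
  have int_sq: "integrable M (\<lambda>\<omega>. (\<Sum>i=1..n. X i \<omega>)\<^sup>2)"
    unfolding sq using int by (intro Bochner_Integration.integrable_sum) auto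
  have "(\<integral>\<omega>. (\<Sum>i=1..n. X i \<omega>)\<^sup>2 \<partial>M) = (\<Sum>i=1..n. \<integral>\<omega>. (\<Sum>j=1..n. X i \<omega> * X j \<omega>) \<partial>M)"
    unfolding sq using int by (intro Bochner_Integration.integral_sum Bochner_Integration.integrable_sum) auto
  also have "\<dots> = (\<Sum>i=1..n. \<Sum>j=1..n. \<integral>\<omega>. X i \<omega> * X j \<omega> \<partial>M)"
    using int by (intro sum.cong refl Bochner_Integration.integral_sum) auto
  also have "\<dots> = (\<Sum>i=1..n. \<Sum>j=1..n. if j = i then (\<integral>\<omega>. (X i \<omega>)\<^sup>2 \<partial>M) else 0)"
    using orth' by (intro sum.cong refl) (auto simp: power2_eq_square)
  also have "\<dots> = (\<Sum>i=1..n. \<integral>\<omega>. (X i \<omega>)\<^sup>2 \<partial>M)" by (intro sum.cong refl) simp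
  also have "\<dots> \<le> (\<Sum>i=1..n. c)" using c by (intro sum_mono) auto
  finally have le: "(\<integral>\<omega>. (\<Sum>i=1..n. X i \<omega>)\<^sup>2 \<partial>M) \<le> real n * c" by simp
  have "(\<integral>\<^sup>+\<omega>. ennreal ((1 / real n * (\<Sum>i=1..n. X i \<omega>))\<^sup>2) \<partial>M) = ennreal (\<integral>\<omega>. (1 / real n * (\<Sum>i=1..n. X i \<omega>))\<^sup>2 \<partial>M)"
    unfolding power_mult_distrib using int_sq by (intro nn_integral_eq_integral) auto
  also have "\<dots> \<le> ennreal (1 / real n * c)"
  proof (rule ennreal_leI)
    have "(\<integral>\<omega>. (1 / real n * (\<Sum>i=1..n. X i \<omega>))\<^sup>2 \<partial>M) = (1 / real n)\<^sup>2 * (\<integral>\<omega>. (\<Sum>i=1..n. X i \<omega>)\<^sup>2 \<partial>M)"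
      unfolding power_mult_distrib by simp
    also have "\<dots> \<le> (1 / real n)\<^sup>2 * (real n * c)" by (intro mult_left_mono le) simp
    also have "\<dots> = 1 / real n * c" using n by (simp add: power2_eq_square)
    finally show "(\<integral>\<omega>. (1 / real n * (\<Sum>i=1..n. X i \<omega>))\<^sup>2 \<partial>M) \<le> 1 / real n * c" .
  qed
  also have "\<dots> = ennreal (1 / real n) * ennreal c" by (rule ennreal_mult') simp
  finally show ?thesis .
qed

definition average_tensor :: "nat \<Rightarrow> (nat \<Rightarrow> L2) \<Rightarrow> (nat \<Rightarrow> L2) \<Rightarrow> L2 \<Rightarrow> L2"
  where "average_tensor n a b x = (1 / real n) *\<^sub>R (\<Sum>i=1..n. (a i \<bullet> x) *\<^sub>R b i)"

lemma bounded_linear_average_tensor: "bounded_linear (average_tensor n a b)"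
proof -
  have "bounded_linear (\<lambda>x. (1 / real n) *\<^sub>R (\<Sum>i=1..n. (a i \<bullet> x) *\<^sub>R b i))"
    by (intro bounded_linear_const_scaleR bounded_linear_sum bounded_linear_scaleR_const bounded_linear_inner_right)
  then show ?thesis by (simp add: average_tensor_def[abs_def])
qed

lemma average_tensor_inner:
  "average_tensor n a b x \<bullet> y = 1 / real n * (\<Sum>i=1..n. (a i \<bullet> x) * (b i \<bullet> y))"
  by (simp add: average_tensor_def inner_sum_left)

lemma average_tensor_adjoint: "average_tensor n a b x \<bullet> y = x \<bullet> average_tensor n b a y"
  unfolding inner_commute[of x] average_tensor_inner by (simp add: mult.commute)

locale ar1_sample = ar1_process +
  fixes \<alpha> :: "nat \<Rightarrow> real"
  assumes fourth_moment: "integrable M (\<lambda>\<omega>. norm (F k \<omega>) ^ 4)"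
    and Gam_pos: "x \<in> L2_on T \<Longrightarrow> x \<noteq> 0 \<Longrightarrow> 0 < x \<bullet> Gam x"
    and \<alpha>_pos: "\<alpha> n > 0"
    and rate1: "(\<lambda>n. 1 / (real n * \<alpha> n)) \<longlonglongrightarrow> 0" and rate2: "(\<lambda>n. 1 / (real n * (\<alpha> n)\<^sup>2)) \<longlonglongrightarrow> 0"
begin

lemma noise_fourth_moment: "integrable M (\<lambda>\<omega>. norm (E k \<omega>) ^ 4)"
proof -
  have le: "norm (a - R c) ^ 4 \<le> 8 * norm a ^ 4 + 8 * (onorm R ^ 4 * norm c ^ 4)" for a c
  proof -
    have "(norm (a + (- R c)))\<^sup>2 \<le> 2 * (norm a)\<^sup>2 + 2 * (norm (R c))\<^sup>2" using norm_add_sq_le[of a "- R c"] by simp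
    then have "((norm (a - R c))\<^sup>2)\<^sup>2 \<le> (2 * (norm a)\<^sup>2 + 2 * (norm (R c))\<^sup>2)\<^sup>2" by (intro power_mono) auto
    also have "\<dots> \<le> 2 * (2 * (norm a)\<^sup>2)\<^sup>2 + 2 * (2 * (norm (R c))\<^sup>2)\<^sup>2"
      using sum_squares_bound[of "2 * (norm a)\<^sup>2" "2 * (norm (R c))\<^sup>2"] by (simp add: power2_sum)
    finally have "norm (a - R c) ^ 4 \<le> 8 * norm a ^ 4 + 8 * norm (R c) ^ 4" by (simp add: power_mult_distrib)
    also have "norm (R c) ^ 4 \<le> (onorm R * norm c) ^ 4" by (intro power_mono onorm[OF linear_R]) simp
    finally show ?thesis by (simp add: power_mult_distrib)
  qed
  show ?thesis
  proof (rule Bochner_Integration.integrable_bound)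
    show "integrable M (\<lambda>\<omega>. 8 * norm (F (k + 1) \<omega>) ^ 4 + 8 * (onorm R ^ 4 * norm (F k \<omega>) ^ 4))"
      using fourth_moment by auto
    show "AE \<omega> in M. norm (norm (E k \<omega>) ^ 4) \<le> norm (8 * norm (F (k + 1) \<omega>) ^ 4 + 8 * (onorm R ^ 4 * norm (F k \<omega>) ^ 4))"
      using F_recursion[of k]
    proof eventually_elim
      case (elim \<omega>)
      then have "E k \<omega> = F (k + 1) \<omega> - R (F k \<omega>)" by simp
      then show ?case using le[of "F (k + 1) \<omega>" "F k \<omega>"] by simp
    qed
  qed measurable
qed

lemma noise_fourth_products: "integrable M (\<lambda>\<omega>. (E k \<omega> \<bullet> y)\<^sup>2 * (E k \<omega> \<bullet> x)\<^sup>2)"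
proof (rule Bochner_Integration.integrable_bound)
  show "integrable M (\<lambda>\<omega>. ((norm y)\<^sup>2 * (norm x)\<^sup>2) * norm (E k \<omega>) ^ 4)" using noise_fourth_moment by auto
  have "(z \<bullet> y)\<^sup>2 * (z \<bullet> x)\<^sup>2 \<le> ((norm y)\<^sup>2 * (norm x)\<^sup>2) * norm z ^ 4" for z :: L2
    using mult_mono[OF inner_square_le[of z y] inner_square_le[of z x]] by (simp add: mult_ac)
  then show "AE \<omega> in M. norm ((E k \<omega> \<bullet> y)\<^sup>2 * (E k \<omega> \<bullet> x)\<^sup>2) \<le> norm (((norm y)\<^sup>2 * (norm x)\<^sup>2) * norm (E k \<omega>) ^ 4)"
    by simp
qed measurable

lemma E_msq: "msq M (E k) = msq M (E 0)" and F_msq: "msq M (F k) = msq M (F 0)"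
  using noise_energy[of 0 k] state_energy[of 0 k] noise_energy[of 0 0] state_energy[of 0 0] by auto

lemma F_measurable [measurable]: "F k \<in> borel_measurable M"
  using sq_rvD(1)[OF F_rv] .

text \<open>The products \<open>\<epsilon>\<^sub>i \<otimes> f\<^sub>i\<close> form martingale differences, because \<open>f\<^sub>i\<close> is determined by the past
  of the noise.\<close>

lemma noise_state_products:
  fixes i j :: nat
  shows "(\<integral>\<omega>. ((F i \<omega> \<bullet> y) * (E i \<omega> \<bullet> x))\<^sup>2 \<partial>M) = cov_form M (F 0) (F 0) y y * cov_form M (E 0) (E 0) x x"
    and "integrable M (\<lambda>\<omega>. ((F i \<omega> \<bullet> y) * (E i \<omega> \<bullet> x))\<^sup>2)"
    and "i < j \<Longrightarrow> (\<integral>\<omega>. ((F i \<omega> \<bullet> y) * (E i \<omega> \<bullet> x)) * ((F j \<omega> \<bullet> y) * (E j \<omega> \<bullet> x)) \<partial>M) = 0"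
proof -
  obtain g where g: "\<And>k. sq_rv M (g k)" "\<And>k j. k \<le> j \<Longrightarrow> g k \<in> borel_measurable (past j)" "\<And>k. AE \<omega> in M. g k \<omega> = F k \<omega>"
    using state_is_moving_average by blast
  have [measurable]: "g k \<in> borel_measurable M" for k using sq_rvD(1)[OF g(1)] .
  have int2: "integrable M (\<lambda>\<omega>. (g k \<omega> \<bullet> y)\<^sup>2)" "integrable M (\<lambda>\<omega>. (E k \<omega> \<bullet> x)\<^sup>2)" for k
    using sq_rv_inner(1)[OF g(1)] sq_rv_inner(1)[OF E_rv] .
  have sq: "(\<integral>\<omega>. (g i \<omega> \<bullet> y)\<^sup>2 * (E i \<omega> \<bullet> x)\<^sup>2 \<partial>M) = (\<integral>\<omega>. (g i \<omega> \<bullet> y)\<^sup>2 \<partial>M) * (\<integral>\<omega>. (E i \<omega> \<bullet> x)\<^sup>2 \<partial>M)"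
    "integrable M (\<lambda>\<omega>. (g i \<omega> \<bullet> y)\<^sup>2 * (E i \<omega> \<bullet> x)\<^sup>2)" for i :: nat
  proof -
    have m: "(\<lambda>\<omega>. (g i \<omega> \<bullet> y)\<^sup>2) \<in> borel_measurable (past i)" using g(2)[OF order_refl] by measurable
    have "(\<lambda>z. (z \<bullet> x)\<^sup>2) \<in> borel_measurable borel" by measurable
    note * = expectation_past_mult[OF m this int2]
    show "(\<integral>\<omega>. (g i \<omega> \<bullet> y)\<^sup>2 * (E i \<omega> \<bullet> x)\<^sup>2 \<partial>M) = (\<integral>\<omega>. (g i \<omega> \<bullet> y)\<^sup>2 \<partial>M) * (\<integral>\<omega>. (E i \<omega> \<bullet> x)\<^sup>2 \<partial>M)"
      "integrable M (\<lambda>\<omega>. (g i \<omega> \<bullet> y)\<^sup>2 * (E i \<omega> \<bullet> x)\<^sup>2)" by (rule *)+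
  qed
  have cong2: "AE \<omega> in M. ((F i \<omega> \<bullet> y) * (E i \<omega> \<bullet> x))\<^sup>2 = (g i \<omega> \<bullet> y)\<^sup>2 * (E i \<omega> \<bullet> x)\<^sup>2" for i :: nat
    using g(3)[of i] by eventually_elim (simp add: power_mult_distrib)
  show "integrable M (\<lambda>\<omega>. ((F i \<omega> \<bullet> y) * (E i \<omega> \<bullet> x))\<^sup>2)"
    by (rule integrable_cong_AE_imp[OF sq(2)]) (use cong2[of i] in \<open>auto elim: eventually_mono\<close>)
  have gF: "(\<integral>\<omega>. (g i \<omega> \<bullet> y)\<^sup>2 \<partial>M) = cov_form M (F 0) (F 0) y y"
    using cov_form_cong_AE[OF g(1) g(1) F_rv F_rv g(3) g(3), of i i y y] F_stationary[of 0 i 0 y y]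
    by (simp add: cov_form_def power2_eq_square)
  have EE: "(\<integral>\<omega>. (E i \<omega> \<bullet> x)\<^sup>2 \<partial>M) = cov_form M (E 0) (E 0) x x"
    using E_cov_identical[of i x x 0] by (simp add: cov_form_def power2_eq_square)
  have "(\<integral>\<omega>. ((F i \<omega> \<bullet> y) * (E i \<omega> \<bullet> x))\<^sup>2 \<partial>M) = (\<integral>\<omega>. (g i \<omega> \<bullet> y)\<^sup>2 * (E i \<omega> \<bullet> x)\<^sup>2 \<partial>M)"
    by (rule integral_cong_AE) (use cong2[of i] in auto)
  then show "(\<integral>\<omega>. ((F i \<omega> \<bullet> y) * (E i \<omega> \<bullet> x))\<^sup>2 \<partial>M) = cov_form M (F 0) (F 0) y y * cov_form M (E 0) (E 0) x x"
    by (simp only: sq(1) gF EE)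
  assume "i < j"
  let ?u = "\<lambda>\<omega>. (g i \<omega> \<bullet> y) * (E i \<omega> \<bullet> x) * (g j \<omega> \<bullet> y)"
  have [measurable]: "g i \<in> borel_measurable (past j)" "g j \<in> borel_measurable (past j)" "E i \<in> borel_measurable (past j)"
    using \<open>i < j\<close> by (auto intro: g(2) E_past)
  have u: "?u \<in> borel_measurable (past j)" by measurable
  have int_u: "integrable M ?u"
    using sq(2)[of i] int2(1)[of j] by (intro integrable_prod_of_squares) (auto simp: power_mult_distrib)
  have "(\<lambda>z. z \<bullet> x) \<in> borel_measurable borel" by measurable
  from expectation_past_mult(1)[OF u this int_u E_inner_integrable]
  have "(\<integral>\<omega>. ?u \<omega> * (E j \<omega> \<bullet> x) \<partial>M) = 0" by (simp add: E_inner_mean)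
  moreover have "(\<integral>\<omega>. ((F i \<omega> \<bullet> y) * (E i \<omega> \<bullet> x)) * ((F j \<omega> \<bullet> y) * (E j \<omega> \<bullet> x)) \<partial>M) = (\<integral>\<omega>. ?u \<omega> * (E j \<omega> \<bullet> x) \<partial>M)"
  proof (rule integral_cong_AE)
    show "AE \<omega> in M. ((F i \<omega> \<bullet> y) * (E i \<omega> \<bullet> x)) * ((F j \<omega> \<bullet> y) * (E j \<omega> \<bullet> x)) = ?u \<omega> * (E j \<omega> \<bullet> x)"
      using g(3)[of i] g(3)[of j] by eventually_elim (simp add: mult_ac)
  qed measurable
  ultimately show "(\<integral>\<omega>. ((F i \<omega> \<bullet> y) * (E i \<omega> \<bullet> x)) * ((F j \<omega> \<bullet> y) * (E j \<omega> \<bullet> x)) \<partial>M) = 0" by simp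
qed

lemma noise_square_products:
  fixes i j :: nat and x y :: L2
  defines "X \<equiv> \<lambda>i \<omega>. (E (int i) \<omega> \<bullet> y) * (E (int i) \<omega> \<bullet> x) - cov_form M (E 0) (E 0) y x"
  shows "integrable M (\<lambda>\<omega>. (X i \<omega>)\<^sup>2)"
    and "(\<integral>\<omega>. (X i \<omega>)\<^sup>2 \<partial>M) \<le> (\<integral>\<omega>. (E 0 \<omega> \<bullet> y)\<^sup>2 * (E 0 \<omega> \<bullet> x)\<^sup>2 \<partial>M)"
    and "i < j \<Longrightarrow> (\<integral>\<omega>. X i \<omega> * X j \<omega> \<partial>M) = 0"
proof -
  let ?c = "cov_form M (E 0) (E 0) y x"
  have int2: "integrable M (\<lambda>\<omega>. (E k \<omega> \<bullet> y) * (E k \<omega> \<bullet> x))" for k by (rule integrable_cov_form[OF E_rv E_rv])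
  have mean: "(\<integral>\<omega>. (E k \<omega> \<bullet> y) * (E k \<omega> \<bullet> x) \<partial>M) = ?c" for k
    using E_cov_identical[of k y x 0] by (simp only: cov_form_def)
  have X2: "(X i \<omega>)\<^sup>2 = (E i \<omega> \<bullet> y)\<^sup>2 * (E i \<omega> \<bullet> x)\<^sup>2 - 2 * ?c * ((E i \<omega> \<bullet> y) * (E i \<omega> \<bullet> x)) + ?c\<^sup>2" for i \<omega>
    by (simp add: X_def power2_diff power_mult_distrib)
  show "integrable M (\<lambda>\<omega>. (X i \<omega>)\<^sup>2)" unfolding X2 using noise_fourth_products int2 by auto
  have "(\<integral>\<omega>. (X i \<omega>)\<^sup>2 \<partial>M) = (\<integral>\<omega>. (E i \<omega> \<bullet> y)\<^sup>2 * (E i \<omega> \<bullet> x)\<^sup>2 \<partial>M) - 2 * ?c * ?c + ?c\<^sup>2"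
    unfolding X2 using noise_fourth_products[of i y x] int2[of i] mean[of i] by (simp add: prob_space)
  also have "\<dots> \<le> (\<integral>\<omega>. (E i \<omega> \<bullet> y)\<^sup>2 * (E i \<omega> \<bullet> x)\<^sup>2 \<partial>M)" by (simp add: power2_eq_square)
  also have "\<dots> = (\<integral>\<omega>. (E 0 \<omega> \<bullet> y)\<^sup>2 * (E 0 \<omega> \<bullet> x)\<^sup>2 \<partial>M)"
    by (rule E_identical[where h = "\<lambda>z. (z \<bullet> y)\<^sup>2 * (z \<bullet> x)\<^sup>2"]) measurable
  finally show "(\<integral>\<omega>. (X i \<omega>)\<^sup>2 \<partial>M) \<le> (\<integral>\<omega>. (E 0 \<omega> \<bullet> y)\<^sup>2 * (E 0 \<omega> \<bullet> x)\<^sup>2 \<partial>M)" .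
  assume "i < j"
  then have [measurable]: "E i \<in> borel_measurable (past j)" by (intro E_past) simp
  have u: "X i \<in> borel_measurable (past j)" unfolding X_def by measurable
  have int_X: "integrable M (X i)" for i unfolding X_def using int2 by auto
  have "(\<lambda>z. (z \<bullet> y) * (z \<bullet> x) - ?c) \<in> borel_measurable borel" by measurable
  from expectation_past_mult(1)[OF u this int_X int_X[of j, unfolded X_def]]
  show "(\<integral>\<omega>. X i \<omega> * X j \<omega> \<partial>M) = 0"
    using int2[of j] mean[of j] by (simp add: X_def prob_space)
qed

definition cross_error :: "nat \<Rightarrow> 'a \<Rightarrow> L2 \<Rightarrow> L2"
  where "cross_error n \<omega> = average_tensor n (\<lambda>i. F (int i) \<omega>) (\<lambda>i. E (int i) \<omega>)"

definition noise_error :: "nat \<Rightarrow> 'a \<Rightarrow> L2 \<Rightarrow> L2"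
  where "noise_error n \<omega> x = average_tensor n (\<lambda>i. E (int i) \<omega>) (\<lambda>i. E (int i) \<omega>) x - cov_op M (E 0) (E 0) x"

definition noise_mean :: "nat \<Rightarrow> 'a \<Rightarrow> L2"
  where "noise_mean n \<omega> = (1 / real n) *\<^sub>R (\<Sum>i=1..n. E (int i) \<omega>)"

definition boundary :: "nat \<Rightarrow> 'a \<Rightarrow> real"
  where "boundary n \<omega> = ((norm (F 1 \<omega>))\<^sup>2 + (norm (F (int n + 1) \<omega>))\<^sup>2) / real n"

text \<open>Averages over \<open>n - 1\<close> terms occur beside averages over \<open>n\<close> terms; the rates are therefore stated for
  numbers of terms \<open>N n\<close> that are at least \<open>n / 2\<close>.\<close>

lemma rate_shifted:
  assumes N: "\<And>n. n \<ge> 2 \<Longrightarrow> real n \<le> 2 * real (N n)" and p: "p = 1 \<or> p = (2::nat)"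
  shows "(\<lambda>n. c / real (N n) / \<alpha> n ^ p) \<longlonglongrightarrow> 0"
proof (rule Lim_null_comparison)
  have "(\<lambda>n. 1 / (real n * \<alpha> n ^ p)) \<longlonglongrightarrow> 0" using p rate1 rate2 by auto
  then have "(\<lambda>n. 2 * \<bar>c\<bar> * (1 / (real n * \<alpha> n ^ p))) \<longlonglongrightarrow> 2 * \<bar>c\<bar> * 0" by (intro tendsto_intros)
  then show "(\<lambda>n. 2 * \<bar>c\<bar> * (1 / (real n * \<alpha> n ^ p))) \<longlonglongrightarrow> 0" by simp
  show "\<forall>\<^sub>F n in sequentially. norm (c / real (N n) / \<alpha> n ^ p) \<le> 2 * \<bar>c\<bar> * (1 / (real n * \<alpha> n ^ p))"
  proof (rule eventually_sequentiallyI)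
    fix n :: nat assume n: "2 \<le> n"
    have pos: "0 < \<alpha> n ^ p" using \<alpha>_pos by simp
    have "1 / real (N n) \<le> 2 / real n" using N[OF n] n by (simp add: field_simps)
    then have "\<bar>c\<bar> * (1 / real (N n)) / \<alpha> n ^ p \<le> \<bar>c\<bar> * (2 / real n) / \<alpha> n ^ p"
      using pos by (intro divide_right_mono mult_left_mono) auto
    then show "norm (c / real (N n) / \<alpha> n ^ p) \<le> 2 * \<bar>c\<bar> * (1 / (real n * \<alpha> n ^ p))"
      using pos by (simp add: abs_divide mult_ac)
  qed
qed

text \<open>Each entry has variance of order \<open>1 / n\<close> by orthogonality. The sum of these variances over all
  entries is finite because the entries factor into a noise part and a state part, with finite traces.\<close>

lemma cross_error_rate:
  assumes N: "\<And>n. n \<ge> 2 \<Longrightarrow> real n \<le> 2 * real (N n)"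
  shows "o_prob M \<alpha> (\<lambda>n \<omega>. onorm (cross_error (N n) \<omega>))"
proof -
  obtain e :: "nat \<Rightarrow> L2" where e: "parseval e" using ex_parseval by blast
  define D where "D n \<omega> = (\<Sum>k. \<Sum>l. ennreal ((cross_error (N n) \<omega> (e l) \<bullet> e k)\<^sup>2))" for n \<omega>
  define c where "c = msq M (F 0) * msq M (E 0)"
  have [measurable]: "(\<lambda>\<omega>. cross_error n \<omega> x \<bullet> y) \<in> borel_measurable M" for n x y
    unfolding cross_error_def average_tensor_inner by measurable
  have D: "(\<integral>\<^sup>+\<omega>. D n \<omega> \<partial>M) \<le> ennreal (c / real (N n))" if n: "n \<ge> 2" for n
  proof -
    have "N n \<ge> 1" using N[OF n] n by (cases "N n") auto
    have entry: "(\<integral>\<^sup>+\<omega>. ennreal ((cross_error (N n) \<omega> (e l) \<bullet> e k)\<^sup>2) \<partial>M)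
      \<le> ennreal (1 / real (N n)) * ennreal (cov_form M (F 0) (F 0) (e l) (e l) * cov_form M (E 0) (E 0) (e k) (e k))" for k l
      unfolding cross_error_def average_tensor_inner
      by (rule mean_square_average[OF \<open>N n \<ge> 1\<close>]) (use noise_state_products in auto)
    have "(\<integral>\<^sup>+\<omega>. D n \<omega> \<partial>M) = (\<Sum>k. \<Sum>l. \<integral>\<^sup>+\<omega>. ennreal ((cross_error (N n) \<omega> (e l) \<bullet> e k)\<^sup>2) \<partial>M)"
      unfolding D_def by (simp add: nn_integral_suminf)
    also have "\<dots> \<le> (\<Sum>k. \<Sum>l. ennreal (1 / real (N n)) *
        ennreal (cov_form M (F 0) (F 0) (e l) (e l) * cov_form M (E 0) (E 0) (e k) (e k)))"
      by (intro suminf_le entry) auto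
    also have "\<dots> = (\<Sum>k. \<Sum>l. ennreal (1 / real (N n)) * ennreal (cov_form M (E 0) (E 0) (e k) (e k)) *
        ennreal (cov_form M (F 0) (F 0) (e l) (e l)))"
      by (intro suminf_cong) (simp add: cov_form_def ennreal_mult[symmetric] mult_ac)
    also have "\<dots> = ennreal (1 / real (N n)) * (\<Sum>k. ennreal (cov_form M (E 0) (E 0) (e k) (e k))) *
        (\<Sum>l. ennreal (cov_form M (F 0) (F 0) (e l) (e l)))"
      by (simp add: mult.assoc)
    also have "(\<Sum>k. ennreal (cov_form M (E 0) (E 0) (e k) (e k))) = ennreal (msq M (E 0))"
      using inner_expectation_trace[OF e E_rv E_rv] by (intro suminf_ennreal_eq) (auto simp: cov_form_def msq_eq_inner)
    also have "(\<Sum>l. ennreal (cov_form M (F 0) (F 0) (e l) (e l))) = ennreal (msq M (F 0))"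
      using inner_expectation_trace[OF e F_rv F_rv] by (intro suminf_ennreal_eq) (auto simp: cov_form_def msq_eq_inner)
    also have "ennreal (1 / real (N n)) * ennreal (msq M (E 0)) * ennreal (msq M (F 0)) = ennreal (c / real (N n))"
      by (simp add: c_def ennreal_mult[symmetric] mult_ac)
    finally show ?thesis .
  qed
  show ?thesis
  proof (rule o_prob_moment[where p = 2 and ?n0.0 = 2, OF _ D])
    show "D n \<in> borel_measurable M" for n unfolding D_def by measurable
    show "ennreal ((onorm (cross_error (N n) \<omega>))\<^sup>2) \<le> D n \<omega>" for n \<omega>
      unfolding D_def cross_error_def
      by (rule onorm_le_hilbert_schmidt[OF e bounded_linear_average_tensor average_tensor_adjoint])
    show "(\<lambda>n. c / real (N n) / \<alpha> n ^ 2) \<longlonglongrightarrow> 0" by (rule rate_shifted[OF N]) auto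
  qed (auto intro: \<alpha>_pos)
qed

lemma bounded_linear_noise_error: "bounded_linear (noise_error n \<omega>)"
  unfolding noise_error_def[abs_def]
  by (intro bounded_linear_sub bounded_linear_average_tensor bounded_linear_cov_op E_rv)

lemma noise_error_inner: "n \<ge> 1 \<Longrightarrow> noise_error n \<omega> x \<bullet> y =
    1 / real n * (\<Sum>i=1..n. (E (int i) \<omega> \<bullet> x) * (E (int i) \<omega> \<bullet> y) - cov_form M (E 0) (E 0) x y)"
  by (simp add: noise_error_def inner_diff_left average_tensor_inner cov_op_inner[OF E_rv E_rv] sum_subtractf right_diff_distrib)

lemma noise_error_symmetric: "noise_error n \<omega> x \<bullet> y = x \<bullet> noise_error n \<omega> y"
  using average_tensor_adjoint[of n "\<lambda>i. E (int i) \<omega>" "\<lambda>i. E (int i) \<omega>" x y] cov_form_commute[of M "E 0" "E 0" x y]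
  by (simp add: noise_error_def inner_diff_left inner_diff_right cov_op_inner[OF E_rv E_rv] inner_commute[of x "cov_op _ _ _ _"])

text \<open>Here the variances of the entries add up to the fourth moment of the noise.\<close>

lemma noise_error_rate:
  assumes N: "\<And>n. n \<ge> 2 \<Longrightarrow> real n \<le> 2 * real (N n)"
  shows "o_prob M \<alpha> (\<lambda>n \<omega>. onorm (noise_error (N n) \<omega>))"
proof -
  obtain e :: "nat \<Rightarrow> L2" where e: "parseval e" using ex_parseval by blast
  define D where "D n \<omega> = (\<Sum>k. \<Sum>l. ennreal ((noise_error (N n) \<omega> (e l) \<bullet> e k)\<^sup>2))" for n \<omega>
  define c where "c = (\<integral>\<omega>. norm (E 0 \<omega>) ^ 4 \<partial>M)"
  have [measurable]: "(\<lambda>\<omega>. noise_error n \<omega> x \<bullet> y) \<in> borel_measurable M" for n x y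
    unfolding noise_error_def inner_diff_left average_tensor_inner by measurable
  have D: "(\<integral>\<^sup>+\<omega>. D n \<omega> \<partial>M) \<le> ennreal (c / real (N n))" if n: "n \<ge> 2" for n
  proof -
    have n1: "N n \<ge> 1" using N[OF n] n by (cases "N n") auto
    let ?q = "\<lambda>k l \<omega>. (E 0 \<omega> \<bullet> e l)\<^sup>2 * (E 0 \<omega> \<bullet> e k)\<^sup>2"
    have entry: "(\<integral>\<^sup>+\<omega>. ennreal ((noise_error (N n) \<omega> (e l) \<bullet> e k)\<^sup>2) \<partial>M) \<le> ennreal (1 / real (N n)) * (\<integral>\<^sup>+\<omega>. ennreal (?q k l \<omega>) \<partial>M)" for k l
    proof -
      have "(\<integral>\<^sup>+\<omega>. ennreal ((noise_error (N n) \<omega> (e l) \<bullet> e k)\<^sup>2) \<partial>M) \<le> ennreal (1 / real (N n)) * ennreal (\<integral>\<omega>. ?q k l \<omega> \<partial>M)"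
        unfolding noise_error_inner[OF n1]
        by (rule mean_square_average[OF n1]) (use noise_square_products in auto)
      also have "ennreal (\<integral>\<omega>. ?q k l \<omega> \<partial>M) = (\<integral>\<^sup>+\<omega>. ennreal (?q k l \<omega>) \<partial>M)"
        by (rule nn_integral_eq_integral[OF noise_fourth_products, symmetric]) simp
      finally show ?thesis .
    qed
    have "(\<integral>\<^sup>+\<omega>. D n \<omega> \<partial>M) = (\<Sum>k. \<Sum>l. \<integral>\<^sup>+\<omega>. ennreal ((noise_error (N n) \<omega> (e l) \<bullet> e k)\<^sup>2) \<partial>M)"
      unfolding D_def by (simp add: nn_integral_suminf)
    also have "\<dots> \<le> (\<Sum>k. \<Sum>l. ennreal (1 / real (N n)) * (\<integral>\<^sup>+\<omega>. ennreal (?q k l \<omega>) \<partial>M))"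
      by (intro suminf_le entry) auto
    also have "\<dots> = ennreal (1 / real (N n)) * (\<integral>\<^sup>+\<omega>. (\<Sum>k. \<Sum>l. ennreal (?q k l \<omega>)) \<partial>M)"
      by (simp add: nn_integral_suminf)
    also have "(\<integral>\<^sup>+\<omega>. (\<Sum>k. \<Sum>l. ennreal (?q k l \<omega>)) \<partial>M) = (\<integral>\<^sup>+\<omega>. ennreal (norm (E 0 \<omega>) ^ 4) \<partial>M)"
    proof (rule nn_integral_cong)
      fix \<omega>
      have "(\<Sum>k. \<Sum>l. ennreal (?q k l \<omega>)) = (\<Sum>k. (\<Sum>l. ennreal ((E 0 \<omega> \<bullet> e l)\<^sup>2)) * ennreal ((E 0 \<omega> \<bullet> e k)\<^sup>2))"
        by (simp add: ennreal_mult)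
      also have "\<dots> = ennreal ((norm (E 0 \<omega>))\<^sup>2) * ennreal ((norm (E 0 \<omega>))\<^sup>2)"
        by (simp only: parseval_nn_suminf[OF e] ennreal_suminf_cmult)
      also have "\<dots> = ennreal (norm (E 0 \<omega>) ^ 4)" by (simp add: ennreal_mult[symmetric] power2_eq_square power4_eq_xxxx mult_ac)
      finally show "(\<Sum>k. \<Sum>l. ennreal (?q k l \<omega>)) = ennreal (norm (E 0 \<omega>) ^ 4)" .
    qed
    also have "\<dots> = ennreal c"
      unfolding c_def by (rule nn_integral_eq_integral[OF noise_fourth_moment]) simp
    also have "ennreal (1 / real (N n)) * ennreal c = ennreal (c / real (N n))"
      by (simp add: ennreal_mult'[symmetric])
    finally show ?thesis .
  qed
  show ?thesis
  proof (rule o_prob_moment[where p = 2 and ?n0.0 = 2, OF _ D])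
    show "D n \<in> borel_measurable M" for n unfolding D_def by measurable
    show "ennreal ((onorm (noise_error (N n) \<omega>))\<^sup>2) \<le> D n \<omega>" for n \<omega>
      unfolding D_def by (rule onorm_le_hilbert_schmidt[OF e bounded_linear_noise_error noise_error_symmetric])
    show "(\<lambda>n. c / real (N n) / \<alpha> n ^ 2) \<longlonglongrightarrow> 0" by (rule rate_shifted[OF N]) auto
  qed (auto intro: \<alpha>_pos)
qed

lemma noise_mean_rate: "o_prob M \<alpha> (\<lambda>n \<omega>. (norm (noise_mean n \<omega>))\<^sup>2)"
proof (rule o_prob_moment[where p = 1 and ?n0.0 = 2])
  fix n :: nat assume n: "n \<ge> 2"
  have rv: "sq_rv M (\<lambda>\<omega>. \<Sum>i=1..n. E (int i) \<omega>)" by (intro sq_rv_sum E_rv) simp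
  have "msq M (\<lambda>\<omega>. \<Sum>i=1..n. E (int i) \<omega>) = (\<Sum>i=1..n. msq M (E (int i)))"
  proof (rule msq_sum_orthogonal)
    fix i j :: nat assume "i \<noteq> j"
    then have "int i \<noteq> int j" by simp
    from inner_expectation_zero[OF E_rv E_rv E_uncorrelated[OF this]]
    show "(\<integral>\<omega>. E (int i) \<omega> \<bullet> E (int j) \<omega> \<partial>M) = 0" .
  qed (simp, rule E_rv)
  also have "\<dots> = (\<Sum>i=1..n. msq M (E 0))" by (rule sum.cong[OF refl E_msq])
  also have "\<dots> = real n * msq M (E 0)" by simp
  finally have ms: "msq M (\<lambda>\<omega>. \<Sum>i=1..n. E (int i) \<omega>) = real n * msq M (E 0)" .
  have "(\<integral>\<^sup>+\<omega>. ennreal ((norm (noise_mean n \<omega>))\<^sup>2) \<partial>M) = ennreal (\<integral>\<omega>. (norm (noise_mean n \<omega>))\<^sup>2 \<partial>M)"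
    unfolding noise_mean_def norm_scaleR power_mult_distrib using sq_rvD(2)[OF rv]
    by (intro nn_integral_eq_integral) auto
  also have "(\<integral>\<omega>. (norm (noise_mean n \<omega>))\<^sup>2 \<partial>M) = (1 / real n)\<^sup>2 * msq M (\<lambda>\<omega>. \<Sum>i=1..n. E (int i) \<omega>)"
    unfolding noise_mean_def norm_scaleR power_mult_distrib msq_def by simp
  also have "\<dots> = msq M (E 0) / real n" unfolding ms using n by (simp add: power2_eq_square)
  finally show "(\<integral>\<^sup>+\<omega>. ennreal ((norm (noise_mean n \<omega>))\<^sup>2) \<partial>M) \<le> ennreal (msq M (E 0) / real n)" by simp
next
  show "(\<lambda>n. msq M (E 0) / real n / \<alpha> n ^ 1) \<longlonglongrightarrow> 0" by (rule rate_shifted) auto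
  show "(\<lambda>\<omega>. ennreal ((norm (noise_mean n \<omega>))\<^sup>2)) \<in> borel_measurable M" for n unfolding noise_mean_def by measurable
qed (auto intro: \<alpha>_pos)

lemma boundary_rate:
  assumes N: "\<And>n. n \<ge> 2 \<Longrightarrow> real n \<le> 2 * real (N n)"
  shows "o_prob M \<alpha> (\<lambda>n \<omega>. boundary (N n) \<omega>)"
proof (rule o_prob_moment[where p = 1 and ?n0.0 = 2])
  fix n :: nat
  have "(\<integral>\<^sup>+\<omega>. ennreal (boundary (N n) \<omega>) \<partial>M) = ennreal (\<integral>\<omega>. boundary (N n) \<omega> \<partial>M)"
    unfolding boundary_def using sq_rvD(2)[OF F_rv] by (intro nn_integral_eq_integral) auto
  also have "(\<integral>\<omega>. boundary (N n) \<omega> \<partial>M) = 2 * msq M (F 0) / real (N n)"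
    unfolding boundary_def using sq_rvD(2)[OF F_rv] F_msq[of 1] F_msq[of "int (N n) + 1"] by (simp add: msq_def)
  finally show "(\<integral>\<^sup>+\<omega>. ennreal (boundary (N n) \<omega>) \<partial>M) \<le> ennreal (2 * msq M (F 0) / real (N n))" by simp
next
  show "(\<lambda>n. 2 * msq M (F 0) / real (N n) / \<alpha> n ^ 1) \<longlonglongrightarrow> 0" by (rule rate_shifted[OF N]) auto
  show "(\<lambda>\<omega>. ennreal (boundary (N n) \<omega>)) \<in> borel_measurable M" for n unfolding boundary_def by measurable
qed (auto intro: \<alpha>_pos)

end

section \<open>Consistency of the empirical covariance operators\<close>

lemma norm_tensor_le: "norm ((a \<bullet> x) *\<^sub>R a) \<le> (norm a)\<^sup>2 * norm x" for a x :: L2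
  using mult_right_mono[OF Cauchy_Schwarz_ineq2[of a x] norm_ge_zero[of a]] by (simp add: power2_eq_square mult_ac)

context ar1_sample
begin

definition memory :: nat where
  "memory = (SOME m. \<forall>x. norm ((R ^^ m) x) \<le> 1 / 2 * norm x \<and> norm ((R' ^^ m) x) \<le> 1 / 2 * norm x)"

lemma memory: "norm ((R ^^ memory) x) \<le> 1 / 2 * norm x" "norm ((R' ^^ memory) x) \<le> 1 / 2 * norm x"
  using someI_ex[OF power_contraction[OF Gam_pos]] unfolding memory_def by auto

definition operator_const :: real where
  "operator_const = 2 * (\<Sum>j<memory. onorm (R ^^ j) * onorm (R' ^^ j))"

definition vector_const :: real where
  "vector_const = 2 * (\<Sum>j<memory. onorm (R ^^ j))"

lemma operator_const_nonneg: "operator_const \<ge> 0"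
  unfolding operator_const_def
  by (intro mult_nonneg_nonneg sum_nonneg onorm_pos_le linear_R_pow linear_R'_pow) simp

text \<open>A discrete Lyapunov equation. Iterated \<^const>\<open>memory\<close> times, it shrinks \<open>Z\<close> by the factor \<open>1 / 4\<close> and
  collects finitely many images of \<open>W\<close>.\<close>

lemma lyapunov_bound:
  assumes Z: "bounded_linear Z" and eq: "\<And>x. Z x = R (Z (R' x)) + W x"
    and W: "\<And>x. norm (W x) \<le> w * norm x" and w: "w \<ge> 0"
  shows "onorm Z \<le> operator_const * w"
proof -
  have iter: "Z x = (R ^^ k) (Z ((R' ^^ k) x)) + (\<Sum>j<k. (R ^^ j) (W ((R' ^^ j) x)))" for k x
  proof (induction k)
    case (Suc k)
    have "(R ^^ k) (Z ((R' ^^ k) x)) = (R ^^ Suc k) (Z ((R' ^^ Suc k) x)) + (R ^^ k) (W ((R' ^^ k) x))"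
      using eq[of "(R' ^^ k) x"] by (simp add: linear_add[OF bounded_linear.linear[OF linear_R_pow]] funpow_swap1)
    then show ?case using Suc by simp
  qed simp
  define s where "s = (\<Sum>j<memory. onorm (R ^^ j) * onorm (R' ^^ j))"
  have "norm (Z x) \<le> (1 / 4 * onorm Z + w * s) * norm x" for x
  proof -
    have "norm (Z x) \<le> norm ((R ^^ memory) (Z ((R' ^^ memory) x))) + norm (\<Sum>j<memory. (R ^^ j) (W ((R' ^^ j) x)))"
      by (subst iter[of x memory]) (rule norm_triangle_ineq)
    moreover have "norm ((R ^^ memory) (Z ((R' ^^ memory) x))) \<le> 1 / 4 * onorm Z * norm x"
    proof -
      have "norm ((R ^^ memory) (Z ((R' ^^ memory) x))) \<le> 1 / 2 * norm (Z ((R' ^^ memory) x))" by (rule memory)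
      also have "\<dots> \<le> 1 / 2 * (onorm Z * norm ((R' ^^ memory) x))" by (intro mult_left_mono onorm[OF Z]) simp
      also have "\<dots> \<le> 1 / 2 * (onorm Z * (1 / 2 * norm x))"
        by (intro mult_left_mono memory onorm_pos_le[OF Z]) simp
      finally show ?thesis by simp
    qed
    moreover have "norm (\<Sum>j<memory. (R ^^ j) (W ((R' ^^ j) x))) \<le> w * s * norm x"
    proof -
      have "norm (\<Sum>j<memory. (R ^^ j) (W ((R' ^^ j) x))) \<le> (\<Sum>j<memory. norm ((R ^^ j) (W ((R' ^^ j) x))))" by (rule norm_sum)
      also have "\<dots> \<le> (\<Sum>j<memory. onorm (R ^^ j) * (w * (onorm (R' ^^ j) * norm x)))"
      proof (rule sum_mono)
        fix j
        have "norm ((R ^^ j) (W ((R' ^^ j) x))) \<le> onorm (R ^^ j) * norm (W ((R' ^^ j) x))" by (rule onorm[OF linear_R_pow])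
        also have "\<dots> \<le> onorm (R ^^ j) * (w * norm ((R' ^^ j) x))"
          by (intro mult_left_mono W onorm_pos_le linear_R_pow)
        also have "\<dots> \<le> onorm (R ^^ j) * (w * (onorm (R' ^^ j) * norm x))"
          by (intro mult_left_mono onorm[OF linear_R'_pow] w onorm_pos_le linear_R_pow)
        finally show "norm ((R ^^ j) (W ((R' ^^ j) x))) \<le> onorm (R ^^ j) * (w * (onorm (R' ^^ j) * norm x))" .
      qed
      also have "\<dots> = w * s * norm x" by (simp add: s_def sum_distrib_left sum_distrib_right mult_ac)
      finally show ?thesis .
    qed
    ultimately show ?thesis by (simp add: distrib_right)
  qed
  moreover have s: "s \<ge> 0" unfolding s_def by (intro sum_nonneg mult_nonneg_nonneg onorm_pos_le linear_R_pow linear_R'_pow)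
  ultimately have "onorm Z \<le> 1 / 4 * onorm Z + w * s"
    using onorm_pos_le[OF Z] w by (intro onorm_bound) auto
  then have "onorm Z \<le> 4 / 3 * (w * s)" by simp
  also have "\<dots> \<le> 2 * (w * s)" using w s by (intro mult_right_mono) auto
  finally show ?thesis by (simp add: operator_const_def s_def mult_ac)
qed

lemma fixed_point_bound:
  assumes eq: "v = R v + u"
  shows "norm v \<le> vector_const * norm u"
proof -
  have iter: "v = (R ^^ k) v + (\<Sum>j<k. (R ^^ j) u)" for k
  proof (induction k)
    case (Suc k)
    have "(R ^^ k) v = (R ^^ k) (R v + u)" using eq by (rule arg_cong)
    also have "\<dots> = (R ^^ Suc k) v + (R ^^ k) u"
      by (simp add: linear_add[OF bounded_linear.linear[OF linear_R_pow]] funpow_swap1)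
    finally have "(R ^^ k) v = (R ^^ Suc k) v + (R ^^ k) u" .
    then show ?case using Suc by (simp only: sum.lessThan_Suc) (metis add.assoc add.commute)
  qed simp
  have "norm v \<le> norm ((R ^^ memory) v) + norm (\<Sum>j<memory. (R ^^ j) u)"
    by (subst iter[of memory]) (rule norm_triangle_ineq)
  also have "\<dots> \<le> 1 / 2 * norm v + (\<Sum>j<memory. onorm (R ^^ j) * norm u)"
    by (intro add_mono memory order_trans[OF norm_sum] sum_mono onorm[OF linear_R_pow])
  finally show ?thesis by (simp add: vector_const_def sum_distrib_right[symmetric])
qed

definition second_moment :: "nat \<Rightarrow> 'a \<Rightarrow> L2 \<Rightarrow> L2"
  where "second_moment n \<omega> = average_tensor n (\<lambda>i. F (int i) \<omega>) (\<lambda>i. F (int i) \<omega>)"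

definition state_error :: "nat \<Rightarrow> 'a \<Rightarrow> L2 \<Rightarrow> L2"
  where "state_error n \<omega> x = second_moment n \<omega> x - Gam x"

definition state_mean :: "nat \<Rightarrow> 'a \<Rightarrow> L2"
  where "state_mean n \<omega> = (1 / real n) *\<^sub>R (\<Sum>i=1..n. F (int i) \<omega>)"

definition follows_model :: "'a \<Rightarrow> bool"
  where "follows_model \<omega> \<longleftrightarrow> (\<forall>i::nat. F (int i + 1) \<omega> = R (F (int i) \<omega>) + E (int i) \<omega>)"

lemma AE_follows_model: "AE \<omega> in M. follows_model \<omega>"
  unfolding follows_model_def AE_all_countable using F_recursion by blast

lemma Gam_balance: "Gam x = R (Gam (R' x)) + cov_op M (E 0) (E 0) x"
proof (rule vector_eq_rdot[THEN iffD1], rule allI)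
  fix y
  have RF: "sq_rv M (\<lambda>\<omega>. R (F 0 \<omega>))" by (rule sq_rv_bounded_linear[OF linear_R F_rv])
  have sum: "sq_rv M (\<lambda>\<omega>. R (F 0 \<omega>) + E 0 \<omega>)" by (rule sq_rv_add[OF RF E_rv])
  have rec: "AE \<omega> in M. F 1 \<omega> = R (F 0 \<omega>) + E 0 \<omega>" using F_recursion[of 0] by simp
  have cross: "cov_form M (\<lambda>\<omega>. R (F 0 \<omega>)) (E 0) x y = 0" "cov_form M (\<lambda>\<omega>. R (F 0 \<omega>)) (E 0) y x = 0" for x y
    unfolding cov_form_adjoint_left[OF R_adjoint] by (rule F_E_uncorrelated)+
  have "Gam x \<bullet> y = cov_form M (\<lambda>\<omega>. R (F 0 \<omega>) + E 0 \<omega>) (\<lambda>\<omega>. R (F 0 \<omega>) + E 0 \<omega>) x y"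
    unfolding Gam_inner[of x y 1] by (rule cov_form_cong_AE[OF F_rv F_rv sum sum rec rec])
  also have "\<dots> = cov_form M (\<lambda>\<omega>. R (F 0 \<omega>)) (\<lambda>\<omega>. R (F 0 \<omega>) + E 0 \<omega>) x y + cov_form M (E 0) (\<lambda>\<omega>. R (F 0 \<omega>) + E 0 \<omega>) x y"
    by (rule cov_form_add_left[OF RF E_rv sum])
  also have "cov_form M (\<lambda>\<omega>. R (F 0 \<omega>)) (\<lambda>\<omega>. R (F 0 \<omega>) + E 0 \<omega>) x y = cov_form M (\<lambda>\<omega>. R (F 0 \<omega>)) (\<lambda>\<omega>. R (F 0 \<omega>)) y x"
    unfolding cov_form_commute[of M _ "\<lambda>\<omega>. R (F 0 \<omega>) + E 0 \<omega>"] cov_form_add_left[OF RF E_rv RF]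
    using cross(1)[of x y] by (simp only: cov_form_commute[of M "E 0"] add_0_right)
  also have "cov_form M (E 0) (\<lambda>\<omega>. R (F 0 \<omega>) + E 0 \<omega>) x y = cov_form M (E 0) (E 0) x y"
    unfolding cov_form_commute[of M _ "\<lambda>\<omega>. R (F 0 \<omega>) + E 0 \<omega>"] cov_form_add_left[OF RF E_rv E_rv] cross
    by (simp only: add_0_left cov_form_commute[of M "E 0" "E 0" y])
  also have "cov_form M (\<lambda>\<omega>. R (F 0 \<omega>)) (\<lambda>\<omega>. R (F 0 \<omega>)) y x = Gam (R' x) \<bullet> R' y"
    unfolding cov_form_commute[of M _ _ y x] Gam_inner[of _ _ 0] cov_form_def R_adjoint
    by (simp only: mult.commute)
  also have "Gam (R' x) \<bullet> R' y = R (Gam (R' x)) \<bullet> y" by (rule R_adjoint[symmetric])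
  finally show "Gam x \<bullet> y = (R (Gam (R' x)) + cov_op M (E 0) (E 0) x) \<bullet> y"
    by (simp add: inner_add_left cov_op_inner[OF E_rv E_rv])
qed

lemma sum_shift: "(\<Sum>i=1..n. h (int i + 1)) = (\<Sum>i=1..n. h (int i)) + h (int n + 1) - (h 1 :: 'b::real_vector)"
  by (induction n) (simp_all add: add.commute)

text \<open>
  Substituting the model into each summand reproduces the second moment conjugated by the transition
  operator. What remains are averages of martingale differences and a boundary term from shifting
  the sum, so the error solves a Lyapunov equation with a small inhomogeneity.
\<close>

lemma state_error_recursion:
  assumes fm: "follows_model \<omega>"
  shows "state_error n \<omega> x = R (state_error n \<omega> (R' x)) +
    (cross_error n \<omega> (R' x) + R (average_tensor n (\<lambda>i. E (int i) \<omega>) (\<lambda>i. F (int i) \<omega>) x) + noise_error n \<omega> x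
      + (1 / real n) *\<^sub>R ((F 1 \<omega> \<bullet> x) *\<^sub>R F 1 \<omega> - (F (int n + 1) \<omega> \<bullet> x) *\<^sub>R F (int n + 1) \<omega>))"
proof -
  note lin = bounded_linear.linear[OF linear_R]
  let ?F = "\<lambda>i. F (int i) \<omega>" and ?E = "\<lambda>i. E (int i) \<omega>"
  have rec: "F (int i + 1) \<omega> = R (?F i) + ?E i" for i using fm by (simp add: follows_model_def)
  have "(\<Sum>i=1..n. (F (int i + 1) \<omega> \<bullet> x) *\<^sub>R F (int i + 1) \<omega>) =
    (\<Sum>i=1..n. (?F i \<bullet> R' x) *\<^sub>R R (?F i) + (?F i \<bullet> R' x) *\<^sub>R ?E i + (?E i \<bullet> x) *\<^sub>R R (?F i) + (?E i \<bullet> x) *\<^sub>R ?E i)"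
    unfolding rec by (intro sum.cong refl) (simp add: inner_add_left R_adjoint scaleR_add_left scaleR_add_right)
  also have "\<dots> = R (\<Sum>i=1..n. (?F i \<bullet> R' x) *\<^sub>R ?F i) + (\<Sum>i=1..n. (?F i \<bullet> R' x) *\<^sub>R ?E i)
      + R (\<Sum>i=1..n. (?E i \<bullet> x) *\<^sub>R ?F i) + (\<Sum>i=1..n. (?E i \<bullet> x) *\<^sub>R ?E i)"
    by (simp add: sum.distrib linear_sum[OF lin] linear_scale[OF lin])
  finally have "(1 / real n) *\<^sub>R (\<Sum>i=1..n. (F (int i + 1) \<omega> \<bullet> x) *\<^sub>R F (int i + 1) \<omega>) =
    R (second_moment n \<omega> (R' x)) + cross_error n \<omega> (R' x) + R (average_tensor n ?E ?F x) + average_tensor n ?E ?E x"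
    by (simp add: second_moment_def cross_error_def average_tensor_def linear_scale[OF lin] scaleR_add_right)
  moreover have "(1 / real n) *\<^sub>R (\<Sum>i=1..n. (F (int i + 1) \<omega> \<bullet> x) *\<^sub>R F (int i + 1) \<omega>) = second_moment n \<omega> x
    + (1 / real n) *\<^sub>R ((F (int n + 1) \<omega> \<bullet> x) *\<^sub>R F (int n + 1) \<omega> - (F 1 \<omega> \<bullet> x) *\<^sub>R F 1 \<omega>)"
    unfolding sum_shift[of "\<lambda>k. (F k \<omega> \<bullet> x) *\<^sub>R F k \<omega>"]
    by (simp add: second_moment_def average_tensor_def scaleR_add_right scaleR_diff_right)
  ultimately have "second_moment n \<omega> x = R (second_moment n \<omega> (R' x)) + cross_error n \<omega> (R' x)
    + R (average_tensor n ?E ?F x) + average_tensor n ?E ?E x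
    + (1 / real n) *\<^sub>R ((F 1 \<omega> \<bullet> x) *\<^sub>R F 1 \<omega> - (F (int n + 1) \<omega> \<bullet> x) *\<^sub>R F (int n + 1) \<omega>)"
    by (simp add: scaleR_diff_right algebra_simps)
  then show ?thesis
    by (simp add: state_error_def noise_error_def linear_diff[OF lin] Gam_balance[of x] algebra_simps)
qed

lemma bounded_linear_state_error: "bounded_linear (state_error n \<omega>)"
  unfolding state_error_def[abs_def] second_moment_def
  by (intro bounded_linear_sub bounded_linear_average_tensor linear_Gam)

lemma boundary_nonneg: "boundary n \<omega> \<ge> 0"
  by (simp add: boundary_def)

lemma state_error_le:
  assumes fm: "follows_model \<omega>"
  shows "onorm (state_error n \<omega>) \<le> operator_const *
    ((onorm R' + onorm R) * onorm (cross_error n \<omega>) + onorm (noise_error n \<omega>) + boundary n \<omega>)"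
proof (rule lyapunov_bound[OF bounded_linear_state_error state_error_recursion[OF fm]])
  have lin_cross: "bounded_linear (cross_error n \<omega>)"
    unfolding cross_error_def by (rule bounded_linear_average_tensor)
  note pos = onorm_pos_le[OF linear_R] onorm_pos_le[OF linear_R'] onorm_pos_le[OF lin_cross] onorm_pos_le[OF bounded_linear_noise_error]
  show "0 \<le> (onorm R' + onorm R) * onorm (cross_error n \<omega>) + onorm (noise_error n \<omega>) + boundary n \<omega>"
    using pos boundary_nonneg by (intro add_nonneg_nonneg mult_nonneg_nonneg) auto
  fix x
  let ?T = "average_tensor n (\<lambda>i. E (int i) \<omega>) (\<lambda>i. F (int i) \<omega>)"
  let ?B = "(1 / real n) *\<^sub>R ((F 1 \<omega> \<bullet> x) *\<^sub>R F 1 \<omega> - (F (int n + 1) \<omega> \<bullet> x) *\<^sub>R F (int n + 1) \<omega>)"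
  have "norm (cross_error n \<omega> (R' x)) \<le> onorm (cross_error n \<omega>) * norm (R' x)" by (rule onorm[OF lin_cross])
  also have "\<dots> \<le> onorm (cross_error n \<omega>) * (onorm R' * norm x)" by (intro mult_left_mono onorm[OF linear_R'] pos)
  finally have 1: "norm (cross_error n \<omega> (R' x)) \<le> onorm R' * onorm (cross_error n \<omega>) * norm x" by (simp add: mult_ac)
  have "norm (R (?T x)) \<le> onorm R * norm (?T x)" by (rule onorm[OF linear_R])
  also have "\<dots> \<le> onorm R * (onorm (cross_error n \<omega>) * norm x)"
    using average_tensor_adjoint unfolding cross_error_def
    by (intro mult_left_mono onorm_adjoint_le[OF bounded_linear_average_tensor] pos)
  finally have 2: "norm (R (?T x)) \<le> onorm R * onorm (cross_error n \<omega>) * norm x" by (simp add: mult_ac)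
  have 3: "norm (noise_error n \<omega> x) \<le> onorm (noise_error n \<omega>) * norm x" by (rule onorm[OF bounded_linear_noise_error])
  have "norm ?B \<le> (1 / real n) * (norm ((F 1 \<omega> \<bullet> x) *\<^sub>R F 1 \<omega>) + norm ((F (int n + 1) \<omega> \<bullet> x) *\<^sub>R F (int n + 1) \<omega>))"
    unfolding norm_scaleR[of "1 / real n"] by (rule mult_mono[OF _ norm_triangle_ineq4]) auto
  also have "\<dots> \<le> (1 / real n) * ((norm (F 1 \<omega>))\<^sup>2 * norm x + (norm (F (int n + 1) \<omega>))\<^sup>2 * norm x)"
    by (intro mult_left_mono add_mono norm_tensor_le) simp
  finally have 4: "norm ?B \<le> boundary n \<omega> * norm x" by (simp add: boundary_def add_divide_distrib distrib_right)
  have "norm (cross_error n \<omega> (R' x) + R (?T x) + noise_error n \<omega> x + ?B)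
    \<le> norm (cross_error n \<omega> (R' x)) + norm (R (?T x)) + norm (noise_error n \<omega> x) + norm ?B"
    by (intro order_trans[OF norm_triangle_ineq] add_mono order_refl)
  also have "\<dots> \<le> onorm R' * onorm (cross_error n \<omega>) * norm x + onorm R * onorm (cross_error n \<omega>) * norm x
    + onorm (noise_error n \<omega>) * norm x + boundary n \<omega> * norm x"
    using 1 2 3 4 by linarith
  finally show "norm (cross_error n \<omega> (R' x) + R (?T x) + noise_error n \<omega> x + ?B)
    \<le> ((onorm R' + onorm R) * onorm (cross_error n \<omega>) + onorm (noise_error n \<omega>) + boundary n \<omega>) * norm x"
    by (simp add: distrib_right)
qed

lemma state_error_rate:
  assumes N: "\<And>n. n \<ge> 2 \<Longrightarrow> real n \<le> 2 * real (N n)"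
  shows "o_prob M \<alpha> (\<lambda>n \<omega>. onorm (state_error (N n) \<omega>))"
proof (rule o_prob_mono_AE[where ?n0.0 = 0])
  show "o_prob M \<alpha> (\<lambda>n \<omega>. operator_const * ((onorm R' + onorm R) * onorm (cross_error (N n) \<omega>)
      + onorm (noise_error (N n) \<omega>) + boundary (N n) \<omega>))"
    by (intro o_prob_cmult o_prob_add cross_error_rate noise_error_rate boundary_rate N operator_const_nonneg \<alpha>_pos
        add_nonneg_nonneg onorm_pos_le linear_R linear_R')
  show "AE \<omega> in M. onorm (state_error (N n) \<omega>) \<le> operator_const * ((onorm R' + onorm R) * onorm (cross_error (N n) \<omega>)
      + onorm (noise_error (N n) \<omega>) + boundary (N n) \<omega>)" for n
    using AE_follows_model by eventually_elim (rule state_error_le)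
qed

lemma state_mean_le:
  assumes fm: "follows_model \<omega>" and n: "n \<ge> 1"
  shows "(norm (state_mean n \<omega>))\<^sup>2 \<le> vector_const\<^sup>2 * (2 * (norm (noise_mean n \<omega>))\<^sup>2 + 4 * boundary n \<omega>)"
proof -
  note lin = bounded_linear.linear[OF linear_R]
  let ?d = "(1 / real n) *\<^sub>R (F 1 \<omega> - F (int n + 1) \<omega>)"
  have rec: "F (int i + 1) \<omega> = R (F (int i) \<omega>) + E (int i) \<omega>" for i using fm by (simp add: follows_model_def)
  have "(\<Sum>i=1..n. F (int i + 1) \<omega>) = R (\<Sum>i=1..n. F (int i) \<omega>) + (\<Sum>i=1..n. E (int i) \<omega>)"
    unfolding rec by (simp add: sum.distrib linear_sum[OF lin])
  then have "(\<Sum>i=1..n. F (int i) \<omega>) = R (\<Sum>i=1..n. F (int i) \<omega>) + (\<Sum>i=1..n. E (int i) \<omega>) + (F 1 \<omega> - F (int n + 1) \<omega>)"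
    unfolding sum_shift[of "\<lambda>k. F k \<omega>"] by (simp add: algebra_simps)
  then have "state_mean n \<omega> = (1 / real n) *\<^sub>R (R (\<Sum>i=1..n. F (int i) \<omega>) + (\<Sum>i=1..n. E (int i) \<omega>) + (F 1 \<omega> - F (int n + 1) \<omega>))"
    unfolding state_mean_def by (rule arg_cong)
  moreover have "R (state_mean n \<omega>) = (1 / real n) *\<^sub>R R (\<Sum>i=1..n. F (int i) \<omega>)"
    by (simp only: state_mean_def linear_scale[OF lin])
  ultimately have "state_mean n \<omega> = R (state_mean n \<omega>) + (noise_mean n \<omega> + ?d)"
    by (simp only: noise_mean_def scaleR_add_right add.assoc)
  from fixed_point_bound[OF this] have "(norm (state_mean n \<omega>))\<^sup>2 \<le> (vector_const * norm (noise_mean n \<omega> + ?d))\<^sup>2"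
    by (intro power_mono) auto
  also have "\<dots> = vector_const\<^sup>2 * (norm (noise_mean n \<omega> + ?d))\<^sup>2" by (simp add: power_mult_distrib)
  also have "\<dots> \<le> vector_const\<^sup>2 * (2 * (norm (noise_mean n \<omega>))\<^sup>2 + 4 * boundary n \<omega>)"
  proof (rule mult_left_mono)
    have "(norm ?d)\<^sup>2 = (1 / real n)\<^sup>2 * (norm (F 1 \<omega> + (- F (int n + 1) \<omega>)))\<^sup>2"
      by (simp add: power_mult_distrib power_divide)
    also have "\<dots> \<le> (1 / real n)\<^sup>2 * (2 * (norm (F 1 \<omega>))\<^sup>2 + 2 * (norm (- F (int n + 1) \<omega>))\<^sup>2)"
      by (intro mult_left_mono norm_add_sq_le) simp
    also have "\<dots> = (1 / real n) * (2 * boundary n \<omega>)"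
      by (simp add: boundary_def power2_eq_square add_divide_distrib)
    also have "\<dots> \<le> 1 * (2 * boundary n \<omega>)" using n boundary_nonneg by (intro mult_right_mono) auto
    finally show "(norm (noise_mean n \<omega> + ?d))\<^sup>2 \<le> 2 * (norm (noise_mean n \<omega>))\<^sup>2 + 4 * boundary n \<omega>"
      using norm_add_sq_le[of "noise_mean n \<omega>" ?d] by linarith
  qed simp
  finally show ?thesis .
qed

lemma state_mean_rate: "o_prob M \<alpha> (\<lambda>n \<omega>. (norm (state_mean n \<omega>))\<^sup>2)"
proof (rule o_prob_mono_AE[where ?n0.0 = 1])
  show "o_prob M \<alpha> (\<lambda>n \<omega>. vector_const\<^sup>2 * (2 * (norm (noise_mean n \<omega>))\<^sup>2 + 4 * boundary n \<omega>))"
    by (intro o_prob_cmult o_prob_add noise_mean_rate boundary_rate \<alpha>_pos) auto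
  show "AE \<omega> in M. (norm (state_mean n \<omega>))\<^sup>2 \<le> vector_const\<^sup>2 * (2 * (norm (noise_mean n \<omega>))\<^sup>2 + 4 * boundary n \<omega>)" if "n \<ge> 1" for n
    using AE_follows_model by eventually_elim (rule state_mean_le[OF _ that])
qed

text \<open>The empirical operators without their kernels.\<close>

definition G11 :: "nat \<Rightarrow> 'a \<Rightarrow> L2 \<Rightarrow> L2"
  where "G11 n \<omega> x = second_moment n \<omega> x - (state_mean n \<omega> \<bullet> x) *\<^sub>R state_mean n \<omega>"

definition G12 :: "nat \<Rightarrow> 'a \<Rightarrow> L2 \<Rightarrow> L2"
  where "G12 n \<omega> x = average_tensor (n - 1) (\<lambda>i. F (int i) \<omega>) (\<lambda>i. F (int i + 1) \<omega>) x
    - (state_mean n \<omega> \<bullet> x) *\<^sub>R state_mean n \<omega>"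

definition G21 :: "nat \<Rightarrow> 'a \<Rightarrow> L2 \<Rightarrow> L2"
  where "G21 n \<omega> x = average_tensor (n - 1) (\<lambda>i. F (int i + 1) \<omega>) (\<lambda>i. F (int i) \<omega>) x
    - (state_mean n \<omega> \<bullet> x) *\<^sub>R state_mean n \<omega>"

lemma bounded_linear_tensor: "bounded_linear (\<lambda>x. (a \<bullet> x) *\<^sub>R a)" for a :: L2
  by (intro bounded_linear_scaleR_const bounded_linear_inner_right)

lemma linear_G11: "bounded_linear (G11 n \<omega>)" and linear_G12: "bounded_linear (G12 n \<omega>)" and linear_G21: "bounded_linear (G21 n \<omega>)"
  unfolding G11_def[abs_def] G12_def[abs_def] G21_def[abs_def] second_moment_def
  by (intro bounded_linear_sub bounded_linear_average_tensor bounded_linear_tensor)+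

lemma G12_adjoint: "G12 n \<omega> x \<bullet> y = x \<bullet> G21 n \<omega> y"
  unfolding G12_def G21_def inner_diff_left inner_diff_right average_tensor_adjoint
  by (simp add: inner_commute[of x "state_mean n \<omega>"] mult.commute)

lemma G11_symmetric: "G11 n \<omega> x \<bullet> y = x \<bullet> G11 n \<omega> y"
  unfolding G11_def second_moment_def inner_diff_left inner_diff_right average_tensor_adjoint
  by (simp add: inner_commute[of x "state_mean n \<omega>"] mult.commute)

lemma G11_nonneg: "0 \<le> x \<bullet> G11 n \<omega> x"
proof -
  let ?a = "\<lambda>i. F (int i) \<omega> \<bullet> x"
  have "(state_mean n \<omega> \<bullet> x)\<^sup>2 = (1 / real n)\<^sup>2 * (\<Sum>i=1..n. 1 * ?a i)\<^sup>2"
    by (simp add: state_mean_def inner_sum_left power_divide)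
  also have "\<dots> \<le> (1 / real n)\<^sup>2 * ((\<Sum>i=1..n. 1\<^sup>2) * (\<Sum>i=1..n. (?a i)\<^sup>2))"
    by (intro mult_left_mono Cauchy_Schwarz_ineq_sum) simp
  also have "\<dots> = 1 / real n * (\<Sum>i=1..n. (?a i)\<^sup>2)" by (cases "n = 0") (simp_all add: power2_eq_square)
  finally have "(state_mean n \<omega> \<bullet> x)\<^sup>2 \<le> second_moment n \<omega> x \<bullet> x"
    by (simp add: second_moment_def average_tensor_inner power2_eq_square)
  then show ?thesis by (simp add: G11_def inner_diff_right inner_commute[of x] power2_eq_square)
qed

lemma sample_range:
  assumes "\<omega> \<in> space M"
  shows "G11 n \<omega> x \<in> L2_on T" "G21 n \<omega> x \<in> L2_on T"
  unfolding G11_def G21_def second_moment_def average_tensor_def state_mean_def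
  by (intro subspace_diff[OF subspace_L2_on] subspace_scale[OF subspace_L2_on] subspace_sum[OF subspace_L2_on] F_mem assms)+

definition total_error :: "nat \<Rightarrow> 'a \<Rightarrow> real"
  where "total_error n \<omega> = onorm (\<lambda>x. G11 n \<omega> x - Gam x) + onorm (\<lambda>x. G12 n \<omega> x - R (Gam x))"

lemma linear_errors: "bounded_linear (\<lambda>x. G11 n \<omega> x - Gam x)" "bounded_linear (\<lambda>x. G12 n \<omega> x - R (Gam x))"
  by (intro bounded_linear_sub linear_G11 linear_G12 linear_Gam bounded_linear_compose[OF linear_R linear_Gam])+

lemma total_error_bounds:
  "norm (G11 n \<omega> x - Gam x) \<le> total_error n \<omega> * norm x" "norm (G12 n \<omega> x - R (Gam x)) \<le> total_error n \<omega> * norm x"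
  "total_error n \<omega> \<ge> 0"
proof -
  note pos = onorm_pos_le[OF linear_errors(1)[of n \<omega>]] onorm_pos_le[OF linear_errors(2)[of n \<omega>]]
  show "total_error n \<omega> \<ge> 0" using pos by (simp add: total_error_def)
  show "norm (G11 n \<omega> x - Gam x) \<le> total_error n \<omega> * norm x"
    using pos by (intro order_trans[OF onorm[OF linear_errors(1)]] mult_right_mono) (auto simp: total_error_def)
  show "norm (G12 n \<omega> x - R (Gam x)) \<le> total_error n \<omega> * norm x"
    using pos by (intro order_trans[OF onorm[OF linear_errors(2)]] mult_right_mono) (auto simp: total_error_def)
qed

lemma total_error_le:
  assumes fm: "follows_model \<omega>"
  shows "total_error n \<omega> \<le> onorm (state_error n \<omega>) + onorm R * onorm (state_error (n - 1) \<omega>)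
    + onorm (cross_error (n - 1) \<omega>) + 2 * (norm (state_mean n \<omega>))\<^sup>2"
proof -
  note lin = bounded_linear.linear[OF linear_R]
  let ?m = "state_mean n \<omega>"
  have lin_cross: "bounded_linear (cross_error k \<omega>)" for k
    unfolding cross_error_def by (rule bounded_linear_average_tensor)
  note pos = onorm_pos_le[OF linear_R] onorm_pos_le[OF bounded_linear_state_error] onorm_pos_le[OF lin_cross]
  have "onorm (\<lambda>x. G11 n \<omega> x - Gam x) \<le> onorm (state_error n \<omega>) + (norm ?m)\<^sup>2"
  proof (rule onorm_bound)
    fix x
    have "G11 n \<omega> x - Gam x = state_error n \<omega> x - (?m \<bullet> x) *\<^sub>R ?m" by (simp add: G11_def state_error_def)
    also have "norm \<dots> \<le> onorm (state_error n \<omega>) * norm x + (norm ?m)\<^sup>2 * norm x"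
      by (intro order_trans[OF norm_triangle_ineq4] add_mono onorm[OF bounded_linear_state_error] norm_tensor_le)
    finally show "norm (G11 n \<omega> x - Gam x) \<le> (onorm (state_error n \<omega>) + (norm ?m)\<^sup>2) * norm x" by (simp add: distrib_right)
  qed (use pos in auto)
  moreover have "onorm (\<lambda>x. G12 n \<omega> x - R (Gam x)) \<le> onorm R * onorm (state_error (n - 1) \<omega>) + onorm (cross_error (n - 1) \<omega>) + (norm ?m)\<^sup>2"
  proof (rule onorm_bound)
    fix x
    have rec: "F (int i + 1) \<omega> = R (F (int i) \<omega>) + E (int i) \<omega>" for i using fm by (simp add: follows_model_def)
    have "average_tensor (n - 1) (\<lambda>i. F (int i) \<omega>) (\<lambda>i. F (int i + 1) \<omega>) x = R (second_moment (n - 1) \<omega> x) + cross_error (n - 1) \<omega> x"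
      unfolding rec by (simp add: average_tensor_def second_moment_def cross_error_def scaleR_add_right sum.distrib
          linear_sum[OF lin] linear_scale[OF lin])
    then have "G12 n \<omega> x - R (Gam x) = (R (state_error (n - 1) \<omega> x) + cross_error (n - 1) \<omega> x) - (?m \<bullet> x) *\<^sub>R ?m"
      by (simp add: G12_def state_error_def linear_diff[OF lin])
    also have "norm \<dots> \<le> (onorm R * (onorm (state_error (n - 1) \<omega>) * norm x) + onorm (cross_error (n - 1) \<omega>) * norm x) + (norm ?m)\<^sup>2 * norm x"
    proof (intro order_trans[OF norm_triangle_ineq4] add_mono order_trans[OF norm_triangle_ineq] norm_tensor_le onorm[OF lin_cross])
      show "norm (R (state_error (n - 1) \<omega> x)) \<le> onorm R * (onorm (state_error (n - 1) \<omega>) * norm x)"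
        by (intro order_trans[OF onorm[OF linear_R]] mult_left_mono onorm[OF bounded_linear_state_error] pos)
    qed
    finally show "norm (G12 n \<omega> x - R (Gam x)) \<le> (onorm R * onorm (state_error (n - 1) \<omega>) + onorm (cross_error (n - 1) \<omega>) + (norm ?m)\<^sup>2) * norm x"
      by (simp add: distrib_right mult.assoc)
  qed (use pos in auto)
  ultimately show ?thesis unfolding total_error_def by linarith
qed

theorem total_error_rate: "o_prob M \<alpha> total_error"
proof (rule o_prob_mono_AE[where ?n0.0 = 0])
  have shift: "real n \<le> 2 * real (n - 1)" if "n \<ge> 2" for n :: nat using that by simp
  have same: "real n \<le> 2 * real n" for n :: nat by simp
  have "o_prob M \<alpha> (\<lambda>n \<omega>. 2 * (norm (state_mean n \<omega>))\<^sup>2)"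
    by (rule o_prob_cmult[OF state_mean_rate _ \<alpha>_pos]) simp
  moreover have "o_prob M \<alpha> (\<lambda>n \<omega>. onorm R * onorm (state_error (n - 1) \<omega>))"
    by (rule o_prob_cmult[OF state_error_rate[OF shift] onorm_pos_le[OF linear_R] \<alpha>_pos])
  ultimately show "o_prob M \<alpha> (\<lambda>n \<omega>. onorm (state_error n \<omega>) + onorm R * onorm (state_error (n - 1) \<omega>)
    + onorm (cross_error (n - 1) \<omega>) + 2 * (norm (state_mean n \<omega>))\<^sup>2)"
    using state_error_rate[OF same] cross_error_rate[OF shift] by (intro o_prob_add)
  show "AE \<omega> in M. total_error n \<omega> \<le> onorm (state_error n \<omega>) + onorm R * onorm (state_error (n - 1) \<omega>)
    + onorm (cross_error (n - 1) \<omega>) + 2 * (norm (state_mean n \<omega>))\<^sup>2" for n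
    using AE_follows_model by eventually_elim (rule total_error_le)
qed

end

section \<open>The limit pencil and the sample pencils\<close>

lemma average_tensor_compact:
  assumes "\<And>n::nat. norm (x n) \<le> B"
  shows "\<exists>r. strict_mono r \<and> (\<forall>y. convergent (\<lambda>n. y \<bullet> x (r n))) \<and> (\<forall>N a b. convergent (\<lambda>n. average_tensor N a b (x (r n))))"
proof -
  obtain r where r: "strict_mono r" "\<And>y. convergent (\<lambda>n. y \<bullet> x (r n))"
    using bounded_seq_weakly_convergent_subseq[of x B, OF assms] by blast
  have "convergent (\<lambda>n. average_tensor N a b (x (r n)))" for N a b
  proof -
    have "(\<lambda>n. average_tensor N a b (x (r n))) \<longlonglongrightarrow> (1 / real N) *\<^sub>R (\<Sum>i=1..N. lim (\<lambda>n. a i \<bullet> x (r n)) *\<^sub>R b i)"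
      unfolding average_tensor_def
      by (intro tendsto_intros r(2)[unfolded convergent_LIMSEQ_iff])
    then show ?thesis by (rule convergentI)
  qed
  then show ?thesis using r by blast
qed

text \<open>Equal consecutive eigenvalues would have eigenvectors that are proportional, yet orthonormal.\<close>

lemma pencil_distinct_strict:
  assumes "pencil_distinct H P Q" "pencil_listing H P Q lam b" "i \<ge> 1"
  shows "lam (Suc i) < lam i"
proof (rule ccontr)
  assume "\<not> lam (Suc i) < lam i"
  moreover have "lam (Suc i) \<le> lam i" using assms(2,3) unfolding pencil_listing_def by simp
  ultimately have eq: "lam (Suc i) = lam i" by simp
  have eigen: "pencil_eigen H P Q (lam i) (b i)" "pencil_eigen H P Q (lam i) (b (Suc i))"
    using assms(2,3) eq unfolding pencil_listing_def by (metis, metis le_SucI)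
  then obtain s where s: "b (Suc i) = s *\<^sub>R b i" using assms(1) unfolding pencil_distinct_def by blast
  have "b (Suc i) \<bullet> Q (b i) = 0" "b i \<bullet> Q (b i) = 1"
    using assms(2,3) unfolding pencil_listing_def by auto
  then have "s = 0" by (simp add: s)
  then show False using s eigen(2) by (simp add: pencil_eigen_def)
qed

text \<open>To prove convergence in probability it suffices to follow the deterministic sequences along which
  the error is negligible.\<close>

lemma tendsto_in_prob_sequentially:
  assumes Dl: "o_prob M \<alpha> Dl" and nonneg: "\<And>n \<omega>. Dl n \<omega> \<ge> 0" and \<alpha>: "\<And>n. \<alpha> n > 0"
    and seq: "\<And>n \<omega>. (\<And>k. n k \<ge> k + 2) \<Longrightarrow> (\<And>k. \<omega> k \<in> space M) \<Longrightarrow>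
      (\<lambda>k. Dl (n k) (\<omega> k) / \<alpha> (n k)) \<longlonglongrightarrow> 0 \<Longrightarrow> (\<lambda>k. X (n k) (\<omega> k)) \<longlonglongrightarrow> c"
  shows "tendsto_in_prob M X c"
  unfolding tendsto_in_prob_def
proof (intro allI impI)
  fix e :: real assume e: "e > 0"
  \<comment> \<open>The offset 2 keeps the indices in the range of sample sizes for which both empirical operators make sense.\<close>
  have "\<exists>k. \<forall>n\<ge>k + 2. \<forall>\<omega>\<in>space M. Dl n \<omega> \<le> 1 / real (Suc k) * \<alpha> n \<longrightarrow> \<bar>X n \<omega> - c\<bar> \<le> e"
  proof (rule ccontr)
    assume "\<not> ?thesis"
    then have "\<forall>k. \<exists>n \<omega>. n \<ge> k + 2 \<and> \<omega> \<in> space M \<and> Dl n \<omega> \<le> 1 / real (Suc k) * \<alpha> n \<and> e < \<bar>X n \<omega> - c\<bar>"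
      by (meson not_le)
    then obtain n \<omega> where *: "\<And>k. n k \<ge> k + 2" "\<And>k. \<omega> k \<in> space M"
      "\<And>k. Dl (n k) (\<omega> k) \<le> 1 / real (Suc k) * \<alpha> (n k)" "\<And>k. e < \<bar>X (n k) (\<omega> k) - c\<bar>" by metis
    have "(\<lambda>k. Dl (n k) (\<omega> k) / \<alpha> (n k)) \<longlonglongrightarrow> 0"
    proof (rule tendsto_sandwich[OF _ _ tendsto_const LIMSEQ_Suc[OF lim_1_over_n]])
      show "\<forall>\<^sub>F k in sequentially. Dl (n k) (\<omega> k) / \<alpha> (n k) \<le> 1 / real (Suc k)"
        using *(3) \<alpha> by (intro always_eventually allI) (simp only: pos_divide_le_eq)
    qed (use nonneg \<alpha> in \<open>auto simp: less_imp_le\<close>)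
    from seq[OF *(1,2) this] have "(\<lambda>k. \<bar>X (n k) (\<omega> k) - c\<bar>) \<longlonglongrightarrow> \<bar>c - c\<bar>" by (intro tendsto_intros)
    then have "\<forall>\<^sub>F k in sequentially. \<bar>X (n k) (\<omega> k) - c\<bar> < e" using e by (intro order_tendstoD) auto
    then obtain N where "\<bar>X (n N) (\<omega> N) - c\<bar> < e" by (auto simp: eventually_sequentially)
    then show False using *(4)[of N] by simp
  qed
  then obtain k where k: "\<And>n \<omega>. n \<ge> k + 2 \<Longrightarrow> \<omega> \<in> space M \<Longrightarrow> Dl n \<omega> \<le> 1 / real (Suc k) * \<alpha> n \<Longrightarrow> \<bar>X n \<omega> - c\<bar> \<le> e"
    by blast
  have pos: "0 < 1 / real (Suc k)" by simp
  have lim: "(\<lambda>n. outer_measure_of M {\<omega> \<in> space M. 1 / real (Suc k) * \<alpha> n < Dl n \<omega>}) \<longlonglongrightarrow> 0"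
    using Dl pos unfolding o_prob_def by blast
  show "(\<lambda>n. outer_measure_of M {\<omega> \<in> space M. e < \<bar>X n \<omega> - c\<bar>}) \<longlonglongrightarrow> 0"
  proof (rule ennreal_tendsto_zero_le[OF lim], rule eventually_sequentiallyI)
    fix n assume n: "k + 2 \<le> n"
    show "outer_measure_of M {\<omega> \<in> space M. e < \<bar>X n \<omega> - c\<bar>} \<le> outer_measure_of M {\<omega> \<in> space M. 1 / real (Suc k) * \<alpha> n < Dl n \<omega>}"
      using k[OF n] by (intro outer_measure_of_mono) (force simp: not_le[symmetric])
  qed
qed

context ar1_sample
begin

text \<open>
  For approximate eigenvectors \<open>u\<^sub>n\<close> the images \<open>\<rho>\<Gamma>u\<^sub>n\<close> have a limit point \<open>l\<close> by compactness of \<open>\<rho>\<close>. The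
  approximate eigenvalue equation then forces \<open>\<Gamma>u\<^sub>n\<close> towards \<open>\<Gamma>c\<close> with \<open>c = \<rho>'l / m\<close>.
\<close>

lemma limit_pencil: "hilbert_pencil (L2_on T) (\<lambda>x. R (Gam x)) (\<lambda>x. Gam (R' x)) Gam"
proof (rule hilbert_pencil.intro)
  have norm_Gam: "(norm (Gam x))\<^sup>2 \<le> onorm Gam * (x \<bullet> Gam x)" for x
  proof -
    let ?g = "Gam x"
    have "(?g \<bullet> ?g)\<^sup>2 \<le> (x \<bullet> Gam x) * (?g \<bullet> Gam ?g)"
    proof (rule quadratic_nonneg_discriminant)
      fix t
      have "0 \<le> (x + t *\<^sub>R ?g) \<bullet> Gam (x + t *\<^sub>R ?g)" by (rule Gam_nonneg)
      also have "\<dots> = x \<bullet> Gam x + 2 * t * (?g \<bullet> ?g) + t\<^sup>2 * (?g \<bullet> Gam ?g)"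
        using Gam_symmetric[of x "Gam x"]
        by (simp add: linear_add[OF bounded_linear.linear[OF linear_Gam]] linear_scale[OF bounded_linear.linear[OF linear_Gam]]
            inner_add_left inner_add_right power2_eq_square algebra_simps)
      finally show "0 \<le> \<dots>" .
    qed
    also have "\<dots> \<le> (x \<bullet> Gam x) * (onorm Gam * (norm ?g)\<^sup>2)"
    proof (rule mult_left_mono[OF _ Gam_nonneg])
      have "?g \<bullet> Gam ?g \<le> norm ?g * norm (Gam ?g)" by (rule norm_cauchy_schwarz)
      also have "\<dots> \<le> norm ?g * (onorm Gam * norm ?g)" by (intro mult_left_mono onorm[OF linear_Gam]) simp
      finally show "?g \<bullet> Gam ?g \<le> onorm Gam * (norm ?g)\<^sup>2" by (simp add: power2_eq_square mult_ac)
    qed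
    finally have "(norm ?g)\<^sup>2 * (norm ?g)\<^sup>2 \<le> (onorm Gam * (x \<bullet> Gam x)) * (norm ?g)\<^sup>2"
      by (simp add: power2_norm_eq_inner[symmetric] power2_eq_square mult_ac)
    then show ?thesis
      using mult_right_le_imp_le[of "(norm ?g)\<^sup>2" "(norm ?g)\<^sup>2"] Gam_nonneg[of x] onorm_pos_le[OF linear_Gam]
      by (cases "?g = 0") auto
  qed
  show "subspace (L2_on T)" by (rule subspace_L2_on)
  show "bounded_linear (\<lambda>x. R (Gam x))" by (rule bounded_linear_compose[OF linear_R linear_Gam])
  show "bounded_linear (\<lambda>x. Gam (R' x))" by (rule bounded_linear_compose[OF linear_Gam linear_R'])
  show "bounded_linear Gam" by (rule linear_Gam)
  show "R (Gam x) \<bullet> y = x \<bullet> Gam (R' y)" for x y by (simp only: R_adjoint Gam_symmetric)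
  show "Gam x \<bullet> y = x \<bullet> Gam y" for x y by (rule Gam_symmetric)
  show "0 < x \<bullet> Gam x" if "x \<in> L2_on T" "x \<noteq> 0" for x by (rule Gam_pos[OF that])
  show "Gam x \<in> L2_on T" "Gam (R' x) \<in> L2_on T" for x by (rule Gam_range)+
  show "\<exists>C\<ge>0. \<forall>x\<in>L2_on T. (norm (R (Gam x)))\<^sup>2 \<le> C * (x \<bullet> Gam x)"
  proof (intro exI[of _ "(onorm R)\<^sup>2 * onorm Gam"] conjI ballI)
    show "0 \<le> (onorm R)\<^sup>2 * onorm Gam" using onorm_pos_le[OF linear_Gam] by simp
    fix x
    have "(norm (R (Gam x)))\<^sup>2 \<le> (onorm R * norm (Gam x))\<^sup>2" by (intro power_mono onorm[OF linear_R]) simp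
    also have "\<dots> = (onorm R)\<^sup>2 * (norm (Gam x))\<^sup>2" by (rule power_mult_distrib)
    also have "\<dots> \<le> (onorm R)\<^sup>2 * (onorm Gam * (x \<bullet> Gam x))" by (intro mult_left_mono norm_Gam) simp
    finally show "(norm (R (Gam x)))\<^sup>2 \<le> (onorm R)\<^sup>2 * onorm Gam * (x \<bullet> Gam x)" by (simp add: mult.assoc)
  qed
  fix m :: real and u :: "nat \<Rightarrow> L2"
  assume m: "m > 0" and u: "\<And>n. u n \<bullet> Gam (u n) = 1" and lim: "(\<lambda>n. m *\<^sub>R Gam (u n) - Gam (R' (R (Gam (u n))))) \<longlonglongrightarrow> 0"
  have "norm (Gam (u n)) \<le> sqrt (onorm Gam)" for n
    using norm_Gam[of "u n"] by (intro real_le_rsqrt) (simp add: u)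
  from R_compact[of "\<lambda>n. Gam (u n)", OF this] obtain r l where r: "strict_mono r" "(\<lambda>n. R (Gam (u (r n)))) \<longlonglongrightarrow> l" by blast
  define c where "c = (1 / m) *\<^sub>R R' l"
  have "(\<lambda>n. (1 / m) *\<^sub>R ((m *\<^sub>R Gam (u (r n)) - Gam (R' (R (Gam (u (r n)))))) + Gam (R' (R (Gam (u (r n))))))) \<longlonglongrightarrow> (1 / m) *\<^sub>R (0 + Gam (R' l))"
    using LIMSEQ_subseq_LIMSEQ[OF lim r(1)] r(2)
    by (intro tendsto_intros bounded_linear.tendsto[OF linear_Gam] bounded_linear.tendsto[OF linear_R']) (simp_all add: o_def)
  then have Gc: "(\<lambda>n. Gam (u (r n))) \<longlonglongrightarrow> Gam c"
    using m by (simp add: c_def linear_scale[OF bounded_linear.linear[OF linear_Gam]])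
  then have "(\<lambda>n. R (Gam (u (r n)))) \<longlonglongrightarrow> R (Gam c)" by (rule bounded_linear.tendsto[OF linear_R])
  moreover have "c \<in> L2_on T" unfolding c_def by (intro subspace_scale[OF subspace_L2_on] R'_range)
  ultimately show "\<exists>c\<in>L2_on T. \<exists>r. strict_mono r \<and> (\<lambda>n. Gam (u (r n))) \<longlonglongrightarrow> Gam c \<and> (\<lambda>n. R (Gam (u (r n)))) \<longlonglongrightarrow> R (Gam c)"
    using r(1) Gc by blast
qed

text \<open>The regularised form is bounded below by \<open>\<alpha>\<^sub>n\<close>. As \<^const>\<open>G12\<close> has finite rank, the approximate
  eigenvalue equation makes the approximate eigenvectors converge along a weakly convergent subsequence.\<close>

lemma sample_pencil:
  assumes \<omega>: "\<omega> \<in> space M"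
  shows "hilbert_pencil (L2_on T) (G12 n \<omega>) (G21 n \<omega>) (\<lambda>x. G11 n \<omega> x + \<alpha> n *\<^sub>R x)"
proof (rule hilbert_pencil.intro)
  let ?Q = "\<lambda>x. G11 n \<omega> x + \<alpha> n *\<^sub>R x"
  have a: "\<alpha> n > 0" by (rule \<alpha>_pos)
  have coercive: "\<alpha> n * (norm x)\<^sup>2 \<le> x \<bullet> ?Q x" for x
    using G11_nonneg[of x n \<omega>] by (simp add: inner_add_right power2_norm_eq_inner)
  show "subspace (L2_on T)" by (rule subspace_L2_on)
  show "bounded_linear (G12 n \<omega>)" "bounded_linear (G21 n \<omega>)" by (rule linear_G12, rule linear_G21)
  show linQ: "bounded_linear ?Q"
    by (intro bounded_linear_add linear_G11 bounded_linear_scaleR_right)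
  show "G12 n \<omega> x \<bullet> y = x \<bullet> G21 n \<omega> y" for x y by (rule G12_adjoint)
  show "?Q x \<bullet> y = x \<bullet> ?Q y" for x y by (simp add: inner_add_left inner_add_right G11_symmetric)
  show "0 < x \<bullet> ?Q x" if "x \<noteq> 0" for x
    using coercive[of x] a that by (smt (verit) mult_pos_pos zero_less_norm_iff zero_less_power)
  show "?Q x \<in> L2_on T" if "x \<in> L2_on T" for x
    using that by (intro subspace_add[OF subspace_L2_on] subspace_scale[OF subspace_L2_on] sample_range[OF \<omega>])
  show "G21 n \<omega> y \<in> L2_on T" for y by (rule sample_range[OF \<omega>])
  show "\<exists>C\<ge>0. \<forall>x\<in>L2_on T. (norm (G12 n \<omega> x))\<^sup>2 \<le> C * (x \<bullet> ?Q x)"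
  proof (intro exI[of _ "(onorm (G12 n \<omega>))\<^sup>2 / \<alpha> n"] conjI ballI)
    show "0 \<le> (onorm (G12 n \<omega>))\<^sup>2 / \<alpha> n" using a by simp
    fix x
    have "(norm (G12 n \<omega> x))\<^sup>2 \<le> (onorm (G12 n \<omega>) * norm x)\<^sup>2" by (intro power_mono onorm[OF linear_G12]) simp
    also have "\<dots> = (onorm (G12 n \<omega>))\<^sup>2 / \<alpha> n * (\<alpha> n * (norm x)\<^sup>2)" using a by (simp add: power_mult_distrib)
    also have "\<dots> \<le> (onorm (G12 n \<omega>))\<^sup>2 / \<alpha> n * (x \<bullet> ?Q x)" using a by (intro mult_left_mono coercive) simp
    finally show "(norm (G12 n \<omega> x))\<^sup>2 \<le> (onorm (G12 n \<omega>))\<^sup>2 / \<alpha> n * (x \<bullet> ?Q x)" .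
  qed
  fix m :: real and u :: "nat \<Rightarrow> L2"
  assume m: "m > 0" and uH: "\<And>k. u k \<in> L2_on T" and u: "\<And>k. u k \<bullet> ?Q (u k) = 1"
    and lim: "(\<lambda>k. m *\<^sub>R ?Q (u k) - G21 n \<omega> (G12 n \<omega> (u k))) \<longlonglongrightarrow> 0"
  have "norm (u k) \<le> sqrt (1 / \<alpha> n)" for k
    using coercive[of "u k"] a by (intro real_le_rsqrt) (simp add: u pos_le_divide_eq mult.commute)
  from average_tensor_compact[of u, OF this] obtain r where r: "strict_mono r" "\<And>y. convergent (\<lambda>k. y \<bullet> u (r k))"
    "\<And>N a b. convergent (\<lambda>k. average_tensor N a b (u (r k)))" by blast
  obtain l1 l2 where "(\<lambda>k. state_mean n \<omega> \<bullet> u (r k)) \<longlonglongrightarrow> l1"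
    "(\<lambda>k. average_tensor (n - 1) (\<lambda>i. F (int i) \<omega>) (\<lambda>i. F (int i + 1) \<omega>) (u (r k))) \<longlonglongrightarrow> l2"
    using r(2,3) unfolding convergent_def by meson
  then have "(\<lambda>k. G12 n \<omega> (u (r k))) \<longlonglongrightarrow> l2 - l1 *\<^sub>R state_mean n \<omega>"
    unfolding G12_def by (intro tendsto_intros)
  then obtain l where l: "(\<lambda>k. G12 n \<omega> (u (r k))) \<longlonglongrightarrow> l" by blast
  have "(\<lambda>k. (1 / m) *\<^sub>R ((m *\<^sub>R ?Q (u (r k)) - G21 n \<omega> (G12 n \<omega> (u (r k)))) + G21 n \<omega> (G12 n \<omega> (u (r k))))) \<longlonglongrightarrow> (1 / m) *\<^sub>R (0 + G21 n \<omega> l)"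
    using LIMSEQ_subseq_LIMSEQ[OF lim r(1)] l
    by (intro tendsto_intros bounded_linear.tendsto[OF linear_G21]) (simp_all add: o_def)
  then have "(\<lambda>k. ?Q (u (r k))) \<longlonglongrightarrow> (1 / m) *\<^sub>R G21 n \<omega> l" using m by simp
  then have Qc: "Cauchy (\<lambda>k. ?Q (u (r k)))" by (rule LIMSEQ_imp_Cauchy)
  have below: "\<alpha> n * norm x \<le> norm (?Q x)" for x
  proof (cases "x = 0")
    case False
    have "(\<alpha> n * norm x) * norm x \<le> norm (?Q x) * norm x"
      using order_trans[OF coercive[of x] norm_cauchy_schwarz[of x "?Q x"]] by (simp add: power2_eq_square mult_ac)
    then show ?thesis using False by simp
  qed simp
  have "Cauchy (\<lambda>k. u (r k))"
  proof (rule metric_CauchyI)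
    fix e :: real assume "e > 0"
    then obtain N where N: "\<And>i j. i \<ge> N \<Longrightarrow> j \<ge> N \<Longrightarrow> dist (?Q (u (r i))) (?Q (u (r j))) < \<alpha> n * e"
      using metric_CauchyD[OF Qc, of "\<alpha> n * e"] a by auto
    have "dist (u (r i)) (u (r j)) < e" if "i \<ge> N" "j \<ge> N" for i j
    proof -
      have "\<alpha> n * norm (u (r i) - u (r j)) \<le> norm (?Q (u (r i)) - ?Q (u (r j)))"
        using below[of "u (r i) - u (r j)"] by (simp only: linear_diff[OF bounded_linear.linear[OF linQ]])
      also have "\<dots> < \<alpha> n * e" using N[OF that] by (simp only: dist_norm)
      finally show ?thesis using a by (simp add: dist_norm)
    qed
    then show "\<exists>N. \<forall>i\<ge>N. \<forall>j\<ge>N. dist (u (r i)) (u (r j)) < e" by blast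
  qed
  then obtain c where c: "(\<lambda>k. u (r k)) \<longlonglongrightarrow> c" using Cauchy_convergent convergent_def by blast
  have "c \<in> L2_on T" by (rule closed_sequentially[OF closed_L2_on uH c])
  then show "\<exists>c\<in>L2_on T. \<exists>r. strict_mono r \<and> (\<lambda>k. ?Q (u (r k))) \<longlonglongrightarrow> ?Q c \<and> (\<lambda>k. G12 n \<omega> (u (r k))) \<longlonglongrightarrow> G12 n \<omega> c"
    using r(1) bounded_linear.tendsto[OF linQ c] bounded_linear.tendsto[OF linear_G12 c] by blast
qed

lemma state_mean_function:
  shows "sq_int (sample_mean \<delta> f n \<omega>)" "L2_of (sample_mean \<delta> f n \<omega>) = state_mean n \<omega>"
proof -
  have eq: "sample_mean \<delta> f n \<omega> = (\<lambda>s. (1 / real n) * (\<Sum>i=1..n. 1 * fun_of (F (int i) \<omega>) s))"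
    by (rule ext) (simp add: sample_mean_def F_def)
  have sum: "sq_int (\<lambda>s. \<Sum>i=1..n. 1 * fun_of (F (int i) \<omega>) s) \<and>
    L2_of (\<lambda>s. \<Sum>i=1..n. 1 * fun_of (F (int i) \<omega>) s) = (\<Sum>i=1..n. 1 *\<^sub>R L2_of (fun_of (F (int i) \<omega>)))"
    by (rule L2_of_sum[where c = "\<lambda>_. 1"]) (simp_all add: sq_int_fun_of)
  show "sq_int (sample_mean \<delta> f n \<omega>)" unfolding eq using sum by (intro sq_int_scale) blast
  show "L2_of (sample_mean \<delta> f n \<omega>) = state_mean n \<omega>"
    unfolding eq L2_of_scale[OF conjunct1[OF sum]] conjunct2[OF sum] by (simp add: state_mean_def L2_of_fun_of)
qed

lemma state_mean_mem: "\<omega> \<in> space M \<Longrightarrow> state_mean n \<omega> \<in> L2_on T"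
  unfolding state_mean_def by (intro subspace_scale[OF subspace_L2_on] subspace_sum[OF subspace_L2_on] F_mem)

lemma Gamma11_hat_eq: "\<omega> \<in> space M \<Longrightarrow> Gamma11_hat T \<delta> f n \<omega> = G11 n \<omega>"
proof
  fix x assume \<omega>: "\<omega> \<in> space M"
  have "Gamma11_hat T \<delta> f n \<omega> x = int_op T (\<lambda>s u. (1 / real n) * (\<Sum>i=1..n. fun_of (F (int i) \<omega>) s * fun_of (F (int i) \<omega>) u)
      - sample_mean \<delta> f n \<omega> s * sample_mean \<delta> f n \<omega> u) x"
    by (simp add: Gamma11_hat_def F_def)
  also have "\<dots> = G11 n \<omega> x"
    by (subst int_op_finite_rank)
      (simp_all add: F_mem[OF \<omega>] state_mean_function state_mean_mem[OF \<omega>] G11_def second_moment_def average_tensor_def)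
  finally show "Gamma11_hat T \<delta> f n \<omega> x = G11 n \<omega> x" .
qed

lemma Gamma12_hat_eq: "\<omega> \<in> space M \<Longrightarrow> n \<ge> 2 \<Longrightarrow> Gamma12_hat T \<delta> f n \<omega> = G12 n \<omega>"
proof
  fix x assume \<omega>: "\<omega> \<in> space M" and n: "n \<ge> 2"
  have "Gamma12_hat T \<delta> f n \<omega> x = int_op T (\<lambda>s u. (1 / real (n - 1)) * (\<Sum>i=1..n-1. fun_of (F (int i + 1) \<omega>) s * fun_of (F (int i) \<omega>) u)
      - sample_mean \<delta> f n \<omega> s * sample_mean \<delta> f n \<omega> u) x"
    using n by (simp add: Gamma12_hat_def F_def of_nat_diff)
  also have "\<dots> = G12 n \<omega> x"
    by (subst int_op_finite_rank)
      (simp_all add: F_mem[OF \<omega>] state_mean_function state_mean_mem[OF \<omega>] G12_def average_tensor_def)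
  finally show "Gamma12_hat T \<delta> f n \<omega> x = G12 n \<omega> x" .
qed

end

section \<open>Consistency of the regularised canonical correlations\<close>

theorem theorem3:
  fixes M :: "'a measure" and Tbar \<delta> t :: real
    and K :: "real \<Rightarrow> real \<Rightarrow> real"
    and \<epsilon> f :: "real \<Rightarrow> 'a \<Rightarrow> L2"
    and \<alpha> :: "nat \<Rightarrow> real"
    and lam :: "nat \<Rightarrow> real" and b :: "nat \<Rightarrow> L2"
    and lam_hat :: "nat \<Rightarrow> 'a \<Rightarrow> nat \<Rightarrow> real" and b_hat :: "nat \<Rightarrow> 'a \<Rightarrow> nat \<Rightarrow> L2"
  assumes "prob_space M" and "Tbar > 0" and "\<delta> > 0" and "t \<in> time_grid \<delta>"
    and "hs_kernel Tbar K"
    and "strong_white_noise M Tbar \<delta> \<epsilon>"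
    and model: "ar1_defines M Tbar \<delta> (int_op Tbar K) \<epsilon> f"
    and "\<forall>s\<in>time_grid \<delta>. integrable M (\<lambda>\<omega>. norm (f s \<omega>) ^ 4)"
    and pos_def: "\<forall>x\<in>L2_on Tbar. x \<noteq> 0 \<longrightarrow> x \<bullet> Gamma11 M f t x > 0"
    and "pencil_distinct (L2_on Tbar)
      (adjoint (Gamma12 M \<delta> f t) \<circ> Gamma12 M \<delta> f t) (Gamma11 M f t)"
    and "pencil_listing (L2_on Tbar)
      (adjoint (Gamma12 M \<delta> f t) \<circ> Gamma12 M \<delta> f t) (Gamma11 M f t) lam b"
    and "\<And>n \<omega>. n \<ge> 2 \<Longrightarrow> \<omega> \<in> space M \<Longrightarrow>
      pencil_listing (L2_on Tbar)
        (adjoint (Gamma12_hat Tbar \<delta> f n \<omega>) \<circ> Gamma12_hat Tbar \<delta> f n \<omega>)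
        (\<lambda>x. Gamma11_hat Tbar \<delta> f n \<omega> x + \<alpha> n *\<^sub>R x)
        (lam_hat n \<omega>) (b_hat n \<omega>)"
    and "\<And>n. \<alpha> n > 0" and "\<alpha> \<longlonglongrightarrow> 0"
    and "filterlim (\<lambda>n. sqrt (real n / ln (real n)) * \<alpha> n) at_top sequentially"
    and "j \<ge> 1"
  shows "tendsto_in_prob M (\<lambda>n \<omega>. lam_hat n \<omega> j) (lam j) \<and>
    (\<exists>\<sigma> :: nat \<Rightarrow> 'a \<Rightarrow> real. (\<forall>n \<omega>. \<sigma> n \<omega> \<in> {-1, 1}) \<and>
      tendsto_in_prob M (\<lambda>n \<omega>. (\<sigma> n \<omega> *\<^sub>R b_hat n \<omega> j - b j) \<bullet>
        Gamma11 M f t (\<sigma> n \<omega> *\<^sub>R b_hat n \<omega> j - b j)) 0)"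
proof -
  note distinct = assms(10) and listing = assms(11) and sample_listing = assms(12)
    and \<alpha>_pos = assms(13) and \<alpha>_lim = assms(14) and \<alpha>_rate = assms(15) and j = assms(16)
  interpret ar1_process M Tbar \<delta> K \<epsilon> f
    using assms unfolding ar1_process_def ar1_process_axioms_def by blast
  obtain k0 :: int where t: "t = of_int k0 * \<delta>" using assms(4) by (auto simp: time_grid_def)
  have G11_eq: "Gamma11 M f t = Gam"
    by (rule ext) (simp add: Gamma11_def t Gam_eq_cov_op[of k0, symmetric] F_def)
  have t1: "t + \<delta> = of_int (k0 + 1) * \<delta>" by (simp add: t algebra_simps)
  have G12_eq: "Gamma12 M \<delta> f t = (\<lambda>x. R (Gam x))"
    unfolding Gamma12_def t1 unfolding t using cross_cov_op[of k0] unfolding F_def by blast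
  have G21_eq: "adjoint (Gamma12 M \<delta> f t) = (\<lambda>x. Gam (R' x))"
    unfolding G12_eq by (rule adjoint_unique) (simp only: R_adjoint Gam_symmetric simp_thms)
  have rate2: "(\<lambda>n. 1 / (real n * (\<alpha> n)\<^sup>2)) \<longlonglongrightarrow> 0"
  proof -
    have "filterlim (\<lambda>n. sqrt (real n) * \<alpha> n) at_top sequentially"
    proof (rule filterlim_at_top_mono[OF \<alpha>_rate], rule eventually_sequentiallyI)
      fix n :: nat assume n: "3 \<le> n"
      \<comment> \<open>From \<open>n = 3\<close> on the logarithm is at least 1, and dropping it enlarges the sequence.\<close>
      have "exp (1::real) \<le> 3" using exp_le by simp
      then have "1 \<le> ln (real n)" using n by (subst ln_ge_iff) auto
      then have "real n / ln (real n) \<le> real n / 1" by (intro divide_left_mono) auto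
      then have "sqrt (real n / ln (real n)) \<le> sqrt (real n)" by simp
      then show "sqrt (real n / ln (real n)) * \<alpha> n \<le> sqrt (real n) * \<alpha> n"
        using \<alpha>_pos[of n] by (intro mult_right_mono) auto
    qed
    then have "(\<lambda>n. inverse (sqrt (real n) * \<alpha> n)) \<longlonglongrightarrow> 0"
      by (rule tendsto_inverse_0_at_top)
    then have "(\<lambda>n. (inverse (sqrt (real n) * \<alpha> n))\<^sup>2) \<longlonglongrightarrow> 0\<^sup>2" by (rule tendsto_power)
    moreover have "(inverse (sqrt (real n) * \<alpha> n))\<^sup>2 = 1 / (real n * (\<alpha> n)\<^sup>2)" for n
      by (simp add: power_mult_distrib power_inverse power_divide inverse_eq_divide)
    ultimately show ?thesis by (simp only: zero_power2)
  qed
  have rate1: "(\<lambda>n. 1 / (real n * \<alpha> n)) \<longlonglongrightarrow> 0"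
  proof -
    have "(\<lambda>n. 1 / (real n * (\<alpha> n)\<^sup>2) * \<alpha> n) \<longlonglongrightarrow> 0 * 0" by (intro tendsto_mult rate2 \<alpha>_lim)
    moreover have "1 / (real n * (\<alpha> n)\<^sup>2) * \<alpha> n = 1 / (real n * \<alpha> n)" for n
      using \<alpha>_pos[of n] by (simp add: power2_eq_square)
    ultimately show ?thesis by simp
  qed
  interpret ar1_sample M Tbar \<delta> K \<epsilon> f \<alpha>
  proof
    show "integrable M (\<lambda>\<omega>. norm (F k \<omega>) ^ 4)" for k using assms(8) grid[of k] by (simp add: F_def)
    show "0 < x \<bullet> Gam x" if "x \<in> L2_on Tbar" "x \<noteq> 0" for x using pos_def that by (simp add: G11_eq)
  qed (fact \<alpha>_pos rate1 rate2)+
  define \<sigma> where "\<sigma> n \<omega> = (if b_hat n \<omega> j \<bullet> Gam (b j) \<ge> 0 then 1 else - 1 :: real)" for n \<omega>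
  have G21_hat: "adjoint (G12 n \<omega>) = G21 n \<omega>" for n \<omega>
    by (rule adjoint_unique) (simp add: G12_adjoint)
  have perturbation: "pencil_perturbation (L2_on Tbar) (\<lambda>x. R (Gam x)) (\<lambda>x. Gam (R' x)) Gam lam b
      (\<lambda>k. G12 (n k) (\<omega> k)) (\<lambda>k. G21 (n k) (\<omega> k)) (\<lambda>k. G11 (n k) (\<omega> k)) (\<lambda>k. \<alpha> (n k)) (\<lambda>k. total_error (n k) (\<omega> k))
      (\<lambda>k. lam_hat (n k) (\<omega> k)) (\<lambda>k. b_hat (n k) (\<omega> k))"
    if n: "\<And>k. n k \<ge> k + 2" and \<omega>: "\<And>k. \<omega> k \<in> space M"
      and lim: "(\<lambda>k. total_error (n k) (\<omega> k) / \<alpha> (n k)) \<longlonglongrightarrow> 0" for n \<omega>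
  proof (intro pencil_perturbation.intro limit_pencil pencil_perturbation_axioms.intro)
    have n2: "n k \<ge> 2" for k using n[of k] by simp
    show "pencil_listing (L2_on Tbar) ((\<lambda>x. Gam (R' x)) \<circ> (\<lambda>x. R (Gam x))) Gam lam b"
      using listing unfolding G11_eq G21_eq unfolding G12_eq .
    show "hilbert_pencil (L2_on Tbar) (G12 (n k) (\<omega> k)) (G21 (n k) (\<omega> k)) (\<lambda>x. G11 (n k) (\<omega> k) x + \<alpha> (n k) *\<^sub>R x)" for k
      by (rule sample_pencil[OF \<omega>])
    show "pencil_listing (L2_on Tbar) (G21 (n k) (\<omega> k) \<circ> G12 (n k) (\<omega> k)) (\<lambda>x. G11 (n k) (\<omega> k) x + \<alpha> (n k) *\<^sub>R x)
        (lam_hat (n k) (\<omega> k)) (b_hat (n k) (\<omega> k))" for k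
      using sample_listing[OF n2 \<omega>, of k k] unfolding Gamma12_hat_eq[OF \<omega> n2] Gamma11_hat_eq[OF \<omega>] G21_hat .
    show "norm (G12 (n k) (\<omega> k) x - R (Gam x)) \<le> total_error (n k) (\<omega> k) * norm x"
      "norm (G11 (n k) (\<omega> k) x - Gam x) \<le> total_error (n k) (\<omega> k) * norm x"
      "total_error (n k) (\<omega> k) \<ge> 0" for k x by (rule total_error_bounds)+
    show "\<alpha> (n k) > 0" for k by (rule \<alpha>_pos)
    show "(\<lambda>k. \<alpha> (n k)) \<longlonglongrightarrow> 0"
    proof (rule filterlim_compose[OF \<alpha>_lim])
      have "k \<le> n k" for k using n[of k] by simp
      then show "filterlim n sequentially sequentially"
        by (intro filterlim_at_top_mono[OF filterlim_ident]) simp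
    qed
    show "(\<lambda>k. total_error (n k) (\<omega> k) / \<alpha> (n k)) \<longlonglongrightarrow> 0" by (rule lim)
    show "lam (Suc i) < lam i" if "i \<ge> 1" for i by (rule pencil_distinct_strict[OF distinct listing that])
  qed
  have "tendsto_in_prob M (\<lambda>n \<omega>. lam_hat n \<omega> j) (lam j)"
    by (rule tendsto_in_prob_sequentially[OF total_error_rate total_error_bounds(3) \<alpha>_pos])
      (rule pencil_perturbation.eigenvalue_tendsto[OF perturbation j])
  moreover have "tendsto_in_prob M (\<lambda>n \<omega>. (\<sigma> n \<omega> *\<^sub>R b_hat n \<omega> j - b j) \<bullet> Gamma11 M f t (\<sigma> n \<omega> *\<^sub>R b_hat n \<omega> j - b j)) 0"
    unfolding G11_eq \<sigma>_def
    by (rule tendsto_in_prob_sequentially[OF total_error_rate total_error_bounds(3) \<alpha>_pos])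
      (rule pencil_perturbation.eigenvector_tendsto[OF perturbation j])
  moreover have "\<sigma> n \<omega> \<in> {-1, 1}" for n \<omega> by (simp add: \<sigma>_def)
  ultimately show ?thesis by blast
qed

end
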